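(* Let $m,n$ be relatively prime positive integers, let $1<p<\infty$, $a,b\in\mathbb R$, and let $N$ be a positive integer. The following are equivalent: (i) $S^+_{a,b,2N}$ is bounded on $L^p(H_{m/n})$; (ii) $S_{a,b,2N}$ is bounded on $L^p(H_{m/n})$; (iii) the following three conditions all hold: $$-ap<1<(b+1)p,$$ $$(2N-2a)(m+n-1)p<4(m+n)<\big((2b-2N)(m+n-1)+4(m+n)\big)p,$$ $$2N\le a+b+2.$$
   Context: For relatively prime positive integers $m,n$, the rational Hartogs triangle is $H_{m/n}=\{(z_1,z_2)\in\mathbb C^2:|z_1|^m<|z_2|^n<1\}$. $dV$ denotes Lebesgue measure on $\mathbb C^2$, and $L^p(H_{m/n})$ is taken with respect to $dV$. $B_{m/n}(z,w)$ denotes the Bergman kernel of $H_{m/n}$, i.e. the reproducing kernel of the Hilbert space of holomorphic functions on $H_{m/n}$ that are square integrable with respect to $dV$; it satisfies $B_{m/n}(z,z)>0$. For $a,b\in\mathbb R$ and $c>0$ define $$S^+_{a,b,c}f(z)=\int_{H_{m/n}}\frac{|B_{m/n}(z,w)|^{c/2}}{B_{m/n}(z,z)^{a/2}B_{m/n}(w,w)^{b/2}}\,f(w)\,dV(w),$$ and for a positive integer $N$ define $$S_{a,b,2N}f(z)=\int_{H_{m/n}}\frac{B_{m/n}(z,w)^{N}}{B_{m/n}(z,z)^{a/2}B_{m/n}(w,w)^{b/2}}\,f(w)\,dV(w).$$ An integral operator is bounded on $L^p$ if for every $f\in L^p$ the defining integral converges absolutely for almost every $z$ and the operator satisfies $\|Sf\|_{L^p}\le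 C\|f\|_{L^p}$ with $C$ independent of $f$. *)

theory Defs
  imports "HOL-Analysis.Analysis"
begin

definition hartogs :: "nat \<Rightarrow> nat \<Rightarrow> (complex \<times> complex) set" where
  "hartogs m n = {(z1, z2). cmod z1 ^ m < cmod z2 ^ n \<and> cmod z2 ^ n < 1}"

(* The library's holomorphic_on covers one variable only. On an open subset of C^2, holomorphy is
   total differentiability with a complex-linear differential. *)
definition holomorphic2_on ::
    "(complex \<times> complex \<Rightarrow> complex) \<Rightarrow> (complex \<times> complex) set \<Rightarrow> bool" where
  "holomorphic2_on f \<Omega> \<longleftrightarrow>
     (\<forall>z\<in>\<Omega>. \<exists>d1 d2. (f has_derivative (\<lambda>(u, v). d1 * u + d2 * v)) (at z))"

definition bergman_space ::
    "(complex \<times> complex) set \<Rightarrow> (complex \<times> complex \<Rightarrow> complex) set" where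
  "bergman_space \<Omega> =
     {f. holomorphic2_on f \<Omega> \<and> integrable (lebesgue_on \<Omega>) (\<lambda>z. (cmod (f z))\<^sup>2)}"

definition is_bergman_kernel ::
    "(complex \<times> complex) set \<Rightarrow> (complex \<times> complex \<Rightarrow> complex \<times> complex \<Rightarrow> complex) \<Rightarrow> bool" where
  "is_bergman_kernel \<Omega> K \<longleftrightarrow>
     (\<forall>w\<in>\<Omega>. (\<lambda>z. K z w) \<in> bergman_space \<Omega> \<and>
        (\<forall>f\<in>bergman_space \<Omega>. f w = (LINT z|lebesgue_on \<Omega>. f z * cnj (K z w))))"

(* SOME instead of THE: functions here are total, so a reproducing kernel is determined only on
   \<Omega> \<times> \<Omega>, which is the only place where its values are used. *)
definition bergman_kernel ::
    "(complex \<times> complex) set \<Rightarrow> complex \<times> complex \<Rightarrow> complex \<times> complex \<Rightarrow> complex" where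
  "bergman_kernel \<Omega> = (SOME K. is_bergman_kernel \<Omega> K)"

lemma is_bergman_kernel_adjoint:
  assumes K: "is_bergman_kernel \<Omega> K" and L: "is_bergman_kernel \<Omega> L"
    and z: "z \<in> \<Omega>" and w: "w \<in> \<Omega>"
  shows "L z w = cnj (K w z)"
proof -
  have Kz: "(\<lambda>x. K x z) \<in> bergman_space \<Omega>" and Lw: "(\<lambda>x. L x w) \<in> bergman_space \<Omega>"
    and Kf: "\<And>f. f \<in> bergman_space \<Omega> \<Longrightarrow> f z = (LINT x|lebesgue_on \<Omega>. f x * cnj (K x z))"
    and Lf: "\<And>f. f \<in> bergman_space \<Omega> \<Longrightarrow> f w = (LINT x|lebesgue_on \<Omega>. f x * cnj (L x w))"
    using K L z w unfolding is_bergman_kernel_def by blast+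
  have "L z w = (LINT x|lebesgue_on \<Omega>. L x w * cnj (K x z))"
    by (rule Kf[OF Lw])
  also have "\<dots> = (LINT x|lebesgue_on \<Omega>. cnj (K x z * cnj (L x w)))"
    by (simp add: mult.commute)
  also have "\<dots> = cnj (LINT x|lebesgue_on \<Omega>. K x z * cnj (L x w))"
    by (rule Bochner_Integration.integral_cnj)
  also have "(LINT x|lebesgue_on \<Omega>. K x z * cnj (L x w)) = K w z"
    by (rule Lf[OF Kz, symmetric])
  finally show ?thesis .
qed

lemma is_bergman_kernel_unique:
  assumes "is_bergman_kernel \<Omega> K" "is_bergman_kernel \<Omega> L" "z \<in> \<Omega>" "w \<in> \<Omega>"
  shows "K z w = L z w"
  using is_bergman_kernel_adjoint[of \<Omega> K K z w] is_bergman_kernel_adjoint[of \<Omega> K L z w] assms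
  by simp

definition Lp_space :: "real \<Rightarrow> 'a measure \<Rightarrow> ('a \<Rightarrow> complex) set" where
  "Lp_space p M = {f \<in> borel_measurable M. integrable M (\<lambda>x. cmod (f x) powr p)}"

definition Lp_norm :: "real \<Rightarrow> 'a measure \<Rightarrow> ('a \<Rightarrow> complex) \<Rightarrow> real" where
  "Lp_norm p M f = (LINT x|M. cmod (f x) powr p) powr (1 / p)"

definition integral_op :: "'a measure \<Rightarrow> ('a \<Rightarrow> 'a \<Rightarrow> complex) \<Rightarrow> ('a \<Rightarrow> complex) \<Rightarrow> 'a \<Rightarrow> complex" where
  "integral_op M k f z = (LINT w|M. k z w * f w)"

(* Bochner integrability is absolute convergence; where it fails, the value of integral_op is 0,
   which by the first conjunct affects only a null set. *)
definition integral_op_bounded :: "real \<Rightarrow> 'a measure \<Rightarrow> ('a \<Rightarrow> 'a \<Rightarrow> complex) \<Rightarrow> bool" where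
  "integral_op_bounded p M k \<longleftrightarrow>
     (\<exists>C. \<forall>f\<in>Lp_space p M.
        (AE z in M. integrable M (\<lambda>w. k z w * f w)) \<and>
        integral_op M k f \<in> Lp_space p M \<and>
        Lp_norm p M (integral_op M k f) \<le> C * Lp_norm p M f)"

(* B(z,z) is a positive real, stored as a complex number; Re makes real powers available. *)
definition bergman_diag :: "nat \<Rightarrow> nat \<Rightarrow> complex \<times> complex \<Rightarrow> real" where
  "bergman_diag m n z = Re (bergman_kernel (hartogs m n) z z)"

definition S_plus_kernel ::
    "nat \<Rightarrow> nat \<Rightarrow> real \<Rightarrow> real \<Rightarrow> real \<Rightarrow> complex \<times> complex \<Rightarrow> complex \<times> complex \<Rightarrow> complex" where
  "S_plus_kernel m n a b c z w =
     of_real (cmod (bergman_kernel (hartogs m n) z w) powr (c / 2) /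
       (bergman_diag m n z powr (a / 2) * bergman_diag m n w powr (b / 2)))"

(* The operator S with parameters a, b, 2N. *)
definition S_kernel ::
    "nat \<Rightarrow> nat \<Rightarrow> real \<Rightarrow> real \<Rightarrow> nat \<Rightarrow> complex \<times> complex \<Rightarrow> complex \<times> complex \<Rightarrow> complex" where
  "S_kernel m n a b N z w =
     bergman_kernel (hartogs m n) z w ^ N /
       of_real (bergman_diag m n z powr (a / 2) * bergman_diag m n w powr (b / 2))"

definition S_plus_bounded :: "nat \<Rightarrow> nat \<Rightarrow> real \<Rightarrow> real \<Rightarrow> real \<Rightarrow> real \<Rightarrow> bool" where
  "S_plus_bounded m n a b c p \<longleftrightarrow>
     integral_op_bounded p (lebesgue_on (hartogs m n)) (S_plus_kernel m n a b c)"

definition S_bounded :: "nat \<Rightarrow> nat \<Rightarrow> real \<Rightarrow> real \<Rightarrow> nat \<Rightarrow> real \<Rightarrow> bool" where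
  "S_bounded m n a b N p \<longleftrightarrow>
     integral_op_bounded p (lebesgue_on (hartogs m n)) (S_kernel m n a b N)"

end

theory Submission
  imports Defs "HOL-Complex_Analysis.Complex_Analysis"
begin

text \<open>The monomial \<open>z\<^sub>1 ^ j * z\<^sub>2 ^ k\<close> is square integrable iff
  \<open>n (j + 1) + m (k + 1) > 0\<close>, and these monomials form an orthogonal basis of the Bergman space. Splitting
  \<open>j = r + m i\<close> sums the kernel in closed form: up to constants it is bounded by
  \<open>\<Sum>\<^sub>r \<bar>e\<^sub>r(z) e\<^sub>r(w)\<bar> / (\<bar>1 - u\<bar>\<^sup>2 \<bar>1 - t\<bar>\<^sup>2)\<close>, where
  \<open>e\<^sub>r\<close> is the basis monomial for \<open>j = r < m\<close> with minimal \<open>k\<close>,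
  \<open>t = z\<^sub>2 * cnj w\<^sub>2\<close>, and \<open>u\<close> is the analogous product for
  \<open>z\<^sub>1 ^ m / z\<^sub>2 ^ n\<close>; on the diagonal this is sharp. Integration over the torus reduces
  the sufficiency of the conditions to one-dimensional Forelli-Rudin estimates and Schur's test.

  For necessity, coprimality provides exactly one \<open>r0\<close> whose monomial has
  \<open>n (r0 + 1) + m (k + 1) = 1\<close>, the most singular one. By orthogonality the operator maps
  \<open>\<mu>\<^sub>i \<psi>\<close>, with \<open>\<mu>\<^sub>i = e\<^sub>r\<^sub>0 ^ N * (z\<^sub>1 ^ m / z\<^sub>2 ^ n) ^ i\<close> and \<open>\<psi>\<close> invariant
  under the torus, to a multiple of \<open>\<mu>\<^sub>i\<close> times a power of \<open>B(z, z)\<close>. Choosing \<open>\<psi>\<close>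
  extremal in Hoelder's inequality bounds a product of two norms: finiteness for \<open>i = 0\<close> gives the
  first four inequalities, the growth as \<open>i \<rightarrow> \<infinity>\<close> the last one.\<close>

section \<open>Torus averages and radial integrals\<close>

text \<open>In the coordinates u = z1^m / z2^n and t = z2 the domain looks like a bidisc, and -ap <
  1 < (b+1)p together with 2N \<le> a+b+2 are the conditions at |u| = 1 and |t| = 1. What differs
  from the bidisc is the origin: the basis monomials can grow like |z2|^(-(m+n-1)/m), and the two
  middle inequalities say that the resulting powers stay integrable against the factor |z2|^(1+2n/m)
  of polar coordinates. Sufficiency therefore uses a Schur weight with two independent exponents,
  one for the boundary and one for the origin. Necessity has to deal with powers of the kernel, in
  which the m residues r mix. Coprimality ensures that the worst growth is attained, by one r only.
  A rotation with weights (n, m) leaves u fixed and gives every other residue a strictly larger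
  phase, so a mean over this rotation isolates the N-th power of the worst term. The test functions
  bring the p-norm of a weight formed with a and the q-norm of the same weight formed with b into
  one product; lower bounds for each norm then give the conditions on a and on b together.\<close>

lemma borel_measurable_Complex [measurable]: "(\<lambda>(x, y). Complex x y) \<in> borel \<Otimes>\<^sub>M borel \<rightarrow>\<^sub>M borel"
  unfolding borel_prod case_prod_beta by (intro borel_measurable_continuous_onI continuous_intros continuous_on_Complex)

text \<open>Boxes in the complex plane correspond to rectangles, and measures that agree on boxes
  are equal. This opens the way to Fubini in real and imaginary part, where a shear becomes a
  translation.\<close>

lemma lborel_complex_eq: "(lborel :: complex measure) = distr (lborel \<Otimes>\<^sub>M lborel) borel (\<lambda>(x, y). Complex x y)"
proof (rule lborel_eqI)
  fix l u :: complex
  assume le: "\<And>b. b \<in> Basis \<Longrightarrow> l \<bullet> b \<le> u \<bullet> b"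
  have le1: "Re l \<le> Re u" "Im l \<le> Im u"
    using le[of 1] le[of \<i>] by (auto simp: Basis_complex_def)
  have "(\<lambda>(x, y). Complex x y) -` box l u = {Re l<..<Re u} \<times> {Im l<..<Im u}"
    by (auto simp: in_box_complex_iff)
  then have "emeasure (distr (lborel \<Otimes>\<^sub>M lborel) borel (\<lambda>(x, y). Complex x y)) (box l u)
     = emeasure (lborel \<Otimes>\<^sub>M lborel) ({Re l<..<Re u} \<times> {Im l<..<Im u})"
    by (subst emeasure_distr) (auto simp: space_pair_measure)
  also have "\<dots> = ennreal (Re u - Re l) * ennreal (Im u - Im l)"
    using le1 by (subst lborel.emeasure_pair_measure_Times) auto
  also have "\<dots> = ennreal (\<Prod>b\<in>Basis. (u - l) \<bullet> b)"
    using le1 by (simp add: Basis_complex_def ennreal_mult')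
  finally show "emeasure (distr (lborel \<Otimes>\<^sub>M lborel) borel (\<lambda>(x, y). Complex x y)) (box l u) = ennreal (\<Prod>b\<in>Basis. (u - l) \<bullet> b)" .
qed simp

lemma nn_integral_complex_split:
  fixes F :: "complex \<Rightarrow> ennreal"
  assumes [measurable]: "F \<in> borel_measurable borel"
  shows "(\<integral>\<^sup>+z. F z \<partial>lborel) = (\<integral>\<^sup>+x. \<integral>\<^sup>+y. F (Complex x y) \<partial>lborel \<partial>lborel)"
    and "(\<integral>\<^sup>+z. F z \<partial>lborel) = (\<integral>\<^sup>+y. \<integral>\<^sup>+x. F (Complex x y) \<partial>lborel \<partial>lborel)"
proof -
  have *: "(\<lambda>p. F (Complex (fst p) (snd p))) \<in> borel_measurable (lborel \<Otimes>\<^sub>M lborel)"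
    using measurable_compose[OF borel_measurable_Complex assms] by (simp add: case_prod_beta cong: measurable_cong_sets)
  have "(\<integral>\<^sup>+z. F z \<partial>lborel) = (\<integral>\<^sup>+p. F (case p of (x, y) \<Rightarrow> Complex x y) \<partial>(lborel \<Otimes>\<^sub>M lborel))"
    by (subst lborel_complex_eq, subst nn_integral_distr) auto
  then have eq: "(\<integral>\<^sup>+z. F z \<partial>lborel) = (\<integral>\<^sup>+p. F (Complex (fst p) (snd p)) \<partial>(lborel \<Otimes>\<^sub>M lborel))"
    by (simp add: case_prod_beta)
  show "(\<integral>\<^sup>+z. F z \<partial>lborel) = (\<integral>\<^sup>+x. \<integral>\<^sup>+y. F (Complex x y) \<partial>lborel \<partial>lborel)"
    unfolding eq using lborel.nn_integral_fst[OF *] by simp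
  show "(\<integral>\<^sup>+z. F z \<partial>lborel) = (\<integral>\<^sup>+y. \<integral>\<^sup>+x. F (Complex x y) \<partial>lborel \<partial>lborel)"
    unfolding eq using lborel_pair.nn_integral_snd[OF *] by simp
qed

text \<open>Once the imaginary part is fixed, the shear only translates the real part. So the
  integral over the real part has to be the inner one, and for the other shear the outer
  one.\<close>

lemma nn_integral_shear_Re:
  fixes F :: "complex \<Rightarrow> ennreal"
  assumes [measurable]: "F \<in> borel_measurable borel"
  shows "(\<integral>\<^sup>+z. F (Complex (Re z + a * Im z) (Im z)) \<partial>lborel) = (\<integral>\<^sup>+z. F z \<partial>lborel)"
proof -
  have m: "(\<lambda>x. F (Complex x y)) \<in> borel_measurable borel" for y
    by (rule measurable_compose[OF _ assms])
      (intro borel_measurable_continuous_onI continuous_intros continuous_on_Complex)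
  have "(\<lambda>z. F (Complex (Re z + a * Im z) (Im z))) \<in> borel_measurable borel"
    by (rule measurable_compose[OF _ assms])
      (intro borel_measurable_continuous_onI continuous_intros continuous_on_Complex)
  then show ?thesis
    apply (subst (1 2) nn_integral_complex_split(2))
    subgoal by simp
    subgoal by simp
    apply (rule nn_integral_cong)
    subgoal for v
      using nn_integral_real_affine[OF m[of v], of 1 "a * v"] by (simp add: add.commute)
    done
qed

lemma nn_integral_shear_Im:
  fixes F :: "complex \<Rightarrow> ennreal"
  assumes [measurable]: "F \<in> borel_measurable borel"
  shows "(\<integral>\<^sup>+z. F (Complex (Re z) (Im z + a * Re z)) \<partial>lborel) = (\<integral>\<^sup>+z. F z \<partial>lborel)"
proof -
  have m: "(\<lambda>y. F (Complex x y)) \<in> borel_measurable borel" for x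
    by (rule measurable_compose[OF _ assms])
      (intro borel_measurable_continuous_onI continuous_intros continuous_on_Complex)
  have "(\<lambda>z. F (Complex (Re z) (Im z + a * Re z))) \<in> borel_measurable borel"
    by (rule measurable_compose[OF _ assms])
      (intro borel_measurable_continuous_onI continuous_intros continuous_on_Complex)
  then show ?thesis
    apply (subst (1 2) nn_integral_complex_split(1))
    subgoal by simp
    subgoal by simp
    apply (rule nn_integral_cong)
    subgoal for v
      using nn_integral_real_affine[OF m[of v], of 1 "a * v"] by (simp add: add.commute)
    done
qed

text \<open>Every rotation other than the one by \<open>\<pi>\<close> is a product of three shears.\<close>

lemma nn_integral_rotate:
  fixes F :: "complex \<Rightarrow> ennreal"
  assumes F: "F \<in> borel_measurable borel" and c: "cmod c = 1"
  shows "(\<integral>\<^sup>+z. F (c * z) \<partial>lborel) = (\<integral>\<^sup>+z. F z \<partial>lborel)"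
proof -
  have gen: "(\<integral>\<^sup>+z. F (c * z) \<partial>lborel) = (\<integral>\<^sup>+z. F z \<partial>lborel)"
    if F: "F \<in> borel_measurable borel" and c: "cmod c = 1" and ne: "c \<noteq> -1" for c and F :: "complex \<Rightarrow> ennreal"
  proof -
    have one: "Re c ^ 2 + Im c ^ 2 = 1" using c by (metis cmod_power2 one_power2)
    have R: "1 + Re c \<noteq> 0"
    proof
      assume "1 + Re c = 0"
      then have "Re c = -1" by simp
      with one have "Im c = 0" by simp
      with \<open>Re c = -1\<close> ne show False by (simp add: complex_eq_iff)
    qed
    \<comment> \<open>For \<open>c\<close> = cis \<theta> the shear parameters are -tan(\<theta>/2)
      and sin \<theta>. The half-angle tangent is what excludes \<theta> = \<pi>.\<close>
    define a where "a = - Im c / (1 + Re c)"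
    define b where "b = Im c"
    have ab: "1 + a * b = Re c"
    proof -
      have "Im c ^ 2 = (1 - Re c) * (1 + Re c)" using one by (simp add: power2_eq_square algebra_simps)
      then have "a * b = - (1 - Re c)" unfolding a_def b_def using R by (simp add: power2_eq_square)
      then show ?thesis by simp
    qed
    have aR: "a * (1 + Re c) = - Im c" using R by (simp add: a_def)
    define F1 where "F1 = (\<lambda>z. F (Complex (Re z + a * Im z) (Im z)))"
    define F2 where "F2 = (\<lambda>z. F1 (Complex (Re z) (Im z + b * Re z)))"
    have F1: "F1 \<in> borel_measurable borel" unfolding F1_def
      by (rule measurable_compose[OF _ F])
      (intro borel_measurable_continuous_onI continuous_intros continuous_on_Complex)
    have F2: "F2 \<in> borel_measurable borel" unfolding F2_def
      by (rule measurable_compose[OF _ F1])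
      (intro borel_measurable_continuous_onI continuous_intros continuous_on_Complex)
    have "F (c * z) = F2 (Complex (Re z + a * Im z) (Im z))" for z
    proof -
      have im: "Im z + b * (Re z + a * Im z) = Im (c * z)"
        using ab by (simp add: b_def algebra_simps) (metis add.commute distrib_left mult.commute mult.left_commute mult.right_neutral)
      have "(Re z + a * Im z) + a * (Im z + b * (Re z + a * Im z)) = Re z * (1 + a * b) + Im z * (a * (1 + (1 + a * b)))"
        by (simp add: algebra_simps)
      also have "\<dots> = Re (c * z)" unfolding ab aR by (simp add: mult.commute)
      finally have re: "(Re z + a * Im z) + a * (Im z + b * (Re z + a * Im z)) = Re (c * z)" .
      show ?thesis unfolding F2_def F1_def by (simp only: complex.sel im re[unfolded im] complex_surj)
    qed
    then have "(\<integral>\<^sup>+z. F (c * z) \<partial>lborel) = (\<integral>\<^sup>+z. F2 z \<partial>lborel)"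
      using nn_integral_shear_Re[OF F2, of a] by simp
    also have "\<dots> = (\<integral>\<^sup>+z. F1 z \<partial>lborel)" unfolding F2_def by (rule nn_integral_shear_Im[OF F1])
    also have "\<dots> = (\<integral>\<^sup>+z. F z \<partial>lborel)" unfolding F1_def by (rule nn_integral_shear_Re[OF F])
    finally show ?thesis .
  qed
  show ?thesis
  proof (cases "c = -1")
    case False then show ?thesis using gen F c by blast
  next
    case True
    \<comment> \<open>The excluded rotation is two quarter turns, each of which is covered by
      \<open>gen\<close>.\<close>
    have Fi: "(\<lambda>z. F (\<i> * z)) \<in> borel_measurable borel"
      by (rule measurable_compose[OF _ F]) (intro borel_measurable_continuous_onI continuous_intros)
    have "(\<integral>\<^sup>+z. F (\<i> * (\<i> * z)) \<partial>lborel) = (\<integral>\<^sup>+z. F (\<i> * z) \<partial>lborel)"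
      by (rule gen[OF Fi]) (auto simp: complex_eq_iff)
    also have "\<dots> = (\<integral>\<^sup>+z. F z \<partial>lborel)"
      by (rule gen[OF F]) (auto simp: complex_eq_iff)
    finally show ?thesis using True by (simp flip: mult.assoc)
  qed
qed

lemma nn_integral_rotate2:
  fixes F :: "complex \<times> complex \<Rightarrow> ennreal"
  assumes F[measurable]: "F \<in> borel_measurable borel" and c: "cmod c = 1" "cmod d = 1"
  shows "(\<integral>\<^sup>+z. F (c * fst z, d * snd z) \<partial>lborel) = (\<integral>\<^sup>+z. F z \<partial>lborel)"
proof -
  have F'[measurable]: "F \<in> borel_measurable (lborel \<Otimes>\<^sub>M lborel)"
    by (simp add: lborel_prod)
  have G[measurable]: "(\<lambda>z. F (c * fst z, d * snd z)) \<in> borel_measurable (lborel \<Otimes>\<^sub>M lborel)"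
    unfolding lborel_prod measurable_lborel2
    by (rule measurable_compose[OF _ F]) (intro borel_measurable_continuous_onI continuous_intros)
  have G1[measurable]: "(\<lambda>z. F (c * fst z, snd z)) \<in> borel_measurable (lborel \<Otimes>\<^sub>M lborel)"
    unfolding lborel_prod measurable_lborel2
    by (rule measurable_compose[OF _ F]) (intro borel_measurable_continuous_onI continuous_intros)
  have s1: "(\<lambda>y. F (x, y)) \<in> borel_measurable borel" for x
    by (rule measurable_compose[OF _ F]) (intro borel_measurable_continuous_onI continuous_intros)
  have s2: "(\<lambda>x. F (x, y)) \<in> borel_measurable borel" for y
    by (rule measurable_compose[OF _ F]) (intro borel_measurable_continuous_onI continuous_intros)
  have "(\<integral>\<^sup>+z. F (c * fst z, d * snd z) \<partial>lborel) = (\<integral>\<^sup>+x. \<integral>\<^sup>+y. F (c * x, d * y) \<partial>lborel \<partial>lborel)"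
    using lborel.nn_integral_fst[OF G] by (simp add: lborel_prod)
  also have "\<dots> = (\<integral>\<^sup>+x. \<integral>\<^sup>+y. F (c * x, y) \<partial>lborel \<partial>lborel)"
    by (rule nn_integral_cong) (rule nn_integral_rotate[OF s1 c(2)])
  also have "\<dots> = (\<integral>\<^sup>+y. \<integral>\<^sup>+x. F (c * x, y) \<partial>lborel \<partial>lborel)"
    using lborel_pair.Fubini[OF G1] by simp
  also have "\<dots> = (\<integral>\<^sup>+y. \<integral>\<^sup>+x. F (x, y) \<partial>lborel \<partial>lborel)"
    by (rule nn_integral_cong) (rule nn_integral_rotate[OF s2 c(1)])
  also have "\<dots> = (\<integral>\<^sup>+z. F z \<partial>lborel)"
    using lborel_pair.nn_integral_snd[OF F'] by (simp add: lborel_prod)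
  finally show ?thesis .
qed

text \<open>As an identity of measures the invariance carries over to Bochner integrals of complex
  functions.\<close>

lemma distr_rotate2:
  assumes "cmod c = 1" "cmod d = 1"
  shows "distr lborel borel (\<lambda>z. (c * fst z, d * snd z)) = lborel"
proof (rule measure_eqI)
  fix A assume "A \<in> sets (distr lborel borel (\<lambda>z. (c * fst z, d * snd z)))"
  then have A[measurable]: "A \<in> sets borel" by simp
  have m[measurable]: "(\<lambda>z. (c * fst z, d * snd z)) \<in> borel_measurable borel"
    by (intro borel_measurable_continuous_onI continuous_intros)
  have "emeasure (distr lborel borel (\<lambda>z. (c * fst z, d * snd z))) A = (\<integral>\<^sup>+z. indicator A z \<partial>distr lborel borel (\<lambda>z. (c * fst z, d * snd z)))"
    by simp
  also have "\<dots> = (\<integral>\<^sup>+z. indicator A (c * fst z, d * snd z) \<partial>lborel)"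
    by (subst nn_integral_distr) auto
  also have "\<dots> = (\<integral>\<^sup>+z. indicator A z \<partial>lborel)" by (rule nn_integral_rotate2) (auto simp: assms)
  finally show "emeasure (distr lborel borel (\<lambda>z. (c * fst z, d * snd z))) A = emeasure lborel A" by simp
qed simp

section \<open>Averages over angles, and polar coordinates in the plane\<close>

text \<open>The normalised angle is a probability measure on the real line, so means over a circle
  are ordinary integrals and Fubini against \<open>lborel\<close> is available.\<close>

definition circ :: "real measure" where "circ = uniform_measure lborel {0..2*pi}"

lemma sets_circ [simp, measurable_cong]: "sets circ = sets borel"
  and space_circ [simp]: "space circ = UNIV"
  by (simp_all add: circ_def)

lemma emeasure_circ_UNIV [simp]: "emeasure circ UNIV = 1"
  unfolding circ_def by (subst emeasure_uniform_measure) (auto simp: ennreal_mult_eq_top_iff divide_ennreal)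

interpretation circ: finite_measure circ
  by standard simp

lemma measure_circ_UNIV [simp]: "measure circ UNIV = 1"
  by (simp add: measure_def)

lemma AE_circ: "AE x in circ. 0 \<le> x \<and> x \<le> 2 * pi"
  unfolding circ_def by (rule AE_uniform_measureI) auto

lemma nn_integral_circ:
  assumes "f \<in> borel_measurable borel"
  shows "(\<integral>\<^sup>+x. f x \<partial>circ) = (\<integral>\<^sup>+x. f x * indicator {0..2*pi} x \<partial>lborel) / ennreal (2 * pi)"
  unfolding circ_def using assms by (subst nn_integral_uniform_measure) auto

lemma continuous_on_imp_integrable_circ:
  fixes f :: "real \<Rightarrow> 'a :: {banach, second_countable_topology}"
  assumes "continuous_on UNIV f"
  shows "integrable circ f"
proof -
  have "compact (f ` {0..2*pi})"
    using assms by (intro compact_continuous_image) (auto intro: continuous_on_subset)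
  then obtain B where B: "\<And>x. x \<in> {0..2*pi} \<Longrightarrow> norm (f x) \<le> B"
    by (meson bounded_iff compact_imp_bounded imageI)
  show ?thesis
  proof (rule circ.integrable_const_bound[of _ B])
    show "AE x in circ. norm (f x) \<le> B"
      using AE_circ by (rule eventually_mono) (use B in auto)
    show "f \<in> borel_measurable circ"
      using borel_measurable_continuous_onI[OF assms] by (simp cong: measurable_cong_sets)
  qed
qed

lemma borel_measurable_torus [measurable]:
  "(\<lambda>(\<theta>, z). (cis (k * \<theta>) * fst z, cis (l * \<theta>) * snd z)) \<in> borel \<Otimes>\<^sub>M borel \<rightarrow>\<^sub>M (borel :: (complex \<times> complex) measure)"
  unfolding borel_prod case_prod_beta by (intro borel_measurable_continuous_onI continuous_intros)

text \<open>The integral is invariant for each angle separately, hence also after averaging over the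
  angle. Periodicity in \<theta> plays no part in this argument, so the speeds \<open>k\<close> and
  \<open>l\<close> can be arbitrary reals; the speed -1/m occurs below.\<close>

lemma nn_integral_avg:
  fixes F :: "complex \<times> complex \<Rightarrow> ennreal"
  assumes F: "F \<in> borel_measurable borel"
  shows "(\<integral>\<^sup>+z. F z \<partial>lborel) = (\<integral>\<^sup>+z. \<integral>\<^sup>+\<theta>. F (cis (k * \<theta>) * fst z, cis (l * \<theta>) * snd z) \<partial>circ \<partial>lborel)"
proof -
  interpret pair_sigma_finite circ "lborel :: (complex \<times> complex) measure" ..
  let ?G = "\<lambda>\<theta> z. F (cis (k * \<theta>) * fst z, cis (l * \<theta>) * snd z)"
  have "(\<lambda>p. F ((\<lambda>(\<theta>, z). (cis (k * \<theta>) * fst z, cis (l * \<theta>) * snd z)) p)) \<in> borel_measurable (borel \<Otimes>\<^sub>M borel)"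
    by (rule measurable_compose[OF borel_measurable_torus F])
  then have G: "(\<lambda>(\<theta>, z). ?G \<theta> z) \<in> borel_measurable (circ \<Otimes>\<^sub>M lborel)"
    by (simp add: case_prod_beta cong: measurable_cong_sets)
  have "(\<integral>\<^sup>+z. \<integral>\<^sup>+\<theta>. ?G \<theta> z \<partial>circ \<partial>lborel) = (\<integral>\<^sup>+\<theta>. \<integral>\<^sup>+z. ?G \<theta> z \<partial>lborel \<partial>circ)"
    using Fubini[OF G] by (simp add: case_prod_beta)
  also have "\<dots> = (\<integral>\<^sup>+\<theta>. (\<integral>\<^sup>+z. F z \<partial>lborel) \<partial>circ)"
    by (intro nn_integral_cong nn_integral_rotate2[OF F]) auto
  finally show ?thesis by simp
qed

text \<open>The norm of the rotated function has the same integral for every angle, so the function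
  of angle and point is integrable on the product and the integrations may be exchanged.\<close>

lemma integral_avg:
  fixes F :: "complex \<times> complex \<Rightarrow> complex"
  assumes F: "integrable lborel F"
  shows "integrable lborel (\<lambda>z. LINT \<theta>|circ. F (cis (k * \<theta>) * fst z, cis (l * \<theta>) * snd z))"
    and "(LINT z|lborel. F z) = (LINT z|lborel. LINT \<theta>|circ. F (cis (k * \<theta>) * fst z, cis (l * \<theta>) * snd z))"
proof -
  interpret pair_sigma_finite circ "lborel :: (complex \<times> complex) measure" ..
  have Fm[measurable]: "F \<in> borel_measurable borel" using F by auto
  let ?G = "\<lambda>\<theta> z. F (cis (k * \<theta>) * fst z, cis (l * \<theta>) * snd z)"
  have "(\<lambda>p. F ((\<lambda>(\<theta>, z). (cis (k * \<theta>) * fst z, cis (l * \<theta>) * snd z)) p)) \<in> borel_measurable (borel \<Otimes>\<^sub>M borel)"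
    by (rule measurable_compose[OF borel_measurable_torus Fm])
  then have G: "(\<lambda>(\<theta>, z). ?G \<theta> z) \<in> borel_measurable (circ \<Otimes>\<^sub>M lborel)"
    by (simp add: case_prod_beta cong: measurable_cong_sets)
  have m: "(\<lambda>z. (cis (k * \<theta>) * fst z, cis (l * \<theta>) * snd z)) \<in> lborel \<rightarrow>\<^sub>M borel" for \<theta>
    unfolding measurable_lborel2 by (intro borel_measurable_continuous_onI continuous_intros)
  have inv: "integrable lborel (\<lambda>z. f (cis (k * \<theta>) * fst z, cis (l * \<theta>) * snd z))"
      "(LINT z|lborel. f (cis (k * \<theta>) * fst z, cis (l * \<theta>) * snd z)) = (LINT z|lborel. f z)" if "integrable lborel f"
    for \<theta> and f :: "complex \<times> complex \<Rightarrow> 'b::{banach, second_countable_topology}"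
    using integrable_distr_eq[OF m, of f \<theta>] integral_distr[OF m, of f \<theta>] distr_rotate2[of "cis (k * \<theta>)" "cis (l * \<theta>)"] that
    by auto
  have int: "integrable (circ \<Otimes>\<^sub>M lborel) (\<lambda>(\<theta>, z). ?G \<theta> z)"
  proof (rule Fubini_integrable[OF G])
    show "integrable circ (\<lambda>x. LINT y|lborel. norm (case (x, y) of (\<theta>, z) \<Rightarrow> ?G \<theta> z))"
      using inv(2)[OF integrable_norm[OF F]] by simp
    show "AE x in circ. integrable lborel (\<lambda>y. case (x, y) of (\<theta>, z) \<Rightarrow> ?G \<theta> z)"
      using inv(1)[OF F] by simp
  qed
  from integrable_snd[OF int] show "integrable lborel (\<lambda>z. LINT \<theta>|circ. ?G \<theta> z)" .
  from Fubini_integral[OF int]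
  have "(LINT z|lborel. LINT \<theta>|circ. ?G \<theta> z) = (LINT \<theta>|circ. LINT z|lborel. ?G \<theta> z)" .
  also have "\<dots> = (LINT z|lborel. F z)" using inv(2)[OF F] by simp
  finally show "(LINT z|lborel. F z) = (LINT z|lborel. LINT \<theta>|circ. ?G \<theta> z)" by simp
qed

text \<open>Polar coordinates by distribution functions: the law of the modulus and the density 2
  \<pi> r both give the half-line up to a \<ge> 0 the disc area \<pi> a^2, and these half-lines form
  an intersection-stable generator.\<close>

lemma nn_integral_radial:
  fixes g :: "real \<Rightarrow> ennreal"
  assumes g[measurable]: "g \<in> borel_measurable borel"
  shows "(\<integral>\<^sup>+z. g (cmod z) \<partial>lborel) = (\<integral>\<^sup>+r. g r * ennreal (2 * pi * r) * indicator {0<..} r \<partial>lborel)"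
proof -
  have "distr lborel borel cmod = density lborel (\<lambda>r. ennreal (2 * pi * r) * indicator {0<..} r)" (is "?M = ?N")
  proof (rule measure_eqI_generator_eq[where \<Omega>=UNIV and E="range (\<lambda>a. {..a})" and A="\<lambda>n. {..real n}"])
    show "Int_stable (range (\<lambda>a::real. {..a}))" by (auto simp: Int_stable_def)
    show "sets ?M = sigma_sets UNIV (range atMost)"
      by (simp add: borel_eq_atMost)
    show "sets ?N = sigma_sets UNIV (range atMost)"
      by (simp add: borel_eq_atMost)
    have Meq: "emeasure ?M {..a} = (if a < 0 then 0 else ennreal (pi * a\<^sup>2))" for a
    proof -
      have "emeasure ?M {..a} = emeasure lborel (cball (0::complex) a)"
        by (subst emeasure_distr) (auto simp: vimage_def cball_def)
      also have "\<dots> = (if a < 0 then 0 else ennreal (pi * a\<^sup>2))"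
        using emeasure_cball[of a "0::complex"] by (auto simp: unit_ball_vol_2 eval_unit_ball_vol)
      finally show ?thesis .
    qed
    show "emeasure ?M X = emeasure ?N X" if "X \<in> range atMost" for X
    proof -
      from that obtain a where X: "X = {..a}" by auto
      show ?thesis
      proof (cases "a < 0")
        case True
        then have "emeasure ?N {..a} = (\<integral>\<^sup>+(r::real). 0 \<partial>lborel)"
            by (subst emeasure_density) (auto intro!: nn_integral_cong simp del: nn_integral_const split: split_indicator)
          then show ?thesis unfolding X Meq using True by simp
      next
        case False
        have "emeasure ?N {..a} = (\<integral>\<^sup>+r. ennreal (2 * pi * r) * indicator {0..a} r \<partial>lborel)"
          by (subst emeasure_density) (auto intro!: nn_integral_cong simp: indicator_def)
        also have "\<dots> = ennreal (pi * a\<^sup>2 - pi * 0\<^sup>2)"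
          by (rule nn_integral_FTC_Icc) (use False in \<open>auto intro!: derivative_eq_intros\<close>)
        finally show ?thesis unfolding X Meq using False by simp
      qed
    qed
    show "(\<Union>i. {..real i}) = UNIV" using real_arch_simple by blast
    show "emeasure ?M {..real i} \<noteq> \<infinity>" for i unfolding Meq by simp
  qed auto
  then have "(\<integral>\<^sup>+z. g (cmod z) \<partial>lborel) = (\<integral>\<^sup>+r. g r \<partial>density lborel (\<lambda>r. ennreal (2 * pi * r) * indicator {0<..} r))"
    by (subst nn_integral_distr[symmetric, of cmod lborel borel]) (auto intro: borel_measurable_continuous_onI)
  also have "\<dots> = (\<integral>\<^sup>+r. (ennreal (2 * pi * r) * indicator {0<..} r) * g r \<partial>lborel)"
    by (subst nn_integral_density) auto
  finally show ?thesis by (simp add: mult_ac)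
qed

section \<open>One-dimensional estimates with powers\<close>

text \<open>Split at y = \<epsilon>: below, the maximum is constant and \<open>\<beta> > -1\<close>
  gives integrability at 0; above, \<open>e > \<beta> + 1\<close> gives integrability at infinity.
  Both pieces scale like \<epsilon>^(\<beta>+1-e).\<close>

lemma nn_integral_powr_max_le:
  fixes \<beta> e \<epsilon> :: real
  assumes "\<beta> > -1" "e > \<beta> + 1" "\<epsilon> > 0"
  shows "(\<integral>\<^sup>+y. ennreal (y powr \<beta> * max \<epsilon> y powr (-e)) * indicator {0<..} y \<partial>lborel)
     \<le> ennreal ((1 / (\<beta> + 1) + 1 / (e - \<beta> - 1)) * \<epsilon> powr (\<beta> + 1 - e))"
proof -
  have i1: "(\<integral>\<^sup>+y. ennreal (y powr \<beta>) * indicator {0..\<epsilon>} y \<partial>lborel) = ennreal (\<epsilon> powr (\<beta> + 1) / (\<beta> + 1))"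
    by (rule nn_integral_has_integral_lebesgue'[OF _ has_integral_powr_from_0]) (use assms in auto)
  have i2: "(\<integral>\<^sup>+y. ennreal (y powr (\<beta> - e)) * indicator {\<epsilon>..} y \<partial>lborel) = ennreal (- (\<epsilon> powr (\<beta> - e + 1)) / (\<beta> - e + 1))"
    by (rule nn_integral_has_integral_lebesgue'[OF _ has_integral_powr_to_inf]) (use assms in auto)
  have "(\<integral>\<^sup>+y. ennreal (y powr \<beta> * max \<epsilon> y powr (-e)) * indicator {0<..} y \<partial>lborel)
     \<le> (\<integral>\<^sup>+y. ennreal (\<epsilon> powr (-e)) * (ennreal (y powr \<beta>) * indicator {0..\<epsilon>} y) + ennreal (y powr (\<beta> - e)) * indicator {\<epsilon>..} y \<partial>lborel)"
  proof (intro nn_integral_mono)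
    fix y :: real
    consider "y \<le> 0" | "0 < y" "y \<le> \<epsilon>" | "0 < y" "\<epsilon> < y" by linarith
    then show "ennreal (y powr \<beta> * max \<epsilon> y powr (-e)) * indicator {0<..} y \<le> ennreal (\<epsilon> powr (-e)) * (ennreal (y powr \<beta>) * indicator {0..\<epsilon>} y) + ennreal (y powr (\<beta> - e)) * indicator {\<epsilon>..} y"
    proof cases
      case 1 then show ?thesis by simp
    next
      case 2
      then have "max \<epsilon> y = \<epsilon>" by simp
      then have "ennreal (y powr \<beta> * max \<epsilon> y powr (-e)) * indicator {0<..} y = ennreal (\<epsilon> powr (-e)) * (ennreal (y powr \<beta>) * indicator {0..\<epsilon>} y)"
        using 2 by (simp add: ennreal_mult mult.commute)
      then show ?thesis by simp
    next
      case 3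
      then have "max \<epsilon> y = y" by simp
      then show ?thesis using 3 by (simp flip: powr_add)
    qed
  qed
  also have "\<dots> = ennreal (\<epsilon> powr (-e)) * ennreal (\<epsilon> powr (\<beta> + 1) / (\<beta> + 1)) + ennreal (- (\<epsilon> powr (\<beta> - e + 1)) / (\<beta> - e + 1))"
    by (subst nn_integral_add) (auto simp: nn_integral_cmult i1 i2)
  also have "\<dots> = ennreal (\<epsilon> powr (-e) * (\<epsilon> powr (\<beta> + 1) / (\<beta> + 1)) + (- (\<epsilon> powr (\<beta> - e + 1)) / (\<beta> - e + 1)))"
    using assms by (subst ennreal_mult[symmetric], simp, simp, intro ennreal_plus[symmetric] divide_nonpos_nonpos) (auto intro: divide_nonpos_nonpos)
  also have "\<epsilon> powr (-e) * (\<epsilon> powr (\<beta> + 1) / (\<beta> + 1)) = \<epsilon> powr (\<beta> + 1 - e) / (\<beta> + 1)"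
    by (simp flip: powr_add)
  also have "(- (\<epsilon> powr (\<beta> - e + 1)) / (\<beta> - e + 1)) = \<epsilon> powr (\<beta> + 1 - e) / (e - \<beta> - 1)"
    using assms by (simp add: divide_simps) (simp add: algebra_simps)
  finally show ?thesis by (simp add: algebra_simps)
qed

text \<open>Up to \<pi>/3 the derivative cos is at least 1/2. Beyond, sin is at least 1/2, while y/4
  stays below 1/2 because y \<le> \<pi>/2 < 2.\<close>

lemma sin_ge_quarter:
  assumes "0 \<le> y" "y \<le> pi / 2"
  shows "y / 4 \<le> sin y"
proof (cases "y \<le> pi / 3")
  case True
  show ?thesis
  proof (cases "y = 0")
    case False
    then have "0 < y" using assms by simp
    then obtain x where x: "0 < x" "x < y" "sin y - sin 0 = (y - 0) * cos x"
      using MVT2[of 0 y sin cos] by (auto intro: DERIV_sin)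
    have "cos (pi / 3) \<le> cos x"
      using x True by (intro cos_monotone_0_pi_le) auto
    then have "1 / 2 \<le> cos x" by (simp add: cos_60)
    then have "y * (1 / 2) \<le> y * cos x" using \<open>0 < y\<close> by (intro mult_left_mono) auto
    then show ?thesis using x \<open>0 < y\<close> by simp
  qed auto
next
  case False
  have "sin (pi / 6) \<le> sin y"
    using False assms by (intro sin_monotone_2pi_le) auto
  then show ?thesis using assms pi_less_4 by (simp add: sin_30)
qed

lemma abs_le_norm_one_minus_cis:
  assumes "\<bar>\<phi>\<bar> \<le> pi"
  shows "\<bar>\<phi>\<bar> \<le> 4 * cmod (1 - cis \<phi>)"
proof -
  have "cmod (1 - cis \<phi>) ^ 2 = (2 * sin (\<phi> / 2)) ^ 2"
  proof -
    have "cmod (1 - cis \<phi>) ^ 2 = (1 - cos \<phi>)^2 + (sin \<phi>)^2" by (simp add: cmod_power2)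
    also have "\<dots> = 2 - 2 * cos \<phi>" using sin_cos_squared_add[of \<phi>] by (simp add: power2_eq_square algebra_simps)
    also have "cos \<phi> = 1 - 2 * sin (\<phi> / 2) ^ 2" using cos_double_sin[of "\<phi>/2"] by simp
    finally show ?thesis by (simp add: power2_eq_square)
  qed
  then have "cmod (1 - cis \<phi>) = \<bar>2 * sin (\<phi> / 2)\<bar>"
    by (metis abs_norm_cancel power2_eq_iff_nonneg abs_ge_zero power2_abs norm_ge_zero)
  moreover have "\<bar>\<phi>\<bar> / 2 / 4 \<le> \<bar>sin (\<phi> / 2)\<bar>"
    using sin_ge_quarter[of "\<bar>\<phi>\<bar> / 2"] assms by (cases "\<phi> \<ge> 0") auto
  ultimately show ?thesis by simp
qed

text \<open>Near the boundary the complex distance to 1 is controlled by the larger of the radial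
  and the angular distance. The constant is 8 = 4 times 2: the factor 4 from
  \<open>abs_le_norm_one_minus_cis\<close>, and 2 for moving from the unit circle to radius
  \<rho>.\<close>

lemma norm_one_minus_mult_cis_ge:
  assumes "0 \<le> \<rho>" "\<rho> < 1" "\<bar>\<phi>\<bar> \<le> pi"
  shows "max (1 - \<rho>) \<bar>\<phi>\<bar> \<le> 8 * cmod (1 - of_real \<rho> * cis \<phi>)"
proof -
  let ?D = "cmod (1 - of_real \<rho> * cis \<phi>)"
  have n: "cmod (of_real \<rho> * cis \<phi>) = \<rho>" using assms by (simp add: norm_mult)
  have 1: "1 - \<rho> \<le> ?D" using norm_triangle_ineq2[of 1 "of_real \<rho> * cis \<phi>"] n by simp
  have "1 - cis \<phi> = (1 - of_real \<rho> * cis \<phi>) - of_real (1 - \<rho>) * cis \<phi>" by (simp add: algebra_simps)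
  then have "cmod (1 - cis \<phi>) \<le> ?D + cmod (of_real (1 - \<rho>) * cis \<phi>)"
    by (metis norm_triangle_ineq4)
  also have "cmod (of_real (1 - \<rho>) * cis \<phi>) = 1 - \<rho>" using assms unfolding norm_mult norm_of_real by simp
  finally have "cmod (1 - cis \<phi>) \<le> 2 * ?D" using 1 by simp
  then show ?thesis using abs_le_norm_one_minus_cis[OF assms(3)] 1 assms by simp
qed

text \<open>The angular half of the Forelli-Rudin estimate: the lower bound by a maximum reduces it
  to \<open>nn_integral_powr_max_le\<close> with \<beta> = 0, and integrating out the angle costs
  one power of 1 - |\<xi>|.\<close>

lemma nn_integral_circ_kernel_le:
  assumes c: "c > 1"
  obtains C :: real where "C > 0"
    "\<And>\<xi>. cmod \<xi> < 1 \<Longrightarrow> (\<integral>\<^sup>+\<theta>. ennreal (cmod (1 - cis \<theta> * \<xi>) powr (-c)) \<partial>circ) \<le> ennreal (C * (1 - cmod \<xi>) powr (1 - c))"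
proof
  define K where "K = (1 / (0 + 1) + 1 / (c - 0 - 1))"
  have K: "K > 0" using c by (simp add: K_def add_pos_pos)
  show "8 powr c * (4 * K / (2 * pi)) > 0" using K by simp
  fix \<xi> :: complex assume \<xi>: "cmod \<xi> < 1"
  define \<rho> where "\<rho> = cmod \<xi>"
  define \<alpha> where "\<alpha> = Arg \<xi>"
  have \<xi>eq: "\<xi> = of_real \<rho> * cis \<alpha>" unfolding \<rho>_def \<alpha>_def by (metis rcis_cmod_Arg rcis_def)
  have \<alpha>: "- pi < \<alpha>" "\<alpha> \<le> pi" unfolding \<alpha>_def using Arg_bounded by auto
  have \<rho>: "0 \<le> \<rho>" "\<rho> < 1" using \<xi> by (auto simp: \<rho>_def)
  define M where "M = (\<lambda>y::real. ennreal (max (1 - \<rho>) \<bar>y\<bar> powr (-c)))"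
  have Mm[measurable]: "M \<in> borel_measurable borel" unfolding M_def by measurable
  have half: "(\<integral>\<^sup>+y. M y * indicator {0<..} y \<partial>lborel) \<le> ennreal (K * (1 - \<rho>) powr (1 - c))"
  proof -
    have "(\<integral>\<^sup>+y. M y * indicator {0<..} y \<partial>lborel) = (\<integral>\<^sup>+y. ennreal (y powr 0 * max (1 - \<rho>) y powr (-c)) * indicator {0<..} y \<partial>lborel)"
      by (intro nn_integral_cong) (auto simp: M_def indicator_def)
    also have "\<dots> \<le> ennreal (K * (1 - \<rho>) powr (1 - c))"
      using nn_integral_powr_max_le[of 0 c "1 - \<rho>"] c \<rho> by (simp add: K_def)
    finally show ?thesis .
  qed
  have full: "(\<integral>\<^sup>+y. M y \<partial>lborel) \<le> ennreal (2 * K * (1 - \<rho>) powr (1 - c))"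
  proof -
    have "(\<integral>\<^sup>+y. M y \<partial>lborel) = (\<integral>\<^sup>+y. M y * indicator {0<..} y + M y * indicator {..<0} y \<partial>lborel)"
      by (intro nn_integral_cong_AE AE_mp[OF AE_lborel_singleton[of 0] AE_I2]) (auto simp: indicator_def)
    also have "\<dots> = (\<integral>\<^sup>+y. M y * indicator {0<..} y \<partial>lborel) + (\<integral>\<^sup>+y. M y * indicator {..<0} y \<partial>lborel)"
      by (subst nn_integral_add) auto
    also have "(\<integral>\<^sup>+y. M y * indicator {..<0} y \<partial>lborel) = (\<integral>\<^sup>+y. M y * indicator {0<..} y \<partial>lborel)"
      by (subst nn_integral_real_affine[where c="-1" and t=0]) (auto simp: M_def indicator_def intro!: nn_integral_cong)
    also have "(\<integral>\<^sup>+y. M y * indicator {0<..} y \<partial>lborel) + (\<integral>\<^sup>+y. M y * indicator {0<..} y \<partial>lborel) \<le> ennreal (K * (1 - \<rho>) powr (1 - c)) + ennreal (K * (1 - \<rho>) powr (1 - c))"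
      by (intro add_mono half)
    also have "\<dots> = ennreal (2 * K * (1 - \<rho>) powr (1 - c))"
      using K by (subst ennreal_plus[symmetric]) auto
    finally show ?thesis .
  qed
  \<comment> \<open>The angle \<alpha> + \<theta> lies between -\<pi> and 3\<pi>, so it or its shift
    by -2\<pi> lies in the fundamental interval. Adding both candidates gives a bound without a case
    distinction under the integral.\<close>
  have pt: "ennreal (cmod (1 - cis \<theta> * \<xi>) powr (-c)) \<le> ennreal (8 powr c) * (M (\<alpha> + 1 * \<theta>) + M ((\<alpha> - 2 * pi) + 1 * \<theta>))" if th: "0 \<le> \<theta>" "\<theta> \<le> 2 * pi" for \<theta>
  proof -
    have key: "ennreal (cmod (1 - of_real \<rho> * cis \<phi>) powr (-c)) \<le> ennreal (8 powr c) * M \<phi>" if "\<bar>\<phi>\<bar> \<le> pi" for \<phi>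
    proof -
      have "cmod (1 - of_real \<rho> * cis \<phi>) powr (-c) \<le> (max (1 - \<rho>) \<bar>\<phi>\<bar> / 8) powr (-c)"
        using norm_one_minus_mult_cis_ge[OF \<rho> that] c \<rho> by (intro powr_mono2') auto
      also have "\<dots> = 8 powr c * max (1 - \<rho>) \<bar>\<phi>\<bar> powr (-c)"
        using \<rho> by (subst powr_divide) (auto simp: powr_minus_divide)
      finally show ?thesis unfolding M_def by (subst ennreal_mult[symmetric]) (auto intro!: ennreal_leI)
    qed
    have eq: "cis \<theta> * \<xi> = of_real \<rho> * cis (\<alpha> + \<theta>)" "cis \<theta> * \<xi> = of_real \<rho> * cis (\<alpha> - 2 * pi + \<theta>)"
    proof -
      show a: "cis \<theta> * \<xi> = of_real \<rho> * cis (\<alpha> + \<theta>)"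
        unfolding \<xi>eq by (simp add: cis_mult add.commute mult.left_commute)
      have "cis ((\<alpha> + \<theta>) - 2 * pi) = cis (\<alpha> + \<theta>)" by (simp flip: cis_divide)
      then show "cis \<theta> * \<xi> = of_real \<rho> * cis (\<alpha> - 2 * pi + \<theta>)"
        unfolding a by (simp add: algebra_simps)
    qed
    show ?thesis
    proof (cases "\<alpha> + \<theta> \<le> pi")
      case True
      then have "\<bar>\<alpha> + \<theta>\<bar> \<le> pi" using th \<alpha> by auto
      from key[OF this] show ?thesis unfolding eq(1) by (simp add: distrib_left add_increasing2)
    next
      case False
      then have "\<bar>\<alpha> - 2 * pi + \<theta>\<bar> \<le> pi" using th \<alpha> by auto
      from key[OF this] show ?thesis unfolding eq(2) by (simp add: distrib_left add_increasing)
    qed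
  qed
  have km: "(\<lambda>\<theta>. ennreal (cmod (1 - cis \<theta> * \<xi>) powr (-c))) \<in> borel_measurable borel"
  proof -
    have [measurable]: "(\<lambda>\<theta>. cmod (1 - cis \<theta> * \<xi>)) \<in> borel_measurable borel"
      by (intro borel_measurable_continuous_onI continuous_intros)
    show ?thesis by measurable
  qed
  have "(\<integral>\<^sup>+\<theta>. ennreal (cmod (1 - cis \<theta> * \<xi>) powr (-c)) \<partial>circ) = (\<integral>\<^sup>+\<theta>. ennreal (cmod (1 - cis \<theta> * \<xi>) powr (-c)) * indicator {0..2*pi} \<theta> \<partial>lborel) / ennreal (2 * pi)"
    by (rule nn_integral_circ[OF km])
  also have "\<dots> \<le> (\<integral>\<^sup>+\<theta>. ennreal (8 powr c) * (M (\<alpha> + 1 * \<theta>) + M ((\<alpha> - 2 * pi) + 1 * \<theta>)) \<partial>lborel) / ennreal (2 * pi)"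
    by (intro divide_right_mono_ennreal nn_integral_mono) (use pt in \<open>auto simp: indicator_def\<close>)
  also have "(\<integral>\<^sup>+\<theta>. ennreal (8 powr c) * (M (\<alpha> + 1 * \<theta>) + M ((\<alpha> - 2 * pi) + 1 * \<theta>)) \<partial>lborel) = ennreal (8 powr c) * ((\<integral>\<^sup>+\<theta>. M (\<alpha> + 1 * \<theta>) \<partial>lborel) + (\<integral>\<^sup>+\<theta>. M ((\<alpha> - 2 * pi) + 1 * \<theta>) \<partial>lborel))"
    by (subst nn_integral_cmult, measurable, subst nn_integral_add, auto)
  also have "(\<integral>\<^sup>+\<theta>. M (\<alpha> + 1 * \<theta>) \<partial>lborel) = (\<integral>\<^sup>+y. M y \<partial>lborel)"
    using nn_integral_real_affine[OF Mm, of 1 \<alpha>] by simp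
  also have "(\<integral>\<^sup>+\<theta>. M ((\<alpha> - 2 * pi) + 1 * \<theta>) \<partial>lborel) = (\<integral>\<^sup>+y. M y \<partial>lborel)"
    using nn_integral_real_affine[OF Mm, of 1 "\<alpha> - 2 * pi"] by simp
  also have "ennreal (8 powr c) * ((\<integral>\<^sup>+y. M y \<partial>lborel) + (\<integral>\<^sup>+y. M y \<partial>lborel)) / ennreal (2 * pi)
     \<le> ennreal (8 powr c) * (ennreal (2 * K * (1 - \<rho>) powr (1 - c)) + ennreal (2 * K * (1 - \<rho>) powr (1 - c))) / ennreal (2 * pi)"
    by (intro divide_right_mono_ennreal mult_left_mono add_mono full) auto
  also have "\<dots> = ennreal (8 powr c * (2 * K * (1 - \<rho>) powr (1 - c) + 2 * K * (1 - \<rho>) powr (1 - c)) / (2 * pi))"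
    using K by (subst ennreal_plus[symmetric], simp, simp, subst ennreal_mult[symmetric], simp, simp, subst divide_ennreal, auto)
  also have "8 powr c * (2 * K * (1 - \<rho>) powr (1 - c) + 2 * K * (1 - \<rho>) powr (1 - c)) / (2 * pi) = 8 powr c * (4 * K / (2 * pi)) * (1 - cmod \<xi>) powr (1 - c)"
    by (simp add: \<rho>_def algebra_simps)
  finally show "(\<integral>\<^sup>+\<theta>. ennreal (cmod (1 - cis \<theta> * \<xi>) powr (-c)) \<partial>circ) \<le> ennreal (8 powr c * (4 * K / (2 * pi)) * (1 - cmod \<xi>) powr (1 - c))" .
qed

text \<open>A power is increasing or decreasing according to the sign of the exponent. The sum of
  the endpoint values bounds it in both cases, so exponents of unknown sign such as a and b can be
  treated uniformly.\<close>

lemma powr_le_of_bounds: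
  fixes a b x \<beta> :: real
  assumes "0 < a" "a \<le> x" "x \<le> b"
  shows "x powr \<beta> \<le> a powr \<beta> + b powr \<beta>"
proof (cases "\<beta> \<ge> 0")
  case True
  then have "x powr \<beta> \<le> b powr \<beta>" using assms by (intro powr_mono2) auto
  then show ?thesis by (simp add: add_increasing)
next
  case False
  then have "x powr \<beta> \<le> a powr \<beta>" using assms by (intro powr_mono2') auto
  then show ?thesis by (simp add: add_increasing2)
qed

text \<open>The radial half of the Forelli-Rudin estimate. For r \<le> 1/2 only r^\<kappa> matters.
  For r > 1/2 the substitution y = 1 - r and the bound 1 - x r \<ge> max (1 - x) (1 - r) lead back
  to \<open>nn_integral_powr_max_le\<close>.\<close>

lemma nn_integral_radial_kernel_le:
  fixes \<beta> e \<kappa> :: real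
  assumes \<beta>: "\<beta> > -1" and e: "e > \<beta> + 1" and \<kappa>: "\<kappa> > -1"
  obtains C :: real where "C > 0"
    "\<And>x. 0 \<le> x \<Longrightarrow> x < 1 \<Longrightarrow>
       (\<integral>\<^sup>+r. ennreal (r powr \<kappa> * (1 - r) powr \<beta> * (1 - x * r) powr (-e)) * indicator {0<..<1} r \<partial>lborel)
       \<le> ennreal (C * (1 - x) powr (\<beta> + 1 - e))"
proof
  define B where "B = (1/2) powr \<beta> + 1 powr \<beta>"
  define A where "A = (1/2) powr \<kappa> + 1 powr \<kappa>"
  define K where "K = 1 / (\<beta> + 1) + 1 / (e - \<beta> - 1)"
  define C1 where "C1 = B * 2 powr e * ((1/2) powr (\<kappa> + 1) / (\<kappa> + 1))"
  have pos: "A > 0" "B > 0" "K > 0" "C1 > 0" using assms by (auto simp: A_def B_def K_def C1_def add_pos_pos)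
  show "C1 + A * K > 0" using pos by (simp add: add_pos_pos)
  fix x :: real assume x: "0 \<le> x" "x < 1"
  have pt: "ennreal (r powr \<kappa> * (1 - r) powr \<beta> * (1 - x * r) powr (-e)) * indicator {0<..<1} r
     \<le> ennreal (B * 2 powr e) * (ennreal (r powr \<kappa>) * indicator {0..1/2} r)
       + ennreal A * (ennreal ((1 + (-1) * r) powr \<beta> * max (1 - x) (1 + (-1) * r) powr (-e)) * indicator {0<..} (1 + (-1) * r))" for r
  proof -
    consider "r \<notin> {0<..<1}" | "0 < r" "r \<le> 1/2" | "1/2 < r" "r < 1" by fastforce
    then show ?thesis
    proof cases
      case 1 then show ?thesis by simp
    next
      case 2
      have b: "(1 - r) powr \<beta> \<le> B" unfolding B_def by (rule powr_le_of_bounds) (use 2 in auto)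
      have "x * r \<le> 1 * (1/2)" by (intro mult_mono) (use x 2 in auto)
      then have "(1 - x * r) powr (-e) \<le> (1/2) powr (-e)" using e \<beta> by (intro powr_mono2') auto
      then have k: "(1 - x * r) powr (-e) \<le> 2 powr e" by (simp add: powr_minus_divide powr_divide)
      have "r powr \<kappa> * (1 - r) powr \<beta> * (1 - x * r) powr (-e) \<le> r powr \<kappa> * B * 2 powr e"
        using b k pos by (intro mult_mono) auto
      then have "ennreal (r powr \<kappa> * (1 - r) powr \<beta> * (1 - x * r) powr (-e)) \<le> ennreal (B * 2 powr e) * ennreal (r powr \<kappa>)"
        using pos by (subst ennreal_mult[symmetric]) (auto intro!: ennreal_leI simp: mult_ac)
      then show ?thesis using 2 by (auto simp: indicator_def intro: add_increasing2)
    next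
      case 3
      have a: "r powr \<kappa> \<le> A" unfolding A_def by (rule powr_le_of_bounds) (use 3 in auto)
      have "x * r \<le> x" "x * r \<le> r" using x 3 by (auto simp: mult_left_le mult_left_le_one_le)
      then have "(1 - x * r) powr (-e) \<le> max (1 - x) (1 - r) powr (-e)"
        using e \<beta> x 3 by (intro powr_mono2') auto
      then have "r powr \<kappa> * (1 - r) powr \<beta> * (1 - x * r) powr (-e) \<le> A * (1 - r) powr \<beta> * max (1 - x) (1 - r) powr (-e)"
        using a pos by (intro mult_mono) auto
      then have "ennreal (r powr \<kappa> * (1 - r) powr \<beta> * (1 - x * r) powr (-e)) \<le> ennreal A * ennreal ((1 - r) powr \<beta> * max (1 - x) (1 - r) powr (-e))"
        using pos by (subst ennreal_mult[symmetric]) (auto intro!: ennreal_leI simp: mult_ac)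
      then show ?thesis using 3 by (auto simp: indicator_def intro: add_increasing)
    qed
  qed
  have i1: "(\<integral>\<^sup>+r. ennreal (r powr \<kappa>) * indicator {0..1/2} r \<partial>lborel) = ennreal ((1/2) powr (\<kappa> + 1) / (\<kappa> + 1))"
    by (rule nn_integral_has_integral_lebesgue'[OF _ has_integral_powr_from_0]) (use assms in auto)
  define g where "g = (\<lambda>y. ennreal (y powr \<beta> * max (1 - x) y powr (-e)) * indicator {0<..} y)"
  have g: "g \<in> borel_measurable borel" unfolding g_def by measurable
  have i2: "(\<integral>\<^sup>+r. g (1 + (-1) * r) \<partial>lborel) \<le> ennreal (K * (1 - x) powr (\<beta> + 1 - e))"
    using nn_integral_real_affine[OF g, of "-1" 1] nn_integral_powr_max_le[OF \<beta> e, of "1 - x"] x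
    by (simp add: g_def K_def)
  have "(\<integral>\<^sup>+r. ennreal (r powr \<kappa> * (1 - r) powr \<beta> * (1 - x * r) powr (-e)) * indicator {0<..<1} r \<partial>lborel)
    \<le> (\<integral>\<^sup>+r. ennreal (B * 2 powr e) * (ennreal (r powr \<kappa>) * indicator {0..1/2} r) + ennreal A * g (1 + (-1) * r) \<partial>lborel)"
    by (intro nn_integral_mono order_trans[OF pt]) (simp add: g_def)
  also have "\<dots> = ennreal (B * 2 powr e) * ennreal ((1/2) powr (\<kappa> + 1) / (\<kappa> + 1)) + ennreal A * (\<integral>\<^sup>+r. g (1 + (-1) * r) \<partial>lborel)"
    using g by (subst nn_integral_add) (auto simp: nn_integral_cmult i1)
  also have "\<dots> \<le> ennreal (B * 2 powr e) * ennreal ((1/2) powr (\<kappa> + 1) / (\<kappa> + 1)) + ennreal A * ennreal (K * (1 - x) powr (\<beta> + 1 - e))"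
    by (intro add_left_mono mult_left_mono i2) auto
  also have "\<dots> = ennreal (C1 + A * (K * (1 - x) powr (\<beta> + 1 - e)))"
    using pos \<kappa> by (subst (1 2) ennreal_mult[symmetric]) (auto simp: C1_def)
  \<comment> \<open>The contribution of r \<le> 1/2 is a constant; it is absorbed because the
    exponent \<beta> + 1 - e is negative and so the power of 1 - x is at least 1.\<close>
  also have "\<dots> \<le> ennreal ((C1 + A * K) * (1 - x) powr (\<beta> + 1 - e))"
  proof (rule ennreal_leI)
    have "1 \<le> (1 - x) powr (\<beta> + 1 - e)"
      using x e powr_mono2'[of "\<beta> + 1 - e" "1 - x" 1] by simp
    then have "C1 * 1 \<le> C1 * (1 - x) powr (\<beta> + 1 - e)" using pos by (intro mult_left_mono) auto
    then show "C1 + A * (K * (1 - x) powr (\<beta> + 1 - e)) \<le> (C1 + A * K) * (1 - x) powr (\<beta> + 1 - e)"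
      by (simp add: algebra_simps)
  qed
  finally show "(\<integral>\<^sup>+r. ennreal (r powr \<kappa> * (1 - r) powr \<beta> * (1 - x * r) powr (-e)) * indicator {0<..<1} r \<partial>lborel)
       \<le> ennreal ((C1 + A * K) * (1 - x) powr (\<beta> + 1 - e))" .
qed

text \<open>Below 1 the integrand dominates 1/r, whose integral is a difference of logarithms and
  exceeds every bound.\<close>

lemma nn_integral_powr_eq_top:
  fixes s \<delta> :: real
  assumes s: "s \<le> -1" and \<delta>: "0 < \<delta>"
  shows "(\<integral>\<^sup>+r. ennreal (r powr s) * indicator {0<..<\<delta>} r \<partial>lborel) = \<infinity>"
proof (rule ccontr)
  define \<eta> where "\<eta> = min \<delta> 1 / 2"
  have \<eta>: "0 < \<eta>" "\<eta> < \<delta>" "\<eta> < 1" using \<delta> by (auto simp: \<eta>_def)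
  let ?I = "(\<integral>\<^sup>+r. ennreal (r powr s) * indicator {0<..<\<delta>} r \<partial>lborel)"
  assume "?I \<noteq> \<infinity>"
  then obtain B where B: "B \<ge> 0" "?I = ennreal B" by (cases ?I) auto
  \<comment> \<open>Chosen so that ln \<eta> - ln t = B + 1, one more than the supposed value of the
    integral.\<close>
  define t where "t = \<eta> * exp (- B - 1)"
  have t: "0 < t" "t < \<eta>" using \<eta> B by (auto simp: t_def mult_less_cancel_left1)
  have "ennreal (ln \<eta> - ln t) = (\<integral>\<^sup>+r. ennreal (1 / r) * indicator {t..\<eta>} r \<partial>lborel)"
    by (rule nn_integral_FTC_Icc[symmetric]) (use t in \<open>auto intro!: derivative_eq_intros\<close>)
  also have "\<dots> \<le> ?I"
  proof (rule nn_integral_mono)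
    fix r :: real
    show "ennreal (1 / r) * indicator {t..\<eta>} r \<le> ennreal (r powr s) * indicator {0<..<\<delta>} r"
    proof (cases "r \<in> {t..\<eta>}")
      case True
      then have r: "0 < r" "r < 1" "r < \<delta>" using t \<eta> by auto
      have "r powr (-1) \<le> r powr s" using r s by (intro powr_mono') auto
      then have "1 / r \<le> r powr s" using r by (simp add: powr_minus_divide)
      then show ?thesis using r by (auto simp: indicator_def intro!: ennreal_leI)
    qed auto
  qed
  finally have "ln \<eta> - ln t \<le> B" unfolding B by (simp add: ennreal_le_iff B)
  moreover have "ln t = ln \<eta> + (- B - 1)" unfolding t_def using \<eta> by (simp add: ln_mult)
  ultimately show False by simp
qed

text \<open>A Laplace-type lower bound: the mass sits where 1 - r is of order 1/k. There r^(D k) is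
  at least exp(-2 D) and (1 - r)^s is comparable to k^(-s), on an interval of length 1/(4 k). The
  bound holds for every real s, so it also covers weights that fail to be integrable at 1.\<close>

lemma nn_integral_power_powr_ge:
  fixes s D :: real
  assumes D: "D > 0"
  obtains c :: real where "c > 0"
    "\<And>k. k \<ge> 2 \<Longrightarrow> ennreal (c * k powr (-s - 1)) \<le> (\<integral>\<^sup>+r. ennreal (r powr (D * k) * (1 - r) powr s) * indicator {1/2<..<1} r \<partial>lborel)"
proof
  define c0 where "c0 = exp (- 2 * D) * min 1 ((1/2) powr s)"
  have c0: "c0 > 0" by (simp add: c0_def)
  then show "c0 / 4 > 0" by simp
  fix k :: real assume k: "k \<ge> 2"
  \<comment> \<open>Here 1 - r runs from 1/(2k) to 3/(4k); \<open>k \<ge> 2\<close> keeps the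
    interval to the right of 1/2.\<close>
  define p q where "p = 1 - 3 / (4 * k)" and "q = 1 - 1 / (2 * k)"
  have pq: "p < q" "1/2 < p" "q < 1" using k by (auto simp: p_def q_def field_simps)
  have pt: "ennreal (c0 * k powr (-s)) * indicator {p..q} r \<le> ennreal (r powr (D * k) * (1 - r) powr s) * indicator {1/2<..<1} r" for r
  proof (cases "r \<in> {p..q}")
    case True
    then have r: "1/2 < r" "r < 1" using pq by auto
    have "exp (- 2 * D) \<le> r powr (D * k)"
    proof -
      have r1: "1 - 1/k \<le> r" using True k by (auto simp: p_def field_simps)
      have "ln (1 / r) \<le> 1 / r - 1" using r by (intro ln_le_minus_one) auto
      also have "\<dots> = (1 - r) / r" using r by (simp add: field_simps)
      also have "\<dots> \<le> (1 / k) / (1 / 2)" using r r1 k by (intro frac_le) auto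
      finally have "- 2 / k \<le> ln r" using r by (simp add: ln_div)
      then have "(D * k) * (- 2 / k) \<le> (D * k) * ln r" using D k by (intro mult_left_mono) auto
      then have "- 2 * D \<le> (D * k) * ln r" using k by simp
      then show ?thesis using r by (simp add: powr_def)
    qed
    moreover have "min 1 ((1/2) powr s) * k powr (-s) \<le> (1 - r) powr s"
    proof (cases "s \<ge> 0")
      case True
      have "(1 / (2 * k)) powr s \<le> (1 - r) powr s" using \<open>r \<in> {p..q}\<close> True k by (intro powr_mono2) (auto simp: q_def)
      moreover have "(1 / (2 * k)) powr s = (1/2) powr s * k powr (-s)" using k by (simp add: powr_divide powr_mult powr_minus_divide)
      moreover have "min 1 ((1/2) powr s) * k powr (-s) \<le> (1/2) powr s * k powr (-s)" by (intro mult_right_mono) auto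
      ultimately show ?thesis by linarith
    next
      case False
      have "(1 / k) powr s \<le> (1 - r) powr s" using \<open>r \<in> {p..q}\<close> False k r by (intro powr_mono2') (auto simp: p_def field_simps)
      moreover have "(1 / k) powr s = 1 * k powr (-s)" using k by (simp add: powr_divide powr_minus_divide)
      moreover have "min 1 ((1/2) powr s) * k powr (-s) \<le> 1 * k powr (-s)" by (intro mult_right_mono) auto
      ultimately show ?thesis by linarith
    qed
    ultimately have "exp (- 2 * D) * (min 1 ((1/2) powr s) * k powr (-s)) \<le> r powr (D * k) * (1 - r) powr s"
      by (intro mult_mono) auto
    then show ?thesis using True r by (auto simp: c0_def mult_ac intro!: ennreal_leI)
  qed auto
  have "c0 / 4 * k powr (- s - 1) = c0 * k powr (-s) * (q - p)"
    using k by (simp add: p_def q_def powr_diff field_simps)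
  then have "ennreal (c0 / 4 * k powr (- s - 1)) = ennreal (c0 * k powr (-s)) * emeasure lborel {p..q}"
    using c0 pq by (simp only:) (simp add: ennreal_mult)
  also have "\<dots> = (\<integral>\<^sup>+r. ennreal (c0 * k powr (-s)) * indicator {p..q} r \<partial>lborel)"
    by (simp add: nn_integral_cmult)
  also have "\<dots> \<le> (\<integral>\<^sup>+r. ennreal (r powr (D * k) * (1 - r) powr s) * indicator {1/2<..<1} r \<partial>lborel)"
    by (intro nn_integral_mono pt)
  finally show "ennreal (c0 / 4 * k powr (- s - 1)) \<le> (\<integral>\<^sup>+r. ennreal (r powr (D * k) * (1 - r) powr s) * indicator {1/2<..<1} r \<partial>lborel)" .
qed

section \<open>The Hartogs triangle in polar coordinates\<close>

text \<open>Taking m-th roots exhibits the domain as a family of discs of radius |z2|^(n/m) over the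
  punctured unit disc. This fibration underlies both the radial integrals and the Taylor expansion
  in z1.\<close>

lemma hartogs_iff:
  assumes "0 < m" "0 < n"
  shows "z \<in> hartogs m n \<longleftrightarrow>
    snd z \<noteq> 0 \<and> cmod (snd z) < 1 \<and> cmod (fst z) < cmod (snd z) powr (real n / real m)"
proof (cases "snd z = 0")
  case True
  then show ?thesis using assms by (cases z) (auto simp: hartogs_def power_0_left)
next
  case False
  let ?R = "cmod (snd z) powr (real n / real m)"
  have "?R ^ m = cmod (snd z) powr (real n / real m * real m)"
    using False by (simp add: powr_power)
  also have "\<dots> = cmod (snd z) ^ n" using False assms by (simp add: powr_realpow)
  finally have R: "?R ^ m = cmod (snd z) ^ n" .
  have "cmod (fst z) ^ m < cmod (snd z) ^ n \<longleftrightarrow> cmod (fst z) < ?R"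
    unfolding R[symmetric] using power_mono_iff[of ?R "cmod (fst z)" m] assms(1) by (metis not_le norm_ge_zero powr_ge_zero)
  moreover have "cmod (snd z) ^ n < 1 \<longleftrightarrow> cmod (snd z) < 1"
    using power_mono_iff[of 1 "cmod (snd z)" n] assms(2) by (metis not_le norm_ge_zero power_one zero_le_one)
  ultimately show ?thesis using False by (cases z) (auto simp: hartogs_def)
qed

lemma open_hartogs: "open (hartogs m n)"
proof -
  have "hartogs m n = {z. cmod (fst z) ^ m < cmod (snd z) ^ n} \<inter> {z. cmod (snd z) ^ n < 1}"
    by (auto simp: hartogs_def)
  then show ?thesis by (auto intro!: open_Int open_Collect_less continuous_intros)
qed

lemma borel_hartogs [measurable]: "hartogs m n \<in> sets borel"
  by (rule borel_open[OF open_hartogs])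

lemma nn_integral_disc_radial:
  fixes G :: "real \<Rightarrow> ennreal"
  assumes G[measurable]: "G \<in> borel_measurable borel" and R: "0 < R"
  shows "(\<integral>\<^sup>+z. G (cmod z / R) * indicator {..<R} (cmod z) \<partial>lborel)
    = ennreal (R\<^sup>2) * (\<integral>\<^sup>+\<rho>. G \<rho> * ennreal (2 * pi * \<rho>) * indicator {0<..<1} \<rho> \<partial>lborel)"
proof -
  have "(\<integral>\<^sup>+z. G (cmod z / R) * indicator {..<R} (cmod z) \<partial>lborel)
    = (\<integral>\<^sup>+r. G (r / R) * indicator {..<R} r * ennreal (2 * pi * r) * indicator {0<..} r \<partial>lborel)"
    by (rule nn_integral_radial) measurable
  also have "\<dots> = ennreal R * (\<integral>\<^sup>+r. G ((0 + R * r) / R) * indicator {..<R} (0 + R * r) * ennreal (2 * pi * (0 + R * r)) * indicator {0<..} (0 + R * r) \<partial>lborel)"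
    using R by (subst nn_integral_real_affine[where c=R and t=0]) auto
  also have "(\<integral>\<^sup>+r. G ((0 + R * r) / R) * indicator {..<R} (0 + R * r) * ennreal (2 * pi * (0 + R * r)) * indicator {0<..} (0 + R * r) \<partial>lborel)
     = (\<integral>\<^sup>+r. ennreal R * (G r * ennreal (2 * pi * r) * indicator {0<..<1} r) \<partial>lborel)"
  proof (rule nn_integral_cong)
    fix r :: real
    have "ennreal (2 * pi * (R * r)) = ennreal R * ennreal (2 * pi * r)" if "0 < r"
      using R that by (simp add: mult_ac flip: ennreal_mult)
    then show "G ((0 + R * r) / R) * indicator {..<R} (0 + R * r) * ennreal (2 * pi * (0 + R * r)) * indicator {0<..} (0 + R * r)
       = ennreal R * (G r * ennreal (2 * pi * r) * indicator {0<..<1} r)"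
      using R by (auto simp: indicator_def zero_less_mult_iff mult.left_commute)
  qed
  also have "\<dots> = ennreal R * (\<integral>\<^sup>+r. G r * ennreal (2 * pi * r) * indicator {0<..<1} r \<partial>lborel)"
    by (rule nn_integral_cmult) measurable
  finally show ?thesis using R by (simp add: power2_eq_square ennreal_mult mult.assoc)
qed

lemma nn_integral_hartogs_split:
  fixes F :: "complex \<times> complex \<Rightarrow> ennreal"
  assumes F: "F \<in> borel_measurable borel" and mn: "0 < m" "0 < n"
  shows "(\<integral>\<^sup>+z. F z * indicator (hartogs m n) z \<partial>lborel)
     = (\<integral>\<^sup>+y. (\<integral>\<^sup>+x. F (x, y) * indicator {..<cmod y powr (real n / real m)} (cmod x) \<partial>lborel) * indicator (ball 0 1 - {0}) y \<partial>lborel)"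
proof -
  have "(\<lambda>z. F z * indicator (hartogs m n) z) \<in> borel_measurable (lborel \<Otimes>\<^sub>M lborel)"
    using F by (simp add: lborel_prod)
  from lborel_pair.nn_integral_snd[OF this]
  have "(\<integral>\<^sup>+z. F z * indicator (hartogs m n) z \<partial>lborel) = (\<integral>\<^sup>+y. \<integral>\<^sup>+x. F (x, y) * indicator (hartogs m n) (x, y) \<partial>lborel \<partial>lborel)"
    by (simp add: lborel_prod)
  also have "\<dots> = (\<integral>\<^sup>+y. (\<integral>\<^sup>+x. F (x, y) * indicator {..<cmod y powr (real n / real m)} (cmod x) \<partial>lborel) * indicator (ball 0 1 - {0}) y \<partial>lborel)"
    by (intro nn_integral_cong) (auto simp: indicator_def hartogs_iff[OF mn])
  finally show ?thesis .
qed

text \<open>Rescaling each slice to the unit disc turns the domain into the square of (\<rho>, r) in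
  (0,1)^2. The exponent 1 + 2\<gamma> consists of 1 from polar coordinates in z2 and 2\<gamma> from
  the area scaling of the slice.\<close>

lemma nn_integral_hartogs_radial:
  fixes G :: "real \<times> real \<Rightarrow> ennreal"
  assumes G[measurable]: "G \<in> borel_measurable borel" and mn: "0 < m" "0 < n"
  defines "\<gamma> \<equiv> real n / real m"
  shows "(\<integral>\<^sup>+z. G (cmod (fst z) / cmod (snd z) powr \<gamma>, cmod (snd z)) * indicator (hartogs m n) z \<partial>lborel)
     = (\<integral>\<^sup>+r. (\<integral>\<^sup>+\<rho>. G (\<rho>, r) * ennreal (2 * pi * \<rho>) * indicator {0<..<1} \<rho> \<partial>lborel) * ennreal (2 * pi * r powr (1 + 2 * \<gamma>)) * indicator {0<..<1} r \<partial>lborel)"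
proof -
  have G2[measurable]: "G \<in> borel_measurable (borel \<Otimes>\<^sub>M borel)" by (simp add: borel_prod)
  define I where "I = (\<lambda>r. (\<integral>\<^sup>+\<rho>. G (\<rho>, r) * ennreal (2 * pi * \<rho>) * indicator {0<..<1} \<rho> \<partial>lborel))"
  have I[measurable]: "I \<in> borel_measurable borel" unfolding I_def by measurable
  have fm: "(\<lambda>z. G (cmod (fst z) / cmod (snd z) powr \<gamma>, cmod (snd z))) \<in> borel_measurable borel"
    unfolding borel_prod[symmetric] by measurable
  have "(\<integral>\<^sup>+z. G (cmod (fst z) / cmod (snd z) powr \<gamma>, cmod (snd z)) * indicator (hartogs m n) z \<partial>lborel)
     = (\<integral>\<^sup>+y. (\<integral>\<^sup>+x. G (cmod x / cmod y powr \<gamma>, cmod y) * indicator {..<cmod y powr \<gamma>} (cmod x) \<partial>lborel) * indicator (ball 0 1 - {0}) y \<partial>lborel)"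
    using nn_integral_hartogs_split[OF fm mn] by (simp add: \<gamma>_def)
  also have "\<dots> = (\<integral>\<^sup>+y. (\<lambda>r. ennreal ((r powr \<gamma>)\<^sup>2) * I r * indicator {0<..<1} r) (cmod y) \<partial>lborel)"
  proof (rule nn_integral_cong)
    fix y :: complex
    show "(\<integral>\<^sup>+x. G (cmod x / cmod y powr \<gamma>, cmod y) * indicator {..<cmod y powr \<gamma>} (cmod x) \<partial>lborel) * indicator (ball 0 1 - {0}) y
       = (\<lambda>r. ennreal ((r powr \<gamma>)\<^sup>2) * I r * indicator {0<..<1} r) (cmod y)"
    proof (cases "y \<in> ball 0 1 - {0}")
      case True
      have "(\<integral>\<^sup>+x. G (cmod x / cmod y powr \<gamma>, cmod y) * indicator {..<cmod y powr \<gamma>} (cmod x) \<partial>lborel)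
         = ennreal ((cmod y powr \<gamma>)\<^sup>2) * I (cmod y)"
        unfolding I_def by (rule nn_integral_disc_radial) (use True in auto)
      then show ?thesis using True by simp
    qed auto
  qed
  also have "\<dots> = (\<integral>\<^sup>+r. ennreal ((r powr \<gamma>)\<^sup>2) * I r * indicator {0<..<1} r * ennreal (2 * pi * r) * indicator {0<..} r \<partial>lborel)"
    by (rule nn_integral_radial) measurable
  also have "\<dots> = (\<integral>\<^sup>+r. I r * ennreal (2 * pi * r powr (1 + 2 * \<gamma>)) * indicator {0<..<1} r \<partial>lborel)"
  proof (rule nn_integral_cong)
    fix r :: real
    have "(r powr \<gamma>)\<^sup>2 * (2 * pi * r) = 2 * pi * r powr (1 + 2 * \<gamma>)" if "0 < r"
    proof -
      have "r powr (1 + 2 * \<gamma>) = r * (r powr \<gamma> * r powr \<gamma>)"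
        using that powr_add[of r 1 "2 * \<gamma>"] powr_add[of r \<gamma> \<gamma>] by (simp only: mult_2 powr_one)
      then show ?thesis by (simp add: power2_eq_square mult_ac del: powr_add)
    qed
    then have "ennreal ((r powr \<gamma>)\<^sup>2) * ennreal (2 * pi * r) = ennreal (2 * pi * r powr (1 + 2 * \<gamma>))" if "0 < r"
      using that by (subst ennreal_mult[symmetric]) simp_all
    then have "I r * (ennreal ((r powr \<gamma>)\<^sup>2) * ennreal (2 * pi * r)) = I r * ennreal (2 * pi * r powr (1 + 2 * \<gamma>))" if "0 < r"
      using that by simp
    moreover have "ennreal ((r powr \<gamma>)\<^sup>2) * I r * ennreal (2 * pi * r) = I r * (ennreal ((r powr \<gamma>)\<^sup>2) * ennreal (2 * pi * r))"
      by (simp only: mult_ac)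
    ultimately show "ennreal ((r powr \<gamma>)\<^sup>2) * I r * indicator {0<..<1} r * ennreal (2 * pi * r) * indicator {0<..} r
      = I r * ennreal (2 * pi * r powr (1 + 2 * \<gamma>)) * indicator {0<..<1} r"
      by (cases "0 < r \<and> r < 1") (simp_all only: indicator_def, auto)
  qed
  finally show ?thesis by (simp add: I_def)
qed

section \<open>Fourier coefficients, mean values and a removable singularity\<close>

lemma integral_circ:
  fixes f :: "real \<Rightarrow> complex"
  assumes f[measurable]: "f \<in> borel_measurable borel"
  shows "(LINT \<theta>|circ. f \<theta>) = (LINT \<theta>|lborel. indicator {0..2*pi} \<theta> *\<^sub>R f \<theta>) / of_real (2 * pi)"
proof -
  have "circ = density lborel (\<lambda>x. ennreal (indicator {0..2*pi} x / (2 * pi)))"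
    unfolding circ_def uniform_measure_def
    by (intro arg_cong2[where f=density] refl ext) (auto simp: indicator_def divide_ennreal[of 1 "2*pi", symmetric])
  then have "(LINT \<theta>|circ. f \<theta>) = (LINT \<theta>|lborel. (indicator {0..2*pi} \<theta> / (2 * pi)) *\<^sub>R f \<theta>)"
    using integral_density[of f lborel "\<lambda>x. indicator {0..2*pi} x / (2 * pi)"] by simp
  also have "\<dots> = (LINT \<theta>|lborel. (indicator {0..2*pi} \<theta> *\<^sub>R f \<theta>) / of_real (2 * pi))"
    by (intro Bochner_Integration.integral_cong) (auto simp: scaleR_conv_of_real)
  finally show ?thesis by simp
qed

lemma integral_circ_cis:
  fixes k :: int
  assumes "k \<noteq> 0"
  shows "(LINT \<theta>|circ. cis (of_int k * \<theta>)) = 0"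
proof -
  have m: "(\<lambda>\<theta>. cis (of_int k * \<theta>)) \<in> borel_measurable borel"
    by (intro borel_measurable_continuous_onI continuous_intros)
  have "(LINT \<theta>|lborel. indicator {0..2*pi} \<theta> *\<^sub>R cis (of_int k * \<theta>))
     = cis (of_int k * (2 * pi)) / (\<i> * of_int k) - cis (of_int k * 0) / (\<i> * of_int k)"
  proof (rule integral_FTC_Icc)
    fix x :: real
    have "((\<lambda>x. exp (\<i> * of_int k * of_real x) / (\<i> * of_int k)) has_vector_derivative exp (\<i> * of_int k * of_real x)) (at x within {0..2*pi})"
      using assms
      by (auto intro!: derivative_eq_intros has_vector_derivative_real_field simp: field_simps)
    then show "((\<lambda>x. cis (of_int k * x) / (\<i> * of_int k)) has_vector_derivative cis (of_int k * x)) (at x within {0..2*pi})"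
      by (simp add: cis_conv_exp mult_ac)
  qed (auto intro!: continuous_intros)
  also have "cis (of_int k * (2 * pi)) = 1" using cis_multiple_2pi[of "of_int k"] by (simp add: mult_ac)
  finally show ?thesis by (subst integral_circ[OF m]) simp
qed

lemma integral_circ_cis_if:
  "(LINT \<theta>|circ. cis (of_int k * \<theta>)) = (if k = 0 then 1 else 0)"
  using integral_circ_cis[of k] by simp

text \<open>The rotation may be run through at any nonzero integer speed \<open>d\<close>.\<close>

lemma integral_circ_power_series:
  fixes d :: int and F :: "complex \<Rightarrow> complex"
  assumes F: "\<And>z. z \<in> ball 0 R \<Longrightarrow> (\<lambda>i. c i * z ^ i) sums F z" and u: "cmod u < R" and d: "d \<noteq> 0"
  shows "(LINT \<theta>|circ. F (cis (of_int d * \<theta>) * u) * cis (- (of_int d * real q * \<theta>))) = c q * u ^ q"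
proof -
  define f where "f = (\<lambda>i \<theta>. c i * u ^ i * cis (of_int (d * (int i - int q)) * \<theta>))"
  \<comment> \<open>Convergence at an intermediate radius gives absolute convergence at
    \<open>u\<close>, uniformly in the angle, as termwise integration requires.\<close>
  obtain R' where R': "cmod u < R'" "R' < R" using u dense by blast
  have sm: "summable (\<lambda>i. norm (c i * u ^ i))"
  proof (rule powser_insidea)
    have "of_real R' \<in> ball (0::complex) R" using R' by (simp add: abs_less_iff) (smt (verit) norm_ge_zero)
    from F[OF this] show "summable (\<lambda>i. c i * of_real R' ^ i)" by (simp add: sums_iff)
    show "norm u < norm (of_real R' :: complex)" using R' by (smt (verit) norm_ge_zero norm_of_real)
  qed
  have i: "integrable circ (f i)" for i
    unfolding f_def by (intro continuous_on_imp_integrable_circ continuous_intros)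
  have eq: "F (cis (of_int d * \<theta>) * u) * cis (- (of_int d * real q * \<theta>)) = (\<Sum>i. f i \<theta>)" for \<theta>
  proof -
    have "cis (of_int d * \<theta>) * u \<in> ball 0 R" using u by (simp add: norm_mult)
    from sums_mult2[OF F[OF this], of "cis (- (of_int d * real q * \<theta>))"]
    have "(\<lambda>i. c i * (cis (of_int d * \<theta>) * u) ^ i * cis (- (of_int d * real q * \<theta>))) sums (F (cis (of_int d * \<theta>) * u) * cis (- (of_int d * real q * \<theta>)))" .
    moreover have "c i * (cis (of_int d * \<theta>) * u) ^ i * cis (- (of_int d * real q * \<theta>)) = f i \<theta>" for i
      unfolding f_def power_mult_distrib Complex.DeMoivre
      by (simp add: cis_mult mult_ac) (simp add: algebra_simps)
    ultimately show ?thesis by (simp add: sums_iff)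
  qed
  have nf: "norm (f i \<theta>) = norm (c i * u ^ i)" for i \<theta> by (simp add: f_def norm_mult)
  have "(LINT \<theta>|circ. (\<Sum>i. f i \<theta>)) = (\<Sum>i. LINT \<theta>|circ. f i \<theta>)"
    by (rule integral_suminf[OF i]) (use sm nf in auto)
  also have "(\<lambda>i. LINT \<theta>|circ. f i \<theta>) = (\<lambda>i. if i = q then c q * u ^ q else 0)"
    unfolding f_def using d by (simp add: integral_circ_cis_if fun_eq_iff del: of_int_mult of_int_diff)
  also have "(\<Sum>i. if i = q then c q * u ^ q else 0) = c q * u ^ q"
    using sums_single[of q "\<lambda>_. c q * u ^ q"] by (simp add: sums_iff)
  finally show ?thesis by (simp add: eq)
qed

text \<open>Jensen's inequality for the square: the variance of the modulus around its mean
  \<open>c\<close> is nonnegative.\<close>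

lemma norm_integral_circ_square_le:
  fixes f :: "real \<Rightarrow> complex"
  assumes f: "continuous_on UNIV f"
  shows "ennreal ((norm (LINT \<theta>|circ. f \<theta>))\<^sup>2) \<le> (\<integral>\<^sup>+\<theta>. ennreal ((norm (f \<theta>))\<^sup>2) \<partial>circ)"
proof -
  define c where "c = (LINT \<theta>|circ. norm (f \<theta>))"
  have i1: "integrable circ (\<lambda>\<theta>. norm (f \<theta>))" and i2: "integrable circ (\<lambda>\<theta>. (norm (f \<theta>))\<^sup>2)"
    by (intro continuous_on_imp_integrable_circ continuous_intros f)+
  have "0 \<le> (LINT \<theta>|circ. (norm (f \<theta>) - c)\<^sup>2)" by simp
  also have "\<dots> = (LINT \<theta>|circ. (norm (f \<theta>))\<^sup>2 - 2 * c * norm (f \<theta>) + c\<^sup>2)"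
    by (simp add: power2_eq_square algebra_simps)
  also have "\<dots> = (LINT \<theta>|circ. (norm (f \<theta>))\<^sup>2) - 2 * c * c + c\<^sup>2"
    using i1 i2 by (simp add: c_def)
  finally have "c\<^sup>2 \<le> (LINT \<theta>|circ. (norm (f \<theta>))\<^sup>2)" by (simp add: power2_eq_square)
  moreover have "norm (LINT \<theta>|circ. f \<theta>) \<le> c" unfolding c_def by (rule integral_norm_bound)
  then have "(norm (LINT \<theta>|circ. f \<theta>))\<^sup>2 \<le> c\<^sup>2" by (intro power_mono) auto
  ultimately have "(norm (LINT \<theta>|circ. f \<theta>))\<^sup>2 \<le> (LINT \<theta>|circ. (norm (f \<theta>))\<^sup>2)" by linarith
  then show ?thesis by (subst nn_integral_eq_integral[OF i2]) (auto intro: ennreal_leI)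
qed

lemma nn_integral_avg_complex:
  fixes F :: "complex \<Rightarrow> ennreal"
  assumes F: "F \<in> borel_measurable borel"
  shows "(\<integral>\<^sup>+z. F z \<partial>lborel) = (\<integral>\<^sup>+z. \<integral>\<^sup>+\<theta>. F (cis \<theta> * z) \<partial>circ \<partial>lborel)"
proof -
  interpret pair_sigma_finite circ "lborel :: complex measure" ..
  have "(\<lambda>p::real\<times>complex. cis (fst p) * snd p) \<in> borel_measurable (borel \<Otimes>\<^sub>M borel)"
    unfolding borel_prod by (intro borel_measurable_continuous_onI continuous_intros)
  from measurable_compose[OF this F]
  have G: "(\<lambda>(\<theta>, z). F (cis \<theta> * z)) \<in> borel_measurable (circ \<Otimes>\<^sub>M lborel)"
    by (simp add: case_prod_beta cong: measurable_cong_sets)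
  have "(\<integral>\<^sup>+z. \<integral>\<^sup>+\<theta>. F (cis \<theta> * z) \<partial>circ \<partial>lborel) = (\<integral>\<^sup>+\<theta>. \<integral>\<^sup>+z. F (cis \<theta> * z) \<partial>lborel \<partial>circ)"
    using Fubini[OF G] by (simp add: case_prod_beta)
  also have "\<dots> = (\<integral>\<^sup>+\<theta>. (\<integral>\<^sup>+z. F z \<partial>lborel) \<partial>circ)"
    by (intro nn_integral_cong nn_integral_rotate[OF F]) auto
  finally show ?thesis by simp
qed

text \<open>On each circle about z the value at the centre is the zeroth Fourier coefficient, so
  Jensen's inequality bounds its square by the circle mean. Averaging over rotations of the disc
  collects these bounds into an area integral.\<close>

lemma holomorphic_sub_mean_value:
  assumes g: "g holomorphic_on ball z r" and r: "0 < r"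
  shows "ennreal ((cmod (g z))\<^sup>2 * (pi * r\<^sup>2)) \<le> (\<integral>\<^sup>+w. ennreal ((cmod (g w))\<^sup>2) * indicator (ball z r) w \<partial>lborel)"
proof -
  define F where "F = (\<lambda>v. ennreal ((cmod (g (z + v)))\<^sup>2) * indicator (ball 0 r) v)"
  define h where "h = (\<lambda>v. g (z + v))"
  have h: "h holomorphic_on ball 0 r" unfolding h_def
    by (rule holomorphic_on_compose_gen[OF _ g, unfolded o_def]) (auto intro!: holomorphic_intros simp: dist_norm)
  have hc: "continuous_on (ball 0 r) h" using h holomorphic_on_imp_continuous_on by blast
  have Fb: "F = (\<lambda>v. ennreal ((cmod (indicator (ball 0 r) v *\<^sub>R h v))\<^sup>2))"
    by (auto simp: F_def h_def indicator_def)
  have "(\<lambda>v. indicator (ball 0 r) v *\<^sub>R h v) \<in> borel_measurable borel"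
    by (rule borel_measurable_continuous_on_indicator[OF _ hc]) auto
  then have F: "F \<in> borel_measurable borel" unfolding Fb by measurable
  have "(cmod (g z))\<^sup>2 * (pi * r\<^sup>2) = (cmod (g z))\<^sup>2 * measure lborel (ball (0::complex) r)"
    using r by (simp add: content_ball unit_ball_vol_2 eval_unit_ball_vol)
  then have "ennreal ((cmod (g z))\<^sup>2 * (pi * r\<^sup>2)) = ennreal ((cmod (g z))\<^sup>2) * emeasure lborel (ball (0::complex) r)"
  proof -
    have em: "emeasure lborel (ball (0::complex) r) = ennreal (measure lborel (ball (0::complex) r))"
      by (rule emeasure_eq_ennreal_measure) (use emeasure_lborel_ball_finite[of "0::complex" r] in auto)
    assume "(cmod (g z))\<^sup>2 * (pi * r\<^sup>2) = (cmod (g z))\<^sup>2 * measure lborel (ball (0::complex) r)"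
    then show ?thesis unfolding em by (simp only: ennreal_mult[OF zero_le_power2 measure_nonneg])
  qed
  also have "\<dots> = (\<integral>\<^sup>+(v::complex). ennreal ((cmod (g z))\<^sup>2) * indicator (ball 0 r) v \<partial>lborel)"
    by (simp add: nn_integral_cmult_indicator)
  also have "\<dots> \<le> (\<integral>\<^sup>+v. \<integral>\<^sup>+\<theta>. F (cis \<theta> * v) \<partial>circ \<partial>lborel)"
  proof (rule nn_integral_mono)
    fix v :: complex
    show "ennreal ((cmod (g z))\<^sup>2) * indicator (ball 0 r) v \<le> (\<integral>\<^sup>+\<theta>. F (cis \<theta> * v) \<partial>circ)"
    proof (cases "v \<in> ball 0 r")
      case True
      have "(LINT \<theta>|circ. h (cis (of_int 1 * \<theta>) * v) * cis (- (of_int 1 * real 0 * \<theta>))) = (deriv ^^ 0) h 0 / fact 0 * v ^ 0"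
      proof (rule integral_circ_power_series[where R=r and c = "\<lambda>i. (deriv ^^ i) h 0 / fact i"])
        fix w :: complex assume "w \<in> ball 0 r"
        from holomorphic_power_series[OF h this] show "(\<lambda>i. (deriv ^^ i) h 0 / fact i * w ^ i) sums h w" by simp
      qed (use True in auto)
      then have eq: "g z = (LINT \<theta>|circ. h (cis \<theta> * v))" by (simp add: h_def)
      have "continuous_on UNIV (\<lambda>\<theta>. h (cis \<theta> * v))"
        by (rule continuous_on_compose2[OF hc]) (use True in \<open>auto intro!: continuous_intros simp: norm_mult\<close>)
      from norm_integral_circ_square_le[OF this]
      show ?thesis using True unfolding eq by (simp add: F_def h_def indicator_def norm_mult)
    qed auto
  qed
  also have "\<dots> = (\<integral>\<^sup>+v. F v \<partial>lborel)" by (rule nn_integral_avg_complex[OF F, symmetric])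
  also have "\<dots> = (\<integral>\<^sup>+w. ennreal ((cmod (g w))\<^sup>2) * indicator (ball z r) w \<partial>lborel)"
  proof -
    have "(\<lambda>w. indicator (ball z r) w *\<^sub>R g w) \<in> borel_measurable borel"
      by (rule borel_measurable_continuous_on_indicator[OF _ holomorphic_on_imp_continuous_on[OF g]]) auto
    then have "(\<lambda>w. ennreal ((cmod (indicator (ball z r) w *\<^sub>R g w))\<^sup>2)) \<in> borel_measurable borel" by measurable
    also have "(\<lambda>w. ennreal ((cmod (indicator (ball z r) w *\<^sub>R g w))\<^sup>2)) = (\<lambda>w. ennreal ((cmod (g w))\<^sup>2) * indicator (ball z r) w)"
      by (auto simp: indicator_def)
    finally have m: "(\<lambda>w. ennreal ((cmod (g w))\<^sup>2) * indicator (ball z r) w) \<in> borel_measurable borel" .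
    have "(\<integral>\<^sup>+w. ennreal ((cmod (g w))\<^sup>2) * indicator (ball z r) w \<partial>lborel) = (\<integral>\<^sup>+w. ennreal ((cmod (g w))\<^sup>2) * indicator (ball z r) w \<partial>distr lborel borel ((+) z))"
      by (simp add: lborel_distr_plus)
    also have "\<dots> = (\<integral>\<^sup>+v. ennreal ((cmod (g (z + v)))\<^sup>2) * indicator (ball z r) (z + v) \<partial>lborel)"
      by (subst nn_integral_distr) (use m in auto)
    also have "\<dots> = (\<integral>\<^sup>+v. F v \<partial>lborel)"
      by (intro nn_integral_cong) (auto simp: F_def indicator_def dist_norm)
    finally show ?thesis by simp
  qed
  finally show ?thesis .
qed

text \<open>The sub-mean value property makes \<open>z g(z)\<close> tend to \<open>0\<close>, which is Riemann's criterion.\<close>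

lemma square_integrable_removable:
  assumes g: "g holomorphic_on (ball 0 1 - {0})"
    and fin: "(\<integral>\<^sup>+w. ennreal ((cmod (g w))\<^sup>2) * indicator (ball 0 1 - {0}) w \<partial>lborel) < \<infinity>"
  obtains h where "h holomorphic_on ball 0 1" "\<And>z. z \<in> ball 0 1 - {0} \<Longrightarrow> h z = g z"
proof -
  define f where "f = (\<lambda>w. ennreal ((cmod (g w))\<^sup>2) * indicator (ball 0 1 - {0}) w)"
  have "(\<lambda>w. indicator (ball 0 1 - {0}) w *\<^sub>R g w) \<in> borel_measurable borel"
    by (rule borel_measurable_continuous_on_indicator[OF _ holomorphic_on_imp_continuous_on[OF g]]) auto
  then have "(\<lambda>w. ennreal ((cmod (indicator (ball 0 1 - {0}) w *\<^sub>R g w))\<^sup>2)) \<in> borel_measurable borel" by measurable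
  also have "(\<lambda>w. ennreal ((cmod (indicator (ball 0 1 - {0}) w *\<^sub>R g w))\<^sup>2)) = f"
    by (auto simp: indicator_def f_def)
  finally have m[measurable]: "f \<in> borel_measurable borel" .
  \<comment> \<open>Reading |g|^2 as the density of a finite measure makes continuity from above
    available: small balls around 0 have small mass, since the point 0 itself has none.\<close>
  define \<mu> where "\<mu> = density lborel f"
  have fin_\<mu>: "emeasure \<mu> (space \<mu>) \<noteq> \<infinity>"
  proof -
    have "emeasure \<mu> (space \<mu>) = (\<integral>\<^sup>+w. f w \<partial>lborel)"
      by (simp add: \<mu>_def emeasure_density)
    then show ?thesis using fin by (simp add: f_def less_top)
  qed
  have lim: "(\<lambda>i. emeasure \<mu> (cball 0 (inverse (real (Suc i))))) \<longlonglongrightarrow> emeasure \<mu> (\<Inter>i. cball 0 (inverse (real (Suc i))))"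
  proof (rule Lim_emeasure_decseq)
    show "range (\<lambda>i. cball 0 (inverse (real (Suc i)))) \<subseteq> sets \<mu>" by (auto simp: \<mu>_def)
    show "decseq (\<lambda>i. cball (0::complex) (inverse (real (Suc i))))"
      by (intro decseq_SucI subset_cball le_imp_inverse_le) auto
    show "emeasure \<mu> (cball 0 (inverse (real (Suc i)))) \<noteq> \<infinity>" for i
      using fin_\<mu> emeasure_space[of \<mu> "cball 0 (inverse (real (Suc i)))"] by (metis infinity_ennreal_def neq_top_trans)
  qed
  have "(\<Inter>i. cball 0 (inverse (real (Suc i)))) = {0::complex}"
  proof (intro equalityI subsetI)
    fix x :: complex assume "x \<in> (\<Inter>i. cball 0 (inverse (real (Suc i))))"
    then have *: "norm x \<le> inverse (real (Suc i))" for i by auto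
    have "x = 0"
    proof (rule ccontr)
      assume "x \<noteq> 0"
      then obtain i where "inverse (real (Suc i)) < norm x" using reals_Archimedean[of "norm x"] by auto
      with *[of i] show False by simp
    qed
    then show "x \<in> {0}" by simp
  qed auto
  moreover have "emeasure \<mu> {0} = 0"
  proof -
    have "emeasure \<mu> {0} = (\<integral>\<^sup>+w. f w * indicator {0} w \<partial>lborel)"
      unfolding \<mu>_def by (subst emeasure_density) auto
    also have "\<dots> = (\<integral>\<^sup>+(w::complex). 0 \<partial>lborel)"
      by (intro nn_integral_cong) (auto simp: f_def indicator_def)
    finally show ?thesis by simp
  qed
  ultimately have lim0: "(\<lambda>i. emeasure \<mu> (cball 0 (inverse (real (Suc i))))) \<longlonglongrightarrow> 0" using lim by simp
  have "((\<lambda>z. (z - 0) * g z) \<longlongrightarrow> 0) (at 0)"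
  proof (rule tendstoI)
    fix \<epsilon> :: real assume \<epsilon>: "\<epsilon> > 0"
    have "\<forall>\<^sub>F i in sequentially. emeasure \<mu> (cball 0 (inverse (real (Suc i)))) < ennreal (\<epsilon>\<^sup>2 * pi / 4)"
      by (rule order_tendstoD(2)[OF lim0]) (use \<epsilon> in simp)
    then obtain i where i: "emeasure \<mu> (cball 0 (inverse (real (Suc i)))) < ennreal (\<epsilon>\<^sup>2 * pi / 4)"
      by (meson eventually_sequentially order_refl)
    define \<delta> where "\<delta> = inverse (real (Suc i)) / 2"
    have \<delta>: "\<delta> > 0" by (simp add: \<delta>_def)
    have "dist ((z - 0) * g z) 0 < \<epsilon>" if z: "z \<noteq> 0" "dist z 0 < \<delta>" for z
    proof -
      \<comment> \<open>The disc of radius |z|/2 around z avoids 0 and lies in the small ball. Its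
        area \<pi> |z|^2 / 4 explains the threshold \<epsilon>^2 \<pi> / 4 for the mass.\<close>
      let ?r = "cmod z / 2"
      have d1: "\<delta> \<le> 1/2" by (simp add: \<delta>_def field_simps)
      have w: "w \<noteq> 0 \<and> cmod w < 2 * \<delta>" if "w \<in> ball z ?r" for w
      proof -
        have "cmod (z - w) < cmod z / 2" using that by (simp add: dist_norm)
        moreover have "cmod w \<le> cmod z + cmod (z - w)" using norm_triangle_sub[of w z] by (simp add: norm_minus_commute)
        ultimately show ?thesis using z \<delta> by (auto simp: dist_norm)
      qed
      have sub: "ball z ?r \<subseteq> ball 0 1 - {0}" using w d1 by fastforce
      have "ennreal ((cmod (g z))\<^sup>2 * (pi * ?r\<^sup>2)) \<le> (\<integral>\<^sup>+w. ennreal ((cmod (g w))\<^sup>2) * indicator (ball z ?r) w \<partial>lborel)"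
        by (rule holomorphic_sub_mean_value) (use z g sub holomorphic_on_subset in auto)
      also have "\<dots> \<le> (\<integral>\<^sup>+w. f w * indicator (cball 0 (inverse (real (Suc i)))) w \<partial>lborel)"
        using sub w by (intro nn_integral_mono) (auto simp: f_def indicator_def \<delta>_def intro: less_imp_le)
      also have "\<dots> = emeasure \<mu> (cball 0 (inverse (real (Suc i))))"
        unfolding \<mu>_def by (subst emeasure_density) auto
      also have "\<dots> < ennreal (\<epsilon>\<^sup>2 * pi / 4)" by fact
      finally have "(cmod (g z))\<^sup>2 * (pi * ?r\<^sup>2) < \<epsilon>\<^sup>2 * pi / 4" by (simp add: ennreal_less_iff)
      then have "(cmod z * cmod (g z))\<^sup>2 < \<epsilon>\<^sup>2" by (simp add: power2_eq_square field_simps)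
      then show ?thesis using \<epsilon> by (simp add: norm_mult power_less_imp_less_base)
    qed
    then show "\<forall>\<^sub>F x in at 0. dist ((x - 0) * g x) 0 < \<epsilon>"
      unfolding eventually_at using \<delta> by blast
  qed
  then have "\<exists>h. h holomorphic_on ball 0 1 \<and> (\<forall>z\<in>ball 0 1 - {0}. h z = g z)"
    using holomorphic_on_extend_lim[OF g, THEN iffD2] by simp
  then show ?thesis using that by blast
qed

section \<open>Holomorphic functions of two variables and their slices\<close>

lemma holomorphic2_on_imp_continuous_on:
  assumes "holomorphic2_on f \<Omega>"
  shows "continuous_on \<Omega> f"
  using assms unfolding holomorphic2_on_def
  by (meson continuous_at_imp_continuous_on has_derivative_continuous)

lemma holomorphic2_on_slice1:
  assumes f: "holomorphic2_on f \<Omega>" and S: "\<And>x. x \<in> S \<Longrightarrow> (x, y) \<in> \<Omega>"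
  shows "(\<lambda>x. f (x, y)) holomorphic_on S"
  unfolding holomorphic_on_def
proof
  fix x assume "x \<in> S"
  then obtain d1 d2 where d: "(f has_derivative (\<lambda>(u, v). d1 * u + d2 * v)) (at (x, y))"
    using f S unfolding holomorphic2_on_def by blast
  have "((\<lambda>x. (x, y)) has_derivative (\<lambda>u. (u, 0))) (at x within S)"
    by (auto intro!: derivative_eq_intros)
  from has_derivative_compose[OF this d]
  have "((\<lambda>x. f (x, y)) has_field_derivative d1) (at x within S)"
    by (simp add: has_field_derivative_def)
  then show "(\<lambda>x. f (x, y)) field_differentiable at x within S" by (auto simp: field_differentiable_def)
qed

lemma holomorphic2_on_slice2:
  assumes f: "holomorphic2_on f \<Omega>" and S: "\<And>y. y \<in> S \<Longrightarrow> (x, y) \<in> \<Omega>"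
  shows "(\<lambda>y. f (x, y)) holomorphic_on S"
  unfolding holomorphic_on_def
proof
  fix y assume "y \<in> S"
  then obtain d1 d2 where d: "(f has_derivative (\<lambda>(u, v). d1 * u + d2 * v)) (at (x, y))"
    using f S unfolding holomorphic2_on_def by blast
  have "((\<lambda>y. (x, y)) has_derivative (\<lambda>v. (0, v))) (at y within S)"
    by (auto intro!: derivative_eq_intros)
  from has_derivative_compose[OF this d]
  have "((\<lambda>y. f (x, y)) has_field_derivative d2) (at y within S)"
    by (simp add: has_field_derivative_def)
  then show "(\<lambda>y. f (x, y)) field_differentiable at y within S" by (auto simp: field_differentiable_def)
qed

text \<open>Up to a constant the coefficient is a contour integral A(y) over a circle in x.
  Exchanging the two contour integrals shows that A equals its own Cauchy integral over a circle in
  y, and a continuous function with this property is differentiable inside.\<close>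

lemma taylor_coeff_field_differentiable:
  fixes f :: "complex \<times> complex \<Rightarrow> complex"
  assumes cont: "continuous_on (cball 0 \<rho> \<times> cball y0 \<delta>) f"
    and h1: "\<And>y. y \<in> cball y0 \<delta> \<Longrightarrow> (\<lambda>x. f (x, y)) holomorphic_on ball 0 \<rho>"
    and h2: "\<And>x. x \<in> cball 0 \<rho> \<Longrightarrow> (\<lambda>y. f (x, y)) holomorphic_on ball y0 \<delta>"
    and pos: "\<rho> > 0" "\<delta> > 0"
  shows "(\<lambda>y. (deriv ^^ j) (\<lambda>x. f (x, y)) 0) field_differentiable at y0"
proof -
  define A where "A = (\<lambda>u. contour_integral (circlepath 0 \<rho>) (\<lambda>x. f (x, u) / x ^ Suc j))"
  have c1: "continuous_on (cball 0 \<rho>) (\<lambda>x. f (x, y))" if "y \<in> cball y0 \<delta>" for y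
    by (rule continuous_on_compose2[OF cont]) (use that in \<open>auto intro!: continuous_intros\<close>)
  have c2: "continuous_on (cball y0 \<delta>) (\<lambda>y. f (x, y))" if "x \<in> cball 0 \<rho>" for x
    by (rule continuous_on_compose2[OF cont]) (use that in \<open>auto intro!: continuous_intros\<close>)
  have A_eq: "A u = (2 * pi * \<i>) * (deriv ^^ j) (\<lambda>x. f (x, u)) 0 / fact j" if "u \<in> cball y0 \<delta>" for u
    unfolding A_def using Cauchy_contour_integral_circlepath[OF c1[OF that] h1[OF that], of 0 j] pos by simp
  have circ_cont: "continuous_on UNIV (circlepath (0::complex) \<rho>)"
    by (simp add: circlepath) (intro continuous_intros)
  have contA: "continuous_on (cball y0 \<delta>) A"
  proof -
    have "continuous_on (cball y0 \<delta>) (\<lambda>u. integral (cbox 0 1) (\<lambda>t. f (circlepath 0 \<rho> t, u) / circlepath 0 \<rho> t ^ Suc j * (2 * pi * \<i> * \<rho> * exp (2 * of_real pi * \<i> * t))))"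
    proof (rule integral_continuous_on_param)
      have "continuous_on (cball y0 \<delta> \<times> cbox 0 (1::real)) (\<lambda>p. f (circlepath 0 \<rho> (snd p), fst p))"
      proof (rule continuous_on_compose2[OF cont])
        show "continuous_on (cball y0 \<delta> \<times> cbox 0 (1::real)) (\<lambda>p. (circlepath 0 \<rho> (snd p), fst p))"
          by (intro continuous_intros continuous_on_compose2[OF circ_cont]) auto
        show "(\<lambda>p. (circlepath 0 \<rho> (snd p), fst p)) ` (cball y0 \<delta> \<times> cbox 0 1) \<subseteq> cball 0 \<rho> \<times> cball y0 \<delta>"
          using pos by (auto simp: circlepath norm_mult)
      qed
      moreover have "continuous_on (cball y0 \<delta> \<times> cbox 0 (1::real)) (\<lambda>p. circlepath 0 \<rho> (snd p))"
        by (intro continuous_on_compose2[OF circ_cont] continuous_intros) auto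
      moreover have "circlepath 0 \<rho> t \<noteq> 0" for t using pos by (simp add: circlepath)
      ultimately show "continuous_on (cball y0 \<delta> \<times> cbox 0 1) (\<lambda>(u, t). f (circlepath 0 \<rho> t, u) / circlepath 0 \<rho> t ^ Suc j * (2 * pi * \<i> * \<rho> * exp (2 * of_real pi * \<i> * t)))"
        unfolding case_prod_beta by (intro continuous_intros) auto
    qed
    then show ?thesis unfolding A_def contour_integral_integral vector_derivative_circlepath by simp
  qed
  \<comment> \<open>The exponent 1 is kept explicit because
    \<open>Cauchy_next_derivative_circlepath\<close> expects a power of
    \<open>u - w\<close>.\<close>
  have V: "((\<lambda>u. A u / (u - w) ^ 1) has_contour_integral (2 * pi * \<i> * A w)) (circlepath y0 \<delta>)" if w: "w \<in> ball y0 \<delta>" for w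
  proof -
    have ci: "(\<lambda>u. A u / (u - w)) contour_integrable_on circlepath y0 \<delta>"
      by (intro contour_integrable_continuous_circlepath continuous_intros continuous_on_subset[OF contA])
         (use w pos in \<open>auto simp: dist_norm\<close>)
    have "contour_integral (circlepath y0 \<delta>) (\<lambda>u. A u / (u - w))
       = contour_integral (circlepath y0 \<delta>) (\<lambda>u. contour_integral (circlepath 0 \<rho>) (\<lambda>x. f (x, u) / x ^ Suc j / (u - w)))"
    proof (rule contour_integral_eq)
      fix u assume u: "u \<in> path_image (circlepath y0 \<delta>)"
      then have u': "u \<in> cball y0 \<delta>" using pos by auto
      have "(\<lambda>x. f (x, u) / x ^ Suc j) contour_integrable_on circlepath 0 \<rho>"
        by (intro contour_integrable_continuous_circlepath continuous_intros continuous_on_subset[OF c1[OF u']])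
           (use pos in auto)
      then show "A u / (u - w) = contour_integral (circlepath 0 \<rho>) (\<lambda>x. f (x, u) / x ^ Suc j / (u - w))"
        unfolding A_def using contour_integral_div by fastforce
    qed
    also have "\<dots> = contour_integral (circlepath 0 \<rho>) (\<lambda>x. contour_integral (circlepath y0 \<delta>) (\<lambda>u. f (x, u) / x ^ Suc j / (u - w)))"
    proof (rule contour_integral_swap)
      show "continuous_on (path_image (circlepath y0 \<delta>) \<times> path_image (circlepath 0 \<rho>)) (\<lambda>(u, x). f (x, u) / x ^ Suc j / (u - w))"
        unfolding case_prod_beta
        by (intro continuous_intros continuous_on_compose2[OF cont])
           (use w pos in \<open>auto simp: dist_norm\<close>)
    qed (auto simp: vector_derivative_circlepath intro!: continuous_intros)
    also have "\<dots> = contour_integral (circlepath 0 \<rho>) (\<lambda>x. (2 * pi * \<i>) * (f (x, w) / x ^ Suc j))"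
    proof (rule contour_integral_eq)
      fix x assume "x \<in> path_image (circlepath 0 \<rho>)"
      then have x: "x \<in> cball 0 \<rho>" using pos by auto
      have "((\<lambda>u. f (x, u) / (u - w)) has_contour_integral (2 * of_real pi * \<i> * f (x, w))) (circlepath y0 \<delta>)"
        by (rule Cauchy_integral_circlepath[OF c2[OF x] h2[OF x]]) (use w in \<open>simp add: dist_norm norm_minus_commute\<close>)
      from has_contour_integral_div[OF this, of "x ^ Suc j"]
      show "contour_integral (circlepath y0 \<delta>) (\<lambda>u. f (x, u) / x ^ Suc j / (u - w)) = (2 * pi * \<i>) * (f (x, w) / x ^ Suc j)"
        by (intro contour_integral_unique) (simp add: divide_divide_eq_left mult.commute)
    qed
    also have "\<dots> = 2 * pi * \<i> * A w"
    proof -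
      have w': "w \<in> cball y0 \<delta>" using w by auto
      have "(\<lambda>x. f (x, w) / x ^ Suc j) contour_integrable_on circlepath 0 \<rho>"
        by (intro contour_integrable_continuous_circlepath continuous_intros continuous_on_subset[OF c1[OF w']])
           (use pos in auto)
      then show ?thesis unfolding A_def by (rule contour_integral_lmul)
    qed
    finally show ?thesis using has_contour_integral_integral[OF ci] by simp
  qed
  have "((\<lambda>w. 2 * pi * \<i> * A w) has_field_derivative (of_nat 1 * contour_integral (circlepath y0 \<delta>) (\<lambda>u. A u / (u - y0) ^ Suc 1))) (at y0)"
    by (rule Cauchy_next_derivative_circlepath(2)[OF _ V]) (use pos in \<open>auto intro: continuous_on_subset[OF contA]\<close>)
  then have "(\<lambda>w. 2 * pi * \<i> * A w) field_differentiable at y0"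
    unfolding field_differentiable_def by blast
  \<comment> \<open>One factor 2 \<pi> \<i> comes from the Cauchy formula for the coefficient in x,
    the other from that for A in y.\<close>
  from field_differentiable_mult[OF field_differentiable_const this]
  have "(\<lambda>w. (fact j / (2 * pi * \<i>)^2) * (2 * pi * \<i> * A w)) field_differentiable at y0" .
  then show ?thesis
  proof (rule field_differentiable_transform_within[where d=\<delta>, rotated 3])
    fix u assume "u \<in> UNIV" "dist u y0 < \<delta>"
    then have "u \<in> cball y0 \<delta>" by (simp add: dist_commute)
    then show "(fact j / (2 * pi * \<i>)^2) * (2 * pi * \<i> * A u) = (deriv ^^ j) (\<lambda>x. f (x, u)) 0"
      by (simp add: A_eq power2_eq_square)
  qed (use pos in auto)
qed

text \<open>Among the square integrable monomials \<open>z\<^sub>1 ^ j * z\<^sub>2 ^ k\<close> the least \<open>k\<close> is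
  \<open>- (KK m n j + 1)\<close>, and for it \<open>n (j + 1) + m (k + 1) = LL m n j\<close>.\<close>

definition KK :: "nat \<Rightarrow> nat \<Rightarrow> nat \<Rightarrow> nat" where
  "KK m n j = (n * (j + 1) - 1) div m"

definition LL :: "nat \<Rightarrow> nat \<Rightarrow> nat \<Rightarrow> nat" where
  "LL m n j = (n * (j + 1) - 1) mod m + 1"

lemma LL_KK: "0 < n \<Longrightarrow> n * (j + 1) = m * KK m n j + LL m n j"
  unfolding KK_def LL_def by (simp add: add.assoc[symmetric])

text \<open>Subtracting 1 before \<open>mod\<close> and adding it afterwards moves the remainder to
  the range from 1 to m. Being positive it meets the strict integrability condition; being at most m
  it becomes nonpositive when the exponent of z2 drops by one more.\<close>

lemma LL_bounds: "0 < m \<Longrightarrow> 1 \<le> LL m n j" "0 < m \<Longrightarrow> LL m n j \<le> m"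
  by (auto simp: LL_def Suc_le_eq)

text \<open>Raising the exponent of z1 by m multiplies the minimal monomial by z1^m / z2^n and keeps
  its distance from the integrability threshold. This periodicity leaves only m residue classes to
  consider.\<close>

lemma KK_LL_add:
  assumes "0 < m" "0 < n"
  shows "KK m n (i * m + r) = KK m n r + n * i" "LL m n (i * m + r) = LL m n r"
proof -
  have "n * (i * m + r + 1) - 1 = (n * (r + 1) - 1) + (n * i) * m"
    using assms by (simp add: algebra_simps)
  moreover define t where "t = n * (r + 1) - 1"
  ultimately have "n * (i * m + r + 1) - 1 = t + (n * i) * m" by simp
  then show "KK m n (i * m + r) = KK m n r + n * i" "LL m n (i * m + r) = LL m n r"
    unfolding KK_def LL_def t_def[symmetric] using assms(1) by (simp_all only:) simp_all
qed

section \<open>Laurent expansion of functions in the Bergman space\<close>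

lemma borel_measurable_hartogs_indicator:
  fixes f :: "complex \<times> complex \<Rightarrow> complex"
  assumes "continuous_on (hartogs m n) f"
  shows "(\<lambda>z. indicator (hartogs m n) z *\<^sub>R f z) \<in> borel_measurable borel"
  by (rule borel_measurable_continuous_on_indicator[OF _ assms]) simp

text \<open>The operators are defined with \<open>lebesgue_on\<close>, while rotations and Fubini
  are available for \<open>lborel\<close>. This and the next two lemmas pass between the two by
  extension by zero, for a Borel set S.\<close>

lemma nn_integral_lebesgue_on:
  fixes f :: "'a::euclidean_space \<Rightarrow> ennreal"
  assumes "S \<in> sets borel"
  shows "(\<integral>\<^sup>+z. f z \<partial>lebesgue_on S) = (\<integral>\<^sup>+z. f z * indicator S z \<partial>lborel)"
  using assms by (subst nn_integral_restrict_space) (auto simp: nn_integral_completion)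

lemma integrable_lebesgue_on_iff:
  fixes f :: "'a::euclidean_space \<Rightarrow> 'b :: {banach, second_countable_topology}"
  assumes "S \<in> sets borel" "(\<lambda>z. indicator S z *\<^sub>R f z) \<in> borel_measurable borel"
  shows "integrable (lebesgue_on S) f \<longleftrightarrow> integrable lborel (\<lambda>z. indicator S z *\<^sub>R f z)"
  using assms by (subst integrable_restrict_space) (auto simp: integrable_completion)

lemma integral_lebesgue_on:
  fixes f :: "'a::euclidean_space \<Rightarrow> 'b :: {banach, second_countable_topology}"
  assumes "S \<in> sets borel" "(\<lambda>z. indicator S z *\<^sub>R f z) \<in> borel_measurable borel"
  shows "(LINT z|lebesgue_on S. f z) = (LINT z|lborel. indicator S z *\<^sub>R f z)"
  using assms by (subst integral_restrict_space) (auto simp: integral_completion)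

lemma hartogs_rotate: "cmod c = 1 \<Longrightarrow> cmod d = 1 \<Longrightarrow> (c * x, d * y) \<in> hartogs m n \<longleftrightarrow> (x, y) \<in> hartogs m n"
  by (simp add: hartogs_def norm_mult)

text \<open>The Taylor coefficients in the first variable, multiplied by the power of the second variable
  that square integrability allows, extend holomorphically across \<open>0\<close>.\<close>

lemma bergman_space_taylor:
  assumes f: "f \<in> bergman_space (hartogs m n)" and mn: "0 < m" "0 < n"
  obtains g :: "nat \<Rightarrow> complex \<Rightarrow> complex"
  where "\<And>j. g j holomorphic_on ball 0 1"
    and "\<And>x y. (x, y) \<in> hartogs m n \<Longrightarrow>
           (\<lambda>j. g j y / y ^ (KK m n j + 1) * x ^ j) sums f (x, y)"
    and "\<And>x y j. (x, y) \<in> hartogs m n \<Longrightarrow>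
           (LINT \<theta>|circ. f (cis \<theta> * x, y) * cis (- (real j * \<theta>))) = g j y / y ^ (KK m n j + 1) * x ^ j"
proof -
  let ?H = "hartogs m n"
  define \<gamma> where "\<gamma> = real n / real m"
  have hol: "holomorphic2_on f ?H" and int: "integrable (lebesgue_on ?H) (\<lambda>z. (cmod (f z))\<^sup>2)"
    using f by (auto simp: bergman_space_def)
  have fc: "continuous_on ?H f" by (rule holomorphic2_on_imp_continuous_on[OF hol])
  define a where "a = (\<lambda>j y. (deriv ^^ j) (\<lambda>x. f (x, y)) 0 / fact j)"
  have Hiff: "(x, y) \<in> ?H \<longleftrightarrow> y \<noteq> 0 \<and> cmod y < 1 \<and> cmod x < cmod y powr \<gamma>" for x y
    using hartogs_iff[OF mn, of "(x, y)"] by (simp add: \<gamma>_def)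
  have slice: "(\<lambda>x. f (x, y)) holomorphic_on ball 0 (cmod y powr \<gamma>)" if "y \<noteq> 0" "cmod y < 1" for y
    by (rule holomorphic2_on_slice1[OF hol]) (use that in \<open>auto simp: Hiff\<close>)
  have ser: "(\<lambda>j. a j y * x ^ j) sums f (x, y)" if "(x, y) \<in> ?H" for x y
    using holomorphic_power_series[OF slice, of y x] that by (simp add: Hiff a_def)
  have avg: "(LINT \<theta>|circ. f (cis \<theta> * x, y) * cis (- (real j * \<theta>))) = a j y * x ^ j" if "(x, y) \<in> ?H" for x y j
  proof -
    have "(LINT \<theta>|circ. f (cis (of_int 1 * \<theta>) * x, y) * cis (- (of_int 1 * real j * \<theta>))) = a j y * x ^ j"
      by (rule integral_circ_power_series[where R="cmod y powr \<gamma>" and F = "\<lambda>x. f (x, y)"])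
        (use that ser in \<open>auto simp: Hiff\<close>)
    then show ?thesis by simp
  qed
  have a_hol: "a j holomorphic_on (ball 0 1 - {0})" for j
    unfolding holomorphic_on_def
  proof
    fix y0 :: complex assume y0: "y0 \<in> ball 0 1 - {0}"
    \<comment> \<open>Near \<open>y0\<close> all slices keep more than half of the radius at
      \<open>y0\<close>, so a closed polydisc around (0, y0) lies in the domain.\<close>
    define S where "S = {y. y \<noteq> 0 \<and> cmod y < 1 \<and> cmod y0 powr \<gamma> / 2 < cmod y powr \<gamma>}"
    have "open ({y::complex. y \<noteq> 0} \<inter> {y. cmod y < 1})"
      by (intro open_Int open_Collect_less open_Collect_neq continuous_intros)
    moreover have "continuous_on ({y::complex. y \<noteq> 0} \<inter> {y. cmod y < 1}) (\<lambda>y. cmod y powr \<gamma>)"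
      by (intro continuous_intros) auto
    ultimately have "open (({y::complex. y \<noteq> 0} \<inter> {y. cmod y < 1}) \<inter> (\<lambda>y. cmod y powr \<gamma>) -` {cmod y0 powr \<gamma> / 2<..})"
      by (intro continuous_open_preimage) auto
    also have "(({y::complex. y \<noteq> 0} \<inter> {y. cmod y < 1}) \<inter> (\<lambda>y. cmod y powr \<gamma>) -` {cmod y0 powr \<gamma> / 2<..}) = S"
      by (auto simp: S_def)
    finally have "open S" .
    moreover have "y0 \<in> S" using y0 by (simp add: S_def)
    ultimately obtain \<delta> where \<delta>: "\<delta> > 0" "cball y0 \<delta> \<subseteq> S" by (meson open_contains_cball)
    have inH: "(x, y) \<in> ?H" if "x \<in> cball 0 (cmod y0 powr \<gamma> / 2)" "y \<in> cball y0 \<delta>" for x y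
      using that \<delta> by (fastforce simp: Hiff S_def)
    have "(\<lambda>y. (deriv ^^ j) (\<lambda>x. f (x, y)) 0) field_differentiable at y0"
    proof (rule taylor_coeff_field_differentiable[where \<rho> = "cmod y0 powr \<gamma> / 2" and \<delta> = \<delta>])
      show "continuous_on (cball 0 (cmod y0 powr \<gamma> / 2) \<times> cball y0 \<delta>) f"
        by (rule continuous_on_subset[OF fc]) (use inH in auto)
      show "(\<lambda>x. f (x, y)) holomorphic_on ball 0 (cmod y0 powr \<gamma> / 2)" if "y \<in> cball y0 \<delta>" for y
        by (rule holomorphic2_on_slice1[OF hol]) (use that inH in auto)
      show "(\<lambda>y. f (x, y)) holomorphic_on ball y0 \<delta>" if "x \<in> cball 0 (cmod y0 powr \<gamma> / 2)" for x
        by (rule holomorphic2_on_slice2[OF hol]) (use that inH in auto)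
    qed (use y0 \<delta> in auto)
    then have "a j field_differentiable at y0" unfolding a_def
      by (intro field_differentiable_divide field_differentiable_const) auto
    then show "a j field_differentiable at y0 within ball 0 1 - {0}" by (rule field_differentiable_at_within)
  qed
  \<comment> \<open>Each Taylor term is a circle mean of f, so by Jensen's inequality its L2 norm is
    at most that of f. Integrating |x^j|^2 over the slice leaves a weighted L2 bound in y
    alone.\<close>
  have L2: "(\<integral>\<^sup>+y. ennreal ((cmod (a j y * y ^ (KK m n j + 1)))\<^sup>2) * indicator (ball 0 1 - {0}) y \<partial>lborel) < \<infinity>" for j
  proof -
    let ?F = "\<lambda>z. indicator ?H z *\<^sub>R f z"
    have Fm: "?F \<in> borel_measurable borel" by (rule borel_measurable_hartogs_indicator[OF fc])
    then have F2m: "(\<lambda>z. ennreal ((cmod (?F z))\<^sup>2)) \<in> borel_measurable borel" by measurable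
    have eq: "(\<lambda>z. indicator ?H z *\<^sub>R (cmod (f z))\<^sup>2) = (\<lambda>z. (cmod (?F z))\<^sup>2)" by (auto simp: indicator_def)
    have "(\<lambda>z. indicator ?H z *\<^sub>R (cmod (f z))\<^sup>2) \<in> borel_measurable borel" unfolding eq using Fm by measurable
    from integrable_lebesgue_on_iff[OF borel_hartogs this] int
    have "integrable lborel (\<lambda>z. (cmod (?F z))\<^sup>2)" unfolding eq by blast
    then have "(\<integral>\<^sup>+z. ennreal (norm ((cmod (?F z))\<^sup>2)) \<partial>lborel) < \<infinity>"
      unfolding integrable_iff_bounded by blast
    then have fin: "(\<integral>\<^sup>+z. ennreal ((cmod (?F z))\<^sup>2) \<partial>lborel) < \<infinity>"
      by (simp only: real_norm_def abs_power2)
    have am: "(\<lambda>y. indicator (ball 0 1 - {0}) y *\<^sub>R a j y) \<in> borel_measurable borel"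
      by (rule borel_measurable_continuous_on_indicator[OF _ holomorphic_on_imp_continuous_on[OF a_hol]]) auto
    have Gm: "(\<lambda>z. ennreal ((cmod ((indicator (ball 0 1 - {0}) (snd z) *\<^sub>R a j (snd z)) * fst z ^ j))\<^sup>2)) \<in> borel_measurable borel"
    proof -
      have "(\<lambda>z. indicator (ball 0 1 - {0}) (snd z) *\<^sub>R a j (snd z)) \<in> borel_measurable (borel :: (complex \<times> complex) measure)"
        by (rule measurable_compose[OF _ am]) (intro borel_measurable_continuous_onI continuous_intros)
      moreover have "(\<lambda>z::complex\<times>complex. fst z ^ j) \<in> borel_measurable borel"
        by (intro borel_measurable_continuous_onI continuous_intros)
      ultimately show ?thesis by measurable
    qed
    have "(\<integral>\<^sup>+y. ennreal ((cmod (a j y))\<^sup>2) * ennreal (pi / (j + 1) * (cmod y powr \<gamma>) ^ (2 * j + 2)) * indicator (ball 0 1 - {0}) y \<partial>lborel)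
      = (\<integral>\<^sup>+y. (\<integral>\<^sup>+x. ennreal ((cmod ((indicator (ball 0 1 - {0}) y *\<^sub>R a j y) * x ^ j))\<^sup>2) * indicator {..<cmod y powr \<gamma>} (cmod x) \<partial>lborel) * indicator (ball 0 1 - {0}) y \<partial>lborel)"
    proof (rule nn_integral_cong)
      fix y :: complex
      show "ennreal ((cmod (a j y))\<^sup>2) * ennreal (pi / (j + 1) * (cmod y powr \<gamma>) ^ (2 * j + 2)) * indicator (ball 0 1 - {0}) y
        = (\<integral>\<^sup>+x. ennreal ((cmod ((indicator (ball 0 1 - {0}) y *\<^sub>R a j y) * x ^ j))\<^sup>2) * indicator {..<cmod y powr \<gamma>} (cmod x) \<partial>lborel) * indicator (ball 0 1 - {0}) y"
      proof (cases "y \<in> ball 0 1 - {0}")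
        case True
        define R where "R = cmod y powr \<gamma>"
        have R: "R > 0" using True by (simp add: R_def)
        have "(\<integral>\<^sup>+x. ennreal ((cmod (a j y * x ^ j))\<^sup>2) * indicator {..<R} (cmod x) \<partial>lborel)
          = (\<integral>\<^sup>+x. (\<lambda>\<rho>. ennreal ((cmod (a j y))\<^sup>2 * (R ^ (2 * j) * \<rho> ^ (2 * j)))) (cmod x / R) * indicator {..<R} (cmod x) \<partial>lborel)"
          using R by (intro nn_integral_cong) (simp add: norm_mult norm_power power_mult_distrib power_divide power_mult[symmetric] mult.commute)
        also have "\<dots> = ennreal (R\<^sup>2) * (\<integral>\<^sup>+\<rho>. ennreal ((cmod (a j y))\<^sup>2 * (R ^ (2 * j) * \<rho> ^ (2 * j))) * ennreal (2 * pi * \<rho>) * indicator {0<..<1} \<rho> \<partial>lborel)"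
          by (rule nn_integral_disc_radial) (use R in auto)
        also have "(\<integral>\<^sup>+\<rho>. ennreal ((cmod (a j y))\<^sup>2 * (R ^ (2 * j) * \<rho> ^ (2 * j))) * ennreal (2 * pi * \<rho>) * indicator {0<..<1} \<rho> \<partial>lborel)
          = (\<integral>\<^sup>+\<rho>. ennreal ((cmod (a j y))\<^sup>2 * R ^ (2 * j) * (2 * pi * \<rho> ^ (2 * j + 1))) * indicator {0..1} \<rho> \<partial>lborel)"
        proof -
          have e: "ennreal ((cmod (a j y))\<^sup>2 * (R ^ (2 * j) * \<rho> ^ (2 * j))) * ennreal (2 * pi * \<rho>) = ennreal ((cmod (a j y))\<^sup>2 * R ^ (2 * j) * (2 * pi * \<rho> ^ (2 * j + 1)))"
            if "0 \<le> \<rho>" for \<rho>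
            using that R by (subst ennreal_mult[symmetric]) (simp_all add: mult_ac)
          show ?thesis
            by (intro nn_integral_cong_AE AE_mp[OF AE_lborel_singleton[of 0] AE_mp[OF AE_lborel_singleton[of 1] AE_I2]])
               (auto simp add: indicator_def e)
        qed
        also have "\<dots> = ennreal ((cmod (a j y))\<^sup>2 * R ^ (2 * j) * (pi / (j + 1) * 1 ^ (2 * j + 2)) - (cmod (a j y))\<^sup>2 * R ^ (2 * j) * (pi / (j + 1) * 0 ^ (2 * j + 2)))"
        proof (rule nn_integral_FTC_Icc[where F = "\<lambda>\<rho>. (cmod (a j y))\<^sup>2 * R ^ (2 * j) * (pi / (j + 1) * \<rho> ^ (2 * j + 2))"])
          fix \<rho> :: real assume "\<rho> \<in> {0..1}"
          then have "0 \<le> \<rho>" by simp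
          have "((\<lambda>\<rho>. \<rho> ^ (2 * j + 2)) has_real_derivative real (2 * j + 2) * \<rho> ^ (2 * j + 1)) (at \<rho>)"
            using DERIV_pow[of "2 * j + 2" \<rho>] by simp
          from DERIV_cmult[OF DERIV_cmult[OF this, of "pi / (j + 1)"], of "(cmod (a j y))\<^sup>2 * R ^ (2 * j)"]
          show "((\<lambda>\<rho>. (cmod (a j y))\<^sup>2 * R ^ (2 * j) * (pi / (j + 1) * \<rho> ^ (2 * j + 2))) has_real_derivative
            (cmod (a j y))\<^sup>2 * R ^ (2 * j) * (2 * pi * \<rho> ^ (2 * j + 1))) (at \<rho>)"
            by (rule DERIV_cong) (simp add: field_simps)
          show "0 \<le> (cmod (a j y))\<^sup>2 * R ^ (2 * j) * (2 * pi * \<rho> ^ (2 * j + 1))"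
            using R \<open>0 \<le> \<rho>\<close> by simp
        qed simp_all
        also have "ennreal (R\<^sup>2) * \<dots> = ennreal (R\<^sup>2 * ((cmod (a j y))\<^sup>2 * R ^ (2 * j) * (pi / (j + 1))))"
          by (subst ennreal_mult) simp_all
        also have "R\<^sup>2 * ((cmod (a j y))\<^sup>2 * R ^ (2 * j) * (pi / (j + 1))) = (cmod (a j y))\<^sup>2 * (pi / (j + 1) * R ^ (2 * j + 2))"
          by (simp add: power_add power2_eq_square)
        also have "ennreal \<dots> = ennreal ((cmod (a j y))\<^sup>2) * ennreal (pi / (j + 1) * R ^ (2 * j + 2))"
          using R by (subst ennreal_mult) simp_all
        finally show ?thesis using True by (simp add: R_def)
      qed auto
    qed
    also have "\<dots> = (\<integral>\<^sup>+z. ennreal ((cmod ((indicator (ball 0 1 - {0}) (snd z) *\<^sub>R a j (snd z)) * fst z ^ j))\<^sup>2) * indicator ?H z \<partial>lborel)"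
      using nn_integral_hartogs_split[OF Gm mn] by (simp add: \<gamma>_def)
    also have "\<dots> \<le> (\<integral>\<^sup>+z. \<integral>\<^sup>+\<theta>. ennreal ((cmod (?F (cis (1 * \<theta>) * fst z, cis (0 * \<theta>) * snd z)))\<^sup>2) \<partial>circ \<partial>lborel)"
    proof (rule nn_integral_mono)
      fix z :: "complex \<times> complex"
      show "ennreal ((cmod ((indicator (ball 0 1 - {0}) (snd z) *\<^sub>R a j (snd z)) * fst z ^ j))\<^sup>2) * indicator ?H z
        \<le> (\<integral>\<^sup>+\<theta>. ennreal ((cmod (?F (cis (1 * \<theta>) * fst z, cis (0 * \<theta>) * snd z)))\<^sup>2) \<partial>circ)"
      proof (cases "z \<in> ?H")
        case True
        obtain x y where z: "z = (x, y)" by (cases z)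
        have rot: "(cis \<theta> * x, y) \<in> ?H" for \<theta> using True hartogs_rotate[of "cis \<theta>" 1 x y] by (simp add: z)
        have "continuous_on UNIV (\<lambda>\<theta>. f (cis \<theta> * x, y) * cis (- (real j * \<theta>)))"
          by (intro continuous_intros continuous_on_compose2[OF fc]) (use rot in auto)
        from norm_integral_circ_square_le[OF this]
        have "ennreal ((cmod (a j y * x ^ j))\<^sup>2) \<le> (\<integral>\<^sup>+\<theta>. ennreal ((cmod (f (cis \<theta> * x, y)))\<^sup>2) \<partial>circ)"
          using avg[of x y j] True by (simp add: z norm_mult)
        then show ?thesis using True rot by (auto simp: z Hiff indicator_def)
      qed auto
    qed
    also have "\<dots> = (\<integral>\<^sup>+z. ennreal ((cmod (?F z))\<^sup>2) \<partial>lborel)"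
      by (rule nn_integral_avg[OF F2m, symmetric])
    finally have le: "(\<integral>\<^sup>+y. ennreal ((cmod (a j y))\<^sup>2) * ennreal (pi / (j + 1) * (cmod y powr \<gamma>) ^ (2 * j + 2)) * indicator (ball 0 1 - {0}) y \<partial>lborel)
      \<le> (\<integral>\<^sup>+z. ennreal ((cmod (?F z))\<^sup>2) \<partial>lborel)" .
    have "(\<integral>\<^sup>+y. ennreal ((cmod (a j y * y ^ (KK m n j + 1)))\<^sup>2) * indicator (ball 0 1 - {0}) y \<partial>lborel)
      \<le> (\<integral>\<^sup>+y. ennreal ((j + 1) / pi) * (ennreal ((cmod (a j y))\<^sup>2) * ennreal (pi / (j + 1) * (cmod y powr \<gamma>) ^ (2 * j + 2)) * indicator (ball 0 1 - {0}) y) \<partial>lborel)"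
    proof (rule nn_integral_mono)
      fix y :: complex
      show "ennreal ((cmod (a j y * y ^ (KK m n j + 1)))\<^sup>2) * indicator (ball 0 1 - {0}) y
        \<le> ennreal ((j + 1) / pi) * (ennreal ((cmod (a j y))\<^sup>2) * ennreal (pi / (j + 1) * (cmod y powr \<gamma>) ^ (2 * j + 2)) * indicator (ball 0 1 - {0}) y)"
      proof (cases "y \<in> ball 0 1 - {0}")
        case True
        have "real n * (real j + 1) = real m * real (KK m n j) + real (LL m n j)"
          using arg_cong[OF LL_KK[OF mn(2), of j m], of real] by (simp add: algebra_simps)
        then have "real n * (real j + 1) \<le> real m * (real (KK m n j) + 1)"
          using LL_bounds(2)[OF mn(1), of n j] by (simp add: algebra_simps)
        \<comment> \<open>This is \<open>LL m n j\<close> \<le> m in disguise. Since |y| < 1, the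
          larger exponent lets the factor y^(KK+1) be dominated by the weight that the slice
          supplies.\<close>
        then have e: "\<gamma> * (2 * j + 2) \<le> real (2 * (KK m n j + 1))"
          using mn by (simp add: \<gamma>_def field_simps)
        have "(cmod y ^ (KK m n j + 1))\<^sup>2 = cmod y powr real (2 * (KK m n j + 1))"
          using True by (subst powr_realpow) (simp, simp only: power_mult[symmetric] mult.commute)
        also have "\<dots> \<le> cmod y powr (\<gamma> * (2 * j + 2))"
          using True e by (intro powr_mono') auto
        also have "\<dots> = (cmod y powr \<gamma>) ^ (2 * j + 2)"
          using True by (subst powr_realpow[symmetric]) (auto simp: powr_powr)
        finally have "(cmod (a j y * y ^ (KK m n j + 1)))\<^sup>2 \<le> (cmod (a j y))\<^sup>2 * (cmod y powr \<gamma>) ^ (2 * j + 2)"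
          unfolding norm_mult norm_power power_mult_distrib by (intro mult_left_mono) auto
        also have "\<dots> = (j + 1) / pi * ((cmod (a j y))\<^sup>2 * (pi / (j + 1) * (cmod y powr \<gamma>) ^ (2 * j + 2)))"
        proof -
          have gen: "\<And>q B C :: real. q > 0 \<Longrightarrow> B * C = q / pi * (B * (pi / q * C))" by simp
          show ?thesis by (rule gen) simp
        qed
        finally show ?thesis using True by (simp add: ennreal_mult[symmetric] ennreal_leI)
      qed auto
    qed
    also have "\<dots> = ennreal ((j + 1) / pi) * (\<integral>\<^sup>+y. ennreal ((cmod (a j y))\<^sup>2) * ennreal (pi / (j + 1) * (cmod y powr \<gamma>) ^ (2 * j + 2)) * indicator (ball 0 1 - {0}) y \<partial>lborel)"
    proof (rule nn_integral_cmult)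
      define D where "D = ball (0::complex) 1 - {0}"
      have D[measurable]: "D \<in> sets borel" unfolding D_def by auto
      have "(\<lambda>y. ennreal ((cmod (indicator D y *\<^sub>R a j y))\<^sup>2) * ennreal (pi / (j + 1) * (cmod y powr \<gamma>) ^ (2 * j + 2)) * indicator D y) \<in> borel_measurable lborel"
        using am[folded D_def] by measurable
      also have "(\<lambda>y. ennreal ((cmod (indicator D y *\<^sub>R a j y))\<^sup>2) * ennreal (pi / (j + 1) * (cmod y powr \<gamma>) ^ (2 * j + 2)) * indicator D y)
        = (\<lambda>y. ennreal ((cmod (a j y))\<^sup>2) * ennreal (pi / (j + 1) * (cmod y powr \<gamma>) ^ (2 * j + 2)) * indicator D y)"
        by (auto simp: indicator_def)
      finally show "(\<lambda>y. ennreal ((cmod (a j y))\<^sup>2) * ennreal (pi / (j + 1) * (cmod y powr \<gamma>) ^ (2 * j + 2)) * indicator (ball 0 1 - {0}) y) \<in> borel_measurable lborel"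
        by (simp only: D_def)
    qed
    also have "\<dots> \<le> ennreal ((j + 1) / pi) * (\<integral>\<^sup>+z. ennreal ((cmod (?F z))\<^sup>2) \<partial>lborel)"
      by (intro mult_left_mono le) auto
    also have "\<dots> < \<infinity>" using fin by (simp add: ennreal_mult_less_top)
    finally show ?thesis .
  qed
  have "\<exists>h. h holomorphic_on ball 0 1 \<and> (\<forall>y\<in>ball 0 1 - {0}. h y = a j y * y ^ (KK m n j + 1))" for j
  proof -
    have "(\<lambda>y. a j y * y ^ (KK m n j + 1)) holomorphic_on (ball 0 1 - {0})"
      by (intro holomorphic_intros a_hol)
    then show ?thesis
    proof (rule square_integrable_removable[OF _ L2])
      fix h assume "h holomorphic_on ball 0 1"
        and "\<And>y. y \<in> ball 0 1 - {0} \<Longrightarrow> h y = a j y * y ^ (KK m n j + 1)"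
      then show ?thesis by (intro exI[of _ h] conjI ballI)
    qed
  qed
  then obtain g where g: "\<And>j. g j holomorphic_on ball 0 1" "\<And>j y. y \<in> ball 0 1 - {0} \<Longrightarrow> g j y = a j y * y ^ (KK m n j + 1)"
    by (metis (no_types, lifting))
  have ga: "g j y / y ^ (KK m n j + 1) = a j y" if "(x, y) \<in> ?H" for x y j
    using that by (subst g(2)) (auto simp: Hiff)
  show ?thesis
  proof (rule that[of g])
    show "g j holomorphic_on ball 0 1" for j by (rule g(1))
    show "(\<lambda>j. g j y / y ^ (KK m n j + 1) * x ^ j) sums f (x, y)" if "(x, y) \<in> ?H" for x y
      unfolding ga[OF that] by (rule ser[OF that])
    show "(LINT \<theta>|circ. f (cis \<theta> * x, y) * cis (- (real j * \<theta>))) = g j y / y ^ (KK m n j + 1) * x ^ j"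
      if "(x, y) \<in> ?H" for x y j
      unfolding ga[OF that] by (rule avg[OF that])
  qed
qed

section \<open>Closure properties of holomorphy in two variables\<close>

lemma holomorphic2_on_const: "holomorphic2_on (\<lambda>_. c) \<Omega>"
  unfolding holomorphic2_on_def
  by (intro ballI exI[of _ 0] has_derivative_eq_rhs[OF has_derivative_const]) (auto simp: fun_eq_iff)

lemma holomorphic2_on_fst: "holomorphic2_on fst \<Omega>"
  unfolding holomorphic2_on_def
  by (intro ballI exI[of _ 1] exI[of _ 0]) (auto simp: case_prod_beta intro!: derivative_eq_intros)

lemma holomorphic2_on_snd: "holomorphic2_on snd \<Omega>"
  unfolding holomorphic2_on_def
  by (intro ballI exI[of _ 0] exI[of _ 1]) (auto simp: case_prod_beta intro!: derivative_eq_intros)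

lemma holomorphic2_on_add:
  assumes "holomorphic2_on f \<Omega>" "holomorphic2_on g \<Omega>"
  shows "holomorphic2_on (\<lambda>z. f z + g z) \<Omega>"
  unfolding holomorphic2_on_def
proof
  fix z assume "z \<in> \<Omega>"
  then obtain a b c d where "(f has_derivative (\<lambda>(u, v). a * u + b * v)) (at z)"
    "(g has_derivative (\<lambda>(u, v). c * u + d * v)) (at z)"
    using assms unfolding holomorphic2_on_def by blast
  from has_derivative_add[OF this]
  have "((\<lambda>z. f z + g z) has_derivative (\<lambda>(u, v). (a + c) * u + (b + d) * v)) (at z)"
    by (rule has_derivative_eq_rhs) (auto simp: fun_eq_iff algebra_simps)
  then show "\<exists>d1 d2. ((\<lambda>z. f z + g z) has_derivative (\<lambda>(u, v). d1 * u + d2 * v)) (at z)" by blast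
qed

lemma holomorphic2_on_mult:
  assumes "holomorphic2_on f \<Omega>" "holomorphic2_on g \<Omega>"
  shows "holomorphic2_on (\<lambda>z. f z * g z) \<Omega>"
  unfolding holomorphic2_on_def
proof
  fix z assume "z \<in> \<Omega>"
  then obtain a b c d where "(f has_derivative (\<lambda>(u, v). a * u + b * v)) (at z)"
    "(g has_derivative (\<lambda>(u, v). c * u + d * v)) (at z)"
    using assms unfolding holomorphic2_on_def by blast
  from has_derivative_mult[OF this]
  have "((\<lambda>z. f z * g z) has_derivative (\<lambda>(u, v). (f z * c + a * g z) * u + (f z * d + b * g z) * v)) (at z)"
    by (rule has_derivative_eq_rhs) (auto simp: fun_eq_iff algebra_simps)
  then show "\<exists>d1 d2. ((\<lambda>z. f z * g z) has_derivative (\<lambda>(u, v). d1 * u + d2 * v)) (at z)" by blast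
qed

lemma holomorphic2_on_divide:
  assumes "holomorphic2_on f \<Omega>" "holomorphic2_on g \<Omega>" "\<And>z. z \<in> \<Omega> \<Longrightarrow> g z \<noteq> 0"
  shows "holomorphic2_on (\<lambda>z. f z / g z) \<Omega>"
  unfolding holomorphic2_on_def
proof
  fix z assume z: "z \<in> \<Omega>"
  then obtain a b c d where "(f has_derivative (\<lambda>(u, v). a * u + b * v)) (at z)"
    "(g has_derivative (\<lambda>(u, v). c * u + d * v)) (at z)"
    using assms unfolding holomorphic2_on_def by blast
  from has_derivative_divide'[OF this assms(3)[OF z]]
  have "((\<lambda>z. f z / g z) has_derivative (\<lambda>(u, v). ((a * g z - f z * c) / (g z * g z)) * u + ((b * g z - f z * d) / (g z * g z)) * v)) (at z)"
    by (rule has_derivative_eq_rhs) (auto simp: fun_eq_iff algebra_simps add_divide_distrib diff_divide_distrib)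
  then show "\<exists>d1 d2. ((\<lambda>z. f z / g z) has_derivative (\<lambda>(u, v). d1 * u + d2 * v)) (at z)" by blast
qed

lemma holomorphic2_on_power:
  "holomorphic2_on f \<Omega> \<Longrightarrow> holomorphic2_on (\<lambda>z. f z ^ k) \<Omega>"
  by (induction k) (auto intro: holomorphic2_on_const holomorphic2_on_mult)

lemma holomorphic2_on_sum:
  "(\<And>i. i \<in> I \<Longrightarrow> holomorphic2_on (f i) \<Omega>) \<Longrightarrow> holomorphic2_on (\<lambda>z. \<Sum>i\<in>I. f i z) \<Omega>"
  by (induction I rule: infinite_finite_induct) (auto intro: holomorphic2_on_const holomorphic2_on_add)

lemma holomorphic2_on_minus_from_const:
  assumes "holomorphic2_on f \<Omega>"
  shows "holomorphic2_on (\<lambda>z. c - f z) \<Omega>"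
proof -
  have "holomorphic2_on (\<lambda>z. c + (- 1) * f z) \<Omega>"
    by (intro holomorphic2_on_add holomorphic2_on_mult holomorphic2_on_const assms)
  then show ?thesis by simp
qed

lemmas holomorphic2_intros = holomorphic2_on_const holomorphic2_on_fst holomorphic2_on_snd
  holomorphic2_on_add holomorphic2_on_mult holomorphic2_on_divide holomorphic2_on_power
  holomorphic2_on_sum holomorphic2_on_minus_from_const

section \<open>The Bergman kernel\<close>

text \<open>The orthogonal expansion of the kernel, summed over \<open>j = r + m i\<close> (where
  \<open>KK m n j = KK m n r + n i\<close> and \<open>LL m n j = LL m n r\<close>) and over \<open>q\<close> in \<open>hmono\<close>
  by means of \<open>\<Sum>\<^sub>i (J + m i) v ^ i = (J + (m - J) v) / (1 - v)\<^sup>2\<close>.\<close>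

definition kernel_num :: "nat \<Rightarrow> nat \<Rightarrow> complex \<Rightarrow> complex \<Rightarrow> complex" where
  "kernel_num m n s t =
     (\<Sum>r<m. (of_nat (r + 1) + of_nat (m - 1 - r) * (s ^ m / t ^ n)) *
       (of_nat (LL m n r) + of_nat (m - LL m n r) * t) * (s ^ r / t ^ (KK m n r + 1)))"

definition kernel_fun :: "nat \<Rightarrow> nat \<Rightarrow> complex \<Rightarrow> complex \<Rightarrow> complex" where
  "kernel_fun m n s t =
     kernel_num m n s t / (of_real (pi\<^sup>2 * m) * ((1 - s ^ m / t ^ n)\<^sup>2 * (1 - t)\<^sup>2))"

definition hartogs_kernel :: "nat \<Rightarrow> nat \<Rightarrow> complex \<times> complex \<Rightarrow> complex \<times> complex \<Rightarrow> complex" where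
  "hartogs_kernel m n z w = kernel_fun m n (fst z * cnj (fst w)) (snd z * cnj (snd w))"

text \<open>\<open>q\<close> counts the powers of z2 above the minimal one, so the whole orthogonal
  basis is indexed by two natural numbers and division stands in for negative exponents.\<close>

definition hmono :: "nat \<Rightarrow> nat \<Rightarrow> nat \<Rightarrow> nat \<Rightarrow> complex \<times> complex \<Rightarrow> complex" where
  "hmono m n j q z = fst z ^ j * snd z ^ q / snd z ^ (KK m n j + 1)"

text \<open>Up to constants the square root of the numerator of B(z,z): it carries the singularity
  at the origin, apart from the factors that blow up at |u| = 1 and |t| = 1.\<close>

definition hphi :: "nat \<Rightarrow> nat \<Rightarrow> complex \<times> complex \<Rightarrow> real" where
  "hphi m n z = (\<Sum>r<m. cmod (hmono m n r 0 z))"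

text \<open>The modulus of z1^m / z2^n, which together with z2 maps the domain into a
  bidisc.\<close>

definition hx :: "nat \<Rightarrow> nat \<Rightarrow> complex \<times> complex \<Rightarrow> real" where
  "hx m n z = cmod (fst z) ^ m / cmod (snd z) ^ n"

lemma hx_bounds:
  assumes "z \<in> hartogs m n" "0 < n"
  shows "0 \<le> hx m n z" "hx m n z < 1" "snd z \<noteq> 0" "cmod (snd z) < 1"
proof -
  have *: "cmod (fst z) ^ m < cmod (snd z) ^ n" "cmod (snd z) ^ n < 1" using assms by (auto simp: hartogs_def)
  show "snd z \<noteq> 0"
  proof
    assume "snd z = 0"
    with * assms(2) have "cmod (fst z) ^ m < 0" by (simp add: power_0_left)
    then show False by (smt (verit) zero_le_power norm_ge_zero)
  qed
  then show "hx m n z < 1" using * by (simp add: hx_def divide_less_eq)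
  show "0 \<le> hx m n z" by (simp add: hx_def)
  show "cmod (snd z) < 1"
    using * power_mono_iff[of 1 "cmod (snd z)" n] assms(2) by (metis linorder_not_less norm_ge_zero power_one zero_le_one)
qed

lemma norm_hmono_split:
  assumes "0 < m" "0 < n" "snd z \<noteq> 0"
  shows "cmod (hmono m n (i * m + r) q z) = cmod (hmono m n r 0 z) * hx m n z ^ i * cmod (snd z) ^ q"
  unfolding hmono_def hx_def KK_LL_add[OF assms(1,2)]
  by (simp add: norm_mult norm_divide norm_power power_add power_mult power_divide mult.commute[of i m]) (simp add: mult_ac)

text \<open>One majorant for all basis monomials, with geometric decay in \<open>i\<close> and
  \<open>q\<close>. Evaluated at w it makes the expansions summable, evaluated at z it is square
  integrable.\<close>

lemma norm_hmono_le_hphi: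
  assumes "0 < m" "0 < n" "z \<in> hartogs m n" "r < m"
  shows "cmod (hmono m n (i * m + r) q z) \<le> hphi m n z * hx m n z ^ i * cmod (snd z) ^ q"
proof -
  have "cmod (hmono m n r 0 z) \<le> hphi m n z"
    unfolding hphi_def using assms(4) by (intro member_le_sum) auto
  then show ?thesis
    using norm_hmono_split[OF assms(1,2) hx_bounds(3)[OF assms(3,2)]] hx_bounds(1)[OF assms(3,2)]
    by (simp add: mult_right_mono)
qed

text \<open>Writing a + b i = b (i + 1) + (a - b) combines the geometric series with its
  derivative.\<close>

lemma linear_geometric_sums:
  fixes u :: "'a :: {real_normed_field, banach}"
  assumes "norm u < 1"
  shows "(\<lambda>i. (a + b * of_nat i) * u ^ i) sums ((a + (b - a) * u) / (1 - u)\<^sup>2)"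
proof -
  have "(\<lambda>i. b * (of_nat (Suc i) * u ^ i) + (a - b) * u ^ i) sums (b * (1 / (1 - u)\<^sup>2) + (a - b) * (1 / (1 - u)))"
    by (intro sums_add sums_mult geometric_deriv_sums geometric_sums) (use assms in auto)
  also have "(\<lambda>i. b * (of_nat (Suc i) * u ^ i) + (a - b) * u ^ i) = (\<lambda>i. (a + b * of_nat i) * u ^ i)"
    by (simp add: fun_eq_iff algebra_simps)
  also have "b * (1 / (1 - u)\<^sup>2) + (a - b) * (1 / (1 - u)) = (a + (b - a) * u) / (1 - u)\<^sup>2"
  proof -
    define v where "v = 1 - u"
    have "v \<noteq> 0" using assms by (auto simp: v_def)
    then have "b * (1 / v\<^sup>2) + (a - b) * (1 / v) = (b + (a - b) * v) / v\<^sup>2"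
      by (simp add: field_simps power2_eq_square)
    also have "b + (a - b) * v = a + (b - a) * u" by (simp add: v_def algebra_simps)
    finally show ?thesis by (simp add: v_def)
  qed
  finally show ?thesis .
qed

text \<open>Polar coordinates turn the norm of a monomial into two elementary integrals.\<close>

lemma nn_integral_hmono_square:
  assumes mn: "0 < m" "0 < n"
  shows "(\<integral>\<^sup>+z. ennreal ((cmod (hmono m n j q z))\<^sup>2) * indicator (hartogs m n) z \<partial>lborel)
     = ennreal (pi\<^sup>2 * m / ((j + 1) * (LL m n j + m * q)))"
proof -
  define \<gamma> where "\<gamma> = real n / real m"
  define K where "K = KK m n j"
  \<comment> \<open>The total exponent of r = |z2|, including the 1 + 2\<gamma> of polar
    coordinates. By \<open>c1\<close>, c + 1 = 2 (LL + m q) / m, which is positive since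
    \<open>LL\<close> is at least 1.\<close>
  define c where "c = 2 * \<gamma> * (j + 1) + 2 * q - 2 * K - 1"
  have nL: "real n * (real j + 1) = real m * real K + real (LL m n j)"
    using arg_cong[OF LL_KK[OF mn(2), of j m], of real] by (simp add: K_def algebra_simps)
  have c1: "(c + 1) * m = 2 * (LL m n j + m * q)"
  proof -
    have "(c + 1) * m = 2 * (real n * (real j + 1)) + 2 * m * q - 2 * m * K"
      using mn by (simp add: c_def \<gamma>_def field_simps)
    also have "\<dots> = 2 * (LL m n j + m * q)" unfolding nL by (simp add: algebra_simps)
    finally show ?thesis .
  qed
  have "(c + 1) * m > 0" unfolding c1 using LL_bounds(1)[OF mn(1), of n j] by (simp add: add_pos_nonneg)
  then have c0: "c > -1" using mn by (simp add: zero_less_mult_iff)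
  define G where "G = (\<lambda>p. ennreal (fst p ^ (2 * j) * snd p powr (2 * \<gamma> * j + 2 * q - 2 * K - 2)) :: ennreal)"
  have G: "G \<in> borel_measurable (borel :: (real \<times> real) measure)"
    unfolding G_def borel_prod[symmetric] by measurable
  have "(\<integral>\<^sup>+z. ennreal ((cmod (hmono m n j q z))\<^sup>2) * indicator (hartogs m n) z \<partial>lborel)
     = (\<integral>\<^sup>+z. G (cmod (fst z) / cmod (snd z) powr \<gamma>, cmod (snd z)) * indicator (hartogs m n) z \<partial>lborel)"
  proof (rule nn_integral_cong)
    fix z :: "complex \<times> complex"
    show "ennreal ((cmod (hmono m n j q z))\<^sup>2) * indicator (hartogs m n) z = G (cmod (fst z) / cmod (snd z) powr \<gamma>, cmod (snd z)) * indicator (hartogs m n) z"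
    proof (cases "z \<in> hartogs m n")
      case True
      then have y: "snd z \<noteq> 0" using hx_bounds mn by blast
      define r where "r = cmod (snd z)"
      have r: "r > 0" using y by (simp add: r_def)
      have "(cmod (fst z) / r powr \<gamma>) ^ (2 * j) * r powr (2 * \<gamma> * j + 2 * q - 2 * K - 2)
          = cmod (fst z) ^ (2 * j) * (r powr (2 * \<gamma> * j + 2 * q - 2 * K - 2) / r powr (\<gamma> * (2 * j)))"
        using r by (simp add: power_divide powr_power mult_ac)
      also have "r powr (2 * \<gamma> * j + 2 * q - 2 * K - 2) / r powr (\<gamma> * (2 * j)) = r powr (real (2 * q) - real (2 * (K + 1)))"
        unfolding powr_diff[symmetric] by (simp add: algebra_simps)
      also have "\<dots> = r ^ (2 * q) / r ^ (2 * (K + 1))"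
        using r by (subst powr_diff, subst (1 2) powr_realpow) auto
      also have "cmod (fst z) ^ (2 * j) * (r ^ (2 * q) / r ^ (2 * (K + 1))) = (cmod (hmono m n j q z))\<^sup>2"
        by (simp add: hmono_def norm_mult norm_divide norm_power r_def K_def power_mult_distrib power_divide power_mult[symmetric] mult.commute) (simp add: power2_eq_square)
      finally show ?thesis by (simp add: G_def r_def)
    qed auto
  qed
  also have "\<dots> = (\<integral>\<^sup>+r. (\<integral>\<^sup>+\<rho>. G (\<rho>, r) * ennreal (2 * pi * \<rho>) * indicator {0<..<1} \<rho> \<partial>lborel) * ennreal (2 * pi * r powr (1 + 2 * \<gamma>)) * indicator {0<..<1} r \<partial>lborel)"
    unfolding \<gamma>_def by (rule nn_integral_hartogs_radial[OF G mn])
  also have "\<dots> = (\<integral>\<^sup>+r. ennreal (2 * pi\<^sup>2 / (j + 1)) * (ennreal (r powr c) * indicator {0..1} r) \<partial>lborel)"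
  proof (intro nn_integral_cong_AE AE_mp[OF AE_lborel_singleton[of 0] AE_mp[OF AE_lborel_singleton[of 1] AE_I2]] impI)
    fix r :: real assume r: "r \<noteq> 1" "r \<noteq> 0"
    show "(\<integral>\<^sup>+\<rho>. G (\<rho>, r) * ennreal (2 * pi * \<rho>) * indicator {0<..<1} \<rho> \<partial>lborel) * ennreal (2 * pi * r powr (1 + 2 * \<gamma>)) * indicator {0<..<1} r
      = ennreal (2 * pi\<^sup>2 / (j + 1)) * (ennreal (r powr c) * indicator {0..1} r)"
    proof (cases "0 < r \<and> r < 1")
      case True
      define a where "a = r powr (2 * \<gamma> * j + 2 * q - 2 * K - 2)"
      have a0: "0 \<le> a" by (simp add: a_def)
      have e: "ennreal (\<rho> ^ (2 * j) * a) * ennreal (2 * pi * \<rho>) = ennreal (a * (2 * pi * \<rho> ^ (2 * j + 1)))"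
        if "0 \<le> \<rho>" for \<rho> using that a0 by (subst ennreal_mult[symmetric]) (simp_all add: mult_ac)
      have Ga: "G (\<rho>, r) = ennreal (\<rho> ^ (2 * j) * a)" for \<rho> by (simp add: G_def a_def)
      have "(\<integral>\<^sup>+\<rho>. G (\<rho>, r) * ennreal (2 * pi * \<rho>) * indicator {0<..<1} \<rho> \<partial>lborel)
        = (\<integral>\<^sup>+\<rho>. ennreal (a * (2 * pi * \<rho> ^ (2 * j + 1))) * indicator {0..1} \<rho> \<partial>lborel)"
        by (intro nn_integral_cong_AE AE_mp[OF AE_lborel_singleton[of 0] AE_mp[OF AE_lborel_singleton[of 1] AE_I2]])
           (auto simp add: indicator_def e Ga)
      also have "\<dots> = ennreal (a * (pi / (j + 1) * 1 ^ (2 * j + 2)) - a * (pi / (j + 1) * 0 ^ (2 * j + 2)))"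
      proof (rule nn_integral_FTC_Icc[where F = "\<lambda>\<rho>. a * (pi / (j + 1) * \<rho> ^ (2 * j + 2))"])
        fix \<rho> :: real assume "\<rho> \<in> {0..1}"
        then have "0 \<le> \<rho>" by simp
        have "((\<lambda>\<rho>. \<rho> ^ (2 * j + 2)) has_real_derivative real (2 * j + 2) * \<rho> ^ (2 * j + 1)) (at \<rho>)"
          using DERIV_pow[of "2 * j + 2" \<rho>] by simp
        from DERIV_cmult[OF DERIV_cmult[OF this, of "pi / (j + 1)"], of a]
        show "((\<lambda>\<rho>. a * (pi / (j + 1) * \<rho> ^ (2 * j + 2))) has_real_derivative a * (2 * pi * \<rho> ^ (2 * j + 1))) (at \<rho>)"
          by (rule DERIV_cong) (simp add: field_simps)
        show "0 \<le> a * (2 * pi * \<rho> ^ (2 * j + 1))" using a0 \<open>0 \<le> \<rho>\<close> by simp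
      qed simp_all
      finally have I: "(\<integral>\<^sup>+\<rho>. G (\<rho>, r) * ennreal (2 * pi * \<rho>) * indicator {0<..<1} \<rho> \<partial>lborel) = ennreal (a * (pi / (j + 1)))"
        by simp
      have "a * (pi / (j + 1)) * (2 * pi * r powr (1 + 2 * \<gamma>)) = 2 * pi\<^sup>2 / (j + 1) * (a * r powr (1 + 2 * \<gamma>))"
        by (simp add: power2_eq_square)
      also have "a * r powr (1 + 2 * \<gamma>) = r powr c"
        unfolding a_def powr_add[symmetric] c_def by (simp add: algebra_simps)
      finally show ?thesis using True a0
        by (simp add: I ennreal_mult[symmetric])
    qed (use r in \<open>auto simp: indicator_def\<close>)
  qed
  also have "\<dots> = ennreal (2 * pi\<^sup>2 / (j + 1)) * ennreal (1 powr (c + 1) / (c + 1))"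
    using c0 by (subst nn_integral_cmult, measurable, subst nn_integral_has_integral_lebesgue'[OF _ has_integral_powr_from_0]) auto
  also have "\<dots> = ennreal (2 * pi\<^sup>2 / (j + 1) * (1 / (c + 1)))"
    using c0 by (subst ennreal_mult[symmetric]) auto
  also have "2 * pi\<^sup>2 / (j + 1) * (1 / (c + 1)) = pi\<^sup>2 * m / ((j + 1) * (LL m n j + m * q))"
  proof -
    have gen: "\<And>P J X M :: real. 2 * P / J * (1 / (2 * X / M)) = P * M / (J * X)" by simp
    have e: "c + 1 = 2 * real (LL m n j + m * q) / m" using c1 mn by (simp add: field_simps)
    show ?thesis unfolding e gen by (simp add: algebra_simps)
  qed
  finally show ?thesis by simp
qed

lemma continuous_on_hmono: "0 < n \<Longrightarrow> continuous_on (hartogs m n) (hmono m n j q)"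
proof -
  assume "0 < n"
  then have "continuous_on (hartogs m n) (\<lambda>z. fst z ^ j * snd z ^ q / snd z ^ (KK m n j + 1))"
    by (intro continuous_intros) (auto dest: hx_bounds(3))
  then show ?thesis by (simp add: hmono_def[abs_def])
qed

text \<open>A finite sum of moduli of square integrable monomials is square integrable. This is the
  dominating function behind all later exchanges of sum and integral.\<close>

lemma integrable_hphi_square:
  assumes mn: "0 < m" "0 < n"
  shows "integrable lborel (\<lambda>z. indicator (hartogs m n) z *\<^sub>R (hphi m n z)\<^sup>2)"
proof -
  let ?H = "hartogs m n"
  have e: "integrable lborel (\<lambda>z. indicator ?H z * (cmod (hmono m n r 0 z))\<^sup>2)" for r
  proof (rule integrableI_nonneg)
    have "(\<lambda>z. indicator ?H z *\<^sub>R hmono m n r 0 z) \<in> borel_measurable borel"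
      by (rule borel_measurable_hartogs_indicator[OF continuous_on_hmono[OF mn(2)]])
    then have "(\<lambda>z. (cmod (indicator ?H z *\<^sub>R hmono m n r 0 z))\<^sup>2) \<in> borel_measurable lborel" by measurable
    also have "(\<lambda>z. (cmod (indicator ?H z *\<^sub>R hmono m n r 0 z))\<^sup>2) = (\<lambda>z. indicator ?H z * (cmod (hmono m n r 0 z))\<^sup>2)"
      by (auto simp: indicator_def)
    finally show "(\<lambda>z. indicator ?H z * (cmod (hmono m n r 0 z))\<^sup>2) \<in> borel_measurable lborel" .
    have "(\<integral>\<^sup>+z. ennreal (indicator ?H z * (cmod (hmono m n r 0 z))\<^sup>2) \<partial>lborel) = (\<integral>\<^sup>+z. ennreal ((cmod (hmono m n r 0 z))\<^sup>2) * indicator ?H z \<partial>lborel)"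
      by (intro nn_integral_cong) (auto simp: indicator_def)
    then show "(\<integral>\<^sup>+z. ennreal (indicator ?H z * (cmod (hmono m n r 0 z))\<^sup>2) \<partial>lborel) < \<infinity>"
      unfolding nn_integral_hmono_square[OF mn] by simp
  qed (auto simp: indicator_def)
  have "integrable lborel (\<lambda>z. (\<Sum>r<m. indicator ?H z * (cmod (hmono m n r 0 z))\<^sup>2) * real m)"
    by (intro integrable_mult_left Bochner_Integration.integrable_sum e)
  then show ?thesis
  proof (rule Bochner_Integration.integrable_bound)
    have "(\<lambda>z. \<Sum>r<m. cmod (indicator ?H z *\<^sub>R hmono m n r 0 z)) \<in> borel_measurable lborel"
      unfolding measurable_lborel2
      by (intro borel_measurable_sum measurable_compose[OF _ borel_measurable_norm] borel_measurable_hartogs_indicator continuous_on_hmono mn)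
    then have "(\<lambda>z. (\<Sum>r<m. cmod (indicator ?H z *\<^sub>R hmono m n r 0 z))\<^sup>2) \<in> borel_measurable lborel" by measurable
    also have "(\<lambda>z. (\<Sum>r<m. cmod (indicator ?H z *\<^sub>R hmono m n r 0 z))\<^sup>2) = (\<lambda>z. indicator ?H z *\<^sub>R (hphi m n z)\<^sup>2)"
      by (auto simp: indicator_def hphi_def)
    finally show "(\<lambda>z. indicator ?H z *\<^sub>R (hphi m n z)\<^sup>2) \<in> borel_measurable lborel" .
    show "AE z in lborel. norm (indicator ?H z *\<^sub>R (hphi m n z)\<^sup>2) \<le> norm ((\<Sum>r<m. indicator ?H z * (cmod (hmono m n r 0 z))\<^sup>2) * real m)"
    proof (rule AE_I2)
      fix z
      have "(hphi m n z)\<^sup>2 \<le> (\<Sum>r<m. (cmod (hmono m n r 0 z))\<^sup>2) * card {..<m}"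
        unfolding hphi_def by (rule sum_squared_le_sum_of_squares)
      then show "norm (indicator ?H z *\<^sub>R (hphi m n z)\<^sup>2) \<le> norm ((\<Sum>r<m. indicator ?H z * (cmod (hmono m n r 0 z))\<^sup>2) * real m)"
        by (auto simp: indicator_def)
    qed
  qed
qed

section \<open>The closed form of the kernel belongs to the Bergman space\<close>

lemma norm_u_eq: "cmod ((fst z * cnj (fst w)) ^ m / (snd z * cnj (snd w)) ^ n) = hx m n z * hx m n w"
  by (simp add: hx_def norm_mult norm_divide norm_power power_mult_distrib)

lemma norm_u_le:
  assumes "z \<in> hartogs m n" "w \<in> hartogs m n" "0 < n"
  shows "cmod ((fst z * cnj (fst w)) ^ m / (snd z * cnj (snd w)) ^ n) \<le> hx m n w"
    and "cmod ((fst z * cnj (fst w)) ^ m / (snd z * cnj (snd w)) ^ n) < 1"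
    and "cmod (snd z * cnj (snd w)) \<le> cmod (snd w)"
    and "cmod (snd z * cnj (snd w)) < 1"
proof -
  note hz = hx_bounds[OF assms(1,3)] and hw = hx_bounds[OF assms(2,3)]
  show 1: "cmod ((fst z * cnj (fst w)) ^ m / (snd z * cnj (snd w)) ^ n) \<le> hx m n w"
    unfolding norm_u_eq using hz hw by (simp add: mult_left_le_one_le)
  then show "cmod ((fst z * cnj (fst w)) ^ m / (snd z * cnj (snd w)) ^ n) < 1" using hw by simp
  show 2: "cmod (snd z * cnj (snd w)) \<le> cmod (snd w)" using hz by (simp add: norm_mult mult_left_le_one_le)
  then show "cmod (snd z * cnj (snd w)) < 1" using hw by simp
qed

lemma norm_one_minus_ge:
  fixes u :: complex
  assumes "cmod u \<le> x"
  shows "1 - x \<le> cmod (1 - u)"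
  using norm_triangle_ineq2[of 1 u] assms by simp

text \<open>The bridge between the closed form, a function of the products z1 cnj w1 and z2 cnj w2,
  and the orthogonal expansion in basis monomials.\<close>

lemma hmono_mult_cnj:
  assumes "0 < m" "0 < n"
  shows "(fst z * cnj (fst w)) ^ r / (snd z * cnj (snd w)) ^ (KK m n r + 1) *
      ((fst z * cnj (fst w)) ^ m / (snd z * cnj (snd w)) ^ n) ^ i * (snd z * cnj (snd w)) ^ q
     = hmono m n (i * m + r) q z * cnj (hmono m n (i * m + r) q w)"
  unfolding hmono_def KK_LL_add[OF assms]
  by (simp add: power_add power_mult power_divide power_mult_distrib mult.commute[of i m]) (simp add: mult_ac)

lemma holomorphic2_on_hartogs_kernel:
  assumes mn: "0 < m" "0 < n" and w: "w \<in> hartogs m n"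
  shows "holomorphic2_on (\<lambda>z. hartogs_kernel m n z w) (hartogs m n)"
  unfolding hartogs_kernel_def kernel_fun_def kernel_num_def
proof (intro holomorphic2_intros)
  fix z assume z: "z \<in> hartogs m n"
  have "snd z * cnj (snd w) \<noteq> 0" using hx_bounds(3)[OF z mn(2)] hx_bounds(3)[OF w mn(2)] by simp
  then show "(snd z * cnj (snd w)) ^ n \<noteq> 0" "(snd z * cnj (snd w)) ^ n \<noteq> 0" "\<And>k. (snd z * cnj (snd w)) ^ k \<noteq> 0" by simp_all
  note u = norm_u_le[OF z w mn(2)]
  show "complex_of_real (pi\<^sup>2 * real m) * ((1 - (fst z * cnj (fst w)) ^ m / (snd z * cnj (snd w)) ^ n)\<^sup>2 * (1 - snd z * cnj (snd w))\<^sup>2) \<noteq> 0"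
    using u(2,4) mn by (auto simp: eq_commute[of "1::complex"] simp del: of_real_mult norm_mult power_mult_distrib complex_cnj_power)
qed

text \<open>Both linear factors have the form J + (m - J) v with nonnegative coefficients of sum m,
  hence modulus at most m on the unit disc. What remains is one basis monomial in z and one in
  w.\<close>

lemma norm_kernel_num_le:
  assumes mn: "0 < m" "0 < n" and z: "z \<in> hartogs m n" and w: "w \<in> hartogs m n"
  shows "cmod (kernel_num m n (fst z * cnj (fst w)) (snd z * cnj (snd w))) \<le> real m ^ 2 * (hphi m n z * hphi m n w)"
proof -
  define u where "u = (fst z * cnj (fst w)) ^ m / (snd z * cnj (snd w)) ^ n"
  define t where "t = snd z * cnj (snd w)"
  have u: "cmod u < 1" "cmod t < 1" using norm_u_le[OF z w mn(2)] by (auto simp: u_def t_def)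
  have lin: "cmod (of_nat a + of_nat b * v) \<le> real (a + b)" if "cmod v < 1" for a b :: nat and v :: complex
  proof -
    have "cmod (of_nat a + of_nat b * v) \<le> real a + real b * cmod v"
      by (rule order_trans[OF norm_triangle_ineq]) (simp add: norm_mult)
    also have "\<dots> \<le> real a + real b * 1" using that by (intro add_left_mono mult_left_mono) auto
    finally show ?thesis by simp
  qed
  have "cmod (kernel_num m n (fst z * cnj (fst w)) (snd z * cnj (snd w)))
     \<le> (\<Sum>r<m. cmod ((of_nat (r + 1) + of_nat (m - 1 - r) * u) * (of_nat (LL m n r) + of_nat (m - LL m n r) * t) * ((fst z * cnj (fst w)) ^ r / (snd z * cnj (snd w)) ^ (KK m n r + 1))))"
    unfolding kernel_num_def u_def t_def by (rule norm_sum)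
  also have "\<dots> \<le> (\<Sum>r<m. (real m * real m) * (cmod (hmono m n r 0 z) * hphi m n w))"
  proof (rule sum_mono)
    fix r assume "r \<in> {..<m}"
    then have r: "r < m" by simp
    have a: "cmod (of_nat (r + 1) + of_nat (m - 1 - r) * u) \<le> real m"
      using lin[OF u(1), of "r + 1" "m - 1 - r"] r by simp
    have b: "cmod (of_nat (LL m n r) + of_nat (m - LL m n r) * t) \<le> real m"
      using lin[OF u(2), of "LL m n r" "m - LL m n r"] LL_bounds[OF mn(1), of n r] by simp
    have c: "(fst z * cnj (fst w)) ^ r / (snd z * cnj (snd w)) ^ (KK m n r + 1) = hmono m n r 0 z * cnj (hmono m n r 0 w)"
      using hmono_mult_cnj[OF mn, where i=0 and q=0] by simp
    have d: "cmod (hmono m n r 0 w) \<le> hphi m n w"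
      unfolding hphi_def using r by (intro member_le_sum) auto
    show "cmod ((of_nat (r + 1) + of_nat (m - 1 - r) * u) * (of_nat (LL m n r) + of_nat (m - LL m n r) * t) * ((fst z * cnj (fst w)) ^ r / (snd z * cnj (snd w)) ^ (KK m n r + 1))) \<le> (real m * real m) * (cmod (hmono m n r 0 z) * hphi m n w)"
      unfolding c norm_mult complex_mod_cnj by (intro mult_mono a b d) auto
  qed
  also have "\<dots> = real m ^ 2 * (hphi m n z * hphi m n w)"
    by (simp add: hphi_def[of m n z] sum_distrib_left sum_distrib_right power2_eq_square)
  finally show ?thesis .
qed

lemma norm_hartogs_kernel_le:
  assumes mn: "0 < m" "0 < n" and z: "z \<in> hartogs m n" and w: "w \<in> hartogs m n"
  shows "cmod (hartogs_kernel m n z w) \<le> m / pi\<^sup>2 * (hphi m n z * hphi m n w) /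
     ((cmod (1 - (fst z * cnj (fst w)) ^ m / (snd z * cnj (snd w)) ^ n))\<^sup>2 * (cmod (1 - snd z * cnj (snd w)))\<^sup>2)"
proof -
  have "cmod (hartogs_kernel m n z w) = cmod (kernel_num m n (fst z * cnj (fst w)) (snd z * cnj (snd w))) / (pi\<^sup>2 * m *
     ((cmod (1 - (fst z * cnj (fst w)) ^ m / (snd z * cnj (snd w)) ^ n))\<^sup>2 * (cmod (1 - snd z * cnj (snd w)))\<^sup>2))"
    unfolding hartogs_kernel_def kernel_fun_def norm_divide norm_mult[of "of_real _"] norm_of_real
    by (simp add: norm_mult norm_power abs_mult)
  also have "\<dots> \<le> real m ^ 2 * (hphi m n z * hphi m n w) / (pi\<^sup>2 * m *
     ((cmod (1 - (fst z * cnj (fst w)) ^ m / (snd z * cnj (snd w)) ^ n))\<^sup>2 * (cmod (1 - snd z * cnj (snd w)))\<^sup>2))"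
    by (intro divide_right_mono norm_kernel_num_le assms) auto
  also have "\<dots> = m / pi\<^sup>2 * (hphi m n z * hphi m n w) /
     ((cmod (1 - (fst z * cnj (fst w)) ^ m / (snd z * cnj (snd w)) ^ n))\<^sup>2 * (cmod (1 - snd z * cnj (snd w)))\<^sup>2)"
    using mn by (simp add: power2_eq_square divide_simps)
  finally show ?thesis .
qed

lemma hphi_nonneg: "0 \<le> hphi m n z"
  unfolding hphi_def by (intro sum_nonneg) auto

lemma borel_measurable_hphi_indicator:
  assumes mn: "0 < m" "0 < n"
  shows "(\<lambda>z. indicator (hartogs m n) z *\<^sub>R hphi m n z) \<in> borel_measurable borel"
proof -
  have "continuous_on (hartogs m n) (hphi m n)"
    unfolding hphi_def[abs_def] by (intro continuous_intros continuous_on_hmono mn)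
  then show ?thesis by (intro borel_measurable_continuous_on_indicator) auto
qed

text \<open>For fixed w the denominators stay away from 0, because |u| \<le> \<open>hx m n w\<close>
  < 1 and |t| \<le> |w2| < 1. So the kernel function is dominated by a multiple of the square
  integrable \<open>hphi\<close>.\<close>

lemma hartogs_kernel_in_bergman_space:
  assumes mn: "0 < m" "0 < n" and w: "w \<in> hartogs m n"
  shows "(\<lambda>z. hartogs_kernel m n z w) \<in> bergman_space (hartogs m n)"
proof -
  let ?H = "hartogs m n"
  have hol: "holomorphic2_on (\<lambda>z. hartogs_kernel m n z w) ?H"
    by (rule holomorphic2_on_hartogs_kernel[OF mn w])
  have m0: "(\<lambda>z. indicator ?H z *\<^sub>R hartogs_kernel m n z w) \<in> borel_measurable borel"
    by (rule borel_measurable_hartogs_indicator[OF holomorphic2_on_imp_continuous_on[OF hol]])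
  have eq: "(\<lambda>z. indicator ?H z *\<^sub>R (cmod (hartogs_kernel m n z w))\<^sup>2) = (\<lambda>z. (cmod (indicator ?H z *\<^sub>R hartogs_kernel m n z w))\<^sup>2)"
    by (auto simp: indicator_def)
  have m1: "(\<lambda>z. indicator ?H z *\<^sub>R (cmod (hartogs_kernel m n z w))\<^sup>2) \<in> borel_measurable borel"
    unfolding eq using m0 by measurable
  define C where "C = m / pi\<^sup>2 * hphi m n w / ((1 - hx m n w)\<^sup>2 * (1 - cmod (snd w))\<^sup>2)"
  note hw = hx_bounds[OF w mn(2)]
  have C: "C \<ge> 0" unfolding C_def by (intro divide_nonneg_nonneg mult_nonneg_nonneg hphi_nonneg) auto
  have bound: "cmod (hartogs_kernel m n z w) \<le> C * hphi m n z" if z: "z \<in> ?H" for z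
  proof -
    note u = norm_u_le[OF z w mn(2)]
    have "cmod (hartogs_kernel m n z w) \<le> m / pi\<^sup>2 * (hphi m n z * hphi m n w) /
     ((cmod (1 - (fst z * cnj (fst w)) ^ m / (snd z * cnj (snd w)) ^ n))\<^sup>2 * (cmod (1 - snd z * cnj (snd w)))\<^sup>2)"
      by (rule norm_hartogs_kernel_le[OF mn z w])
    also have "\<dots> \<le> m / pi\<^sup>2 * (hphi m n z * hphi m n w) / ((1 - hx m n w)\<^sup>2 * (1 - cmod (snd w))\<^sup>2)"
    proof -
      have gen: "A / (U\<^sup>2 * T\<^sup>2) \<le> A / (X\<^sup>2 * Y\<^sup>2)"
        if "0 \<le> A" "0 < X" "0 < Y" "X \<le> U" "Y \<le> T" for A U T X Y :: real
        using that by (intro divide_left_mono mult_mono power_mono mult_pos_pos zero_less_power) auto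
      show ?thesis
        by (rule gen) (use hw norm_one_minus_ge[OF u(1)] norm_one_minus_ge[OF u(3)] in \<open>simp_all add: hphi_nonneg\<close>)
    qed
    also have "\<dots> = C * hphi m n z" by (simp add: C_def)
    finally show ?thesis .
  qed
  have "integrable lborel (\<lambda>z. C\<^sup>2 * (indicator ?H z *\<^sub>R (hphi m n z)\<^sup>2))"
    by (intro integrable_mult_right integrable_hphi_square mn)
  then have "integrable lborel (\<lambda>z. indicator ?H z *\<^sub>R (cmod (hartogs_kernel m n z w))\<^sup>2)"
  proof (rule Bochner_Integration.integrable_bound)
    show "AE z in lborel. norm (indicator ?H z *\<^sub>R (cmod (hartogs_kernel m n z w))\<^sup>2) \<le> norm (C\<^sup>2 * (indicator ?H z *\<^sub>R (hphi m n z)\<^sup>2))"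
    proof (rule AE_I2)
      fix z show "norm (indicator ?H z *\<^sub>R (cmod (hartogs_kernel m n z w))\<^sup>2) \<le> norm (C\<^sup>2 * (indicator ?H z *\<^sub>R (hphi m n z)\<^sup>2))"
        using power_mono[OF bound[of z], of 2] by (auto simp: indicator_def power_mult_distrib)
    qed
  qed (use m1 in simp)
  then show ?thesis
    using hol integrable_lebesgue_on_iff[OF borel_hartogs m1] by (simp add: bergman_space_def)
qed

section \<open>The reproducing property\<close>

context
  fixes m n :: nat and f :: "complex \<times> complex \<Rightarrow> complex"
  assumes mn: "0 < m" "0 < n" and f: "f \<in> bergman_space (hartogs m n)"
begin

lemma bergman_measurable: "(\<lambda>z. indicator (hartogs m n) z *\<^sub>R f z) \<in> borel_measurable borel"
  using f by (intro borel_measurable_hartogs_indicator holomorphic2_on_imp_continuous_on) (simp add: bergman_space_def)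

lemma integrable_bergman_hphi:
  "integrable lborel (\<lambda>z. indicator (hartogs m n) z * (cmod (f z) * hphi m n z))"
proof -
  let ?H = "hartogs m n"
  have eq: "(\<lambda>z. indicator ?H z *\<^sub>R (cmod (f z))\<^sup>2) = (\<lambda>z. (cmod (indicator ?H z *\<^sub>R f z))\<^sup>2)"
    by (auto simp: indicator_def)
  have m1: "(\<lambda>z. indicator ?H z *\<^sub>R (cmod (f z))\<^sup>2) \<in> borel_measurable borel"
    unfolding eq using bergman_measurable by measurable
  have "integrable lborel (\<lambda>z. indicator ?H z *\<^sub>R (cmod (f z))\<^sup>2)"
    using f integrable_lebesgue_on_iff[OF borel_hartogs m1] by (simp add: bergman_space_def)
  from Bochner_Integration.integrable_add[OF this integrable_hphi_square[OF mn]]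
  show ?thesis
  proof (rule Bochner_Integration.integrable_bound)
    have "(\<lambda>z. cmod (indicator ?H z *\<^sub>R f z) * (indicator ?H z *\<^sub>R hphi m n z)) \<in> borel_measurable lborel"
      using bergman_measurable borel_measurable_hphi_indicator[OF mn] unfolding measurable_lborel2
      by (intro borel_measurable_times measurable_compose[OF _ borel_measurable_norm])
    also have "(\<lambda>z. cmod (indicator ?H z *\<^sub>R f z) * (indicator ?H z *\<^sub>R hphi m n z)) = (\<lambda>z. indicator ?H z * (cmod (f z) * hphi m n z))"
      by (auto simp: indicator_def)
    finally show "(\<lambda>z. indicator ?H z * (cmod (f z) * hphi m n z)) \<in> borel_measurable lborel" .
    show "AE z in lborel. norm (indicator ?H z * (cmod (f z) * hphi m n z)) \<le> norm (indicator ?H z *\<^sub>R (cmod (f z))\<^sup>2 + indicator ?H z *\<^sub>R (hphi m n z)\<^sup>2)"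
    proof (rule AE_I2)
      fix z
      have "0 \<le> (cmod (f z) - hphi m n z)\<^sup>2" by simp
      then have "cmod (f z) * hphi m n z \<le> (cmod (f z))\<^sup>2 + (hphi m n z)\<^sup>2"
        using mult_nonneg_nonneg[OF norm_ge_zero[of "f z"] hphi_nonneg[of m n z]]
        by (simp add: power2_eq_square algebra_simps)
      then show "norm (indicator ?H z * (cmod (f z) * hphi m n z)) \<le> norm (indicator ?H z *\<^sub>R (cmod (f z))\<^sup>2 + indicator ?H z *\<^sub>R (hphi m n z)\<^sup>2)"
        by (auto simp: indicator_def abs_mult hphi_nonneg)
    qed
  qed
qed

lemma bergman_times_measurable:
  assumes "continuous_on (hartogs m n) g"
  shows "(\<lambda>z. indicator (hartogs m n) z *\<^sub>R (f z * cnj (g z))) \<in> borel_measurable borel"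
proof -
  have "continuous_on (hartogs m n) f"
    using f by (intro holomorphic2_on_imp_continuous_on) (simp add: bergman_space_def)
  with assms show ?thesis by (intro borel_measurable_hartogs_indicator continuous_intros)
qed

lemma integrable_bergman_times:
  assumes g: "continuous_on (hartogs m n) g" and C: "\<And>z. z \<in> hartogs m n \<Longrightarrow> cmod (g z) \<le> C * hphi m n z"
  shows "integrable lborel (\<lambda>z. indicator (hartogs m n) z *\<^sub>R (f z * cnj (g z)))"
    and "(LINT z|lborel. norm (indicator (hartogs m n) z *\<^sub>R (f z * cnj (g z)))) \<le> C * (LINT z|lborel. indicator (hartogs m n) z * (cmod (f z) * hphi m n z))"
proof -
  let ?H = "hartogs m n"
  have i: "integrable lborel (\<lambda>z. C * (indicator ?H z * (cmod (f z) * hphi m n z)))"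
    by (intro integrable_mult_right integrable_bergman_hphi)
  have b: "norm (indicator ?H z *\<^sub>R (f z * cnj (g z))) \<le> C * (indicator ?H z * (cmod (f z) * hphi m n z))" for z
    using mult_left_mono[OF C[of z], of "cmod (f z)"] by (auto simp: indicator_def norm_mult mult_ac)
  show 1: "integrable lborel (\<lambda>z. indicator ?H z *\<^sub>R (f z * cnj (g z)))"
    by (rule Bochner_Integration.integrable_bound[OF i])
      (use bergman_times_measurable[OF g] b in \<open>auto intro!: AE_I2 intro: order_trans[OF _ abs_ge_self]\<close>)
  have "(LINT z|lborel. norm (indicator ?H z *\<^sub>R (f z * cnj (g z)))) \<le> (LINT z|lborel. C * (indicator ?H z * (cmod (f z) * hphi m n z)))"
    by (intro integral_mono integrable_norm 1 i b)
  then show "(LINT z|lborel. norm (indicator ?H z *\<^sub>R (f z * cnj (g z)))) \<le> C * (LINT z|lborel. indicator ?H z * (cmod (f z) * hphi m n z))"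
    by simp
qed

text \<open>Averaging over the two rotations isolates one Laurent coefficient of \<open>f\<close>.\<close>

lemma integral_bergman_hmono:
  assumes g: "g holomorphic_on ball 0 1"
    and avg: "\<And>x y. (x, y) \<in> hartogs m n \<Longrightarrow>
      (LINT \<theta>|circ. f (cis \<theta> * x, y) * cis (- (real j * \<theta>))) = g y / y ^ (KK m n j + 1) * x ^ j"
  shows "(LINT z|lborel. indicator (hartogs m n) z *\<^sub>R (f z * cnj (hmono m n j q z)))
    = (deriv ^^ q) g 0 / fact q * of_real (pi\<^sup>2 * m / ((j + 1) * (LL m n j + m * q)))"
proof -
  let ?H = "hartogs m n" and ?e = "hmono m n j q"
  define i where "i = j div m"
  define r where "r = j mod m"
  have j: "j = i * m + r" and r: "r < m" using mn by (auto simp: i_def r_def)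
  have eb: "cmod (?e z) \<le> 1 * hphi m n z" if z: "z \<in> ?H" for z
  proof -
    note hz = hx_bounds[OF z mn(2)]
    have "cmod (?e z) \<le> hphi m n z * hx m n z ^ i * cmod (snd z) ^ q"
      unfolding j by (rule norm_hmono_le_hphi[OF mn z r])
    also have "\<dots> \<le> hphi m n z * 1 * 1"
      using hz by (intro mult_mono power_le_one hphi_nonneg) (auto simp: hphi_nonneg)
    finally show ?thesis by simp
  qed
  define E where "E = (\<lambda>z. indicator ?H z *\<^sub>R (f z * cnj (?e z)))"
  have iE: "integrable lborel E" unfolding E_def
    by (rule integrable_bergman_times[OF continuous_on_hmono[OF mn(2)] eb])
  define E2 where "E2 = (\<lambda>z. indicator ?H z *\<^sub>R (g (snd z) / snd z ^ (KK m n j + 1) * fst z ^ j * cnj (?e z)))"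
  have E2: "(\<lambda>z. LINT \<theta>|circ. E (cis (1 * \<theta>) * fst z, cis (0 * \<theta>) * snd z)) = E2"
  proof
    fix z :: "complex \<times> complex"
    obtain x y where z: "z = (x, y)" by (cases z)
    show "(LINT \<theta>|circ. E (cis (1 * \<theta>) * fst z, cis (0 * \<theta>) * snd z)) = E2 z"
    proof (cases "z \<in> ?H")
      case True
      have rot: "(cis \<theta> * x, y) \<in> ?H" for \<theta> using True hartogs_rotate[of "cis \<theta>" 1 x y] by (simp add: z)
      have "E (cis (1 * \<theta>) * fst z, cis (0 * \<theta>) * snd z) = f (cis \<theta> * x, y) * cis (- (real j * \<theta>)) * cnj (?e (x, y))" for \<theta>
        using rot[of \<theta>] by (simp add: E_def z hmono_def power_mult_distrib Complex.DeMoivre cis_cnj)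
      then show ?thesis using True avg[of x y] by (simp add: E2_def z)
    next
      case False
      have "(cis \<theta> * x, y) \<notin> ?H" for \<theta> using False hartogs_rotate[of "cis \<theta>" 1 x y] by (simp add: z)
      then show ?thesis using False by (simp add: E_def E2_def z)
    qed
  qed
  have iE2: "integrable lborel E2" and eq1: "(LINT z|lborel. E z) = (LINT z|lborel. E2 z)"
    using integral_avg[OF iE, of 1 0] unfolding E2 by auto
  define c where "c = (deriv ^^ q) g 0 / fact q"
  have E3: "(LINT \<theta>|circ. E2 (cis (0 * \<theta>) * fst z, cis (1 * \<theta>) * snd z)) = c * of_real (indicator ?H z * (cmod (?e z))\<^sup>2)" for z
  proof -
    obtain x y where z: "z = (x, y)" by (cases z)
    show ?thesis
    proof (cases "z \<in> ?H")
      case True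
      then have y: "y \<noteq> 0" "cmod y < 1" using hx_bounds[OF True mn(2)] by (auto simp: z)
      have rot: "(x, cis \<theta> * y) \<in> ?H" for \<theta> using True hartogs_rotate[of 1 "cis \<theta>" x y] by (simp add: z)
      have "E2 (cis (0 * \<theta>) * fst z, cis (1 * \<theta>) * snd z) = g (cis \<theta> * y) * cis (- (real q * \<theta>)) * (x ^ j / y ^ (KK m n j + 1) * cnj (?e (x, y)))" for \<theta>
      proof -
        \<comment> \<open>The phases of the negative powers of z2, one from the coefficient of f and
          one from the conjugated monomial, cancel; only the phase of order q survives.\<close>
        have "cis (real (KK m n j + 1) * \<theta>) * cnj (cis (real (KK m n j + 1) * \<theta>)) = 1"
          by (simp add: cis_cnj cis_mult)
        then have c1: "1 / cis (real (KK m n j + 1) * \<theta>) / cnj (cis (real (KK m n j + 1) * \<theta>)) = 1"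
          by (simp add: field_simps)
        have "E2 (cis (0 * \<theta>) * fst z, cis (1 * \<theta>) * snd z) = g (cis \<theta> * y) * cnj (cis (real q * \<theta>)) * (x ^ j / y ^ (KK m n j + 1) * cnj (?e (x, y))) *
          (1 / cis (real (KK m n j + 1) * \<theta>) / cnj (cis (real (KK m n j + 1) * \<theta>)))"
          using rot[of \<theta>] unfolding E2_def z hmono_def
          by (simp only: fst_conv snd_conv power_mult_distrib Complex.DeMoivre complex_cnj_mult complex_cnj_divide complex_cnj_power)
             (simp add: Complex.DeMoivre mult_ac)
        then show ?thesis unfolding c1 by (simp add: cis_cnj)
      qed
      then have "(LINT \<theta>|circ. E2 (cis (0 * \<theta>) * fst z, cis (1 * \<theta>) * snd z))
        = (LINT \<theta>|circ. g (cis (of_int 1 * \<theta>) * y) * cis (- (of_int 1 * real q * \<theta>))) * (x ^ j / y ^ (KK m n j + 1) * cnj (?e (x, y)))"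
        by simp
      also have "(LINT \<theta>|circ. g (cis (of_int 1 * \<theta>) * y) * cis (- (of_int 1 * real q * \<theta>))) = c * y ^ q"
        unfolding c_def
      proof (rule integral_circ_power_series[where R=1 and c="\<lambda>q. (deriv ^^ q) g 0 / fact q"])
        show "(\<lambda>i. (deriv ^^ i) g 0 / fact i * v ^ i) sums g v" if "v \<in> ball 0 1" for v
          using holomorphic_power_series[OF g that] by simp
      qed (use y in auto)
      also have "c * y ^ q * (x ^ j / y ^ (KK m n j + 1) * cnj (?e (x, y))) = c * (?e (x, y) * cnj (?e (x, y)))"
        by (simp add: hmono_def)
      also have "\<dots> = c * of_real ((cmod (?e (x, y)))\<^sup>2)"
        by (simp only: complex_norm_square)
      finally show ?thesis using True by (simp add: z)
    next
      case False
      have "(x, cis \<theta> * y) \<notin> ?H" for \<theta> using False hartogs_rotate[of 1 "cis \<theta>" x y] by (simp add: z)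
      then show ?thesis using False by (simp add: E2_def z)
    qed
  qed
  have "(LINT z|lborel. E2 z) = (LINT z|lborel. c * of_real (indicator ?H z * (cmod (?e z))\<^sup>2))"
    using integral_avg(2)[OF iE2, of 0 1] unfolding E3 by simp
  also have "\<dots> = c * of_real (LINT z|lborel. indicator ?H z * (cmod (?e z))\<^sup>2)"
    by (simp only: integral_mult_right_zero integral_complex_of_real)
  also have "(LINT z|lborel. indicator ?H z * (cmod (?e z))\<^sup>2) = pi\<^sup>2 * m / ((j + 1) * (LL m n j + m * q))"
  proof -
    have "(\<integral>\<^sup>+z. ennreal (indicator ?H z * (cmod (?e z))\<^sup>2) \<partial>lborel) = (\<integral>\<^sup>+z. ennreal ((cmod (?e z))\<^sup>2) * indicator ?H z \<partial>lborel)"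
      by (intro nn_integral_cong) (auto simp: indicator_def)
    also have "\<dots> = ennreal (pi\<^sup>2 * m / ((j + 1) * (LL m n j + m * q)))" by (rule nn_integral_hmono_square[OF mn])
    finally have nn: "(\<integral>\<^sup>+z. ennreal (indicator ?H z * (cmod (?e z))\<^sup>2) \<partial>lborel) = ennreal (pi\<^sup>2 * m / ((j + 1) * (LL m n j + m * q)))" .
    have "(\<lambda>z. (cmod (indicator ?H z *\<^sub>R ?e z))\<^sup>2) \<in> borel_measurable lborel"
    proof -
      have "(\<lambda>z. indicator ?H z *\<^sub>R ?e z) \<in> borel_measurable borel"
        by (rule borel_measurable_hartogs_indicator[OF continuous_on_hmono[OF mn(2)]])
      then show ?thesis unfolding measurable_lborel2 by measurable
    qed
    also have "(\<lambda>z. (cmod (indicator ?H z *\<^sub>R ?e z))\<^sup>2) = (\<lambda>z. indicator ?H z * (cmod (?e z))\<^sup>2)"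
      by (auto simp: indicator_def)
    finally have "(\<lambda>z. indicator ?H z * (cmod (?e z))\<^sup>2) \<in> borel_measurable lborel" .
    from nn_integral_eq_integrable[OF this, THEN iffD1, OF _ _ nn] show ?thesis by simp
  qed
  finally show ?thesis unfolding eq1[unfolded E_def] c_def .
qed

end

text \<open>The kernel is integrated against f term by term, each term returning one Laurent term of
  f at w. The closed form is unfolded in two nested sums, over \<open>q\<close> and then over
  \<open>i\<close>; each exchange with the integral is dominated by a summable multiple of |f|
  \<open>hphi\<close>.\<close>

lemma hartogs_kernel_reproducing:
  assumes mn: "0 < m" "0 < n" and f: "f \<in> bergman_space (hartogs m n)" and w: "w \<in> hartogs m n"
  shows "f w = (LINT z|lebesgue_on (hartogs m n). f z * cnj (hartogs_kernel m n z w))"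
proof -
  let ?H = "hartogs m n"
  obtain g where g: "\<And>j. g j holomorphic_on ball 0 1"
    and ser: "\<And>x y. (x, y) \<in> ?H \<Longrightarrow> (\<lambda>j. g j y / y ^ (KK m n j + 1) * x ^ j) sums f (x, y)"
    and avg: "\<And>x y j. (x, y) \<in> ?H \<Longrightarrow>
           (LINT \<theta>|circ. f (cis \<theta> * x, y) * cis (- (real j * \<theta>))) = g j y / y ^ (KK m n j + 1) * x ^ j"
    by (rule bergman_space_taylor[OF f mn]) blast
  define x0 y0 where "x0 = fst w" and "y0 = snd w"
  have w_eq: "w = (x0, y0)" by (simp add: x0_def y0_def)
  note hw = hx_bounds[OF w mn(2), folded y0_def]
  define s t where "s = (\<lambda>z::complex \<times> complex. fst z * cnj x0)" and "t = (\<lambda>z::complex \<times> complex. snd z * cnj y0)"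
  define u where "u = (\<lambda>z. s z ^ m / t z ^ n)"
  define D where "D = (\<lambda>r v. (of_nat (LL m n r) + of_nat (m - LL m n r) * v) / (1 - v)\<^sup>2 :: complex)"
  \<comment> \<open>The part of the expansion with z1-exponent i m + r, already summed over
    \<open>q\<close> through \<open>D\<close>.\<close>
  define B where "B = (\<lambda>r i z. of_nat (i * m + r + 1) * (s z ^ r / t z ^ (KK m n r + 1)) * u z ^ i * D r (t z))"
  define a where "a = (\<lambda>j. g j y0 / y0 ^ (KK m n j + 1) * x0 ^ j)"
  define \<Phi> where "\<Phi> = (LINT z|lborel. indicator ?H z * (cmod (f z) * hphi m n z))"
  have bounds: "cmod (u z) \<le> hx m n w" "cmod (u z) < 1" "cmod (t z) \<le> cmod y0" "cmod (t z) < 1" if "z \<in> ?H" for z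
    using norm_u_le[OF that w mn(2)] by (simp_all add: u_def s_def t_def x0_def y0_def)
  have t0: "t z \<noteq> 0" if "z \<in> ?H" for z using hx_bounds(3)[OF that mn(2)] hw by (simp add: t_def)
  have st: "continuous_on ?H s" "continuous_on ?H t" unfolding s_def t_def by (intro continuous_intros)+
  have prod_eq: "s z ^ r / t z ^ (KK m n r + 1) * u z ^ i * t z ^ q = hmono m n (i * m + r) q z * cnj (hmono m n (i * m + r) q w)" for z r i q
    using hmono_mult_cnj[OF mn, of z w r i q] by (simp add: u_def s_def t_def x0_def y0_def)
  have coeff: "(LINT z|lborel. indicator ?H z *\<^sub>R (f z * cnj (B r i z))) = of_real (pi\<^sup>2 * m) * a (i * m + r)" if r: "r < m" for r i
  proof -
    define j where "j = i * m + r"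
    have LLj: "LL m n j = LL m n r" unfolding j_def by (rule KK_LL_add[OF mn])
    \<comment> \<open>The weight (j + 1) (LL + m q) is \<pi>^2 m divided by the squared norm of the
      monomial, so integration against f returns \<pi>^2 m times a term of its expansion at
      w.\<close>
    define b where "b = (\<lambda>q z. of_nat ((j + 1) * (LL m n j + m * q)) * (hmono m n j q z * cnj (hmono m n j q w)))"
    define C where "C = (\<lambda>q. (real (LL m n j) + real m * real q) * cmod y0 ^ q * ((j + 1) * hphi m n w))"
    have bsums: "(\<lambda>q. b q z) sums B r i z" if z: "z \<in> ?H" for z
    proof -
      have "(\<lambda>q. of_nat (j + 1) * (s z ^ r / t z ^ (KK m n r + 1)) * u z ^ i * ((of_nat (LL m n r) + of_nat m * of_nat q) * t z ^ q)) sums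
         (of_nat (j + 1) * (s z ^ r / t z ^ (KK m n r + 1)) * u z ^ i * ((of_nat (LL m n r) + (of_nat m - of_nat (LL m n r)) * t z) / (1 - t z)\<^sup>2))"
        by (intro sums_mult linear_geometric_sums bounds z)
      also have "(\<lambda>q. of_nat (j + 1) * (s z ^ r / t z ^ (KK m n r + 1)) * u z ^ i * ((of_nat (LL m n r) + of_nat m * of_nat q) * t z ^ q)) = (\<lambda>q. b q z)"
      proof
        fix q
        have "of_nat (j + 1) * (s z ^ r / t z ^ (KK m n r + 1)) * u z ^ i * ((of_nat (LL m n r) + of_nat m * of_nat q) * t z ^ q)
          = of_nat (j + 1) * (of_nat (LL m n r) + of_nat m * of_nat q) * (s z ^ r / t z ^ (KK m n r + 1) * u z ^ i * t z ^ q)"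
          by (simp only: mult_ac)
        then show "of_nat (j + 1) * (s z ^ r / t z ^ (KK m n r + 1)) * u z ^ i * ((of_nat (LL m n r) + of_nat m * of_nat q) * t z ^ q) = b q z"
          unfolding prod_eq j_def[symmetric] by (simp only: b_def LLj of_nat_mult of_nat_add)
      qed
      also have "of_nat (j + 1) * (s z ^ r / t z ^ (KK m n r + 1)) * u z ^ i * ((of_nat (LL m n r) + (of_nat m - of_nat (LL m n r)) * t z) / (1 - t z)\<^sup>2) = B r i z"
        using LL_bounds(2)[OF mn(1), of n r] by (simp add: B_def D_def j_def of_nat_diff)
      finally show ?thesis .
    qed
    have bcont: "continuous_on ?H (b q)" for q
      unfolding b_def by (intro continuous_intros continuous_on_hmono mn)
    have bbound: "cmod (b q z) \<le> C q * hphi m n z" if z: "z \<in> ?H" for q z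
    proof -
      note hz = hx_bounds[OF z mn(2)]
      have "cmod (hmono m n j q z) \<le> hphi m n z * hx m n z ^ i * cmod (snd z) ^ q"
        unfolding j_def by (rule norm_hmono_le_hphi[OF mn z r])
      also have "\<dots> \<le> hphi m n z * 1 * 1"
        using hz by (intro mult_mono power_le_one hphi_nonneg) (auto simp: hphi_nonneg)
      finally have 1: "cmod (hmono m n j q z) \<le> hphi m n z" by simp
      have "cmod (hmono m n j q w) \<le> hphi m n w * hx m n w ^ i * cmod y0 ^ q"
        unfolding j_def y0_def by (rule norm_hmono_le_hphi[OF mn w r])
      also have "\<dots> \<le> hphi m n w * 1 * cmod y0 ^ q"
        using hw by (intro mult_mono power_le_one hphi_nonneg) (auto simp: hphi_nonneg)
      finally have 2: "cmod (hmono m n j q w) \<le> hphi m n w * cmod y0 ^ q" by simp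
      have "cmod (b q z) = real ((j + 1) * (LL m n j + m * q)) * (cmod (hmono m n j q z) * cmod (hmono m n j q w))"
        unfolding b_def norm_mult complex_mod_cnj norm_of_nat by simp
      also have "\<dots> \<le> real ((j + 1) * (LL m n j + m * q)) * (hphi m n z * (hphi m n w * cmod y0 ^ q))"
        by (intro mult_left_mono mult_mono 1 2 hphi_nonneg) auto
      also have "\<dots> = C q * hphi m n z" by (simp add: C_def algebra_simps)
      finally show ?thesis .
    qed
    have Csum: "summable C" unfolding C_def
      by (intro summable_mult2 sums_summable[OF linear_geometric_sums]) (use hw in simp)
    define F where "F = (\<lambda>q z. indicator ?H z *\<^sub>R (f z * cnj (b q z)))"
    have Fint: "integrable lborel (F q)" and Fnorm: "(LINT z|lborel. norm (F q z)) \<le> C q * \<Phi>" for q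
      unfolding F_def \<Phi>_def using integrable_bergman_times[OF mn f bcont bbound] by auto
    have F1: "summable (\<lambda>q. norm (F q z))" for z
    proof (cases "z \<in> ?H")
      case True
      show ?thesis
      proof (rule summable_comparison_test'[where N=0])
        show "summable (\<lambda>q. C q * (hphi m n z * cmod (f z)))" by (intro summable_mult2 Csum)
        show "norm (norm (F q z)) \<le> C q * (hphi m n z * cmod (f z))" for q
          using mult_left_mono[OF bbound[OF True, of q], of "cmod (f z)"] True
          by (simp add: F_def norm_mult mult_ac)
      qed
    qed (simp add: F_def)
    have F2: "summable (\<lambda>q. LINT z|lborel. norm (F q z))"
      by (rule summable_comparison_test'[where N=0, OF summable_mult2[OF Csum, of \<Phi>]]) (use Fnorm in auto)
    have S: "(\<lambda>q. LINT z|lborel. F q z) sums (LINT z|lborel. (\<Sum>q. F q z))"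
      by (rule sums_integral[OF Fint]) (use F1 F2 in auto)
    have "(\<Sum>q. F q z) = indicator ?H z *\<^sub>R (f z * cnj (B r i z))" for z
    proof (cases "z \<in> ?H")
      case True
      have "(\<lambda>q. f z * cnj (b q z)) sums (f z * cnj (B r i z))"
        by (intro sums_mult sums_cnj[THEN iffD2] bsums True)
      then show ?thesis using True by (simp add: F_def sums_iff)
    qed (simp add: F_def)
    then have S': "(\<lambda>q. LINT z|lborel. F q z) sums (LINT z|lborel. indicator ?H z *\<^sub>R (f z * cnj (B r i z)))"
      using S by simp
    have "(\<lambda>q. ((deriv ^^ q) (g j) 0 / fact q * y0 ^ q) * (of_real (pi\<^sup>2 * m) * (x0 ^ j / y0 ^ (KK m n j + 1)))) sums
       (g j y0 * (of_real (pi\<^sup>2 * m) * (x0 ^ j / y0 ^ (KK m n j + 1))))"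
      using holomorphic_power_series[OF g, of y0] hw by (intro sums_mult2) simp
    also have "(\<lambda>q. ((deriv ^^ q) (g j) 0 / fact q * y0 ^ q) * (of_real (pi\<^sup>2 * m) * (x0 ^ j / y0 ^ (KK m n j + 1)))) = (\<lambda>q. LINT z|lborel. F q z)"
    proof
      fix q
      define N where "N = real ((j + 1) * (LL m n j + m * q))"
      have N: "N \<noteq> 0" unfolding N_def of_nat_eq_0_iff mult_eq_0_iff using LL_bounds(1)[OF mn(1), of n j] by simp
      have "(LINT z|lborel. F q z) = (LINT z|lborel. (indicator ?H z *\<^sub>R (f z * cnj (hmono m n j q z))) * (of_real N * hmono m n j q w))"
        unfolding F_def b_def N_def of_real_of_nat_eq by (intro Bochner_Integration.integral_cong refl) simp
      also have "\<dots> = (LINT z|lborel. indicator ?H z *\<^sub>R (f z * cnj (hmono m n j q z))) * (of_real N * hmono m n j q w)"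
        by (rule integral_mult_left_zero)
      also have "\<dots> = (deriv ^^ q) (g j) 0 / fact q * of_real (pi\<^sup>2 * m / N) * (of_real N * hmono m n j q w)"
        using integral_bergman_hmono[OF mn f g avg, of j q] by (simp add: N_def)
      also have "\<dots> = (deriv ^^ q) (g j) 0 / fact q * (of_real (pi\<^sup>2 * m) * hmono m n j q w)"
        using N by simp
      also have "\<dots> = ((deriv ^^ q) (g j) 0 / fact q * y0 ^ q) * (of_real (pi\<^sup>2 * m) * (x0 ^ j / y0 ^ (KK m n j + 1)))"
        by (simp add: hmono_def x0_def y0_def)
      finally show "((deriv ^^ q) (g j) 0 / fact q * y0 ^ q) * (of_real (pi\<^sup>2 * m) * (x0 ^ j / y0 ^ (KK m n j + 1))) = (LINT z|lborel. F q z)" by simp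
    qed
    finally have "(\<lambda>q. LINT z|lborel. F q z) sums (g j y0 * (of_real (pi\<^sup>2 * m) * (x0 ^ j / y0 ^ (KK m n j + 1))))" .
    from sums_unique2[OF S' this] show ?thesis by (simp add: a_def j_def)
  qed
  define F where "F = (\<lambda>i z. indicator ?H z *\<^sub>R (f z * cnj (\<Sum>r<m. B r i z)))"
  \<comment> \<open>A bound for m blocks: i m + r + 1 \<le> (1 + i) m, \<open>hx m n w ^ i\<close>
    from the monomial at w, and the last factor bounding \<open>D\<close>.\<close>
  define C where "C = (\<lambda>i. (1 + 1 * real i) * hx m n w ^ i * (real m * (real m * hphi m n w * (real m / (1 - cmod y0)\<^sup>2))))"
  have Csum: "summable C" unfolding C_def
    by (intro summable_mult2 sums_summable[OF linear_geometric_sums]) (use hw in simp)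
  have Bbound1: "cmod (B r i z) \<le> (1 + real i) * hx m n w ^ i * (real m * hphi m n w * (real m / (1 - cmod y0)\<^sup>2)) * hphi m n z"
    if z: "z \<in> ?H" and r: "r < m" for r i z
  proof -
    note hz = hx_bounds[OF z mn(2)]
    have "cmod (hmono m n (i * m + r) 0 z) \<le> hphi m n z * hx m n z ^ i * cmod (snd z) ^ 0"
      by (rule norm_hmono_le_hphi[OF mn z r])
    also have "\<dots> \<le> hphi m n z * 1 * 1"
      using hz by (intro mult_mono power_le_one hphi_nonneg) (auto simp: hphi_nonneg)
    finally have 1: "cmod (hmono m n (i * m + r) 0 z) \<le> hphi m n z" by simp
    have 2: "cmod (hmono m n (i * m + r) 0 w) \<le> hphi m n w * hx m n w ^ i"
      using norm_hmono_le_hphi[OF mn w r, of i 0] by simp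
    have 3: "cmod (D r (t z)) \<le> real m / (1 - cmod y0)\<^sup>2"
      unfolding D_def norm_divide norm_power
    proof (intro frac_le power_mono norm_one_minus_ge bounds z)
      have "cmod (of_nat (LL m n r) + of_nat (m - LL m n r) * t z) \<le> real (LL m n r) + real (m - LL m n r) * cmod (t z)"
        by (rule order_trans[OF norm_triangle_ineq]) (simp add: norm_mult)
      also have "\<dots> \<le> real (LL m n r) + real (m - LL m n r) * 1"
        using bounds(4)[OF z] by (intro add_left_mono mult_left_mono) auto
      finally show "cmod (of_nat (LL m n r) + of_nat (m - LL m n r) * t z) \<le> real m"
        using LL_bounds(2)[OF mn(1), of n r] by simp
    qed (use hw in auto)
    have "i * m + r + 1 \<le> (1 + i) * m" using r by simp
    then have 4: "real (i * m + r + 1) \<le> (1 + real i) * real m" by (metis of_nat_le_iff of_nat_mult of_nat_Suc plus_1_eq_Suc)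
    have "B r i z = of_nat (i * m + r + 1) * (hmono m n (i * m + r) 0 z * cnj (hmono m n (i * m + r) 0 w)) * D r (t z)"
      unfolding prod_eq[symmetric] B_def by simp
    then have "cmod (B r i z) = real (i * m + r + 1) * (cmod (hmono m n (i * m + r) 0 z) * cmod (hmono m n (i * m + r) 0 w)) * cmod (D r (t z))"
      by (simp only: norm_mult norm_of_nat complex_mod_cnj)
    also have "\<dots> \<le> ((1 + real i) * real m) * (hphi m n z * (hphi m n w * hx m n w ^ i)) * (real m / (1 - cmod y0)\<^sup>2)"
      by (intro mult_mono 1 2 3 4 mult_nonneg_nonneg hphi_nonneg) (use hw in auto)
    finally show ?thesis by (simp only: mult_ac)
  qed
  have Bbound: "cmod (\<Sum>r<m. B r i z) \<le> C i * hphi m n z" if z: "z \<in> ?H" for i z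
  proof -
    have "cmod (\<Sum>r<m. B r i z) \<le> (\<Sum>r<m. (1 + real i) * hx m n w ^ i * (real m * hphi m n w * (real m / (1 - cmod y0)\<^sup>2)) * hphi m n z)"
      by (rule order_trans[OF norm_sum]) (intro sum_mono Bbound1 z, simp)
    also have "\<dots> = C i * hphi m n z" by (simp add: C_def)
    finally show ?thesis .
  qed
  have Bcont1: "continuous_on ?H (B r i)" for r i
    unfolding B_def u_def D_def
    by (intro continuous_intros st) (use t0 bounds(4) in \<open>auto simp: eq_commute[of "1::complex"] dest: bounds(4)\<close>)
  have Bcont: "continuous_on ?H (\<lambda>z. \<Sum>r<m. B r i z)" for i
    by (intro continuous_intros Bcont1)
  have Fint: "integrable lborel (F i)" and Fnorm: "(LINT z|lborel. norm (F i z)) \<le> C i * \<Phi>" for i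
    unfolding F_def \<Phi>_def using integrable_bergman_times[OF mn f Bcont Bbound] by auto
  have F1: "summable (\<lambda>i. norm (F i z))" for z
  proof (cases "z \<in> ?H")
    case True
    show ?thesis
    proof (rule summable_comparison_test'[where N=0])
      show "summable (\<lambda>i. C i * (hphi m n z * cmod (f z)))" by (intro summable_mult2 Csum)
      show "norm (norm (F i z)) \<le> C i * (hphi m n z * cmod (f z))" for i
        using mult_left_mono[OF Bbound[OF True, of i], of "cmod (f z)"] True
        by (simp add: F_def norm_mult mult_ac del: cnj_sum)
    qed
  qed (simp add: F_def)
  have F2: "summable (\<lambda>i. LINT z|lborel. norm (F i z))"
    by (rule summable_comparison_test'[where N=0, OF summable_mult2[OF Csum, of \<Phi>]]) (use Fnorm in auto)
  have S: "(\<lambda>i. LINT z|lborel. F i z) sums (LINT z|lborel. (\<Sum>i. F i z))"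
    by (rule sums_integral[OF Fint]) (use F1 F2 in auto)
  have Bsums: "(\<lambda>i. \<Sum>r<m. B r i z) sums (of_real (pi\<^sup>2 * m) * hartogs_kernel m n z w)" if z: "z \<in> ?H" for z
  proof -
    have "(\<lambda>i. \<Sum>r<m. ((of_nat (r + 1) + of_nat m * of_nat i) * u z ^ i) * (s z ^ r / t z ^ (KK m n r + 1) * D r (t z))) sums
      (\<Sum>r<m. ((of_nat (r + 1) + (of_nat m - of_nat (r + 1)) * u z) / (1 - u z)\<^sup>2) * (s z ^ r / t z ^ (KK m n r + 1) * D r (t z)))"
      by (intro sums_sum sums_mult2 linear_geometric_sums bounds z)
    also have "(\<lambda>i. \<Sum>r<m. ((of_nat (r + 1) + of_nat m * of_nat i) * u z ^ i) * (s z ^ r / t z ^ (KK m n r + 1) * D r (t z))) = (\<lambda>i. \<Sum>r<m. B r i z)"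
    proof (intro ext sum.cong refl)
      fix i r
      have e: "(of_nat (i * m + r + 1) :: complex) = of_nat (r + 1) + of_nat m * of_nat i"
        by (simp add: algebra_simps)
      show "((of_nat (r + 1) + of_nat m * of_nat i) * u z ^ i) * (s z ^ r / t z ^ (KK m n r + 1) * D r (t z)) = B r i z"
        unfolding B_def e by (simp only: mult_ac)
    qed
    also have "(\<Sum>r<m. ((of_nat (r + 1) + (of_nat m - of_nat (r + 1)) * u z) / (1 - u z)\<^sup>2) * (s z ^ r / t z ^ (KK m n r + 1) * D r (t z)))
       = (\<Sum>r<m. ((of_nat (r + 1) + of_nat (m - 1 - r) * u z) * (of_nat (LL m n r) + of_nat (m - LL m n r) * t z) * (s z ^ r / t z ^ (KK m n r + 1))) / ((1 - u z)\<^sup>2 * (1 - t z)\<^sup>2))"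
    proof (rule sum.cong[OF refl])
      fix r assume "r \<in> {..<m}"
      then have "m - 1 - r = m - (r + 1)" "r + 1 \<le> m" by auto
      then have e: "(of_nat (m - 1 - r) :: complex) = of_nat m - of_nat (r + 1)" by (simp only: of_nat_diff)
      show "((of_nat (r + 1) + (of_nat m - of_nat (r + 1)) * u z) / (1 - u z)\<^sup>2) * (s z ^ r / t z ^ (KK m n r + 1) * D r (t z))
        = ((of_nat (r + 1) + of_nat (m - 1 - r) * u z) * (of_nat (LL m n r) + of_nat (m - LL m n r) * t z) * (s z ^ r / t z ^ (KK m n r + 1))) / ((1 - u z)\<^sup>2 * (1 - t z)\<^sup>2)"
        unfolding e D_def by (simp add: mult_ac)
    qed
    also have "\<dots> = kernel_num m n (s z) (t z) / ((1 - u z)\<^sup>2 * (1 - t z)\<^sup>2)"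
      unfolding kernel_num_def u_def by (rule sum_divide_distrib[symmetric])
    also have "\<dots> = of_real (pi\<^sup>2 * m) * hartogs_kernel m n z w"
      using mn by (simp add: hartogs_kernel_def kernel_fun_def s_def t_def u_def x0_def y0_def)
    finally show ?thesis .
  qed
  have "(\<Sum>i. F i z) = indicator ?H z *\<^sub>R (f z * cnj (of_real (pi\<^sup>2 * m) * hartogs_kernel m n z w))" for z
  proof (cases "z \<in> ?H")
    case True
    have "(\<lambda>i. f z * cnj (\<Sum>r<m. B r i z)) sums (f z * cnj (of_real (pi\<^sup>2 * m) * hartogs_kernel m n z w))"
      by (intro sums_mult sums_cnj[THEN iffD2] Bsums True)
    then show ?thesis using True by (simp add: F_def sums_iff)
  qed (simp add: F_def)
  then have Fsum: "(\<Sum>i. F i z) = of_real (pi\<^sup>2 * m) * (indicator ?H z *\<^sub>R (f z * cnj (hartogs_kernel m n z w)))" for z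
    by (simp add: indicator_def)
  have S': "(\<lambda>i. LINT z|lborel. F i z) sums (of_real (pi\<^sup>2 * m) * (LINT z|lborel. indicator ?H z *\<^sub>R (f z * cnj (hartogs_kernel m n z w))))"
    using S unfolding Fsum integral_mult_right_zero .
  \<comment> \<open>The m blocks belonging to one \<open>i\<close> are m consecutive terms of the
    Taylor series in z1, so \<open>sums_group\<close> identifies the total with f(w).\<close>
  have Feq: "(LINT z|lborel. F i z) = of_real (pi\<^sup>2 * m) * (\<Sum>j\<in>{i * m..<i * m + m}. a j)" for i
  proof -
    have "(LINT z|lborel. F i z) = (LINT z|lborel. (\<Sum>r<m. indicator ?H z *\<^sub>R (f z * cnj (B r i z))))"
      unfolding F_def by (simp add: sum_distrib_left scaleR_sum_right)
    also have "\<dots> = (\<Sum>r<m. (LINT z|lborel. indicator ?H z *\<^sub>R (f z * cnj (B r i z))))"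
      by (intro Bochner_Integration.integral_sum integrable_bergman_times(1)[OF mn f Bcont1]) (rule Bbound1, auto)
    also have "\<dots> = (\<Sum>r<m. of_real (pi\<^sup>2 * m) * a (i * m + r))"
      by (intro sum.cong refl coeff) auto
    also have "\<dots> = of_real (pi\<^sup>2 * m) * (\<Sum>r<m. a (i * m + r))" by (simp add: sum_distrib_left)
    also have "(\<Sum>r<m. a (i * m + r)) = (\<Sum>j\<in>{i * m..<i * m + m}. a j)"
      using sum.shift_bounds_nat_ivl[of a 0 "i * m" m] by (simp add: atLeast0LessThan add.commute)
    finally show ?thesis .
  qed
  have "(\<lambda>i. \<Sum>j\<in>{i * m..<i * m + m}. a j) sums f w"
    using sums_group[OF ser mn(1), of x0 y0] w by (simp add: w_eq a_def)
  then have "(\<lambda>i. LINT z|lborel. F i z) sums (of_real (pi\<^sup>2 * m) * f w)"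
    unfolding Feq by (rule sums_mult)
  from sums_unique2[OF S' this]
  have eq: "f w = (LINT z|lborel. indicator ?H z *\<^sub>R (f z * cnj (hartogs_kernel m n z w)))"
    using mn by simp
  have "(\<lambda>z. indicator ?H z *\<^sub>R (f z * cnj (hartogs_kernel m n z w))) \<in> borel_measurable borel"
    by (rule bergman_times_measurable[OF mn f])
      (rule holomorphic2_on_imp_continuous_on[OF holomorphic2_on_hartogs_kernel[OF mn w]])
  then show ?thesis unfolding eq by (subst integral_lebesgue_on) auto
qed

lemma is_bergman_kernel_hartogs:
  assumes "0 < m" "0 < n"
  shows "is_bergman_kernel (hartogs m n) (hartogs_kernel m n)"
  unfolding is_bergman_kernel_def
  using hartogs_kernel_in_bergman_space[OF assms] hartogs_kernel_reproducing[OF assms] by blast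

text \<open>The closed form shows that the choice in \<open>bergman_kernel\<close> has a witness,
  and uniqueness of reproducing kernels on the domain determines its values there.\<close>

lemma bergman_kernel_hartogs:
  assumes "0 < m" "0 < n" "z \<in> hartogs m n" "w \<in> hartogs m n"
  shows "bergman_kernel (hartogs m n) z w = hartogs_kernel m n z w"
proof -
  have "is_bergman_kernel (hartogs m n) (bergman_kernel (hartogs m n))"
    unfolding bergman_kernel_def by (rule someI[of _ "hartogs_kernel m n"]) (rule is_bergman_kernel_hartogs[OF assms(1,2)])
  from is_bergman_kernel_unique[OF this is_bergman_kernel_hartogs[OF assms(1,2)] assms(3,4)] show ?thesis .
qed

section \<open>Sufficiency of the conditions\<close>

lemma integrable_powr_of_nn_bound:
  fixes g :: "'a \<Rightarrow> complex"
  assumes g: "g \<in> borel_measurable M" and b: "(\<integral>\<^sup>+z. ennreal (cmod (g z) powr p) \<partial>M) \<le> ennreal B" and "0 \<le> B"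
  shows "g \<in> Lp_space p M" and "(LINT z|M. cmod (g z) powr p) \<le> B"
proof -
  have m: "(\<lambda>z. cmod (g z) powr p) \<in> borel_measurable M" using g by measurable
  have i: "integrable M (\<lambda>z. cmod (g z) powr p)"
    by (rule integrableI_nonneg[OF m]) (use b in \<open>auto simp: less_top[symmetric] top_unique intro: le_less_trans\<close>)
  show "g \<in> Lp_space p M" using g i by (simp add: Lp_space_def)
  show "(LINT z|M. cmod (g z) powr p) \<le> B"
    using b assms(3) nn_integral_eq_integral[OF i] by (simp add: ennreal_le_iff)
qed

text \<open>The operator with kernel |k| applied to |f| dominates the one with kernel k applied to f
  pointwise, and |f| has the same norm as f. Joint measurability of k yields measurability of the
  image.\<close>

lemma integral_op_bounded_of_abs:
  fixes k :: "'a \<Rightarrow> 'a \<Rightarrow> complex"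
  assumes "sigma_finite_measure M"
    and k[measurable]: "(\<lambda>(z, w). k z w) \<in> borel_measurable (M \<Otimes>\<^sub>M M)"
    and bd: "integral_op_bounded p M (\<lambda>z w. of_real (cmod (k z w)))" and p: "p > 1"
  shows "integral_op_bounded p M k"
proof -
  interpret sigma_finite_measure M by fact
  obtain C where C: "\<And>f. f \<in> Lp_space p M \<Longrightarrow>
        (AE z in M. integrable M (\<lambda>w. of_real (cmod (k z w)) * f w)) \<and>
        integral_op M (\<lambda>z w. of_real (cmod (k z w))) f \<in> Lp_space p M \<and>
        Lp_norm p M (integral_op M (\<lambda>z w. of_real (cmod (k z w))) f) \<le> C * Lp_norm p M f"
    using bd unfolding integral_op_bounded_def by blast
  show ?thesis
    unfolding integral_op_bounded_def
  proof (intro exI[of _ C] ballI)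
    fix f assume f: "f \<in> Lp_space p M"
    then have fm[measurable]: "f \<in> borel_measurable M" by (simp add: Lp_space_def)
    define f' where "f' = (\<lambda>w. complex_of_real (cmod (f w)))"
    have f': "f' \<in> Lp_space p M" using f by (simp add: Lp_space_def f'_def)
    have nf': "Lp_norm p M f' = Lp_norm p M f" by (simp add: Lp_norm_def f'_def)
    note Cf = C[OF f']
    have km: "k z \<in> borel_measurable M" if "z \<in> space M" for z
      using measurable_Pair2[OF k that] by simp
    have ae: "AE z in M. integrable M (\<lambda>w. k z w * f w)"
    proof -
      have "AE z in M. integrable M (\<lambda>w. of_real (cmod (k z w)) * f' w)" using Cf by blast
      then show ?thesis
      proof (rule AE_mp, intro AE_I2 impI)
        fix z assume z: "z \<in> space M" and i: "integrable M (\<lambda>w. of_real (cmod (k z w)) * f' w)"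
        show "integrable M (\<lambda>w. k z w * f w)"
          by (rule Bochner_Integration.integrable_bound[OF i])
             (use km[OF z] fm in \<open>auto simp: f'_def norm_mult\<close>)
      qed
    qed
    have Sm: "integral_op M k f \<in> borel_measurable M"
      unfolding integral_op_def by (rule sigma_finite_measure.borel_measurable_lebesgue_integral[OF assms(1)]) measurable
    have dom: "cmod (integral_op M k f z) \<le> cmod (integral_op M (\<lambda>z w. of_real (cmod (k z w))) f' z)" for z
    proof -
      have "cmod (integral_op M k f z) \<le> (LINT w|M. cmod (k z w * f w))"
        unfolding integral_op_def by (rule integral_norm_bound)
      also have "\<dots> = Re (integral_op M (\<lambda>z w. of_real (cmod (k z w))) f' z)"
        unfolding integral_op_def f'_def of_real_mult[symmetric] integral_complex_of_real by (simp add: norm_mult)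
      also have "\<dots> \<le> cmod (integral_op M (\<lambda>z w. of_real (cmod (k z w))) f' z)" by (rule complex_Re_le_cmod)
      finally show ?thesis .
    qed
    have i1: "integrable M (\<lambda>z. cmod (integral_op M (\<lambda>z w. of_real (cmod (k z w))) f' z) powr p)"
      using Cf by (simp add: Lp_space_def)
    have pm: "(\<lambda>z. cmod (integral_op M k f z) powr p) \<in> borel_measurable M" using Sm by measurable
    have i2: "integrable M (\<lambda>z. cmod (integral_op M k f z) powr p)"
      by (rule Bochner_Integration.integrable_bound[OF i1 pm]) (use dom p in \<open>auto intro!: AE_I2 powr_mono2\<close>)
    have "Lp_norm p M (integral_op M k f) \<le> Lp_norm p M (integral_op M (\<lambda>z w. of_real (cmod (k z w))) f')"
      unfolding Lp_norm_def using p
      by (intro powr_mono2 integral_mono i1 i2 dom) auto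
    also have "\<dots> \<le> C * Lp_norm p M f" using Cf nf' by simp
    finally show "(AE z in M. integrable M (\<lambda>w. k z w * f w)) \<and> integral_op M k f \<in> Lp_space p M \<and>
        Lp_norm p M (integral_op M k f) \<le> C * Lp_norm p M f"
      using ae Sm i2 by (simp add: Lp_space_def)
  qed
qed

text \<open>Young's inequality with a free parameter \<open>\<lambda>\<close>, optimised below, replaces Hoelder's inequality.\<close>

lemma young_optimised:
  fixes F A G :: real
  assumes p: "p > 1" and q: "q = p / (p - 1)" and A: "A > 0" and G: "G \<ge> 0" and F: "F \<ge> 0"
    and Y: "\<And>l. l > 0 \<Longrightarrow> F \<le> l powr q / q * A + l powr (-p) / p * G"
  shows "F powr p \<le> A powr (p - 1) * G"
proof -
  have q0: "q > 0" using p q by simp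
  have pq: "1 / p + 1 / q = 1" using p unfolding q by (simp add: field_simps)
  \<comment> \<open>\<open>G\<close> may be 0, and the optimal \<lambda> would degenerate. The
    estimate is made for every larger \<open>G'\<close> and the limit is taken afterwards.\<close>
  have "F powr p \<le> A powr (p - 1) * G'" if G': "G' > G" for G'
  proof -
    have G'0: "G' > 0" using G G' by simp
    \<comment> \<open>The value at which \<lambda>^q A and \<lambda>^(-p) G' are equal; recall p + q
      = p q.\<close>
    define l where "l = (G' / A) powr (1 / (p * q))"
    have l: "l > 0" using A G'0 by (simp add: l_def)
    have l1: "l powr q = (G' / A) powr (1 / p)" using q0 by (simp add: l_def powr_powr)
    have l2: "l powr (-p) = (G' / A) powr (- (1 / q))" using p by (simp add: l_def powr_powr)
    have e1: "(G' / A) powr (1 / p) * A = G' powr (1 / p) * A powr (1 / q)"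
    proof -
      have "(G' / A) powr (1 / p) * A powr 1 = G' powr (1 / p) * A powr (1 - 1 / p)"
        using A G'0 by (simp add: powr_divide powr_diff)
      also have "1 - 1 / p = 1 / q" using pq by simp
      finally show ?thesis using A by simp
    qed
    have e2: "(G' / A) powr (- (1 / q)) * G' = G' powr (1 / p) * A powr (1 / q)"
    proof -
      have "(G' / A) powr (- (1 / q)) * G' powr 1 = G' powr (1 - 1 / q) * A powr (1 / q)"
        using A G'0 by (simp add: powr_divide powr_diff powr_minus field_simps)
      also have "1 - 1 / q = 1 / p" using pq by simp
      finally show ?thesis using G'0 by simp
    qed
    have "F \<le> l powr q / q * A + l powr (-p) / p * G" by (rule Y[OF l])
    also have "\<dots> \<le> l powr q / q * A + l powr (-p) / p * G'"
      using G' p by (intro add_left_mono mult_left_mono) auto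
    also have "\<dots> = ((G' / A) powr (1 / p) * A) / q + ((G' / A) powr (- (1 / q)) * G') / p"
      unfolding l1 l2 by simp
    also have "\<dots> = (G' powr (1 / p) * A powr (1 / q)) * (1 / p + 1 / q)"
      unfolding e1 e2 by (simp add: algebra_simps)
    finally have "F \<le> G' powr (1 / p) * A powr (1 / q)" unfolding pq by simp
    then have "F powr p \<le> (G' powr (1 / p) * A powr (1 / q)) powr p"
      using F p by (intro powr_mono2) auto
    also have "\<dots> = G' powr 1 * A powr (p / q)" using p by (simp add: powr_mult powr_powr)
    also have "p / q = p - 1" using p q by simp
    finally show ?thesis using G'0 by (simp add: mult.commute)
  qed
  then show ?thesis
  proof (cases "A powr (p - 1) = 0")
    case False
    then have pos: "A powr (p - 1) > 0" by simp
    show ?thesis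
    proof (rule dense_ge)
      fix y assume y: "A powr (p - 1) * G < y"
      define G' where "G' = y / A powr (p - 1)"
      have "G < G'" using y pos by (simp add: G'_def field_simps)
      from \<open>\<And>G'. G' > G \<Longrightarrow> F powr p \<le> A powr (p - 1) * G'\<close>[OF this] show "F powr p \<le> y"
        using pos by (simp add: G'_def)
    qed
  qed (use A in simp)
qed

text \<open>Young's inequality is applied to |f| = h (|f| / h). The first term is controlled by
  \<open>S1\<close>, and optimising gives F(z)^p \<le> C^(p-1) h(z)^p G(z), where G integrates Q
  (|f| / h)^p. Integrating in z, Tonelli and \<open>S2\<close> contribute the remaining factor
  C.\<close>

lemma schur_test:
  fixes Q :: "'a \<Rightarrow> 'a \<Rightarrow> real" and h :: "'a \<Rightarrow> real"
  assumes "sigma_finite_measure M"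
    and Q[measurable]: "(\<lambda>(z, w). Q z w) \<in> borel_measurable (M \<Otimes>\<^sub>M M)"
    and h[measurable]: "h \<in> borel_measurable M"
    and Q0: "\<And>z w. z \<in> space M \<Longrightarrow> w \<in> space M \<Longrightarrow> 0 \<le> Q z w"
    and h0: "\<And>z. z \<in> space M \<Longrightarrow> 0 < h z"
    and p: "p > 1" and q: "q = p / (p - 1)" and C: "C > 0"
    and S1: "\<And>z. z \<in> space M \<Longrightarrow> (\<integral>\<^sup>+w. ennreal (Q z w * h w powr q) \<partial>M) \<le> ennreal (C * h z powr q)"
    and S2: "\<And>w. w \<in> space M \<Longrightarrow> (\<integral>\<^sup>+z. ennreal (Q z w * h z powr p) \<partial>M) \<le> ennreal (C * h w powr p)"
  shows "integral_op_bounded p M (\<lambda>z w. of_real (Q z w))"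
  unfolding integral_op_bounded_def
proof (intro exI[of _ C] ballI)
  interpret sigma_finite_measure M by fact
  interpret pair_sigma_finite M M ..
  have q0: "q > 0" using p q by simp
  have pq: "1 / p + 1 / q = 1" using p unfolding q by (simp add: field_simps)
  have qp: "q * (p - 1) = p" using p q by simp
  have q1: "q > 1" using p q by (simp add: less_divide_eq)
  have qp': "1 / q + 1 / p = 1" using pq by simp
  fix f assume f: "f \<in> Lp_space p M"
  then have fm[measurable]: "f \<in> borel_measurable M" and fi: "integrable M (\<lambda>w. cmod (f w) powr p)" by (auto simp: Lp_space_def)
  define G where "G = (\<lambda>z. \<integral>\<^sup>+w. ennreal (Q z w * (cmod (f w) / h w) powr p) \<partial>M)"
  define F where "F = (\<lambda>z. \<integral>\<^sup>+w. ennreal (Q z w * cmod (f w)) \<partial>M)"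
  have Gm[measurable]: "G \<in> borel_measurable M" unfolding G_def by measurable
  define K where "K = (LINT w|M. cmod (f w) powr p)"
  have K0: "K \<ge> 0" by (simp add: K_def)
  have Qz: "Q z \<in> borel_measurable M" if "z \<in> space M" for z using measurable_Pair2[OF Q that] by simp
  have Qw: "(\<lambda>z. Q z w) \<in> borel_measurable M" if "w \<in> space M" for w using measurable_Pair1[OF Q that] by simp
  have lin: "ennreal (a * x + b * y) = ennreal a * ennreal x + ennreal b * ennreal y"
    if "0 \<le> a" "0 \<le> b" "0 \<le> x" "0 \<le> y" for a b x y :: real
    using that by (simp add: ennreal_mult)
  have hp: "(\<lambda>z. h z powr p) \<in> borel_measurable M" by measurable
  have Gint: "(\<integral>\<^sup>+z. ennreal (h z powr p) * G z \<partial>M) \<le> ennreal (C * K)"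
  proof -
    have "(\<integral>\<^sup>+z. ennreal (h z powr p) * G z \<partial>M) = (\<integral>\<^sup>+z. \<integral>\<^sup>+w. ennreal (h z powr p) * ennreal (Q z w * (cmod (f w) / h w) powr p) \<partial>M \<partial>M)"
      unfolding G_def using Qz by (intro nn_integral_cong nn_integral_cmult[symmetric]) measurable
    also have "\<dots> = (\<integral>\<^sup>+w. \<integral>\<^sup>+z. ennreal (h z powr p) * ennreal (Q z w * (cmod (f w) / h w) powr p) \<partial>M \<partial>M)"
      by (rule Fubini'[symmetric]) measurable
    also have "\<dots> \<le> (\<integral>\<^sup>+w. ennreal (C * cmod (f w) powr p) \<partial>M)"
    proof (rule nn_integral_mono)
      fix w assume w: "w \<in> space M"
      have "(\<integral>\<^sup>+z. ennreal (h z powr p) * ennreal (Q z w * (cmod (f w) / h w) powr p) \<partial>M)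
        = (\<integral>\<^sup>+z. ennreal ((cmod (f w) / h w) powr p) * ennreal (Q z w * h z powr p) \<partial>M)"
        using w Q0 by (intro nn_integral_cong) (simp add: ennreal_mult[symmetric] mult_ac)
      also have "\<dots> = ennreal ((cmod (f w) / h w) powr p) * (\<integral>\<^sup>+z. ennreal (Q z w * h z powr p) \<partial>M)"
        by (intro nn_integral_cmult measurable_compose[OF _ measurable_ennreal] borel_measurable_times Qw w hp)
      also have "\<dots> \<le> ennreal ((cmod (f w) / h w) powr p) * ennreal (C * h w powr p)"
        by (intro mult_left_mono S2 w) auto
      also have "\<dots> = ennreal (C * cmod (f w) powr p)"
        using h0[OF w] C by (subst ennreal_mult[symmetric]) (auto simp: powr_divide)
      finally show "(\<integral>\<^sup>+z. ennreal (h z powr p) * ennreal (Q z w * (cmod (f w) / h w) powr p) \<partial>M) \<le> ennreal (C * cmod (f w) powr p)" .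
    qed
    also have "\<dots> = ennreal (C * K)"
      unfolding K_def using fi C by (subst nn_integral_eq_integral) auto
    finally show ?thesis .
  qed
  have "(\<lambda>z. ennreal (h z powr p) * G z) \<in> borel_measurable M" by measurable
  moreover have "(\<integral>\<^sup>+z. ennreal (h z powr p) * G z \<partial>M) \<noteq> \<infinity>"
    using Gint by (metis ennreal_neq_top infinity_ennreal_def neq_top_trans)
  ultimately have "AE z in M. ennreal (h z powr p) * G z \<noteq> \<infinity>" by (rule nn_integral_PInf_AE)
  then have Gfin: "AE z in M. G z < \<infinity>"
  proof (rule AE_mp, intro AE_I2 impI)
    fix z assume z: "z \<in> space M" and "ennreal (h z powr p) * G z \<noteq> \<infinity>"
    then show "G z < \<infinity>" using h0[OF z] by (auto simp: ennreal_mult_eq_top_iff less_top)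
  qed
  \<comment> \<open>Finiteness of \<open>G z\<close> already forces absolute convergence at z, so
    the exceptional null set is the one where \<open>G\<close> is infinite.\<close>
  have key: "F z < \<infinity> \<and> ennreal (enn2real (F z) powr p) \<le> ennreal (C powr (p - 1)) * (ennreal (h z powr p) * G z)"
    if z: "z \<in> space M" and Gz: "G z < \<infinity>" for z
  proof -
    define g where "g = enn2real (G z)"
    have g: "G z = ennreal g" "g \<ge> 0" using Gz by (auto simp: g_def)
    define A where "A = C * h z powr q"
    have A: "A > 0" using C h0[OF z] by (simp add: A_def)
    have Y: "F z \<le> ennreal (l powr q / q * A + l powr (-p) / p * g)" if l: "l > 0" for l
    proof -
      have "F z \<le> (\<integral>\<^sup>+w. ennreal (l powr q / q) * ennreal (Q z w * h w powr q) + ennreal (l powr (-p) / p) * ennreal (Q z w * (cmod (f w) / h w) powr p) \<partial>M)"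
        unfolding F_def
      proof (rule nn_integral_mono)
        fix w assume w: "w \<in> space M"
        have "(l * h w) * (cmod (f w) / (l * h w)) \<le> (l * h w) powr q / q + (cmod (f w) / (l * h w)) powr p / p"
          by (rule Youngs_inequality[OF q1 p qp']) (use l h0[OF w] in auto)
        also have "(l * h w) * (cmod (f w) / (l * h w)) = cmod (f w)" using l h0[OF w] by simp
        also have "(l * h w) powr q / q + (cmod (f w) / (l * h w)) powr p / p = l powr q / q * h w powr q + l powr (-p) / p * (cmod (f w) / h w) powr p"
          using l h0[OF w] by (simp add: powr_mult powr_divide powr_minus_divide)
        finally have "Q z w * cmod (f w) \<le> Q z w * (l powr q / q * h w powr q + l powr (-p) / p * (cmod (f w) / h w) powr p)"
          using Q0[OF z w] by (rule mult_left_mono)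
        then have "Q z w * cmod (f w) \<le> l powr q / q * (Q z w * h w powr q) + l powr (-p) / p * (Q z w * (cmod (f w) / h w) powr p)"
          by (simp add: algebra_simps)
        then have "ennreal (Q z w * cmod (f w)) \<le> ennreal (l powr q / q * (Q z w * h w powr q) + l powr (-p) / p * (Q z w * (cmod (f w) / h w) powr p))"
          by (rule ennreal_leI)
        also have "\<dots> = ennreal (l powr q / q) * ennreal (Q z w * h w powr q) + ennreal (l powr (-p) / p) * ennreal (Q z w * (cmod (f w) / h w) powr p)"
          by (rule lin) (use Q0[OF z w] q0 p in auto)
        finally show "ennreal (Q z w * cmod (f w)) \<le> ennreal (l powr q / q) * ennreal (Q z w * h w powr q) + ennreal (l powr (-p) / p) * ennreal (Q z w * (cmod (f w) / h w) powr p)" .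
      qed
      also have "\<dots> = ennreal (l powr q / q) * (\<integral>\<^sup>+w. ennreal (Q z w * h w powr q) \<partial>M) + ennreal (l powr (-p) / p) * G z"
        unfolding G_def using Qz[OF z] by (subst nn_integral_add) (auto simp: nn_integral_cmult)
      also have "\<dots> \<le> ennreal (l powr q / q) * ennreal A + ennreal (l powr (-p) / p) * ennreal g"
        unfolding A_def g(1) by (intro add_mono mult_left_mono S1 z) auto
      also have "\<dots> = ennreal (l powr q / q * A + l powr (-p) / p * g)"
        by (rule lin[symmetric]) (use A g q0 p in auto)
      finally show ?thesis .
    qed
    have Ffin: "F z < \<infinity>" using Y[of 1] by (simp add: le_less_trans[OF _ ennreal_less_top])
    define Fz where "Fz = enn2real (F z)"
    have Fz: "F z = ennreal Fz" "Fz \<ge> 0" using Ffin by (auto simp: Fz_def)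
    have "Fz powr p \<le> A powr (p - 1) * g"
    proof (rule young_optimised[OF p q A g(2) Fz(2)])
      fix l :: real assume l: "l > 0"
      have "0 \<le> l powr q / q * A + l powr (-p) / p * g" using A g q0 p by simp
      with Y[OF l] show "Fz \<le> l powr q / q * A + l powr (-p) / p * g" unfolding Fz(1) by (simp add: ennreal_le_iff)
    qed
    also have "A powr (p - 1) = C powr (p - 1) * h z powr p"
      using C h0[OF z] by (simp add: A_def powr_mult powr_powr qp)
    finally have "ennreal (Fz powr p) \<le> ennreal (C powr (p - 1) * h z powr p * g)" by (rule ennreal_leI)
    then show ?thesis using Ffin g by (simp add: Fz_def[symmetric] ennreal_mult mult.assoc)
  qed
  have ae: "AE z in M. integrable M (\<lambda>w. of_real (Q z w) * f w)"
    using Gfin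
  proof (rule AE_mp, intro AE_I2 impI)
    fix z assume z: "z \<in> space M" and Gz: "G z < \<infinity>"
    show "integrable M (\<lambda>w. of_real (Q z w) * f w)"
    proof (rule integrableI_bounded)
      have [measurable]: "Q z \<in> borel_measurable M" by (rule Qz[OF z])
      show "(\<lambda>w. of_real (Q z w) * f w) \<in> borel_measurable M" by measurable
      have "(\<integral>\<^sup>+w. ennreal (norm (of_real (Q z w) * f w)) \<partial>M) = F z"
        unfolding F_def using Q0[OF z] by (intro nn_integral_cong) (simp add: norm_mult)
      then show "(\<integral>\<^sup>+w. ennreal (norm (of_real (Q z w) * f w)) \<partial>M) < \<infinity>" using key[OF z Gz] by simp
    qed
  qed
  let ?S = "integral_op M (\<lambda>z w. of_real (Q z w)) f"
  have Sm: "?S \<in> borel_measurable M"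
    unfolding integral_op_def by (rule sigma_finite_measure.borel_measurable_lebesgue_integral[OF assms(1)]) measurable
  have "(\<integral>\<^sup>+z. ennreal (cmod (?S z) powr p) \<partial>M) \<le> (\<integral>\<^sup>+z. ennreal (C powr (p - 1)) * (ennreal (h z powr p) * G z) \<partial>M)"
  proof (rule nn_integral_mono_AE, rule AE_mp[OF Gfin], rule AE_mp[OF ae], intro AE_I2 impI)
    fix z assume z: "z \<in> space M" and Gz: "G z < \<infinity>" and i: "integrable M (\<lambda>w. of_real (Q z w) * f w)"
    have "ennreal (cmod (?S z)) \<le> (\<integral>\<^sup>+w. ennreal (norm (of_real (Q z w) * f w)) \<partial>M)"
      unfolding integral_op_def by (rule integral_norm_bound_ennreal[OF i])
    also have "\<dots> = F z"
      unfolding F_def using Q0[OF z] by (intro nn_integral_cong) (simp add: norm_mult)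
    finally have "cmod (?S z) \<le> enn2real (F z)"
      using key[OF z Gz] by (metis enn2real_ennreal enn2real_mono infinity_ennreal_def norm_ge_zero)
    then have "ennreal (cmod (?S z) powr p) \<le> ennreal (enn2real (F z) powr p)"
      using p by (intro ennreal_leI powr_mono2) auto
    then show "ennreal (cmod (?S z) powr p) \<le> ennreal (C powr (p - 1)) * (ennreal (h z powr p) * G z)"
      using key[OF z Gz] by (meson order_trans)
  qed
  also have "\<dots> = ennreal (C powr (p - 1)) * (\<integral>\<^sup>+z. ennreal (h z powr p) * G z \<partial>M)"
    by (rule nn_integral_cmult) measurable
  also have "\<dots> \<le> ennreal (C powr (p - 1)) * ennreal (C * K)" by (intro mult_left_mono Gint) auto
  also have "\<dots> = ennreal (C powr (p - 1) * (C * K))" using C K0 by (simp add: ennreal_mult)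
  also have "C powr (p - 1) * (C * K) = C powr p * K" using C by (simp add: powr_diff)
  finally have b: "(\<integral>\<^sup>+z. ennreal (cmod (?S z) powr p) \<partial>M) \<le> ennreal (C powr p * K)" .
  have CK: "0 \<le> C powr p * K" using K0 by simp
  have "Lp_norm p M ?S \<le> (C powr p * K) powr (1 / p)"
    unfolding Lp_norm_def using p
    by (intro powr_mono2 integrable_powr_of_nn_bound(2)[OF Sm b CK]) auto
  also have "\<dots> = C * Lp_norm p M f"
    using C p K0 by (simp add: powr_mult powr_powr Lp_norm_def K_def)
  finally show "(AE z in M. integrable M (\<lambda>w. of_real (Q z w) * f w)) \<and> ?S \<in> Lp_space p M \<and> Lp_norm p M ?S \<le> C * Lp_norm p M f"
    using ae integrable_powr_of_nn_bound(1)[OF Sm b CK] by blast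
qed

section \<open>Size of the kernel on the diagonal and Forelli-Rudin estimates\<close>

text \<open>The boundary distance of the bidisc model: the product of the distances of |z1^m / z2^n|
  and |z2| from 1.\<close>

definition hdel :: "nat \<Rightarrow> nat \<Rightarrow> complex \<times> complex \<Rightarrow> real" where
  "hdel m n z = (1 - hx m n z) * (1 - cmod (snd z))"

lemma hdel_pos: "z \<in> hartogs m n \<Longrightarrow> 0 < n \<Longrightarrow> 0 < hdel m n z"
  using hx_bounds by (simp add: hdel_def)

text \<open>In the coordinates \<rho> = |z1| / |z2|^(n/m) and r = |z2| the growth at the origin is
  the power (LL - n - m) / m of r, most singular when LL = 1.\<close>

lemma norm_hmono_polar:
  assumes mn: "0 < m" "0 < n" and z: "snd z \<noteq> 0"
  shows "cmod (hmono m n j 0 z) = (cmod (fst z) / cmod (snd z) powr (real n / real m)) ^ j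
      * cmod (snd z) powr ((real (LL m n j) - real n - real m) / real m)"
proof -
  define r where "r = cmod (snd z)"
  have r: "r > 0" using z by (simp add: r_def)
  have nL: "real n * (real j + 1) = real m * real (KK m n j) + real (LL m n j)"
    using arg_cong[OF LL_KK[OF mn(2), of j m], of real] by (simp add: algebra_simps)
  have e: "(real (LL m n j) - real n - real m) / real m = real n / real m * real j - real (KK m n j + 1)"
  proof -
    have "real (LL m n j) - real n - real m = real n * real j - real m * (real (KK m n j) + 1)"
      using nL by (simp add: algebra_simps)
    then show ?thesis using mn by (simp add: diff_divide_distrib)
  qed
  have "r powr ((real (LL m n j) - real n - real m) / real m) = r powr (real n / real m * real j) / r powr real (KK m n j + 1)"
    unfolding e by (rule powr_diff)
  also have "r powr real (KK m n j + 1) = r ^ (KK m n j + 1)" by (rule powr_realpow[OF r])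
  also have "r powr (real n / real m * real j) = (r powr (real n / real m)) ^ j"
    using r by (simp add: powr_power mult.commute)
  finally have "r powr ((real (LL m n j) - real n - real m) / real m) = (r powr (real n / real m)) ^ j / r ^ (KK m n j + 1)" .
  then show ?thesis using r
    by (simp add: hmono_def norm_mult norm_divide norm_power r_def[symmetric] power_divide)
qed

text \<open>The term j = 0 is a negative power of |z2| < 1. The bound allows exponents of
  \<open>hphi\<close> to be raised, in particular from a negative exponent to 0.\<close>

lemma hphi_ge_1:
  assumes "0 < m" "0 < n" "z \<in> hartogs m n"
  shows "1 \<le> hphi m n z"
proof -
  note hz = hx_bounds[OF assms(3,2)]
  have "cmod (snd z) ^ (KK m n 0 + 1) \<le> 1" using hz by (intro power_le_one) auto
  then have "1 \<le> cmod (hmono m n 0 0 z)"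
    using hz by (simp add: hmono_def norm_divide norm_mult norm_power le_divide_eq)
  also have "\<dots> \<le> hphi m n z"
    unfolding hphi_def using assms(1) by (intro member_le_sum) auto
  finally show ?thesis .
qed

text \<open>Since LL \<ge> 1, no monomial is more singular than the power -(m+n-1)/m of |z2|, the
  source of the factor m + n - 1 in the conditions.\<close>

lemma hphi_le:
  assumes mn: "0 < m" "0 < n" and z: "z \<in> hartogs m n"
  shows "hphi m n z \<le> m * cmod (snd z) powr (- ((real m + real n - 1) / real m))"
proof -
  note hz = hx_bounds[OF z mn(2)]
  have x: "cmod (fst z) / cmod (snd z) powr (real n / real m) \<le> 1"
    using z hartogs_iff[OF mn, of z] by (simp add: divide_le_eq)
  have "hphi m n z \<le> (\<Sum>r<m. cmod (snd z) powr (- ((real m + real n - 1) / real m)))"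
    unfolding hphi_def
  proof (rule sum_mono)
    fix r
    have "cmod (hmono m n r 0 z) \<le> 1 * cmod (snd z) powr ((real (LL m n r) - real n - real m) / real m)"
      unfolding norm_hmono_polar[OF mn hz(3)] using x by (intro mult_right_mono power_le_one) auto
    also have "\<dots> \<le> cmod (snd z) powr (- ((real m + real n - 1) / real m))"
    proof -
      have "- ((real m + real n - 1) / real m) \<le> (real (LL m n r) - real n - real m) / real m"
        using LL_bounds(1)[OF mn(1), of n r] mn by (simp add: field_simps)
      then show ?thesis using hz by (simp add: powr_mono')
    qed
    finally show "cmod (hmono m n r 0 z) \<le> cmod (snd z) powr (- ((real m + real n - 1) / real m))" .
  qed
  then show ?thesis by simp
qed

lemma hartogs_kernel_diag_le:
  assumes mn: "0 < m" "0 < n" and z: "z \<in> hartogs m n"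
  shows "Re (hartogs_kernel m n z z) \<le> m / pi\<^sup>2 * (hphi m n z / hdel m n z)\<^sup>2"
proof -
  note hz = hx_bounds[OF z mn(2)] and u = norm_u_le[OF z z mn(2)]
  have "Re (hartogs_kernel m n z z) \<le> cmod (hartogs_kernel m n z z)" by (rule complex_Re_le_cmod)
  also have "\<dots> \<le> m / pi\<^sup>2 * (hphi m n z * hphi m n z) /
     ((cmod (1 - (fst z * cnj (fst z)) ^ m / (snd z * cnj (snd z)) ^ n))\<^sup>2 * (cmod (1 - snd z * cnj (snd z)))\<^sup>2)"
    by (rule norm_hartogs_kernel_le[OF mn z z])
  also have "\<dots> \<le> m / pi\<^sup>2 * (hphi m n z * hphi m n z) / ((1 - hx m n z)\<^sup>2 * (1 - cmod (snd z))\<^sup>2)"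
  proof -
    have gen: "A / (U\<^sup>2 * T\<^sup>2) \<le> A / (X\<^sup>2 * Y\<^sup>2)"
      if "0 \<le> A" "0 < X" "0 < Y" "X \<le> U" "Y \<le> T" for A U T X Y :: real
      using that by (intro divide_left_mono mult_mono power_mono mult_pos_pos zero_less_power) auto
    show ?thesis
      by (rule gen) (use hz norm_one_minus_ge[OF u(1)] norm_one_minus_ge[OF u(3)] in \<open>simp_all add: hphi_nonneg\<close>)
  qed
  also have "\<dots> = m / pi\<^sup>2 * (hphi m n z / hdel m n z)\<^sup>2"
    by (simp add: hdel_def power2_eq_square)
  finally show ?thesis .
qed

text \<open>On the diagonal all summands of the numerator are nonnegative with coefficients at least
  1, so nothing cancels. In the constant, 16 comes from 1 - y^2 \<le> 2 (1 - y) for both factors,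
  one m from the Cauchy-Schwarz inequality for m terms, and \<pi>^2 m from the normalisation of the
  kernel.\<close>

lemma hartogs_kernel_diag_ge:
  assumes mn: "0 < m" "0 < n" and z: "z \<in> hartogs m n"
  shows "(hphi m n z / hdel m n z)\<^sup>2 / (16 * pi\<^sup>2 * m\<^sup>2) \<le> Re (hartogs_kernel m n z z)"
proof -
  note hz = hx_bounds[OF z mn(2)]
  define x r where "x = hx m n z" and "r = cmod (snd z)"
  have x: "0 \<le> x" "x < 1" and r: "0 < r" "r < 1" using hz by (auto simp: x_def r_def)
  have u: "(fst z * cnj (fst z)) ^ m / (snd z * cnj (snd z)) ^ n = of_real (x\<^sup>2)"
  proof -
    have "x\<^sup>2 = ((cmod (fst z))\<^sup>2) ^ m / ((cmod (snd z))\<^sup>2) ^ n"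
      by (simp add: x_def hx_def power_divide power_mult[symmetric] mult.commute)
    moreover define a b where "a = (cmod (fst z))\<^sup>2" and "b = (cmod (snd z))\<^sup>2"
    moreover have "fst z * cnj (fst z) = of_real a" "snd z * cnj (snd z) = of_real b"
      by (simp_all only: a_def b_def complex_norm_square)
    ultimately show ?thesis by simp
  qed
  have t: "snd z * cnj (snd z) = of_real (r\<^sup>2)" by (simp only: r_def complex_norm_square)
  define S where "S = (\<Sum>j<m. (real (j + 1) + real (m - 1 - j) * x\<^sup>2) * (real (LL m n j) + real (m - LL m n j) * r\<^sup>2) * (cmod (hmono m n j 0 z))\<^sup>2)"
  have "kernel_num m n (fst z * cnj (fst z)) (snd z * cnj (snd z)) = of_real S"
  proof -
    have e: "(fst z * cnj (fst z)) ^ j / (snd z * cnj (snd z)) ^ (KK m n j + 1) = of_real ((cmod (hmono m n j 0 z))\<^sup>2)" for j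
      using hmono_mult_cnj[OF mn, where i=0 and q=0 and w=z and z=z] by (simp add: complex_norm_square del: of_real_power)
    show ?thesis unfolding kernel_num_def u e unfolding t S_def
      by (simp only: of_real_sum of_real_mult of_real_add of_real_of_nat_eq)
  qed
  then have "hartogs_kernel m n z z = of_real (S / (pi\<^sup>2 * m * ((1 - x\<^sup>2)\<^sup>2 * (1 - r\<^sup>2)\<^sup>2)))"
    unfolding hartogs_kernel_def kernel_fun_def u unfolding t by simp
  then have K: "Re (hartogs_kernel m n z z) = S / (pi\<^sup>2 * m * ((1 - x\<^sup>2)\<^sup>2 * (1 - r\<^sup>2)\<^sup>2))" by simp
  have "(\<Sum>j<m. (cmod (hmono m n j 0 z))\<^sup>2) \<le> S"
    unfolding S_def
  proof (rule sum_mono)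
    fix j
    have "1 * 1 \<le> (real (j + 1) + real (m - 1 - j) * x\<^sup>2) * (real (LL m n j) + real (m - LL m n j) * r\<^sup>2)"
      using LL_bounds(1)[OF mn(1), of n j] by (intro mult_mono) (auto intro: add_increasing2)
    then show "(cmod (hmono m n j 0 z))\<^sup>2 \<le> (real (j + 1) + real (m - 1 - j) * x\<^sup>2) * (real (LL m n j) + real (m - LL m n j) * r\<^sup>2) * (cmod (hmono m n j 0 z))\<^sup>2"
      by (simp add: mult_le_cancel_right1)
  qed
  moreover have "(hphi m n z)\<^sup>2 \<le> (\<Sum>j<m. (cmod (hmono m n j 0 z))\<^sup>2) * card {..<m}"
    unfolding hphi_def by (rule sum_squared_le_sum_of_squares)
  ultimately have "(hphi m n z)\<^sup>2 \<le> S * m"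
    by (smt (verit) card_lessThan mult_right_mono of_nat_0_le_iff)
  then have S: "(hphi m n z)\<^sup>2 / m \<le> S" using mn by (simp add: divide_le_eq)
  have sq: "(1 - y\<^sup>2)\<^sup>2 \<le> 4 * (1 - y)\<^sup>2" if "0 \<le> y" "y < 1" for y :: real
  proof -
    have "1 - y\<^sup>2 = (1 - y) * (1 + y)" by (simp add: power2_eq_square algebra_simps)
    also have "\<dots> \<le> (1 - y) * 2" using that by (intro mult_left_mono) auto
    finally have "1 - y\<^sup>2 \<le> (1 - y) * 2" .
    moreover have "0 \<le> 1 - y\<^sup>2" using that by (simp add: power_le_one)
    ultimately have "(1 - y\<^sup>2)\<^sup>2 \<le> ((1 - y) * 2)\<^sup>2" by (intro power_mono)
    then show ?thesis by (simp only: power_mult_distrib) simp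
  qed
  have pos: "0 < (1 - x\<^sup>2)\<^sup>2 * (1 - r\<^sup>2)\<^sup>2"
    using x r power_strict_mono[of x 1 2] power_strict_mono[of r 1 2] by simp
  have d: "(1 - x\<^sup>2)\<^sup>2 * (1 - r\<^sup>2)\<^sup>2 \<le> 16 * (hdel m n z)\<^sup>2"
  proof -
    have "(1 - x\<^sup>2)\<^sup>2 * (1 - r\<^sup>2)\<^sup>2 \<le> (4 * (1 - x)\<^sup>2) * (4 * (1 - r)\<^sup>2)"
      using x r by (intro mult_mono sq) auto
    also have "\<dots> = 16 * (hdel m n z)\<^sup>2" by (simp add: hdel_def x_def r_def power_mult_distrib)
    finally show ?thesis .
  qed
  have "(hphi m n z / hdel m n z)\<^sup>2 / (16 * pi\<^sup>2 * m\<^sup>2) = ((hphi m n z)\<^sup>2 / m) / (pi\<^sup>2 * m * (16 * (hdel m n z)\<^sup>2))"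
    by (simp add: power_divide power2_eq_square)
  also have "\<dots> \<le> S / (pi\<^sup>2 * m * ((1 - x\<^sup>2)\<^sup>2 * (1 - r\<^sup>2)\<^sup>2))"
    using mn pos d by (intro frac_le S mult_left_mono) (auto intro: order_trans[OF _ S])
  finally show ?thesis unfolding K .
qed

text \<open>Two-sided comparability of B(z,z) with (\<open>hphi\<close> / \<open>hdel\<close>)^2
  yields an upper bound for powers of either sign; applied to the opposite exponent it also serves
  as a lower bound.\<close>

lemma hartogs_kernel_diag_powr:
  fixes \<beta> :: real
  assumes mn: "0 < m" "0 < n"
  obtains C :: real where "C > 0"
    "\<And>z. z \<in> hartogs m n \<Longrightarrow> Re (hartogs_kernel m n z z) powr \<beta> \<le> C * (hphi m n z powr (2 * \<beta>) * hdel m n z powr (- (2 * \<beta>)))"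
proof
  define c1 c2 where "c1 = 1 / (16 * pi\<^sup>2 * (real m)\<^sup>2)" and "c2 = real m / pi\<^sup>2"
  have c: "c1 > 0" "c2 > 0" using mn by (auto simp: c1_def c2_def)
  show "c1 powr \<beta> + c2 powr \<beta> > 0" using c by (simp add: add_pos_pos)
  fix z assume z: "z \<in> hartogs m n"
  define Y where "Y = hphi m n z / hdel m n z"
  have p: "hphi m n z > 0" "hdel m n z > 0" using hphi_ge_1[OF mn z] hdel_pos[OF z mn(2)] by auto
  then have Y: "Y > 0" by (simp add: Y_def)
  have "c1 * Y\<^sup>2 \<le> Re (hartogs_kernel m n z z)" "Re (hartogs_kernel m n z z) \<le> c2 * Y\<^sup>2"
    using hartogs_kernel_diag_ge[OF mn z] hartogs_kernel_diag_le[OF mn z] by (simp_all add: c1_def c2_def Y_def)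
  then have "Re (hartogs_kernel m n z z) powr \<beta> \<le> (c1 * Y\<^sup>2) powr \<beta> + (c2 * Y\<^sup>2) powr \<beta>"
    by (rule powr_le_of_bounds[rotated]) (use c Y in auto)
  also have "\<dots> = (c1 powr \<beta> + c2 powr \<beta>) * Y powr (2 * \<beta>)"
  proof -
    have "(Y\<^sup>2) powr \<beta> = Y powr (2 * \<beta>)" using Y by (simp add: powr_powr flip: powr_numeral)
    then show ?thesis using c Y by (simp add: powr_mult distrib_right)
  qed
  also have "Y powr (2 * \<beta>) = hphi m n z powr (2 * \<beta>) * hdel m n z powr (- (2 * \<beta>))"
    using p by (simp add: Y_def powr_divide powr_minus_divide)
  finally show "Re (hartogs_kernel m n z z) powr \<beta> \<le> (c1 powr \<beta> + c2 powr \<beta>) * (hphi m n z powr (2 * \<beta>) * hdel m n z powr (- (2 * \<beta>)))" .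
qed

lemma hx_polar:
  assumes mn: "0 < m" "0 < n" and z: "snd z \<noteq> 0"
  shows "hx m n z = (cmod (fst z) / cmod (snd z) powr (real n / real m)) ^ m"
proof -
  have "(cmod (snd z) powr (real n / real m)) ^ m = cmod (snd z) ^ n"
    using mn z by (simp add: powr_power powr_realpow)
  then show ?thesis by (simp add: hx_def power_divide)
qed

text \<open>Rotating the two coordinates of \<open>w\<close> one after the other replaces the two kernel factors by
  their circle averages; what remains is radial.\<close>

lemma hartogs_forelli_rudin:
  fixes \<beta> c \<kappa> :: real
  assumes mn: "0 < m" "0 < n" and \<beta>: "\<beta> > -1" and c: "c > \<beta> + 2" "c > 1" and \<kappa>: "\<kappa> < 2 + 2 * (real n / real m)"
  obtains C :: real where "C > 0"
    "\<And>z. z \<in> hartogs m n \<Longrightarrow>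
      (\<integral>\<^sup>+w. ennreal (cmod (snd w) powr (-\<kappa>) * hdel m n w powr \<beta> *
          (cmod (1 - (fst z * cnj (fst w)) ^ m / (snd z * cnj (snd w)) ^ n) powr (-c) * cmod (1 - snd z * cnj (snd w)) powr (-c)))
        * indicator (hartogs m n) w \<partial>lborel) \<le> ennreal (C * hdel m n z powr (\<beta> + 2 - c))"
proof -
  let ?H = "hartogs m n"
  define \<gamma> where "\<gamma> = real n / real m"
  obtain C1 where C1: "C1 > 0"
    "\<And>\<xi>. cmod \<xi> < 1 \<Longrightarrow> (\<integral>\<^sup>+\<theta>. ennreal (cmod (1 - cis \<theta> * \<xi>) powr (-c)) \<partial>circ) \<le> ennreal (C1 * (1 - cmod \<xi>) powr (1 - c))"
    using nn_integral_circ_kernel_le[OF c(2)] by blast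
  \<comment> \<open>After the circle average the kernel exponent is c - 1, so
    \<open>c > \<beta> + 2\<close> is what the radial estimate needs. The power 1 is that of \<rho>
    in polar coordinates; for \<open>C3\<close> it is 1 + 2\<gamma> - \<kappa>, larger than -1 by
    the hypothesis on \<open>\<kappa>\<close>.\<close>
  obtain C2 where C2: "C2 > 0" "\<And>x. 0 \<le> x \<Longrightarrow> x < 1 \<Longrightarrow>
       (\<integral>\<^sup>+r. ennreal (r powr 1 * (1 - r) powr \<beta> * (1 - x * r) powr (-(c - 1))) * indicator {0<..<1} r \<partial>lborel)
       \<le> ennreal (C2 * (1 - x) powr (\<beta> + 1 - (c - 1)))"
    using nn_integral_radial_kernel_le[of \<beta> "c - 1" 1] \<beta> c by auto
  obtain C3 where C3: "C3 > 0" "\<And>x. 0 \<le> x \<Longrightarrow> x < 1 \<Longrightarrow>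
       (\<integral>\<^sup>+r. ennreal (r powr (1 + 2 * \<gamma> - \<kappa>) * (1 - r) powr \<beta> * (1 - x * r) powr (-(c - 1))) * indicator {0<..<1} r \<partial>lborel)
       \<le> ennreal (C3 * (1 - x) powr (\<beta> + 1 - (c - 1)))"
    using nn_integral_radial_kernel_le[of \<beta> "c - 1" "1 + 2 * \<gamma> - \<kappa>"] \<beta> c \<kappa> by (auto simp: \<gamma>_def)
  \<comment> \<open>2 \<pi> belongs to polar coordinates; 1 + m^\<beta> pays for replacing 1 -
    \<rho>^m by 1 - \<rho>.\<close>
  define E where "E = 2 * pi * (1 + real m powr \<beta>)"
  have E: "E > 0" by (simp add: E_def add_pos_nonneg)
  define C where "C = C1 * C1 * (E * C2 * (2 * pi * C3))"
  have C: "C > 0" using C1 C2 C3 E by (simp add: C_def)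
  show ?thesis
  proof (rule that[OF C])
    fix z assume z: "z \<in> ?H"
    note hz = hx_bounds[OF z mn(2)]
    define X R where "X = hx m n z" and "R = cmod (snd z)"
    have X: "0 \<le> X" "X < 1" and R: "0 < R" "R < 1" using hz by (auto simp: X_def R_def)
    define u where "u = (\<lambda>w. (fst z * cnj (fst w)) ^ m / (snd z * cnj (snd w)) ^ n)"
    define t where "t = (\<lambda>w::complex \<times> complex. snd z * cnj (snd w))"
    define A where "A = (\<lambda>w. cmod (snd w) powr (-\<kappa>) * hdel m n w powr \<beta>)"
    have A0: "0 \<le> A w" for w by (simp add: A_def)
    define I1 where "I1 = (\<lambda>w. ennreal (A w * (cmod (1 - u w) powr (-c) * cmod (1 - t w) powr (-c))) * indicator ?H w)"
    define I2 where "I2 = (\<lambda>w. ennreal (A w * ((1 - X * hx m n w) powr (1 - c) * cmod (1 - t w) powr (-c))) * indicator ?H w)"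
    define I3 where "I3 = (\<lambda>w. ennreal (A w * ((1 - X * hx m n w) powr (1 - c) * (1 - R * cmod (snd w)) powr (1 - c))) * indicator ?H w)"
    have m1[measurable]: "(\<lambda>w. cmod (snd w)) \<in> borel_measurable (borel :: (complex \<times> complex) measure)"
      "(\<lambda>w. cmod (fst w)) \<in> borel_measurable (borel :: (complex \<times> complex) measure)"
      by (intro borel_measurable_continuous_onI continuous_intros)+
    have m2[measurable]: "hx m n \<in> borel_measurable borel" unfolding hx_def[abs_def] by measurable
    have m3[measurable]: "A \<in> borel_measurable borel" unfolding A_def hdel_def by measurable
    have m4[measurable]: "t \<in> borel_measurable borel" unfolding t_def
      by (intro borel_measurable_continuous_onI continuous_intros)
    have "(\<lambda>w. fst z * cnj (fst w)) \<in> borel_measurable (borel :: (complex \<times> complex) measure)"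
      by (intro borel_measurable_continuous_onI continuous_intros)
    then have m5[measurable]: "u \<in> borel_measurable borel" unfolding u_def
      using m4 unfolding t_def by measurable
    have I1m: "I1 \<in> borel_measurable borel" unfolding I1_def by measurable
    have I2m: "I2 \<in> borel_measurable borel" unfolding I2_def by measurable
    have u_norm: "cmod (u w) = X * hx m n w" for w unfolding u_def X_def by (rule norm_u_eq)
    have t_norm: "cmod (t w) = R * cmod (snd w)" for w by (simp add: t_def R_def norm_mult)
    have lt1: "cmod (u w) < 1" "cmod (t w) < 1" if "w \<in> ?H" for w
      using norm_u_le[OF z that mn(2)] by (simp_all add: u_def t_def)
    have "(\<integral>\<^sup>+w. I1 w \<partial>lborel) = (\<integral>\<^sup>+w. \<integral>\<^sup>+\<theta>. I1 (cis ((- 1 / m) * \<theta>) * fst w, cis (0 * \<theta>) * snd w) \<partial>circ \<partial>lborel)"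
      by (rule nn_integral_avg[OF I1m])
    also have "\<dots> \<le> (\<integral>\<^sup>+w. ennreal C1 * I2 w \<partial>lborel)"
    proof (rule nn_integral_mono)
      fix w :: "complex \<times> complex"
      obtain x y where w: "w = (x, y)" by (cases w)
      have rot: "(cis ((- 1 / m) * \<theta>) * x, y) \<in> ?H \<longleftrightarrow> w \<in> ?H" for \<theta>
        using hartogs_rotate[of "cis ((- 1 / m) * \<theta>)" 1 x y] by (simp add: w)
      show "(\<integral>\<^sup>+\<theta>. I1 (cis ((- 1 / m) * \<theta>) * fst w, cis (0 * \<theta>) * snd w) \<partial>circ) \<le> ennreal C1 * I2 w"
      proof (cases "w \<in> ?H")
        case True
        have "I1 (cis ((- 1 / m) * \<theta>) * fst w, cis (0 * \<theta>) * snd w) = ennreal (A w * cmod (1 - t w) powr (-c)) * ennreal (cmod (1 - cis \<theta> * u w) powr (-c))" for \<theta>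
        proof -
          \<comment> \<open>The denominator m of the speed undoes the m-th power, and its sign
            undoes the conjugation of w, so u turns exactly once.\<close>
          have "u (cis ((- 1 / m) * \<theta>) * x, y) = cis \<theta> * u w"
          proof -
            have "(fst z * cnj (cis ((- 1 / m) * \<theta>) * x)) ^ m = cis (real m * (\<theta> / m)) * (fst z * cnj x) ^ m"
              unfolding complex_cnj_mult cis_cnj by (simp add: power_mult_distrib Complex.DeMoivre)
            then show ?thesis using mn by (simp add: u_def w)
          qed
          moreover have "A (cis ((- 1 / m) * \<theta>) * x, y) = A w" by (simp add: A_def w hdel_def hx_def norm_mult)
          moreover have "t (cis ((- 1 / m) * \<theta>) * x, y) = t w" by (simp add: t_def w)
          ultimately show ?thesis using True rot[of \<theta>] A0[of w]
            by (simp add: I1_def w[symmetric] ennreal_mult[symmetric] mult_ac) (simp add: w mult_ac)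
        qed
        then have "(\<integral>\<^sup>+\<theta>. I1 (cis ((- 1 / m) * \<theta>) * fst w, cis (0 * \<theta>) * snd w) \<partial>circ) = (\<integral>\<^sup>+\<theta>. ennreal (A w * cmod (1 - t w) powr (-c)) * ennreal (cmod (1 - cis \<theta> * u w) powr (-c)) \<partial>circ)"
          by simp
        also have "\<dots> = ennreal (A w * cmod (1 - t w) powr (-c)) * (\<integral>\<^sup>+\<theta>. ennreal (cmod (1 - cis \<theta> * u w) powr (-c)) \<partial>circ)"
        proof (rule nn_integral_cmult)
          have [measurable]: "(\<lambda>\<theta>. cmod (1 - cis \<theta> * u w)) \<in> borel_measurable borel"
            by (intro borel_measurable_continuous_onI continuous_intros)
          show "(\<lambda>\<theta>. ennreal (cmod (1 - cis \<theta> * u w) powr (-c))) \<in> borel_measurable circ" by measurable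
        qed
        also have "\<dots> \<le> ennreal (A w * cmod (1 - t w) powr (-c)) * ennreal (C1 * (1 - cmod (u w)) powr (1 - c))"
          by (intro mult_left_mono C1(2) lt1 True) auto
        also have "\<dots> = ennreal C1 * I2 w"
          using True C1(1) A0[of w] by (simp add: I2_def u_norm ennreal_mult[symmetric] mult_ac)
        finally show ?thesis .
      next
        case False
        then show ?thesis using rot by (simp add: I1_def w)
      qed
    qed
    also have "\<dots> = ennreal C1 * (\<integral>\<^sup>+w. I2 w \<partial>lborel)" using I2m by (intro nn_integral_cmult) simp
    also have "(\<integral>\<^sup>+w. I2 w \<partial>lborel) = (\<integral>\<^sup>+w. \<integral>\<^sup>+\<theta>. I2 (cis (0 * \<theta>) * fst w, cis ((-1) * \<theta>) * snd w) \<partial>circ \<partial>lborel)"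
      by (rule nn_integral_avg[OF I2m])
    also have "\<dots> \<le> (\<integral>\<^sup>+w. ennreal C1 * I3 w \<partial>lborel)"
    proof (rule nn_integral_mono)
      fix w :: "complex \<times> complex"
      obtain x y where w: "w = (x, y)" by (cases w)
      have rot: "(x, cis ((-1) * \<theta>) * y) \<in> ?H \<longleftrightarrow> w \<in> ?H" for \<theta>
        using hartogs_rotate[of 1 "cis ((-1) * \<theta>)" x y] by (simp add: w)
      show "(\<integral>\<^sup>+\<theta>. I2 (cis (0 * \<theta>) * fst w, cis ((-1) * \<theta>) * snd w) \<partial>circ) \<le> ennreal C1 * I3 w"
      proof (cases "w \<in> ?H")
        case True
        have "I2 (cis (0 * \<theta>) * fst w, cis ((-1) * \<theta>) * snd w) = ennreal (A w * (1 - X * hx m n w) powr (1 - c)) * ennreal (cmod (1 - cis \<theta> * t w) powr (-c))" for \<theta>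
        proof -
          have "t (x, cis ((-1) * \<theta>) * y) = cis \<theta> * t w" by (simp add: t_def w cis_cnj mult_ac)
          moreover have "A (x, cis ((-1) * \<theta>) * y) = A w" by (simp add: A_def w hdel_def hx_def norm_mult)
          moreover have "hx m n (x, cis ((-1) * \<theta>) * y) = hx m n w" by (simp add: hx_def w norm_mult)
          ultimately show ?thesis using True rot[of \<theta>] A0[of w]
            by (simp add: I2_def w[symmetric] ennreal_mult[symmetric] mult_ac) (simp add: w mult_ac)
        qed
        then have "(\<integral>\<^sup>+\<theta>. I2 (cis (0 * \<theta>) * fst w, cis ((-1) * \<theta>) * snd w) \<partial>circ) = (\<integral>\<^sup>+\<theta>. ennreal (A w * (1 - X * hx m n w) powr (1 - c)) * ennreal (cmod (1 - cis \<theta> * t w) powr (-c)) \<partial>circ)"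
          by simp
        also have "\<dots> = ennreal (A w * (1 - X * hx m n w) powr (1 - c)) * (\<integral>\<^sup>+\<theta>. ennreal (cmod (1 - cis \<theta> * t w) powr (-c)) \<partial>circ)"
        proof (rule nn_integral_cmult)
          have [measurable]: "(\<lambda>\<theta>. cmod (1 - cis \<theta> * t w)) \<in> borel_measurable borel"
            by (intro borel_measurable_continuous_onI continuous_intros)
          show "(\<lambda>\<theta>. ennreal (cmod (1 - cis \<theta> * t w) powr (-c))) \<in> borel_measurable circ" by measurable
        qed
        also have "\<dots> \<le> ennreal (A w * (1 - X * hx m n w) powr (1 - c)) * ennreal (C1 * (1 - cmod (t w)) powr (1 - c))"
          by (intro mult_left_mono C1(2) lt1 True) auto
        also have "\<dots> = ennreal C1 * I3 w"
          using True C1(1) A0[of w] by (simp add: I3_def t_norm ennreal_mult[symmetric] mult_ac)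
        finally show ?thesis .
      next
        case False
        then show ?thesis using rot by (simp add: I2_def w)
      qed
    qed
    also have "\<dots> = ennreal C1 * (\<integral>\<^sup>+w. I3 w \<partial>lborel)"
      by (intro nn_integral_cmult) (unfold I3_def, measurable)
    also have "(\<integral>\<^sup>+w. I3 w \<partial>lborel) \<le> ennreal (E * C2 * (2 * pi * C3) * hdel m n z powr (\<beta> + 2 - c))"
    proof -
      define G where "G = (\<lambda>p::real \<times> real. ennreal (snd p powr (-\<kappa>) * ((1 - fst p ^ m) * (1 - snd p)) powr \<beta> * ((1 - X * fst p ^ m) powr (1 - c) * (1 - R * snd p) powr (1 - c))))"
      have G: "G \<in> borel_measurable borel" unfolding G_def borel_prod[symmetric] by measurable
      have "(\<integral>\<^sup>+w. I3 w \<partial>lborel) = (\<integral>\<^sup>+w. G (cmod (fst w) / cmod (snd w) powr \<gamma>, cmod (snd w)) * indicator ?H w \<partial>lborel)"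
      proof (rule nn_integral_cong)
        fix w show "I3 w = G (cmod (fst w) / cmod (snd w) powr \<gamma>, cmod (snd w)) * indicator ?H w"
          using hx_polar[OF mn, of w] hx_bounds(3)[OF _ mn(2), of w m]
          by (auto simp: I3_def G_def A_def hdel_def \<gamma>_def indicator_def)
      qed
      also have "\<dots> = (\<integral>\<^sup>+r. (\<integral>\<^sup>+\<rho>. G (\<rho>, r) * ennreal (2 * pi * \<rho>) * indicator {0<..<1} \<rho> \<partial>lborel) * ennreal (2 * pi * r powr (1 + 2 * \<gamma>)) * indicator {0<..<1} r \<partial>lborel)"
        unfolding \<gamma>_def by (rule nn_integral_hartogs_radial[OF G mn])
      also have "\<dots> \<le> (\<integral>\<^sup>+r. ennreal (E * (C2 * (1 - X) powr (\<beta> + 2 - c)) * (2 * pi)) * (ennreal (r powr (1 + 2 * \<gamma> - \<kappa>) * (1 - r) powr \<beta> * (1 - R * r) powr (-(c - 1))) * indicator {0<..<1} r) \<partial>lborel)"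
      proof (rule nn_integral_mono)
        fix r :: real
        show "(\<integral>\<^sup>+\<rho>. G (\<rho>, r) * ennreal (2 * pi * \<rho>) * indicator {0<..<1} \<rho> \<partial>lborel) * ennreal (2 * pi * r powr (1 + 2 * \<gamma>)) * indicator {0<..<1} r
          \<le> ennreal (E * (C2 * (1 - X) powr (\<beta> + 2 - c)) * (2 * pi)) * (ennreal (r powr (1 + 2 * \<gamma> - \<kappa>) * (1 - r) powr \<beta> * (1 - R * r) powr (-(c - 1))) * indicator {0<..<1} r)"
        proof (cases "0 < r \<and> r < 1")
          case True
          define Er where "Er = r powr (-\<kappa>) * (1 - r) powr \<beta> * (1 - R * r) powr (1 - c)"
          have Er: "Er \<ge> 0" by (simp add: Er_def)
          have pt: "G (\<rho>, r) * ennreal (2 * pi * \<rho>) * indicator {0<..<1} \<rho> \<le> ennreal (Er * E) * (ennreal (\<rho> powr 1 * (1 - \<rho>) powr \<beta> * (1 - X * \<rho>) powr (-(c - 1))) * indicator {0<..<1} \<rho>)" for \<rho>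
          proof (cases "0 < \<rho> \<and> \<rho> < 1")
            case True
            have pm: "\<rho> ^ m \<le> \<rho>" using True mn power_decreasing[of 1 m \<rho>] by simp
            \<comment> \<open>Together with \<rho>^m \<le> \<rho> this makes 1 - \<rho>^m and 1 -
              \<rho> comparable, so \<open>powr_le_of_bounds\<close> applies for \<beta> of either
              sign.\<close>
            have bern: "1 - \<rho> ^ m \<le> real m * (1 - \<rho>)"
              using Bernoulli_inequality[of "\<rho> - 1" m] True by (simp add: algebra_simps)
            have b1: "(1 - \<rho> ^ m) powr \<beta> \<le> (1 - \<rho>) powr \<beta> * (1 + real m powr \<beta>)"
            proof -
              have "(1 - \<rho> ^ m) powr \<beta> \<le> (1 - \<rho>) powr \<beta> + (real m * (1 - \<rho>)) powr \<beta>"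
                by (rule powr_le_of_bounds) (use True pm bern in auto)
              moreover have "(real m * (1 - \<rho>)) powr \<beta> = real m powr \<beta> * (1 - \<rho>) powr \<beta>"
                using True by (simp add: powr_mult)
              ultimately show ?thesis by (simp add: distrib_left mult.commute)
            qed
            have b2: "(1 - X * \<rho> ^ m) powr (1 - c) \<le> (1 - X * \<rho>) powr (1 - c)"
            proof (rule powr_mono2')
              have "X * \<rho> \<le> X * 1" using X True by (intro mult_left_mono) auto
              then show "0 < 1 - X * \<rho>" using X by simp
              show "1 - X * \<rho> \<le> 1 - X * \<rho> ^ m" using pm X by (simp add: mult_left_mono)
            qed (use c in auto)
            have "0 \<le> 1 - \<rho> ^ m" using pm True by simp
            then have "r powr (-\<kappa>) * ((1 - \<rho> ^ m) * (1 - r)) powr \<beta> * ((1 - X * \<rho> ^ m) powr (1 - c) * (1 - R * r) powr (1 - c)) * (2 * pi * \<rho>)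
              = Er * ((1 - \<rho> ^ m) powr \<beta> * (1 - X * \<rho> ^ m) powr (1 - c) * (2 * pi * \<rho>))"
              using \<open>0 < r \<and> r < 1\<close> by (simp add: powr_mult Er_def)
            also have "\<dots> \<le> Er * (((1 - \<rho>) powr \<beta> * (1 + real m powr \<beta>)) * (1 - X * \<rho>) powr (1 - c) * (2 * pi * \<rho>))"
              using True Er by (intro mult_left_mono mult_right_mono mult_mono b1 b2) auto
            also have "\<dots> = Er * E * (\<rho> powr 1 * (1 - \<rho>) powr \<beta> * (1 - X * \<rho>) powr (-(c - 1)))"
              using True by (simp add: E_def)
            finally show ?thesis using True Er E
              by (simp add: G_def ennreal_mult[symmetric] ennreal_leI)
          qed auto
          have "(\<integral>\<^sup>+\<rho>. G (\<rho>, r) * ennreal (2 * pi * \<rho>) * indicator {0<..<1} \<rho> \<partial>lborel)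
             \<le> (\<integral>\<^sup>+\<rho>. ennreal (Er * E) * (ennreal (\<rho> powr 1 * (1 - \<rho>) powr \<beta> * (1 - X * \<rho>) powr (-(c - 1))) * indicator {0<..<1} \<rho>) \<partial>lborel)"
            by (intro nn_integral_mono pt)
          also have "\<dots> = ennreal (Er * E) * (\<integral>\<^sup>+\<rho>. ennreal (\<rho> powr 1 * (1 - \<rho>) powr \<beta> * (1 - X * \<rho>) powr (-(c - 1))) * indicator {0<..<1} \<rho> \<partial>lborel)"
            by (intro nn_integral_cmult) measurable
          also have "\<dots> \<le> ennreal (Er * E) * ennreal (C2 * (1 - X) powr (\<beta> + 1 - (c - 1)))"
            by (intro mult_left_mono C2 X) auto
          also have "\<dots> = ennreal (Er * E * (C2 * (1 - X) powr (\<beta> + 2 - c)))"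
            using Er E C2(1) by (subst ennreal_mult[symmetric]) (auto simp: algebra_simps)
          finally have inner: "(\<integral>\<^sup>+\<rho>. G (\<rho>, r) * ennreal (2 * pi * \<rho>) * indicator {0<..<1} \<rho> \<partial>lborel) \<le> ennreal (Er * E * (C2 * (1 - X) powr (\<beta> + 2 - c)))" .
          have "(\<integral>\<^sup>+\<rho>. G (\<rho>, r) * ennreal (2 * pi * \<rho>) * indicator {0<..<1} \<rho> \<partial>lborel) * ennreal (2 * pi * r powr (1 + 2 * \<gamma>))
            \<le> ennreal (Er * E * (C2 * (1 - X) powr (\<beta> + 2 - c))) * ennreal (2 * pi * r powr (1 + 2 * \<gamma>))"
            by (intro mult_right_mono inner) auto
          also have "\<dots> = ennreal (Er * E * (C2 * (1 - X) powr (\<beta> + 2 - c)) * (2 * pi * r powr (1 + 2 * \<gamma>)))"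
            using Er E C2(1) by (subst ennreal_mult[symmetric]) auto
          also have "Er * E * (C2 * (1 - X) powr (\<beta> + 2 - c)) * (2 * pi * r powr (1 + 2 * \<gamma>))
            = E * (C2 * (1 - X) powr (\<beta> + 2 - c)) * (2 * pi) * ((r powr (1 + 2 * \<gamma>) * r powr (-\<kappa>)) * (1 - r) powr \<beta> * (1 - R * r) powr (-(c - 1)))"
            by (simp add: Er_def)
          also have "r powr (1 + 2 * \<gamma>) * r powr (-\<kappa>) = r powr (1 + 2 * \<gamma> - \<kappa>)"
            by (simp flip: powr_add)
          finally show ?thesis using True E C2(1) by (simp add: ennreal_mult)
        qed auto
      qed
      also have "\<dots> = ennreal (E * (C2 * (1 - X) powr (\<beta> + 2 - c)) * (2 * pi)) * (\<integral>\<^sup>+r. ennreal (r powr (1 + 2 * \<gamma> - \<kappa>) * (1 - r) powr \<beta> * (1 - R * r) powr (-(c - 1))) * indicator {0<..<1} r \<partial>lborel)"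
        by (intro nn_integral_cmult) measurable
      also have "\<dots> \<le> ennreal (E * (C2 * (1 - X) powr (\<beta> + 2 - c)) * (2 * pi)) * ennreal (C3 * (1 - R) powr (\<beta> + 1 - (c - 1)))"
        using R by (intro mult_left_mono C3) auto
      also have "\<dots> = ennreal (E * (C2 * (1 - X) powr (\<beta> + 2 - c)) * (2 * pi) * (C3 * (1 - R) powr (\<beta> + 2 - c)))"
        using E C2(1) C3(1) by (subst ennreal_mult[symmetric]) (auto simp: algebra_simps)
      also have "E * (C2 * (1 - X) powr (\<beta> + 2 - c)) * (2 * pi) * (C3 * (1 - R) powr (\<beta> + 2 - c)) = E * C2 * (2 * pi * C3) * hdel m n z powr (\<beta> + 2 - c)"
        using X R by (simp add: hdel_def X_def R_def powr_mult)
      finally show ?thesis .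
    qed
    finally have "(\<integral>\<^sup>+w. I1 w \<partial>lborel) \<le> ennreal C1 * (ennreal C1 * ennreal (E * C2 * (2 * pi * C3) * hdel m n z powr (\<beta> + 2 - c)))"
      by (simp add: mult_left_mono)
    also have "\<dots> = ennreal (C * hdel m n z powr (\<beta> + 2 - c))"
      using C1(1) C2(1) C3(1) E by (simp add: C_def ennreal_mult[symmetric] mult.assoc)
    finally show "(\<integral>\<^sup>+w. ennreal (cmod (snd w) powr (-\<kappa>) * hdel m n w powr \<beta> *
          (cmod (1 - (fst z * cnj (fst w)) ^ m / (snd z * cnj (snd w)) ^ n) powr (-c) * cmod (1 - snd z * cnj (snd w)) powr (-c)))
        * indicator ?H w \<partial>lborel) \<le> ennreal (C * hdel m n z powr (\<beta> + 2 - c))"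
      unfolding I1_def A_def u_def t_def .
  qed
qed

section \<open>Measurability of the operators and the choice of the Schur weight\<close>

lemma lmeasurable_hartogs:
  assumes "0 < m" "0 < n"
  shows "hartogs m n \<in> lmeasurable"
proof -
  have "hartogs m n \<subseteq> ball 0 1 \<times> ball 0 1"
  proof
    fix z assume z: "z \<in> hartogs m n"
    have "cmod (fst z) ^ m < 1" using z by (auto simp: hartogs_def)
    then have "cmod (fst z) < 1"
      using power_mono_iff[of 1 "cmod (fst z)" m] assms(1) by (metis linorder_not_less norm_ge_zero power_one zero_le_one)
    then show "z \<in> ball 0 1 \<times> ball 0 1" using hx_bounds(4)[OF z assms(2)] by (cases z) auto
  qed
  then have "bounded (hartogs m n)" by (rule bounded_subset[rotated]) (simp add: bounded_Times)
  then show ?thesis by (rule lmeasurable_open[OF _ open_hartogs])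
qed

lemma sigma_finite_hartogs:
  assumes "0 < m" "0 < n"
  shows "sigma_finite_measure (lebesgue_on (hartogs m n))"
proof -
  interpret finite_measure "lebesgue_on (hartogs m n)"
    by (rule finite_measure_lebesgue_on[OF lmeasurable_hartogs[OF assms]])
  show ?thesis by unfold_locales
qed

lemma ident_measurable_lebesgue_on: "(\<lambda>z. z) \<in> lebesgue_on S \<rightarrow>\<^sub>M borel"
  using id_borel_measurable_lebesgue_on by (simp add: id_def)

lemma pair_measurable_lebesgue_on:
  fixes S :: "'a :: euclidean_space set"
  assumes f: "f \<in> borel_measurable (borel :: ('a \<times> 'a) measure)"
  shows "f \<in> borel_measurable (lebesgue_on S \<Otimes>\<^sub>M lebesgue_on S)"
proof -
  have "(\<lambda>p. (fst p, snd p)) \<in> lebesgue_on S \<Otimes>\<^sub>M lebesgue_on S \<rightarrow>\<^sub>M (borel \<Otimes>\<^sub>M borel :: ('a \<times> 'a) measure)"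
    by (intro measurable_Pair measurable_compose[OF measurable_fst ident_measurable_lebesgue_on]
        measurable_compose[OF measurable_snd ident_measurable_lebesgue_on])
  then have "(\<lambda>p. p) \<in> lebesgue_on S \<Otimes>\<^sub>M lebesgue_on S \<rightarrow>\<^sub>M (borel :: ('a \<times> 'a) measure)"
    by (simp add: borel_prod)
  from measurable_compose[OF this f] show ?thesis .
qed

lemma borel_measurable_kernel_fun:
  assumes [measurable]: "s \<in> borel_measurable M" "t \<in> borel_measurable M"
  shows "(\<lambda>x. kernel_fun m n (s x) (t x)) \<in> borel_measurable M"
  unfolding kernel_fun_def kernel_num_def by measurable

lemma borel_measurable_hartogs_kernel:
  "(\<lambda>p. hartogs_kernel m n (fst p) (snd p)) \<in> borel_measurable borel"
  "(\<lambda>p. hartogs_kernel m n (fst p) (fst p)) \<in> borel_measurable (borel :: ((complex \<times> complex) \<times> (complex \<times> complex)) measure)"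
  "(\<lambda>p. hartogs_kernel m n (snd p) (snd p)) \<in> borel_measurable (borel :: ((complex \<times> complex) \<times> (complex \<times> complex)) measure)"
  unfolding hartogs_kernel_def
  by (intro borel_measurable_kernel_fun borel_measurable_continuous_onI continuous_intros)+

lemma measurable_S_kernel:
  assumes mn: "0 < m" "0 < n"
  shows "(\<lambda>(z, w). S_kernel m n a b N z w) \<in> borel_measurable (lebesgue_on (hartogs m n) \<Otimes>\<^sub>M lebesgue_on (hartogs m n))"
proof -
  note [measurable] = borel_measurable_hartogs_kernel
  have Re_m[measurable]: "Re \<in> borel_measurable borel" by (intro borel_measurable_continuous_onI continuous_intros)
  have "(\<lambda>p. hartogs_kernel m n (fst p) (snd p) ^ N / of_real (Re (hartogs_kernel m n (fst p) (fst p)) powr (a / 2) * Re (hartogs_kernel m n (snd p) (snd p)) powr (b / 2)))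
    \<in> borel_measurable (borel :: ((complex \<times> complex) \<times> (complex \<times> complex)) measure)"
    by measurable
  from pair_measurable_lebesgue_on[OF this, of "hartogs m n"]
  show ?thesis
    by (rule measurable_cong[THEN iffD1, rotated])
       (auto simp: space_pair_measure S_kernel_def bergman_diag_def bergman_kernel_hartogs[OF mn])
qed

text \<open>For c = 2N the positive kernel is the modulus of the complex one. \<open>N\<close> is
  positive because at zeros of the kernel 0 powr 0 is 0 while 0 ^ 0 is 1.\<close>

lemma S_plus_kernel_eq:
  assumes "0 < N"
  shows "S_plus_kernel m n a b (2 * real N) z w = of_real (cmod (S_kernel m n a b N z w))"
proof -
  have "cmod (bergman_kernel (hartogs m n) z w) powr (2 * real N / 2) = cmod (bergman_kernel (hartogs m n) z w) ^ N"
    using assms by (simp add: powr_realpow')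
  then show ?thesis
    unfolding S_plus_kernel_def S_kernel_def norm_divide norm_power norm_of_real by (simp add: abs_mult)
qed

lemma S_plus_bounded_imp_S_bounded:
  assumes mn: "0 < m" "0 < n" and N: "0 < N" and p: "1 < p" and S: "S_plus_bounded m n a b (2 * real N) p"
  shows "S_bounded m n a b N p"
  unfolding S_bounded_def
proof (rule integral_op_bounded_of_abs[OF sigma_finite_hartogs[OF mn] measurable_S_kernel[OF mn] _ p])
  show "integral_op_bounded p (lebesgue_on (hartogs m n)) (\<lambda>z w. of_real (cmod (S_kernel m n a b N z w)))"
    using S unfolding S_plus_bounded_def S_plus_kernel_eq[OF N] .
qed

text \<open>For negative y the power is bounded by 1 because \<open>hphi\<close> is at least 1; for
  positive y the growth at the origin enters. The truncation costs nothing, since for a negative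
  exponent the corresponding condition at the origin holds automatically.\<close>

lemma hphi_powr_le:
  assumes mn: "0 < m" "0 < n"
  obtains C :: real where "C > 0"
    "\<And>z. z \<in> hartogs m n \<Longrightarrow> hphi m n z powr y \<le> C * cmod (snd z) powr (- ((real m + real n - 1) / real m * max y 0))"
proof
  show "real m powr max y 0 > 0" using mn by simp
  fix z assume z: "z \<in> hartogs m n"
  note hz = hx_bounds[OF z mn(2)]
  have "hphi m n z powr y \<le> hphi m n z powr max y 0"
    using hphi_ge_1[OF mn z] by (intro powr_mono) auto
  also have "\<dots> \<le> (m * cmod (snd z) powr (- ((real m + real n - 1) / real m))) powr max y 0"
    using hphi_le[OF mn z] hphi_ge_1[OF mn z] by (intro powr_mono2) auto
  also have "\<dots> = real m powr max y 0 * cmod (snd z) powr (- ((real m + real n - 1) / real m) * max y 0)"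
    by (simp add: powr_mult powr_powr)
  finally show "hphi m n z powr y \<le> real m powr max y 0 * cmod (snd z) powr (- ((real m + real n - 1) / real m * max y 0))"
    by simp
qed

text \<open>The factors 1 - u and 1 - t have modulus at most 2, so enlarging their negative exponent
  from 2N to c costs only the constant \<open>D\<close>. This freedom is where the inequality 2N
  \<le> a+b+2 will be spent.\<close>

lemma norm_S_kernel_le:
  assumes mn: "0 < m" "0 < n" and N: "0 < N" and c: "2 * real N \<le> c"
  obtains C :: real where "C > 0"
    "\<And>z w. z \<in> hartogs m n \<Longrightarrow> w \<in> hartogs m n \<Longrightarrow>
      cmod (S_kernel m n a b N z w) \<le> C *
        ((cmod (snd z) powr (- ((real m + real n - 1) / real m * max (N - a) 0)) * hdel m n z powr a) *
         (cmod (snd w) powr (- ((real m + real n - 1) / real m * max (N - b) 0)) * hdel m n w powr b) *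
         (cmod (1 - (fst z * cnj (fst w)) ^ m / (snd z * cnj (snd w)) ^ n) powr (-c) * cmod (1 - snd z * cnj (snd w)) powr (-c)))"
proof -
  let ?M = "(real m + real n - 1) / real m"
  obtain Ca where Ca: "Ca > 0" "\<And>z. z \<in> hartogs m n \<Longrightarrow> Re (hartogs_kernel m n z z) powr (- (a / 2)) \<le> Ca * (hphi m n z powr (2 * (- (a / 2))) * hdel m n z powr (- (2 * (- (a / 2)))))"
    by (rule hartogs_kernel_diag_powr[OF mn]) blast
  obtain Cb where Cb: "Cb > 0" "\<And>z. z \<in> hartogs m n \<Longrightarrow> Re (hartogs_kernel m n z z) powr (- (b / 2)) \<le> Cb * (hphi m n z powr (2 * (- (b / 2))) * hdel m n z powr (- (2 * (- (b / 2)))))"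
    by (rule hartogs_kernel_diag_powr[OF mn]) blast
  obtain Da where Da: "Da > 0" "\<And>z. z \<in> hartogs m n \<Longrightarrow> hphi m n z powr (N - a) \<le> Da * cmod (snd z) powr (- (?M * max (N - a) 0))"
    by (rule hphi_powr_le[OF mn]) blast
  obtain Db where Db: "Db > 0" "\<And>z. z \<in> hartogs m n \<Longrightarrow> hphi m n z powr (N - b) \<le> Db * cmod (snd z) powr (- (?M * max (N - b) 0))"
    by (rule hphi_powr_le[OF mn]) blast
  define D where "D = 2 powr (c - 2 * N)"
  define C where "C = (m / pi\<^sup>2) ^ N * Ca * Cb * Da * Db * D * D"
  have D: "D > 0" by (simp add: D_def)
  have Cpos: "C > 0" using mn Ca(1) Cb(1) Da(1) Db(1) D by (simp add: C_def)
  show ?thesis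
  proof (rule that[OF Cpos])
    fix z w assume z: "z \<in> hartogs m n" and w: "w \<in> hartogs m n"
    define U T where "U = cmod (1 - (fst z * cnj (fst w)) ^ m / (snd z * cnj (snd w)) ^ n)" and "T = cmod (1 - snd z * cnj (snd w))"
    note u = norm_u_le[OF z w mn(2)]
    have gen: "0 < cmod (1 - v) \<and> cmod (1 - v) \<le> 2" if "cmod v < 1" for v :: complex
      using norm_one_minus_ge[OF order_refl, of v] norm_triangle_ineq4[of 1 v] that by auto
    have U: "0 < U" "U \<le> 2" and T: "0 < T" "T \<le> 2"
      unfolding U_def T_def using gen[OF u(2)] gen[OF u(4)] by blast+
    have small: "V powr (- (2 * N)) \<le> D * V powr (-c)" if "0 < V" "V \<le> 2" for V :: real
    proof -
      have "V powr (- (2 * N)) = V powr (c - 2 * N) * V powr (-c)" by (simp flip: powr_add)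
      also have "\<dots> \<le> 2 powr (c - 2 * N) * V powr (-c)" using that c by (intro mult_right_mono powr_mono2) auto
      finally show ?thesis by (simp add: D_def)
    qed
    have pz: "hphi m n z > 0" "hphi m n w > 0" using hphi_ge_1[OF mn z] hphi_ge_1[OF mn w] by auto
    have "cmod (hartogs_kernel m n z w) ^ N \<le> (m / pi\<^sup>2 * (hphi m n z * hphi m n w) / (U\<^sup>2 * T\<^sup>2)) ^ N"
      unfolding U_def T_def by (intro power_mono norm_hartogs_kernel_le mn z w) auto
    also have "\<dots> = (m / pi\<^sup>2) ^ N * (hphi m n z powr N * hphi m n w powr N) * (U powr (- (2 * N)) * T powr (- (2 * N)))"
    proof -
      have e: "V powr (- (2 * real N)) = 1 / (V\<^sup>2) ^ N" if "0 < V" for V :: real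
      proof -
        have "V powr (2 * real N) = V ^ (2 * N)" using powr_realpow[OF that, of "2 * N"] by simp
        then show ?thesis by (simp add: powr_minus_divide power_mult)
      qed
      show ?thesis
        using pz U T by (simp add: e powr_realpow power_mult_distrib power_divide)
    qed
    also have "\<dots> \<le> (m / pi\<^sup>2) ^ N * (hphi m n z powr N * hphi m n w powr N) * ((D * U powr (-c)) * (D * T powr (-c)))"
      using D by (intro mult_left_mono mult_mono small U T) auto
    finally have K: "cmod (hartogs_kernel m n z w) ^ N \<le> (m / pi\<^sup>2) ^ N * (hphi m n z powr N * hphi m n w powr N) * ((D * U powr (-c)) * (D * T powr (-c)))" .
    have "cmod (S_kernel m n a b N z w) = cmod (hartogs_kernel m n z w) ^ N * Re (hartogs_kernel m n z z) powr (- (a / 2)) * Re (hartogs_kernel m n w w) powr (- (b / 2))"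
      unfolding S_kernel_def bergman_diag_def bergman_kernel_hartogs[OF mn z w] bergman_kernel_hartogs[OF mn z z] bergman_kernel_hartogs[OF mn w w]
        norm_divide norm_power norm_of_real
      by (simp add: abs_mult powr_minus_divide)
    also have "\<dots> \<le> ((m / pi\<^sup>2) ^ N * (hphi m n z powr N * hphi m n w powr N) * ((D * U powr (-c)) * (D * T powr (-c))))
       * (Ca * (hphi m n z powr (-a) * hdel m n z powr a)) * (Cb * (hphi m n w powr (-b) * hdel m n w powr b))"
      using Ca(2)[OF z] Cb(2)[OF w] Ca(1) Cb(1) D by (intro mult_mono K mult_nonneg_nonneg) auto
    also have "\<dots> = (m / pi\<^sup>2) ^ N * Ca * Cb * D * D * ((hphi m n z powr N * hphi m n z powr (-a)) * (hphi m n w powr N * hphi m n w powr (-b)))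
       * (hdel m n z powr a * hdel m n w powr b * (U powr (-c) * T powr (-c)))"
      by (simp only: mult_ac)
    also have "\<dots> = (m / pi\<^sup>2) ^ N * Ca * Cb * D * D * (hphi m n z powr (N - a) * hphi m n w powr (N - b))
       * (hdel m n z powr a * hdel m n w powr b * (U powr (-c) * T powr (-c)))"
      by (simp flip: powr_add)
    also have "\<dots> \<le> (m / pi\<^sup>2) ^ N * Ca * Cb * D * D * ((Da * cmod (snd z) powr (- (?M * max (N - a) 0))) * (Db * cmod (snd w) powr (- (?M * max (N - b) 0))))
       * (hdel m n z powr a * hdel m n w powr b * (U powr (-c) * T powr (-c)))"
      using Ca(1) Cb(1) D Da(1) Db(1) by (intro mult_right_mono mult_left_mono mult_mono Da Db z w mult_nonneg_nonneg) auto
    also have "\<dots> = C * ((cmod (snd z) powr (- (?M * max (N - a) 0)) * hdel m n z powr a) *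
         (cmod (snd w) powr (- (?M * max (N - b) 0)) * hdel m n w powr b) * (U powr (-c) * T powr (-c)))"
      unfolding C_def by (simp only: mult_ac)
    finally show "cmod (S_kernel m n a b N z w) \<le> C * ((cmod (snd z) powr (- (?M * max (N - a) 0)) * hdel m n z powr a) *
         (cmod (snd w) powr (- (?M * max (N - b) 0)) * hdel m n w powr b) *
         (cmod (1 - (fst z * cnj (fst w)) ^ m / (snd z * cnj (snd w)) ^ n) powr (-c) * cmod (1 - snd z * cnj (snd w)) powr (-c)))"
      unfolding U_def T_def .
  qed
qed

text \<open>Schur's test with weight h = |z2|^(-\<tau>) \<open>hdel\<close>^(-\<sigma>). The
  exponent \<sigma> is governed by the boundary and \<tau> by the origin; the conditions leave room
  to choose each separately.\<close>

lemma S_plus_bounded_of_conditions: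
  assumes mn: "0 < m" "0 < n" and p: "1 < p" and N: "0 < N"
    and c1: "- a * p < 1" "1 < (b + 1) * p"
    and c2: "(2 * real N - 2 * a) * (real m + real n - 1) * p < 4 * (real m + real n)"
    and c3: "4 * (real m + real n) < ((2 * b - 2 * real N) * (real m + real n - 1) + 4 * (real m + real n)) * p"
    and c4: "2 * real N \<le> a + b + 2"
  shows "S_plus_bounded m n a b (2 * real N) p"
proof -
  let ?H = "hartogs m n"
  define q where "q = p / (p - 1)"
  have q: "q > 0" using p by (simp add: q_def)
  have pq: "1 / p + 1 / q = 1" using p unfolding q_def by (simp add: field_simps)
  define \<gamma> where "\<gamma> = real n / real m"
  define M where "M = (real m + real n - 1) / real m"
  have M: "M > 0" using mn by (simp add: M_def)
  define A where "A = M * max (N - a) 0"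
  define B where "B = M * max (N - b) 0"
  \<comment> \<open>With this value the powers of \<open>hdel\<close> balance exactly: a + ((b -
    \<sigma> y) + 2 - c) = -\<sigma> y, and likewise with a and b exchanged.\<close>
  define c where "c = a + b + 2"
  have c: "c \<ge> 2" "2 * real N \<le> c" using c4 N by (auto simp: c_def)
  \<comment> \<open>The least exponent for which the leftover factors |z2|^(-A) and |z2|^(-B) are
    absorbed by h^q and h^p.\<close>
  define \<tau> where "\<tau> = max (A / q) (B / p)"
  have \<tau>: "A \<le> \<tau> * q" "B \<le> \<tau> * p" using q p by (auto simp: \<tau>_def max_def field_simps)
  \<comment> \<open>The threshold 2 + 2n/m = 2(m+n)/m below which a negative power of |z2| is
    integrable at the origin; the two middle conditions become A p < X and B q < X.\<close>
  define X where "X = 2 + 2 * \<gamma>"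
  have gen: "\<And>x k y l :: real. k / l * x * y = (2 * x) * k * y / (2 * l)" by simp
  have X: "X > 0" by (simp add: X_def \<gamma>_def add_pos_nonneg)
  have Ap: "A * p < X"
  proof (cases "N - a \<le> 0")
    case True then show ?thesis using X by (simp add: A_def)
  next
    case False
    then have mx: "max (real N - a) 0 = real N - a" by simp
    have e: "2 * real N - 2 * a = 2 * (real N - a)" by simp
    have "A * p = ((2 * real N - 2 * a) * (real m + real n - 1) * p) / (2 * real m)"
      unfolding A_def M_def mx e by (rule gen)
    also have "\<dots> < 4 * (real m + real n) / (2 * real m)" using c2 mn by (intro divide_strict_right_mono) auto
    also have "\<dots> = X" using mn by (simp add: X_def \<gamma>_def field_simps)
    finally show ?thesis .
  qed
  have Bq: "B * q < X"
  proof (cases "N - b \<le> 0")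
    case True then show ?thesis using X by (simp add: B_def)
  next
    case False
    have "(2 * real N - 2 * b) * (real m + real n - 1) * p < 4 * (real m + real n) * (p - 1)"
      using c3 by (simp add: algebra_simps)
    then have "(2 * real N - 2 * b) * (real m + real n - 1) * q < 4 * (real m + real n)"
      using p by (simp add: q_def divide_less_eq)
    then have "((2 * real N - 2 * b) * (real m + real n - 1) * q) / (2 * real m) < 4 * (real m + real n) / (2 * real m)"
      using mn by (intro divide_strict_right_mono) auto
    also have "4 * (real m + real n) / (2 * real m) = X" using mn by (simp add: X_def \<gamma>_def field_simps)
    also have "((2 * real N - 2 * b) * (real m + real n - 1) * q) / (2 * real m) = B * q"
    proof -
      have mx: "max (real N - b) 0 = real N - b" using False by simp
      have e: "2 * real N - 2 * b = 2 * (real N - b)" by simp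
      show ?thesis unfolding B_def M_def mx e by (rule gen[symmetric])
    qed
    finally show ?thesis .
  qed
  have ABX: "A + B < X"
  proof -
    have "A < X / p" "B < X / q" using Ap Bq p q by (auto simp: less_divide_eq)
    then have "A + B < X * (1 / p + 1 / q)" by (simp add: algebra_simps)
    then show ?thesis unfolding pq by simp
  qed
  \<comment> \<open>If \<tau> = A/q the sum is A + B. If \<tau> = B/p it is B (1 + q/p) = B
    q.\<close>
  have k1: "B + \<tau> * q < X"
  proof (cases "A / q \<ge> B / p")
    case True then show ?thesis using ABX q by (simp add: \<tau>_def max_def)
  next
    case False
    have "B + B / p * q = B * q" using p by (simp add: q_def field_simps)
    then show ?thesis using Bq False by (simp add: \<tau>_def max_def)
  qed
  have k2: "A + \<tau> * p < X"
  proof (cases "A / q \<ge> B / p")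
    case True
    have "A + A / q * p = A * p" using p by (simp add: q_def field_simps)
    then show ?thesis using Ap True by (simp add: \<tau>_def max_def)
  next
    case False then show ?thesis using ABX p by (simp add: \<tau>_def max_def)
  qed
  \<comment> \<open>Of the four comparisons, the two mixing p and q are -a < 1/p and 1/p < b + 1;
    the other two only need a + b + 1 > 0, which follows from c \<ge> 2.\<close>
  have "max (- a / q) (- b / p) < min ((b + 1) / q) ((a + 1) / p)"
  proof -
    have iq: "1 / q = 1 - 1 / p" using pq by simp
    have d: "y / q = y - y / p" for y using iq by (metis divide_inverse inverse_eq_divide mult.right_neutral right_diff_distrib)
    have "- a < 1 / p" using c1(1) p by (simp add: less_divide_eq)
    moreover have "1 / p < b + 1" using c1(2) p by (simp add: divide_less_eq)
    ultimately have "- a / q < (a + 1) / p" "- b / p < (b + 1) / q"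
      unfolding d by (auto simp: add_divide_distrib)
    moreover have "- a / q < (b + 1) / q" using c(1) q by (intro divide_strict_right_mono) (auto simp: c_def)
    moreover have "- b / p < (a + 1) / p" using c(1) p by (intro divide_strict_right_mono) (auto simp: c_def)
    ultimately show ?thesis by simp
  qed
  then obtain \<sigma> where \<sigma>: "max (- a / q) (- b / p) < \<sigma>" "\<sigma> < min ((b + 1) / q) ((a + 1) / p)"
    using dense by blast
  have s1: "b - \<sigma> * q > -1" "a + \<sigma> * q > 0" and s2: "a - \<sigma> * p > -1" "b + \<sigma> * p > 0"
    using \<sigma> p q pos_divide_less_eq[OF q, of "- a" \<sigma>] pos_divide_less_eq[of p "- b" \<sigma>]
    by (auto simp: less_divide_eq)
  obtain C0 where C0: "C0 > 0" "\<And>z w. z \<in> ?H \<Longrightarrow> w \<in> ?H \<Longrightarrow>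
      cmod (S_kernel m n a b N z w) \<le> C0 *
        ((cmod (snd z) powr (- (M * max (N - a) 0)) * hdel m n z powr a) *
         (cmod (snd w) powr (- (M * max (N - b) 0)) * hdel m n w powr b) *
         (cmod (1 - (fst z * cnj (fst w)) ^ m / (snd z * cnj (snd w)) ^ n) powr (-c) * cmod (1 - snd z * cnj (snd w)) powr (-c)))"
    unfolding M_def by (rule norm_S_kernel_le[OF mn N c(2)]) blast
  define R where "R = (\<lambda>z w. cmod (1 - (fst z * cnj (fst w)) ^ m / (snd z * cnj (snd w)) ^ n) powr (-c) * cmod (1 - snd z * cnj (snd w)) powr (-c))"
  have Rsym: "R z w = R w z" for z w
  proof -
    have "1 - (fst w * cnj (fst z)) ^ m / (snd w * cnj (snd z)) ^ n = cnj (1 - (fst z * cnj (fst w)) ^ m / (snd z * cnj (snd w)) ^ n)"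
      by (simp add: mult.commute)
    moreover have "1 - snd w * cnj (snd z) = cnj (1 - snd z * cnj (snd w))" by (simp add: mult.commute)
    ultimately show ?thesis unfolding R_def by (simp only: complex_mod_cnj)
  qed
  obtain C1 where C1: "C1 > 0" "\<And>z. z \<in> ?H \<Longrightarrow>
      (\<integral>\<^sup>+w. ennreal (cmod (snd w) powr (- (B + \<tau> * q)) * hdel m n w powr (b - \<sigma> * q) * R z w) * indicator ?H w \<partial>lborel)
        \<le> ennreal (C1 * hdel m n z powr ((b - \<sigma> * q) + 2 - c))"
    unfolding R_def by (rule hartogs_forelli_rudin[OF mn s1(1), of c "B + \<tau> * q"]) (use s1 c k1 in \<open>auto simp: c_def X_def \<gamma>_def\<close>)
  obtain C2 where C2: "C2 > 0" "\<And>z. z \<in> ?H \<Longrightarrow>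
      (\<integral>\<^sup>+w. ennreal (cmod (snd w) powr (- (A + \<tau> * p)) * hdel m n w powr (a - \<sigma> * p) * R z w) * indicator ?H w \<partial>lborel)
        \<le> ennreal (C2 * hdel m n z powr ((a - \<sigma> * p) + 2 - c))"
    unfolding R_def by (rule hartogs_forelli_rudin[OF mn s2(1), of c "A + \<tau> * p"]) (use s2 c k2 in \<open>auto simp: c_def X_def \<gamma>_def\<close>)
  define h where "h = (\<lambda>z. cmod (snd z) powr (-\<tau>) * hdel m n z powr (-\<sigma>))"
  have hpow: "h w powr y = cmod (snd w) powr (- (\<tau> * y)) * hdel m n w powr (- (\<sigma> * y))" if "w \<in> ?H" for w y
    using hdel_pos[OF that mn(2)] by (simp add: h_def powr_mult powr_powr)
  define C where "C = C0 * (C1 + C2)"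
  have Cpos: "C > 0" using C0(1) C1(1) C2(1) by (simp add: C_def)
  \<comment> \<open>Stated with abstract exponents so that one proof serves both halves of Schur's
    test, with (a, A, q) and (b, B, p) exchanged and \<open>Rsym\<close> for the kernel
    factor.\<close>
  have step: "(\<integral>\<^sup>+w. ennreal (k w * h w powr y) \<partial>lebesgue_on ?H) \<le> ennreal (C * h z powr y)"
    if z: "z \<in> ?H" and k: "\<And>w. w \<in> ?H \<Longrightarrow> k w \<le> C0 * ((cmod (snd z) powr (-A') * hdel m n z powr a') * (cmod (snd w) powr (-B') * hdel m n w powr b') * R z w)"
      and I: "(\<integral>\<^sup>+w. ennreal (cmod (snd w) powr (- (B' + \<tau> * y)) * hdel m n w powr (b' - \<sigma> * y) * R z w) * indicator ?H w \<partial>lborel)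
        \<le> ennreal (C' * hdel m n z powr ((b' - \<sigma> * y) + 2 - c))"
      and e: "a' + b' + 2 = c" and A': "A' \<le> \<tau> * y" and C': "0 < C'" "C' \<le> C1 + C2"
    for z k y A' B' a' b' C'
  proof -
    note hz = hx_bounds[OF z mn(2)]
    define P where "P = C0 * (cmod (snd z) powr (-A') * hdel m n z powr a')"
    have P: "P \<ge> 0" using C0(1) by (simp add: P_def)
    have m: "(\<lambda>w. ennreal (cmod (snd w) powr (- (B' + \<tau> * y)) * hdel m n w powr (b' - \<sigma> * y) * R z w) * indicator ?H w) \<in> borel_measurable lborel"
    proof -
      have [measurable]: "(\<lambda>w. cmod (snd w)) \<in> borel_measurable (borel :: (complex \<times> complex) measure)"
        "(\<lambda>w. cmod (fst w)) \<in> borel_measurable (borel :: (complex \<times> complex) measure)"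
        "(\<lambda>w. fst z * cnj (fst w)) \<in> borel_measurable (borel :: (complex \<times> complex) measure)"
        "(\<lambda>w. snd z * cnj (snd w)) \<in> borel_measurable (borel :: (complex \<times> complex) measure)"
        by (intro borel_measurable_continuous_onI continuous_intros)+
      show ?thesis unfolding hdel_def hx_def R_def by measurable
    qed
    have "(\<integral>\<^sup>+w. ennreal (k w * h w powr y) \<partial>lebesgue_on ?H) = (\<integral>\<^sup>+w. ennreal (k w * h w powr y) * indicator ?H w \<partial>lborel)"
      by (rule nn_integral_lebesgue_on) simp
    also have "\<dots> \<le> (\<integral>\<^sup>+w. ennreal P * (ennreal (cmod (snd w) powr (- (B' + \<tau> * y)) * hdel m n w powr (b' - \<sigma> * y) * R z w) * indicator ?H w) \<partial>lborel)"
    proof (rule nn_integral_mono)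
      fix w
      show "ennreal (k w * h w powr y) * indicator ?H w \<le> ennreal P * (ennreal (cmod (snd w) powr (- (B' + \<tau> * y)) * hdel m n w powr (b' - \<sigma> * y) * R z w) * indicator ?H w)"
      proof (cases "w \<in> ?H")
        case True
        have "k w * h w powr y \<le> C0 * ((cmod (snd z) powr (-A') * hdel m n z powr a') * (cmod (snd w) powr (-B') * hdel m n w powr b') * R z w) * h w powr y"
          by (intro mult_right_mono k True) auto
        also have "\<dots> = P * ((cmod (snd w) powr (-B') * cmod (snd w) powr (- (\<tau> * y))) * (hdel m n w powr b' * hdel m n w powr (- (\<sigma> * y))) * R z w)"
          unfolding hpow[OF True] P_def by (simp only: mult_ac)
        also have "\<dots> = P * (cmod (snd w) powr (- (B' + \<tau> * y)) * hdel m n w powr (b' - \<sigma> * y) * R z w)"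
          by (simp flip: powr_add)
        finally show ?thesis using True P
          by (simp add: ennreal_mult'[symmetric] ennreal_leI)
      qed auto
    qed
    also have "\<dots> = ennreal P * (\<integral>\<^sup>+w. ennreal (cmod (snd w) powr (- (B' + \<tau> * y)) * hdel m n w powr (b' - \<sigma> * y) * R z w) * indicator ?H w \<partial>lborel)"
      by (rule nn_integral_cmult[OF m])
    also have "\<dots> \<le> ennreal P * ennreal (C' * hdel m n z powr ((b' - \<sigma> * y) + 2 - c))"
      by (intro mult_left_mono I) auto
    also have "\<dots> = ennreal (P * (C' * hdel m n z powr ((b' - \<sigma> * y) + 2 - c)))"
      using P C' by (simp add: ennreal_mult)
    also have "\<dots> \<le> ennreal (C * h z powr y)"
    proof (rule ennreal_leI)
      have ee: "a' + ((b' - \<sigma> * y) + 2 - c) = - (\<sigma> * y)" using e by simp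
      have "P * (C' * hdel m n z powr ((b' - \<sigma> * y) + 2 - c)) = C0 * C' * (cmod (snd z) powr (-A') * (hdel m n z powr a' * hdel m n z powr ((b' - \<sigma> * y) + 2 - c)))"
        by (simp add: P_def)
      also have "hdel m n z powr a' * hdel m n z powr ((b' - \<sigma> * y) + 2 - c) = hdel m n z powr (- (\<sigma> * y))"
        by (simp only: powr_add[symmetric] ee)
      also have "C0 * C' * (cmod (snd z) powr (-A') * hdel m n z powr (- (\<sigma> * y))) \<le> C0 * (C1 + C2) * (cmod (snd z) powr (- (\<tau> * y)) * hdel m n z powr (- (\<sigma> * y)))"
        using C0(1) C' A' hz by (intro mult_mono mult_right_mono mult_left_mono powr_mono' mult_nonneg_nonneg) auto
      also have "\<dots> = C * h z powr y" unfolding hpow[OF z] C_def by simp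
      finally show "P * (C' * hdel m n z powr ((b' - \<sigma> * y) + 2 - c)) \<le> C * h z powr y" .
    qed
    finally show ?thesis .
  qed
  have "integral_op_bounded p (lebesgue_on ?H) (\<lambda>z w. of_real (cmod (S_kernel m n a b N z w)))"
  proof (rule schur_test[OF sigma_finite_hartogs[OF mn] _ _ _ _ p q_def Cpos])
    show "(\<lambda>(z, w). cmod (S_kernel m n a b N z w)) \<in> borel_measurable (lebesgue_on ?H \<Otimes>\<^sub>M lebesgue_on ?H)"
      using measurable_compose[OF measurable_S_kernel[OF mn] borel_measurable_norm] by (simp add: case_prod_beta)
    have hb: "h \<in> borel_measurable borel"
    proof -
      have [measurable]: "(\<lambda>w. cmod (snd w)) \<in> borel_measurable (borel :: (complex \<times> complex) measure)"
        "(\<lambda>w. cmod (fst w)) \<in> borel_measurable (borel :: (complex \<times> complex) measure)"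
        by (intro borel_measurable_continuous_onI continuous_intros)+
      show ?thesis unfolding h_def hdel_def hx_def by measurable
    qed
    show "h \<in> borel_measurable (lebesgue_on ?H)"
      by (rule measurable_compose[OF ident_measurable_lebesgue_on hb])
    show "0 < h z" if "z \<in> space (lebesgue_on ?H)" for z
      using that hdel_pos[of z m n] hx_bounds(3)[of z m n] mn by (simp add: h_def)
    show "(\<integral>\<^sup>+w. ennreal (cmod (S_kernel m n a b N z w) * h w powr q) \<partial>lebesgue_on ?H) \<le> ennreal (C * h z powr q)"
      if "z \<in> space (lebesgue_on ?H)" for z
    proof -
      have z: "z \<in> ?H" using that by simp
      show ?thesis
      proof (rule step[OF z _ C1(2)[OF z] _ \<tau>(1)])
        fix w assume "w \<in> ?H"
        from C0(2)[OF z this]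
        show "cmod (S_kernel m n a b N z w) \<le> C0 * ((cmod (snd z) powr (-A) * hdel m n z powr a) * (cmod (snd w) powr (-B) * hdel m n w powr b) * R z w)"
          unfolding A_def B_def R_def .
      qed (use C1(1) C2(1) in \<open>auto simp: c_def\<close>)
    qed
    show "(\<integral>\<^sup>+z. ennreal (cmod (S_kernel m n a b N z w) * h z powr p) \<partial>lebesgue_on ?H) \<le> ennreal (C * h w powr p)"
      if "w \<in> space (lebesgue_on ?H)" for w
    proof -
      have w: "w \<in> ?H" using that by simp
      show ?thesis
      proof (rule step[OF w _ C2(2)[OF w] _ \<tau>(2)])
        fix z assume "z \<in> ?H"
        from C0(2)[OF this w]
        have "cmod (S_kernel m n a b N z w) \<le> C0 * ((cmod (snd z) powr (-A) * hdel m n z powr a) * (cmod (snd w) powr (-B) * hdel m n w powr b) * R z w)"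
          unfolding A_def B_def R_def .
        then show "cmod (S_kernel m n a b N z w) \<le> C0 * ((cmod (snd w) powr (-B) * hdel m n w powr b) * (cmod (snd z) powr (-A) * hdel m n z powr a) * R w z)"
          unfolding Rsym[of z w] by (simp only: mult_ac)
      qed (use C1(1) C2(1) in \<open>auto simp: c_def\<close>)
    qed
  qed auto
  then show ?thesis unfolding S_plus_bounded_def S_plus_kernel_eq[OF N] .
qed

section \<open>Necessity of the conditions\<close>

text \<open>The coefficients of \<open>((J + (m - J) v) / (1 - v)\<^sup>2) ^ N\<close>.\<close>

fun power_coeff :: "nat \<Rightarrow> nat \<Rightarrow> nat \<Rightarrow> nat \<Rightarrow> real" where
  "power_coeff J m 0 i = (if i = 0 then 1 else 0)"
| "power_coeff J m (Suc N) i = (\<Sum>k\<le>i. (real J + real m * real k) * power_coeff J m N (i - k))"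

lemma power_coeff_nonneg: "0 \<le> power_coeff J m N i"
  by (induction N arbitrary: i) (auto intro!: sum_nonneg)

text \<open>Induction by Cauchy products; absolute convergence at v comes from convergence at a
  slightly larger real radius.\<close>

lemma power_coeff_sums:
  fixes v :: complex
  assumes "cmod v < 1"
  shows "(\<lambda>i. of_real (power_coeff J m N i) * v ^ i) sums (((of_nat J + (of_nat m - of_nat J) * v) / (1 - v)\<^sup>2) ^ N)"
  using assms
proof (induction N arbitrary: v)
  case 0
  have "(\<lambda>i. if i = 0 then 1 else 0) sums (1::complex)" using sums_single[of 0 "\<lambda>_. 1::complex"] by simp
  moreover have "(\<lambda>i. of_real (power_coeff J m 0 i) * v ^ i) = (\<lambda>i. if i = 0 then 1 else 0)" by (auto simp: fun_eq_iff)
  ultimately show ?case by simp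
next
  case (Suc N)
  obtain R where R: "cmod v < R" "R < 1" using Suc.prems dense by blast
  have Rc: "cmod (of_real R :: complex) < 1" "norm v < norm (of_real R :: complex)"
    using R by (auto simp: abs_less_iff) (smt (verit) norm_ge_zero)
  have 1: "summable (\<lambda>i. norm ((of_nat J + of_nat m * of_nat i) * v ^ i))"
    by (rule powser_insidea[OF sums_summable[OF linear_geometric_sums] Rc(2)]) (use Rc in simp)
  have 2: "summable (\<lambda>i. norm (of_real (power_coeff J m N i) * v ^ i))"
    by (rule powser_insidea[OF sums_summable[OF Suc.IH[OF Rc(1)]] Rc(2)])
  have "(\<lambda>i. \<Sum>k\<le>i. ((of_nat J + of_nat m * of_nat k) * v ^ k) * (of_real (power_coeff J m N (i - k)) * v ^ (i - k))) sums
    ((\<Sum>i. (of_nat J + of_nat m * of_nat i) * v ^ i) * (\<Sum>i. of_real (power_coeff J m N i) * v ^ i))"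
    by (rule Cauchy_product_sums[OF 1 2])
  also have "(\<Sum>i. (of_nat J + of_nat m * of_nat i) * v ^ i) = (of_nat J + (of_nat m - of_nat J) * v) / (1 - v)\<^sup>2"
    using linear_geometric_sums[OF Suc.prems, of "of_nat J" "of_nat m"] by (simp add: sums_iff)
  also have "(\<Sum>i. of_real (power_coeff J m N i) * v ^ i) = ((of_nat J + (of_nat m - of_nat J) * v) / (1 - v)\<^sup>2) ^ N"
    using Suc.IH[OF Suc.prems] by (simp add: sums_iff)
  also have "(\<lambda>i. \<Sum>k\<le>i. ((of_nat J + of_nat m * of_nat k) * v ^ k) * (of_real (power_coeff J m N (i - k)) * v ^ (i - k))) = (\<lambda>i. of_real (power_coeff J m (Suc N) i) * v ^ i)"
  proof
    fix i
    have "((of_nat J + of_nat m * of_nat k) * v ^ k) * (of_real (power_coeff J m N (i - k)) * v ^ (i - k)) = of_real ((real J + real m * real k) * power_coeff J m N (i - k)) * v ^ i"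
      if "k \<le> i" for k
    proof -
      have "v ^ i = v ^ k * v ^ (i - k)" using that by (simp flip: power_add)
      then show ?thesis by (simp add: mult_ac)
    qed
    then have "(\<Sum>k\<le>i. ((of_nat J + of_nat m * of_nat k) * v ^ k) * (of_real (power_coeff J m N (i - k)) * v ^ (i - k))) = (\<Sum>k\<le>i. of_real ((real J + real m * real k) * power_coeff J m N (i - k)) * v ^ i)"
      by (intro sum.cong) auto
    then show "(\<Sum>k\<le>i. ((of_nat J + of_nat m * of_nat k) * v ^ k) * (of_real (power_coeff J m N (i - k)) * v ^ (i - k))) = of_real (power_coeff J m (Suc N) i) * v ^ i"
      by (simp add: sum_distrib_right)
  qed
  finally show ?case by (simp add: mult.commute)
qed

text \<open>The pole of order 2(N+1) at v = 1 suggests growth i^(2N+1). In the induction step it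
  suffices to keep k \<le> i/2, where i - k is still of order i and the linear factors sum to order
  i^2.\<close>

lemma power_coeff_lower_bound:
  assumes "1 \<le> J" "1 \<le> m"
  obtains c :: real where "c > 0" "\<And>i. c * real (i + 1) ^ (2 * N + 1) \<le> power_coeff J m (Suc N) i"
proof -
  have "\<exists>c>0. \<forall>i. c * real (i + 1) ^ (2 * N + 1) \<le> power_coeff J m (Suc N) i"
  proof (induction N)
    case 0
    have "real (i + 1) \<le> power_coeff J m (Suc 0) i" for i
    proof -
      have "power_coeff J m (Suc 0) i = (\<Sum>k\<le>i. if k = i then real J + real m * real i else 0)"
        unfolding power_coeff.simps by (intro sum.cong) auto
      also have "\<dots> = real J + real m * real i" by simp
      also have "\<dots> \<ge> 1 + 1 * real i" using assms by (intro add_mono mult_right_mono) auto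
      finally show ?thesis by simp
    qed
    then show ?case by (intro exI[of _ 1]) simp
  next
    case (Suc N)
    then obtain c where c: "c > 0" "\<And>i. c * real (i + 1) ^ (2 * N + 1) \<le> power_coeff J m (Suc N) i" by blast
    \<comment> \<open>The power of 2 comes from i - k + 1 \<ge> (i+1)/2. The factor 1/8 comes from
      (h+1)(h+2)/2 with h + 1 \<ge> (i+1)/2.\<close>
    have "c / 2 ^ (2 * N + 1) / 8 * real (i + 1) ^ (2 * Suc N + 1) \<le> power_coeff J m (Suc (Suc N)) i" for i
    proof -
      define h where "h = i div 2"
      have h: "h \<le> i" "real h + 1 \<ge> real (i + 1) / 2" by (auto simp: h_def)
      have "c / 2 ^ (2 * N + 1) / 8 * real (i + 1) ^ (2 * Suc N + 1) = (c * (real (i + 1) / 2) ^ (2 * N + 1)) * ((real (i + 1) / 2) * (real (i + 1) / 2) / 2)"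
        by (simp add: power_divide power2_eq_square)
      also have "\<dots> \<le> (c * (real (i + 1) / 2) ^ (2 * N + 1)) * ((real h + 1) * (real h + 2) / 2)"
        using c h by (intro mult_left_mono divide_right_mono mult_mono) auto
      also have "(real h + 1) * (real h + 2) / 2 = (\<Sum>k\<le>h. real k + 1)"
        by (induction h) (auto simp: field_simps)
      also have "(c * (real (i + 1) / 2) ^ (2 * N + 1)) * (\<Sum>k\<le>h. real k + 1) = (\<Sum>k\<le>h. (real k + 1) * (c * (real (i + 1) / 2) ^ (2 * N + 1)))"
        by (subst mult.commute) (rule sum_distrib_right)
      also have "\<dots> \<le> (\<Sum>k\<le>h. (real J + real m * real k) * power_coeff J m (Suc N) (i - k))"
      proof (intro sum_mono mult_mono)
        fix k assume "k \<in> {..h}"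
        then have k: "k \<le> h" by simp
        have "1 * real k + 1 \<le> real m * real k + real J" using assms by (intro add_mono mult_right_mono) auto
        then show "real k + 1 \<le> real J + real m * real k" by simp
        have "real (i + 1) / 2 \<le> real (i - k + 1)" using k by (simp add: h_def)
        then have "(real (i + 1) / 2) ^ (2 * N + 1) \<le> real (i - k + 1) ^ (2 * N + 1)" by (intro power_mono) auto
        then have "c * (real (i + 1) / 2) ^ (2 * N + 1) \<le> c * real (i - k + 1) ^ (2 * N + 1)" using c by simp
        then show "c * (real (i + 1) / 2) ^ (2 * N + 1) \<le> power_coeff J m (Suc N) (i - k)" using c(2)[of "i - k"] by linarith
      qed (use c in auto)
      also have "\<dots> \<le> (\<Sum>k\<le>i. (real J + real m * real k) * power_coeff J m (Suc N) (i - k))"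
        by (rule sum_mono2) (use h in \<open>auto intro!: mult_nonneg_nonneg power_coeff_nonneg sum_nonneg\<close>)
      finally show ?thesis by simp
    qed
    then show ?case using c by (intro exI[of _ "c / 2 ^ (2 * N + 1) / 8"]) auto
  qed
  then show ?thesis using that by blast
qed

section \<open>Extracting one monomial from a power of the kernel\<close>

definition hmu :: "nat \<Rightarrow> nat \<Rightarrow> nat \<Rightarrow> nat \<Rightarrow> nat \<Rightarrow> complex \<times> complex \<Rightarrow> complex" where
  "hmu m n r0 N i z = hmono m n r0 0 z ^ N * (fst z ^ m / snd z ^ n) ^ i"

text \<open>LL = 1 means n (r + 1) \<equiv> 1 modulo m. Coprimality makes n invertible modulo m, and
  the Bezout coefficient of n, reduced modulo m and shifted by one, is the solution.\<close>

lemma ex_LL_eq_1: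
  assumes mn: "0 < m" "0 < n" and cop: "coprime m n"
  obtains r0 where "r0 < m" "LL m n r0 = 1" "\<And>r. r < m \<Longrightarrow> LL m n r = 1 \<Longrightarrow> r = r0"
proof -
  obtain x y where xy: "n * x = m * y + 1"
    using bezout_nat[of n m] mn cop by (auto simp: coprime_iff_gcd_eq_1 gcd.commute)
  then have x: "x \<ge> 1" by (cases x) auto
  define r0 where "r0 = (x - 1) mod m"
  have r0: "r0 < m" using mn by (simp add: r0_def)
  have e: "(r0 + 1) + m * ((x - 1) div m) = x"
    using x by (simp add: r0_def)
  have "n * (r0 + 1) + n * (m * ((x - 1) div m)) = n * x"
    unfolding distrib_left[symmetric] e ..
  then have "(n * (r0 + 1) - 1) + m * (n * ((x - 1) div m)) = m * y"
    using xy mn by (simp add: algebra_simps)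
  then have "(n * (r0 + 1) - 1) mod m = 0" by (metis mod_mult_self1_is_0 mod_mult_self2)
  then have LL1: "LL m n r0 = 1" by (simp add: LL_def)
  have aux: "r1 = r2" if r: "r1 \<le> r2" "r2 < m" and L: "LL m n r1 = 1" "LL m n r2 = 1" for r1 r2
  proof -
    have "n * (r1 + 1) = m * KK m n r1 + 1" "n * (r2 + 1) = m * KK m n r2 + 1"
      using LL_KK[OF mn(2), of r1 m] LL_KK[OF mn(2), of r2 m] L by simp_all
    then have "n * (r2 + 1) - n * (r1 + 1) = m * KK m n r2 - m * KK m n r1" by simp
    then have "n * (r2 - r1) = m * (KK m n r2 - KK m n r1)"
      by (simp add: diff_mult_distrib2)
    then have "m dvd n * (r2 - r1)" by simp
    then have "m dvd r2 - r1" using cop by (simp add: coprime_dvd_mult_right_iff)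
    then show ?thesis using r by (auto dest: dvd_imp_le)
  qed
  have uniq: "r = r0" if r: "r < m" and L: "LL m n r = 1" for r
    using aux[of r r0] aux[of r0 r] r r0 L LL1 by (metis nle_le)
  show ?thesis by (rule that[OF r0 LL1 uniq])
qed

text \<open>The weights (n, m) fix s^m / t^n, and the monomial of residue r acquires the phase n r -
  m (KK + 1) = (1 - n - m) + (LL - 1). After the common phase is split off, only nonnegative powers
  of cis \<theta> remain, so the rest extends holomorphically in cis \<theta>, and at 0 only the
  residue with LL = 1 survives.\<close>

lemma kernel_fun_rotate:
  fixes s t :: complex
  assumes mn: "0 < m" "0 < n"
  shows "kernel_fun m n (cis (real n * \<theta>) * s) (cis (real m * \<theta>) * t) = cis ((1 - real n - real m) * \<theta>) *
    ((\<Sum>r<m. (of_nat (r + 1) + of_nat (m - 1 - r) * (s ^ m / t ^ n)) *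
       (of_nat (LL m n r) + of_nat (m - LL m n r) * (cis \<theta> ^ m * t)) * (cis \<theta> ^ (LL m n r - 1) * (s ^ r / t ^ (KK m n r + 1)))) /
     (of_real (pi\<^sup>2 * m) * ((1 - s ^ m / t ^ n)\<^sup>2 * (1 - cis \<theta> ^ m * t)\<^sup>2)))"
proof -
  have u: "(cis (real n * \<theta>) * s) ^ m / (cis (real m * \<theta>) * t) ^ n = s ^ m / t ^ n"
    by (simp add: power_mult_distrib Complex.DeMoivre mult_ac)
  have cm: "cis (real m * \<theta>) = cis \<theta> ^ m" by (simp add: Complex.DeMoivre)
  have e: "(cis (real n * \<theta>) * s) ^ r / (cis (real m * \<theta>) * t) ^ (KK m n r + 1)
     = cis ((1 - real n - real m) * \<theta>) * (cis \<theta> ^ (LL m n r - 1) * (s ^ r / t ^ (KK m n r + 1)))" for r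
  proof -
    have nL: "real n * (real r + 1) = real m * real (KK m n r) + real (LL m n r)"
      using arg_cong[OF LL_KK[OF mn(2), of r m], of real] by (simp add: algebra_simps)
    have L: "real (LL m n r - 1) = real (LL m n r) - 1" using LL_bounds(1)[OF mn(1), of n r] by (simp add: of_nat_diff)
    have "real r * (real n * \<theta>) - real (KK m n r + 1) * (real m * \<theta>) = (real n * (real r + 1) - real m * real (KK m n r) - real n - real m) * \<theta>"
      by (simp add: algebra_simps)
    also have "\<dots> = (1 - real n - real m) * \<theta> + real (LL m n r - 1) * \<theta>" unfolding nL L by (simp add: algebra_simps)
    finally have ang: "real r * (real n * \<theta>) - real (KK m n r + 1) * (real m * \<theta>) = (1 - real n - real m) * \<theta> + real (LL m n r - 1) * \<theta>" .
    have "(cis (real n * \<theta>) * s) ^ r / (cis (real m * \<theta>) * t) ^ (KK m n r + 1)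
      = (cis (real r * (real n * \<theta>)) / cis (real (KK m n r + 1) * (real m * \<theta>))) * (s ^ r / t ^ (KK m n r + 1))"
      unfolding power_mult_distrib Complex.DeMoivre by simp
    also have "cis (real r * (real n * \<theta>)) / cis (real (KK m n r + 1) * (real m * \<theta>)) = cis ((1 - real n - real m) * \<theta>) * cis \<theta> ^ (LL m n r - 1)"
      unfolding cis_divide ang Complex.DeMoivre cis_mult ..
    finally show ?thesis by (simp only: mult.assoc)
  qed
  show ?thesis
    unfolding kernel_fun_def kernel_num_def unfolding u e unfolding cm
    by (simp only: times_divide_eq_right sum_distrib_left mult_ac)
qed

text \<open>The phase is the conjugate of the common phase of the kernel, N times over, so it drops
  out of the product. The speeds are negative because the kernel depends on w through
  conjugates.\<close>

lemma hmu_rotate_weighted: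
  assumes mn: "0 < m" "0 < n" and r0: "LL m n r0 = 1"
  shows "hmu m n r0 N i (cis (- real n * \<theta>) * x, cis (- real m * \<theta>) * y) = cnj (cis ((1 - real n - real m) * \<theta>)) ^ N * hmu m n r0 N i (x, y)"
proof -
  have nL: "real n * (real r0 + 1) = real m * real (KK m n r0) + 1"
    using arg_cong[OF LL_KK[OF mn(2), of r0 m], of real] r0 by (simp add: algebra_simps)
  have u: "(cis (- real n * \<theta>) * x) ^ m / (cis (- real m * \<theta>) * y) ^ n = x ^ m / y ^ n"
    by (simp add: power_mult_distrib Complex.DeMoivre mult_ac)
  have ang: "real r0 * (- real n * \<theta>) - real (KK m n r0 + 1) * (- real m * \<theta>) = - ((1 - real n - real m) * \<theta>)"
  proof -
    have "real r0 * (- real n * \<theta>) - real (KK m n r0 + 1) * (- real m * \<theta>) = - ((real n * (real r0 + 1) - real m * real (KK m n r0) - real n - real m) * \<theta>)"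
      by (simp add: algebra_simps)
    then show ?thesis unfolding nL by simp
  qed
  have "hmono m n r0 0 (cis (- real n * \<theta>) * x, cis (- real m * \<theta>) * y)
    = (cis (real r0 * (- real n * \<theta>)) / cis (real (KK m n r0 + 1) * (- real m * \<theta>))) * hmono m n r0 0 (x, y)"
    unfolding hmono_def fst_conv snd_conv power_mult_distrib Complex.DeMoivre by simp
  also have "cis (real r0 * (- real n * \<theta>)) / cis (real (KK m n r0 + 1) * (- real m * \<theta>)) = cnj (cis ((1 - real n - real m) * \<theta>))"
    unfolding cis_divide ang cis_cnj ..
  finally show ?thesis unfolding hmu_def fst_conv snd_conv u by (simp add: power_mult_distrib)
qed

lemma norm_hmu: "cmod (hmu m n r0 N i z) = cmod (hmono m n r0 0 z) ^ N * hx m n z ^ i"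
  by (simp add: hmu_def hx_def norm_mult norm_power norm_divide)

text \<open>Two averages extract from \<open>K(z, w) ^ N\<close> the coefficient of a single monomial: the weighted
  rotation kills every term with \<open>LL m n r > 1\<close>, the rotation of the first coordinate then
  selects a power of \<open>u\<close>.\<close>

lemma integral_kernel_power_hmu:
  fixes \<psi> :: "complex \<times> complex \<Rightarrow> real"
  assumes mn: "0 < m" "0 < n" and r0: "r0 < m" "LL m n r0 = 1" "\<And>r. r < m \<Longrightarrow> LL m n r = 1 \<Longrightarrow> r = r0"
    and z: "z \<in> hartogs m n"
    and \<psi>: "\<And>c d x y. cmod c = 1 \<Longrightarrow> cmod d = 1 \<Longrightarrow> \<psi> (c * x, d * y) = \<psi> (x, y)"
    and int: "integrable lborel (\<lambda>w. indicator (hartogs m n) w *\<^sub>R (hartogs_kernel m n z w ^ N * (hmu m n r0 N i w * of_real (\<psi> w))))"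
  shows "(LINT w|lborel. indicator (hartogs m n) w *\<^sub>R (hartogs_kernel m n z w ^ N * (hmu m n r0 N i w * of_real (\<psi> w))))
    = of_real (power_coeff (r0 + 1) m N i / (pi\<^sup>2 * m) ^ N) * hmu m n r0 N i z *
      of_real (LINT w|lborel. indicator (hartogs m n) w * ((cmod (hmu m n r0 N i w))\<^sup>2 * \<psi> w))"
proof -
  let ?H = "hartogs m n" and ?e = "hmono m n r0 0" and ?\<mu> = "hmu m n r0 N i"
  define E where "E = (\<lambda>w. indicator ?H w *\<^sub>R (hartogs_kernel m n z w ^ N * (?\<mu> w * of_real (\<psi> w))))"
  define s t where "s = (\<lambda>w::complex \<times> complex. fst z * cnj (fst w))" and "t = (\<lambda>w::complex \<times> complex. snd z * cnj (snd w))"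
  define u where "u = (\<lambda>w. s w ^ m / t w ^ n)"
  define av where "av = (\<lambda>v::complex. (of_nat (r0 + 1) + (of_nat m - of_nat (r0 + 1)) * v) / (1 - v)\<^sup>2)"
  define c where "c = complex_of_real (pi\<^sup>2 * m)"
  have iE: "integrable lborel E" using int by (simp add: E_def)
  have bnd: "cmod (u w) < 1" "cmod (t w) < 1" "t w \<noteq> 0" if "w \<in> ?H" for w
    using norm_u_le[OF z that mn(2)] hx_bounds(3)[OF z mn(2)] hx_bounds(3)[OF that mn(2)]
    by (simp_all add: u_def s_def t_def)
  have ue: "u w = (fst z ^ m / snd z ^ n) * cnj (fst w ^ m / snd w ^ n)" for w
    by (simp add: u_def s_def t_def power_mult_distrib)
  have ee: "s w ^ r0 / t w ^ (KK m n r0 + 1) = ?e z * cnj (?e w)" for w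
    using hmono_mult_cnj[OF mn, of z w r0 0 0] by (simp add: s_def t_def)
  define E2 where "E2 = (\<lambda>w. indicator ?H w *\<^sub>R ((av (u w) / c * (?e z * cnj (?e w))) ^ N * (?\<mu> w * of_real (\<psi> w))))"
  have avg1: "(\<lambda>w. LINT \<theta>|circ. E (cis (- real n * \<theta>) * fst w, cis (- real m * \<theta>) * snd w)) = E2"
  proof
    fix w :: "complex \<times> complex"
    obtain x y where w: "w = (x, y)" by (cases w)
    have rot: "(cis (- real n * \<theta>) * x, cis (- real m * \<theta>) * y) \<in> ?H \<longleftrightarrow> w \<in> ?H" for \<theta>
      using hartogs_rotate[of "cis (- real n * \<theta>)" "cis (- real m * \<theta>)" x y] by (simp add: w)
    show "(LINT \<theta>|circ. E (cis (- real n * \<theta>) * fst w, cis (- real m * \<theta>) * snd w)) = E2 w"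
    proof (cases "w \<in> ?H")
      case True
      note b = bnd[OF True]
      \<comment> \<open>cis \<theta> is replaced by a free variable l, so that the circle mean of
        the N-th power becomes its value at l = 0.\<close>
      define \<Phi> where "\<Phi> = (\<lambda>l::complex. ((\<Sum>r<m. (of_nat (r + 1) + of_nat (m - 1 - r) * u w) *
       (of_nat (LL m n r) + of_nat (m - LL m n r) * (l ^ m * t w)) * (l ^ (LL m n r - 1) * (s w ^ r / t w ^ (KK m n r + 1)))) /
     (c * ((1 - u w)\<^sup>2 * (1 - l ^ m * t w)\<^sup>2))))"
      have Eeq: "E (cis (- real n * \<theta>) * fst w, cis (- real m * \<theta>) * snd w) = \<Phi> (cis \<theta>) ^ N * (?\<mu> w * of_real (\<psi> w))" for \<theta>
      proof -
        have k: "hartogs_kernel m n z (cis (- real n * \<theta>) * x, cis (- real m * \<theta>) * y) = cis ((1 - real n - real m) * \<theta>) * \<Phi> (cis \<theta>)"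
        proof -
          have "hartogs_kernel m n z (cis (- real n * \<theta>) * x, cis (- real m * \<theta>) * y) = kernel_fun m n (cis (real n * \<theta>) * s w) (cis (real m * \<theta>) * t w)"
            unfolding hartogs_kernel_def fst_conv snd_conv complex_cnj_mult cis_cnj by (simp add: s_def t_def w mult_ac)
          then show ?thesis unfolding kernel_fun_rotate[OF mn] \<Phi>_def u_def c_def .
        qed
        have one: "cis ((1 - real n - real m) * \<theta>) ^ N * cnj (cis ((1 - real n - real m) * \<theta>)) ^ N = 1"
          by (simp add: power_mult_distrib[symmetric] cis_cnj cis_mult)
        have "E (cis (- real n * \<theta>) * fst w, cis (- real m * \<theta>) * snd w) = (cis ((1 - real n - real m) * \<theta>) * \<Phi> (cis \<theta>)) ^ N *
           ((cnj (cis ((1 - real n - real m) * \<theta>)) ^ N * ?\<mu> w) * of_real (\<psi> w))"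
        proof -
          let ?w = "(cis (- real n * \<theta>) * x, cis (- real m * \<theta>) * y)"
          have "\<psi> ?w = \<psi> w" using \<psi>[of "cis (- real n * \<theta>)" "cis (- real m * \<theta>)" x y] by (simp add: w)
          moreover have "(cis (- real n * \<theta>) * fst w, cis (- real m * \<theta>) * snd w) = ?w" by (simp add: w)
          moreover have "indicator ?H ?w = (1::real)" using rot[of \<theta>] True by simp
          moreover have "?\<mu> ?w = cnj (cis ((1 - real n - real m) * \<theta>)) ^ N * ?\<mu> w"
            unfolding w by (rule hmu_rotate_weighted[OF mn r0(2)])
          ultimately show ?thesis unfolding E_def by (simp only: k scaleR_one)
        qed
        also have "\<dots> = (cis ((1 - real n - real m) * \<theta>) ^ N * cnj (cis ((1 - real n - real m) * \<theta>)) ^ N) * (\<Phi> (cis \<theta>) ^ N * (?\<mu> w * of_real (\<psi> w)))"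
          by (simp only: power_mult_distrib mult_ac)
        finally show ?thesis unfolding one by simp
      qed
      \<comment> \<open>The modulus of the zeros of 1 - l^m t, which is larger than 1; the mean
        value property thus applies on the unit circle.\<close>
      define R where "R = root m (1 / cmod (t w))"
      have R1: "R > 1" unfolding R_def using b mn by (simp add: real_root_gt_1_iff)
      have ne: "1 - l ^ m * t w \<noteq> 0" if "cmod l < R" for l
      proof
        assume "1 - l ^ m * t w = 0"
        then have "l ^ m * t w = 1" by simp
        then have "cmod l ^ m * cmod (t w) = 1" by (metis norm_mult norm_one norm_power)
        moreover have "cmod l ^ m < R ^ m" using that mn by (intro power_strict_mono) auto
        then have "cmod l ^ m < 1 / cmod (t w)" unfolding R_def using mn by (simp add: real_root_pow_pos2)
        then have "cmod l ^ m * cmod (t w) < 1" using b by (simp add: less_divide_eq)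
        ultimately show False by simp
      qed
      have ne2: "1 - u w \<noteq> 0" using b by auto
      have c0: "c \<noteq> 0" using mn by (simp add: c_def)
      have hol: "(\<lambda>l. \<Phi> l ^ N) holomorphic_on ball 0 R"
        unfolding \<Phi>_def by (intro holomorphic_intros) (use ne ne2 c0 in auto)
      have "(LINT \<theta>|circ. \<Phi> (cis (of_int 1 * \<theta>) * 1) ^ N * cis (- (of_int 1 * real 0 * \<theta>))) = (deriv ^^ 0) (\<lambda>l. \<Phi> l ^ N) 0 / fact 0 * 1 ^ 0"
      proof (rule integral_circ_power_series[where R=R and F = "\<lambda>l. \<Phi> l ^ N" and c = "\<lambda>k. (deriv ^^ k) (\<lambda>l. \<Phi> l ^ N) 0 / fact k"])
        show "(\<lambda>k. (deriv ^^ k) (\<lambda>l. \<Phi> l ^ N) 0 / fact k * v ^ k) sums \<Phi> v ^ N" if "v \<in> ball 0 R" for v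
          using holomorphic_power_series[OF hol that] by simp
      qed (use R1 in auto)
      then have mean: "(LINT \<theta>|circ. \<Phi> (cis \<theta>) ^ N) = \<Phi> 0 ^ N" by simp
      have "\<Phi> 0 = av (u w) / c * (?e z * cnj (?e w))"
      proof -
        have "(\<Sum>r<m. (of_nat (r + 1) + of_nat (m - 1 - r) * u w) * (of_nat (LL m n r) + of_nat (m - LL m n r) * (0 ^ m * t w)) * (0 ^ (LL m n r - 1) * (s w ^ r / t w ^ (KK m n r + 1))))
          = (\<Sum>r<m. if r = r0 then (of_nat (r0 + 1) + of_nat (m - 1 - r0) * u w) * (?e z * cnj (?e w)) else 0)"
        proof (rule sum.cong[OF refl])
          fix r assume "r \<in> {..<m}"
          then have r: "r < m" by simp
          show "(of_nat (r + 1) + of_nat (m - 1 - r) * u w) * (of_nat (LL m n r) + of_nat (m - LL m n r) * (0 ^ m * t w)) * (0 ^ (LL m n r - 1) * (s w ^ r / t w ^ (KK m n r + 1)))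
            = (if r = r0 then (of_nat (r0 + 1) + of_nat (m - 1 - r0) * u w) * (?e z * cnj (?e w)) else 0)"
          proof (cases "r = r0")
            case True
            show ?thesis unfolding True ee using mn r0(2) by (simp add: power_0_left)
          next
            case False
            then have "LL m n r \<noteq> 1" using r0(3)[OF r] by blast
            then have "LL m n r - 1 > 0" using LL_bounds(1)[OF mn(1), of n r] by simp
            then show ?thesis using False by (simp add: power_0_left)
          qed
        qed
        also have "\<dots> = (of_nat (r0 + 1) + of_nat (m - 1 - r0) * u w) * (?e z * cnj (?e w))"
          using r0(1) by simp
        also have "(of_nat (m - 1 - r0) :: complex) = of_nat m - of_nat (r0 + 1)"
          using r0(1) by (subst of_nat_diff[symmetric]) auto
        finally show ?thesis unfolding \<Phi>_def av_def using mn by (simp add: power_0_left)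
      qed
      then show ?thesis unfolding Eeq using mean True by (simp add: E2_def)
    next
      case False
      then have "E (cis (- real n * \<theta>) * fst w, cis (- real m * \<theta>) * snd w) = 0" for \<theta>
        using rot[of \<theta>] by (simp add: E_def w)
      then show ?thesis using False by (simp add: E2_def)
    qed
  qed
  have iE2: "integrable lborel E2" and eq1: "(LINT w|lborel. E w) = (LINT w|lborel. E2 w)"
    using integral_avg[OF iE, of "- real n" "- real m"] unfolding avg1 by auto
  have avg2: "(LINT \<theta>|circ. E2 (cis (- 1 * \<theta>) * fst w, cis (0 * \<theta>) * snd w))
     = of_real (power_coeff (r0 + 1) m N i / (pi\<^sup>2 * m) ^ N) * ?\<mu> z * of_real (indicator ?H w * ((cmod (?\<mu> w))\<^sup>2 * \<psi> w))" for w
  proof -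
    obtain x y where w: "w = (x, y)" by (cases w)
    have rot: "(cis (- 1 * \<theta>) * x, y) \<in> ?H \<longleftrightarrow> w \<in> ?H" for \<theta>
      using hartogs_rotate[of "cis (- 1 * \<theta>)" 1 x y] by (simp add: w)
    show ?thesis
    proof (cases "w \<in> ?H")
      case True
      note b = bnd[OF True]
      have Eeq: "E2 (cis (- 1 * \<theta>) * fst w, cis (0 * \<theta>) * snd w) = av (cis (of_int (int m) * \<theta>) * u w) ^ N * cis (- (of_int (int m) * real i * \<theta>)) * ((?e z * cnj (?e w) / c) ^ N * (?\<mu> w * of_real (\<psi> w)))" for \<theta>
      proof -
        let ?w = "(cis (- 1 * \<theta>) * x, y)"
        \<comment> \<open>Turning z1 once turns u through m periods; hence speed m in the
          coefficient extraction.\<close>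
        have u': "u ?w = cis (of_int (int m) * \<theta>) * u w"
          by (simp add: u_def s_def t_def w power_mult_distrib cis_cnj Complex.DeMoivre)
        have e': "?e ?w = cnj (cis (real r0 * \<theta>)) * ?e w"
          by (simp add: hmono_def w power_mult_distrib Complex.DeMoivre cis_cnj)
        have m': "?\<mu> ?w = cnj (cis (real r0 * \<theta>)) ^ N * cis (- (of_int (int m) * real i * \<theta>)) * ?\<mu> w"
        proof -
          have "(cis (- 1 * \<theta>) * x) ^ m / y ^ n = cis (- (real m * \<theta>)) * (x ^ m / y ^ n)"
            by (simp add: power_mult_distrib Complex.DeMoivre)
          moreover have "(cis (- (real m * \<theta>)) * (x ^ m / y ^ n)) ^ i = cis (- (of_int (int m) * real i * \<theta>)) * (x ^ m / y ^ n) ^ i"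
            unfolding power_mult_distrib Complex.DeMoivre by (simp add: mult_ac)
          ultimately have "((cis (- 1 * \<theta>) * x) ^ m / y ^ n) ^ i = cis (- (of_int (int m) * real i * \<theta>)) * (x ^ m / y ^ n) ^ i" by (simp only:)
          then show ?thesis unfolding hmu_def e' by (simp only: w fst_conv snd_conv power_mult_distrib mult_ac)
        qed
        have one: "cis (real r0 * \<theta>) ^ N * cnj (cis (real r0 * \<theta>)) ^ N = 1"
          by (simp add: power_mult_distrib[symmetric] cis_cnj cis_mult)
        have "E2 (cis (- 1 * \<theta>) * fst w, cis (0 * \<theta>) * snd w) = (av (cis (of_int (int m) * \<theta>) * u w) / c * (?e z * cnj (cnj (cis (real r0 * \<theta>)) * ?e w))) ^ N *
           ((cnj (cis (real r0 * \<theta>)) ^ N * cis (- (of_int (int m) * real i * \<theta>)) * ?\<mu> w) * of_real (\<psi> w))"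
        proof -
          have "\<psi> ?w = \<psi> w" using \<psi>[of "cis (- 1 * \<theta>)" 1 x y] by (simp add: w)
          moreover have "(cis (- 1 * \<theta>) * fst w, cis (0 * \<theta>) * snd w) = ?w" by (simp add: w)
          moreover have "indicator ?H ?w = (1::real)" using rot[of \<theta>] True by simp
          ultimately show ?thesis unfolding E2_def by (simp only: u' e' m' scaleR_one)
        qed
        also have "\<dots> = (cis (real r0 * \<theta>) ^ N * cnj (cis (real r0 * \<theta>)) ^ N) * (av (cis (of_int (int m) * \<theta>) * u w) ^ N * cis (- (of_int (int m) * real i * \<theta>)) * ((?e z * cnj (?e w) / c) ^ N * (?\<mu> w * of_real (\<psi> w))))"
          by (simp add: power_mult_distrib power_divide mult_ac)
        finally show ?thesis unfolding one by simp
      qed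
      have "(LINT \<theta>|circ. av (cis (of_int (int m) * \<theta>) * u w) ^ N * cis (- (of_int (int m) * real i * \<theta>))) = of_real (power_coeff (r0 + 1) m N i) * u w ^ i"
      proof (rule integral_circ_power_series[where R=1 and F = "\<lambda>v. av v ^ N" and c = "\<lambda>i. of_real (power_coeff (r0 + 1) m N i)"])
        show "(\<lambda>i. of_real (power_coeff (r0 + 1) m N i) * v ^ i) sums (av v ^ N)" if "v \<in> ball 0 1" for v
          unfolding av_def using power_coeff_sums[of v "r0 + 1" m N] that by simp
      qed (use b mn in auto)
      then have "(LINT \<theta>|circ. E2 (cis (- 1 * \<theta>) * fst w, cis (0 * \<theta>) * snd w)) = of_real (power_coeff (r0 + 1) m N i) * u w ^ i * ((?e z * cnj (?e w) / c) ^ N * (?\<mu> w * of_real (\<psi> w)))"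
        unfolding Eeq integral_mult_left_zero by simp
      also have "\<dots> = of_real (power_coeff (r0 + 1) m N i) / c ^ N * (?e z ^ N * (fst z ^ m / snd z ^ n) ^ i) * ((?\<mu> w * cnj (?e w ^ N * (fst w ^ m / snd w ^ n) ^ i)) * of_real (\<psi> w))"
        unfolding ue by (simp add: power_mult_distrib power_divide) (simp add: mult_ac)
      also have "\<dots> = of_real (power_coeff (r0 + 1) m N i) / c ^ N * ?\<mu> z * ((?\<mu> w * cnj (?\<mu> w)) * of_real (\<psi> w))"
        unfolding hmu_def ..
      also have "\<dots> = of_real (power_coeff (r0 + 1) m N i / (pi\<^sup>2 * m) ^ N) * ?\<mu> z * of_real ((cmod (?\<mu> w))\<^sup>2 * \<psi> w)"
        by (simp only: complex_norm_square[symmetric] of_real_mult of_real_divide of_real_power c_def)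
      finally show ?thesis using True by simp
    next
      case False
      then have "E2 (cis (- 1 * \<theta>) * fst w, cis (0 * \<theta>) * snd w) = 0" for \<theta>
        using rot[of \<theta>] by (simp add: E2_def w)
      then show ?thesis using False by simp
    qed
  qed
  have "(LINT w|lborel. E2 w) = (LINT w|lborel. of_real (power_coeff (r0 + 1) m N i / (pi\<^sup>2 * m) ^ N) * ?\<mu> z * of_real (indicator ?H w * ((cmod (?\<mu> w))\<^sup>2 * \<psi> w)))"
    using integral_avg(2)[OF iE2, of "- 1" 0] unfolding avg2 .
  also have "\<dots> = of_real (power_coeff (r0 + 1) m N i / (pi\<^sup>2 * m) ^ N) * ?\<mu> z * of_real (LINT w|lborel. indicator ?H w * ((cmod (?\<mu> w))\<^sup>2 * \<psi> w))"
    by (simp only: integral_mult_right_zero integral_complex_of_real)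
  finally show ?thesis using eq1 by (simp only: E_def)
qed

section \<open>Weighted norms of the test monomials\<close>

definition hdiag :: "nat \<Rightarrow> nat \<Rightarrow> complex \<times> complex \<Rightarrow> real" where
  "hdiag m n z = Re (hartogs_kernel m n z z)"

lemma hdiag_pos:
  assumes mn: "0 < m" "0 < n" and z: "z \<in> hartogs m n"
  shows "0 < hdiag m n z"
proof -
  have "0 < (hphi m n z / hdel m n z)\<^sup>2 / (16 * pi\<^sup>2 * m\<^sup>2)"
    using hphi_ge_1[OF mn z] hdel_pos[OF z mn(2)] mn by simp
  also have "\<dots> \<le> hdiag m n z" unfolding hdiag_def by (rule hartogs_kernel_diag_ge[OF mn z])
  finally show ?thesis .
qed

lemma hdiag_rotate: "cmod c = 1 \<Longrightarrow> cmod d = 1 \<Longrightarrow> hdiag m n (c * x, d * y) = hdiag m n (x, y)"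
proof -
  assume c: "cmod c = 1" "cmod d = 1"
  have *: "e * v * cnj (e * v) = v * cnj v" if "cmod e = 1" for e v
  proof -
    have "e * v * cnj (e * v) = (e * cnj e) * (v * cnj v)" by (simp add: mult_ac)
    also have "e * cnj e = 1" using that by (simp add: complex_norm_square[symmetric])
    finally show ?thesis by simp
  qed
  show ?thesis unfolding hdiag_def hartogs_kernel_def fst_conv snd_conv *[OF c(1)] *[OF c(2)] ..
qed

text \<open>With \<open>a\<close> it is, up to a constant, the modulus of the image of a test
  function. With \<open>b\<close> it is the modulus of the function against which test functions are
  paired.\<close>

definition hweight :: "nat \<Rightarrow> nat \<Rightarrow> nat \<Rightarrow> nat \<Rightarrow> nat \<Rightarrow> real \<Rightarrow> complex \<times> complex \<Rightarrow> real" where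
  "hweight m n r0 N i a z = cmod (hmu m n r0 N i z) * hdiag m n z powr (- (a / 2))"

lemma hweight_nonneg: "0 \<le> hweight m n r0 N i a z"
  by (simp add: hweight_def)

lemma borel_measurable_hmu: "hmu m n r0 N i \<in> borel_measurable borel"
proof -
  have [measurable]: "fst \<in> borel_measurable (borel :: (complex \<times> complex) measure)" "snd \<in> borel_measurable (borel :: (complex \<times> complex) measure)"
    by (intro borel_measurable_continuous_onI continuous_intros)+
  show ?thesis unfolding hmu_def[abs_def] hmono_def by measurable
qed

lemma borel_measurable_hdiag: "hdiag m n \<in> borel_measurable borel"
proof -
  have "(\<lambda>z. hartogs_kernel m n z z) \<in> borel_measurable borel"
    unfolding hartogs_kernel_def
    by (intro borel_measurable_kernel_fun borel_measurable_continuous_onI continuous_intros)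
  then show ?thesis unfolding hdiag_def[abs_def]
    by (rule measurable_compose) (intro borel_measurable_continuous_onI continuous_intros)
qed

lemma borel_measurable_hweight: "hweight m n r0 N i a \<in> borel_measurable borel"
  unfolding hweight_def[abs_def] using borel_measurable_hmu borel_measurable_hdiag by measurable

text \<open>For \<rho> > 1/2 the factor \<rho>^r0 is bounded below, and every other factor is
  comparable to a pure power of \<rho>, r, 1 - \<rho> or 1 - r. So the integral dominates a product
  of two one-dimensional integrals, and \<open>i\<close> enters only the one in \<rho>.\<close>

lemma hweight_lower_bound:
  fixes a P :: real
  assumes mn: "0 < m" "0 < n" and r0: "r0 < m" "LL m n r0 = 1" and P: "P > 0"
  defines "M \<equiv> (real m + real n - 1) / real m"
  obtains c :: real where "c > 0"
    "\<And>i. ennreal c * ((\<integral>\<^sup>+\<rho>. ennreal (\<rho> powr (real m * P * real i) * (1 - \<rho>) powr (a * P)) * indicator {1/2<..<1} \<rho> \<partial>lborel) *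
        (\<integral>\<^sup>+r. ennreal (r powr (1 + 2 * (real n / real m) - M * (N - a) * P) * (1 - r) powr (a * P)) * indicator {0<..<1} r \<partial>lborel))
      \<le> (\<integral>\<^sup>+z. ennreal (hweight m n r0 N i a z powr P) * indicator (hartogs m n) z \<partial>lborel)"
proof -
  let ?H = "hartogs m n"
  define \<gamma> where "\<gamma> = real n / real m"
  obtain C1 where C1: "C1 > 0" "\<And>z. z \<in> ?H \<Longrightarrow> Re (hartogs_kernel m n z z) powr (a / 2) \<le> C1 * (hphi m n z powr (2 * (a / 2)) * hdel m n z powr (- (2 * (a / 2))))"
    by (rule hartogs_kernel_diag_powr[OF mn]) blast
  \<comment> \<open>A lower bound for \<rho>^r0, valid because r0 < m and \<rho> > 1/2.\<close>
  define b0 where "b0 = (1/2 :: real) ^ m"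
  have b0: "b0 > 0" by (simp add: b0_def)
  define C2 where "C2 = b0 powr a + real m powr a"
  define C3 where "C3 = 1 + real m powr (-a)"
  have C23: "C2 > 0" "C3 > 0" using mn b0 by (auto simp: C2_def C3_def add_pos_nonneg add_nonneg_pos)
  define c0 where "c0 = b0 ^ N / (C1 * C2 * C3)"
  have c0: "c0 > 0" using b0 C1(1) C23 by (simp add: c0_def)
  have pt: "c0 * (\<rho> ^ (m * i) * r powr (- (M * (N - a))) * ((1 - \<rho>) powr a * (1 - r) powr a)) \<le> hweight m n r0 N i a z"
    if z: "z \<in> ?H" and \<rho>: "\<rho> = cmod (fst z) / cmod (snd z) powr \<gamma>" and r: "r = cmod (snd z)" and half: "1/2 < \<rho>" for z \<rho> r i
  proof -
    note hz = hx_bounds[OF z mn(2)]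
    have r': "0 < r" "r < 1" using hz by (auto simp: r)
    have \<rho>1: "\<rho> < 1" using z hartogs_iff[OF mn, of z] by (simp add: \<rho> \<gamma>_def divide_less_eq)
    have x: "hx m n z = \<rho> ^ m" using hx_polar[OF mn hz(3)] by (simp add: \<rho> \<gamma>_def)
    have e: "cmod (hmono m n r0 0 z) = \<rho> ^ r0 * r powr (- M)"
    proof -
      have "(real (LL m n r0) - real n - real m) / real m = - M" using r0 mn by (simp add: M_def field_simps)
      then show ?thesis using norm_hmono_polar[OF mn hz(3), of r0] by (simp add: \<rho> \<gamma>_def r)
    qed
    have "b0 \<le> \<rho> ^ r0"
    proof -
      have "b0 \<le> (1/2) ^ r0" unfolding b0_def using r0 by (intro power_decreasing) auto
      also have "\<dots> \<le> \<rho> ^ r0" using half by (intro power_mono) auto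
      finally show ?thesis .
    qed
    then have e1: "b0 * r powr (- M) \<le> cmod (hmono m n r0 0 z)" unfolding e by (intro mult_right_mono) auto
    have \<mu>: "b0 ^ N * r powr (- (M * N)) * \<rho> ^ (m * i) \<le> cmod (hmu m n r0 N i z)"
    proof -
      have "b0 ^ N * r powr (- (M * N)) * \<rho> ^ (m * i) = (b0 * r powr (- M)) ^ N * (\<rho> ^ m) ^ i"
      proof -
        have "(r powr (- M)) ^ N = r powr (- (M * N))" using r' by (simp add: powr_power mult.commute)
        then show ?thesis by (simp only: power_mult_distrib power_mult)
      qed
      also have "\<dots> \<le> cmod (hmono m n r0 0 z) ^ N * (\<rho> ^ m) ^ i"
        using e1 b0 half by (intro mult_right_mono power_mono) auto
      also have "\<dots> = cmod (hmu m n r0 N i z)" unfolding norm_hmu x ..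
      finally show ?thesis .
    qed
    have phi: "hphi m n z powr a \<le> C2 * r powr (- (M * a))"
    proof -
      have "cmod (hmono m n r0 0 z) \<le> hphi m n z" unfolding hphi_def using r0 by (intro member_le_sum) auto
      then have "b0 * r powr (- M) \<le> hphi m n z" using e1 by simp
      moreover have "hphi m n z \<le> m * r powr (- M)" using hphi_le[OF mn z] by (simp add: M_def r)
      ultimately have "hphi m n z powr a \<le> (b0 * r powr (- M)) powr a + (m * r powr (- M)) powr a"
        using b0 r' by (intro powr_le_of_bounds) auto
      also have "\<dots> = C2 * r powr (- (M * a))"
        using b0 by (simp add: C2_def powr_mult powr_powr distrib_right)
      finally show ?thesis .
    qed
    have del: "hdel m n z powr (-a) \<le> C3 * ((1 - \<rho>) powr (-a) * (1 - r) powr (-a))"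
    proof -
      have pm: "\<rho> ^ m \<le> \<rho>" using half \<rho>1 mn power_decreasing[of 1 m \<rho>] by simp
      have bern: "1 - \<rho> ^ m \<le> real m * (1 - \<rho>)"
        using Bernoulli_inequality[of "\<rho> - 1" m] half by (simp add: algebra_simps)
      have "(1 - \<rho> ^ m) powr (-a) \<le> (1 - \<rho>) powr (-a) + (real m * (1 - \<rho>)) powr (-a)"
        by (rule powr_le_of_bounds) (use pm bern \<rho>1 in auto)
      also have "(real m * (1 - \<rho>)) powr (-a) = real m powr (-a) * (1 - \<rho>) powr (-a)"
        using \<rho>1 by (simp add: powr_mult)
      finally have "(1 - \<rho> ^ m) powr (-a) \<le> C3 * (1 - \<rho>) powr (-a)" by (simp add: C3_def distrib_right)
      then have "(1 - \<rho> ^ m) powr (-a) * (1 - r) powr (-a) \<le> C3 * (1 - \<rho>) powr (-a) * (1 - r) powr (-a)"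
        by (intro mult_right_mono) auto
      moreover have "hdel m n z powr (-a) = (1 - \<rho> ^ m) powr (-a) * (1 - r) powr (-a)"
        using pm \<rho>1 r' by (simp add: hdel_def x r powr_mult)
      ultimately show ?thesis by (simp add: mult.assoc)
    qed
    define T where "T = r powr (- (M * a)) * ((1 - \<rho>) powr (-a) * (1 - r) powr (-a))"
    have T: "T > 0" using r' \<rho>1 by (simp add: T_def)
    have dpos: "hdiag m n z powr (a / 2) > 0" using hdiag_pos[OF mn z] by simp
    have "hdiag m n z powr (a / 2) \<le> C1 * (hphi m n z powr a * hdel m n z powr (-a))"
      using C1(2)[OF z] by (simp add: hdiag_def)
    also have "\<dots> \<le> C1 * ((C2 * r powr (- (M * a))) * (C3 * ((1 - \<rho>) powr (-a) * (1 - r) powr (-a))))"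
      using C1(1) C23 by (intro mult_left_mono mult_mono phi del) auto
    also have "\<dots> = C1 * C2 * C3 * T" by (simp add: T_def)
    finally have "1 / (C1 * C2 * C3 * T) \<le> 1 / hdiag m n z powr (a / 2)"
      using dpos by (intro divide_left_mono) (auto intro!: mult_pos_pos C1(1) C23 T)
    also have "\<dots> = hdiag m n z powr (- (a / 2))" by (simp add: powr_minus_divide)
    finally have d: "1 / (C1 * C2 * C3 * T) \<le> hdiag m n z powr (- (a / 2))" .
    have "c0 * (\<rho> ^ (m * i) * r powr (- (M * (N - a))) * ((1 - \<rho>) powr a * (1 - r) powr a))
      = (b0 ^ N * r powr (- (M * N)) * \<rho> ^ (m * i)) * (1 / (C1 * C2 * C3 * T))"
    proof -
      have "r powr (- (M * (N - a))) = r powr (- (M * N)) * r powr (M * a)"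
        unfolding powr_add[symmetric] by (simp add: algebra_simps)
      then show ?thesis
        unfolding c0_def T_def powr_minus_divide[of r "M * a"] powr_minus_divide[of _ a]
        by simp
    qed
    also have "\<dots> \<le> cmod (hmu m n r0 N i z) * hdiag m n z powr (- (a / 2))"
      using C1(1) C23 T by (intro mult_mono \<mu> d) auto
    finally show ?thesis by (simp add: hweight_def)
  qed
  show ?thesis
  proof (rule that)
    show "c0 powr P > 0" using c0 by simp
    fix i
    define G where "G = (\<lambda>p::real \<times> real. ennreal (c0 powr P) * (ennreal (fst p powr (real m * P * real i) * (1 - fst p) powr (a * P)) * indicator {1/2<..<1} (fst p)) *
       ennreal (snd p powr (- (M * (N - a) * P)) * (1 - snd p) powr (a * P)))"
    have G: "G \<in> borel_measurable borel" unfolding G_def borel_prod[symmetric] by measurable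
    define I where "I = (\<integral>\<^sup>+\<rho>. ennreal (\<rho> powr (real m * P * real i) * (1 - \<rho>) powr (a * P)) * indicator {1/2<..<1} \<rho> \<partial>lborel)"
    have "ennreal (c0 powr P) * (I * (\<integral>\<^sup>+r. ennreal (r powr (1 + 2 * (real n / real m) - M * (N - a) * P) * (1 - r) powr (a * P)) * indicator {0<..<1} r \<partial>lborel))
      = (\<integral>\<^sup>+r. (ennreal (c0 powr P) * I) * (ennreal (r powr (1 + 2 * \<gamma> - M * (N - a) * P) * (1 - r) powr (a * P)) * indicator {0<..<1} r) \<partial>lborel)"
      by (subst nn_integral_cmult) (auto simp: \<gamma>_def mult.assoc)
    also have "\<dots> \<le> (\<integral>\<^sup>+r. (\<integral>\<^sup>+\<rho>. G (\<rho>, r) * ennreal (2 * pi * \<rho>) * indicator {0<..<1} \<rho> \<partial>lborel) * ennreal (2 * pi * r powr (1 + 2 * \<gamma>)) * indicator {0<..<1} r \<partial>lborel)"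
    proof (rule nn_integral_mono)
      fix r :: real
      show "(ennreal (c0 powr P) * I) * (ennreal (r powr (1 + 2 * \<gamma> - M * (N - a) * P) * (1 - r) powr (a * P)) * indicator {0<..<1} r)
        \<le> (\<integral>\<^sup>+\<rho>. G (\<rho>, r) * ennreal (2 * pi * \<rho>) * indicator {0<..<1} \<rho> \<partial>lborel) * ennreal (2 * pi * r powr (1 + 2 * \<gamma>)) * indicator {0<..<1} r"
      proof (cases "r \<in> {0<..<1}")
        case True
        define S where "S = ennreal (r powr (- (M * (N - a) * P)) * (1 - r) powr (a * P))"
        have "ennreal (c0 powr P) * I * S = (\<integral>\<^sup>+\<rho>. (ennreal (c0 powr P) * S) * (ennreal (\<rho> powr (real m * P * real i) * (1 - \<rho>) powr (a * P)) * indicator {1/2<..<1} \<rho>) \<partial>lborel)"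
          unfolding I_def by (subst nn_integral_cmult) (auto simp: mult_ac)
        also have "\<dots> \<le> (\<integral>\<^sup>+\<rho>. G (\<rho>, r) * ennreal (2 * pi * \<rho>) * indicator {0<..<1} \<rho> \<partial>lborel)"
        proof (rule nn_integral_mono)
          fix \<rho> :: real
          show "(ennreal (c0 powr P) * S) * (ennreal (\<rho> powr (real m * P * real i) * (1 - \<rho>) powr (a * P)) * indicator {1/2<..<1} \<rho>) \<le> G (\<rho>, r) * ennreal (2 * pi * \<rho>) * indicator {0<..<1} \<rho>"
          proof (cases "\<rho> \<in> {1/2<..<1}")
            case True
            have "1 * 1 \<le> (2 * pi) * \<rho>"
            proof -
              have "1 * (1/2) \<le> pi * \<rho>" using True pi_gt3 by (intro mult_mono) auto
              then show ?thesis by simp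
            qed
            then have one: "1 \<le> ennreal (2 * pi * \<rho>)" by simp
            have "(ennreal (c0 powr P) * S) * (ennreal (\<rho> powr (real m * P * real i) * (1 - \<rho>) powr (a * P)) * indicator {1/2<..<1} \<rho>) = G (\<rho>, r) * 1"
              by (simp add: G_def S_def mult_ac)
            also have "\<dots> \<le> G (\<rho>, r) * ennreal (2 * pi * \<rho>)" by (intro mult_left_mono one) auto
            finally show ?thesis using True by simp
          qed auto
        qed
        finally have in1: "ennreal (c0 powr P) * I * S \<le> (\<integral>\<^sup>+\<rho>. G (\<rho>, r) * ennreal (2 * pi * \<rho>) * indicator {0<..<1} \<rho> \<partial>lborel)" .
        have "ennreal (r powr (1 + 2 * \<gamma> - M * (N - a) * P) * (1 - r) powr (a * P)) = S * ennreal (r powr (1 + 2 * \<gamma>))"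
        proof -
          have "r powr (1 + 2 * \<gamma> - M * (N - a) * P) = r powr (- (M * (N - a) * P)) * r powr (1 + 2 * \<gamma>)"
            unfolding powr_add[symmetric] by simp
          then show ?thesis unfolding S_def by (simp add: ennreal_mult[symmetric] mult_ac)
        qed
        also have "\<dots> \<le> S * ennreal (2 * pi * r powr (1 + 2 * \<gamma>))"
        proof (intro mult_left_mono ennreal_leI)
          have "1 * r powr (1 + 2 * \<gamma>) \<le> (2 * pi) * r powr (1 + 2 * \<gamma>)" using pi_gt3 by (intro mult_right_mono) auto
          then show "r powr (1 + 2 * \<gamma>) \<le> 2 * pi * r powr (1 + 2 * \<gamma>)" by simp
        qed auto
        finally have in2: "ennreal (r powr (1 + 2 * \<gamma> - M * (N - a) * P) * (1 - r) powr (a * P)) \<le> S * ennreal (2 * pi * r powr (1 + 2 * \<gamma>))" .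
        have "(ennreal (c0 powr P) * I) * ennreal (r powr (1 + 2 * \<gamma> - M * (N - a) * P) * (1 - r) powr (a * P)) \<le> (ennreal (c0 powr P) * I) * (S * ennreal (2 * pi * r powr (1 + 2 * \<gamma>)))"
          by (intro mult_left_mono in2) auto
        also have "\<dots> = (ennreal (c0 powr P) * I * S) * ennreal (2 * pi * r powr (1 + 2 * \<gamma>))" by (simp only: mult.assoc)
        also have "\<dots> \<le> (\<integral>\<^sup>+\<rho>. G (\<rho>, r) * ennreal (2 * pi * \<rho>) * indicator {0<..<1} \<rho> \<partial>lborel) * ennreal (2 * pi * r powr (1 + 2 * \<gamma>))"
          by (intro mult_right_mono in1) auto
        finally show ?thesis using True by simp
      qed auto
    qed
    also have "\<dots> = (\<integral>\<^sup>+z. G (cmod (fst z) / cmod (snd z) powr \<gamma>, cmod (snd z)) * indicator ?H z \<partial>lborel)"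
      unfolding \<gamma>_def by (rule nn_integral_hartogs_radial[OF G mn, symmetric])
    also have "\<dots> \<le> (\<integral>\<^sup>+z. ennreal (hweight m n r0 N i a z powr P) * indicator ?H z \<partial>lborel)"
    proof (rule nn_integral_mono)
      fix z
      show "G (cmod (fst z) / cmod (snd z) powr \<gamma>, cmod (snd z)) * indicator ?H z \<le> ennreal (hweight m n r0 N i a z powr P) * indicator ?H z"
      proof (cases "z \<in> ?H \<and> 1/2 < cmod (fst z) / cmod (snd z) powr \<gamma>")
        case True
        define \<rho> r where "\<rho> = cmod (fst z) / cmod (snd z) powr \<gamma>" and "r = cmod (snd z)"
        have z: "z \<in> ?H" and half: "1/2 < \<rho>" using True by (auto simp: \<rho>_def)
        have r': "0 < r" "r < 1" using hx_bounds[OF z mn(2)] by (auto simp: r_def)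
        have \<rho>1: "\<rho> < 1" using z hartogs_iff[OF mn, of z] by (simp add: \<rho>_def \<gamma>_def divide_less_eq)
        have "c0 powr P * (\<rho> powr (real m * P * real i) * (1 - \<rho>) powr (a * P)) * (r powr (- (M * (N - a) * P)) * (1 - r) powr (a * P))
           = (c0 * (\<rho> ^ (m * i) * r powr (- (M * (N - a))) * ((1 - \<rho>) powr a * (1 - r) powr a))) powr P"
        proof -
          have "(\<rho> ^ (m * i)) powr P = \<rho> powr (real m * P * real i)"
            using half by (simp add: powr_realpow[symmetric] powr_powr mult_ac)
          then show ?thesis using half \<rho>1 r' c0 by (simp add: powr_mult powr_powr mult_ac)
        qed
        also have "\<dots> \<le> hweight m n r0 N i a z powr P"
          using P c0 half \<rho>1 r' by (intro powr_mono2 pt[OF z \<rho>_def r_def half]) auto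
        finally have "ennreal (c0 powr P * (\<rho> powr (real m * P * real i) * (1 - \<rho>) powr (a * P)) * (r powr (- (M * (N - a) * P)) * (1 - r) powr (a * P))) \<le> ennreal (hweight m n r0 N i a z powr P)"
          by (rule ennreal_leI)
        then show ?thesis using z half \<rho>1
          unfolding \<rho>_def[symmetric] unfolding r_def[symmetric] by (simp add: G_def ennreal_mult)
      next
        case False
        then show ?thesis by (auto simp: G_def)
      qed
    qed
    finally show "ennreal (c0 powr P) * (I * (\<integral>\<^sup>+r. ennreal (r powr (1 + 2 * (real n / real m) - M * (N - a) * P) * (1 - r) powr (a * P)) * indicator {0<..<1} r \<partial>lborel))
      \<le> (\<integral>\<^sup>+z. ennreal (hweight m n r0 N i a z powr P) * indicator ?H z \<partial>lborel)" .
  qed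
qed

text \<open>The test functions are truncations of the extremal function of Hoelder's inequality for the
  weight \<open>hweight \<dots> b\<close>; the operator maps each of them to a multiple of the same function.\<close>

lemma S_bounded_weights:
  assumes mn: "0 < m" "0 < n" and r0: "r0 < m" "LL m n r0 = 1" "\<And>r. r < m \<Longrightarrow> LL m n r = 1 \<Longrightarrow> r = r0"
    and p: "1 < p" and q: "q = p / (p - 1)"
    and C: "\<And>f. f \<in> Lp_space p (lebesgue_on (hartogs m n)) \<Longrightarrow>
        (AE z in lebesgue_on (hartogs m n). integrable (lebesgue_on (hartogs m n)) (\<lambda>w. S_kernel m n a b N z w * f w)) \<and>
        integral_op (lebesgue_on (hartogs m n)) (S_kernel m n a b N) f \<in> Lp_space p (lebesgue_on (hartogs m n)) \<and>
        Lp_norm p (lebesgue_on (hartogs m n)) (integral_op (lebesgue_on (hartogs m n)) (S_kernel m n a b N) f) \<le> C * Lp_norm p (lebesgue_on (hartogs m n)) f"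
    and cfp: "power_coeff (r0 + 1) m N i > 0"
    and Gpos: "0 < (\<integral>\<^sup>+z. ennreal (hweight m n r0 N i a z powr p) * indicator (hartogs m n) z \<partial>lborel)"
    and Hpos: "0 < (\<integral>\<^sup>+z. ennreal (hweight m n r0 N i b z powr q) * indicator (hartogs m n) z \<partial>lborel)"
  obtains G H :: real where "0 < G" "0 < H"
    "(\<integral>\<^sup>+z. ennreal (hweight m n r0 N i a z powr p) * indicator (hartogs m n) z \<partial>lborel) = ennreal G"
    "(\<integral>\<^sup>+z. ennreal (hweight m n r0 N i b z powr q) * indicator (hartogs m n) z \<partial>lborel) = ennreal H"
    "power_coeff (r0 + 1) m N i / (pi\<^sup>2 * m) ^ N * (G powr (1 / p) * H powr (1 / q)) \<le> C"
proof -
  let ?H = "hartogs m n"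
  let ?M = "lebesgue_on ?H"
  interpret M: finite_measure ?M
    by (rule finite_measure_lebesgue_on[OF lmeasurable_hartogs[OF mn]])
  have q1: "q > 1" using p q by (simp add: less_divide_eq)
  have pq: "1 / p + 1 / q = 1" using p unfolding q by (simp add: field_simps)
  have qp: "(q - 1) * p = q" using p unfolding q by (simp add: field_simps)
  define A where "A = power_coeff (r0 + 1) m N i / (pi\<^sup>2 * m) ^ N"
  have A: "A > 0" using cfp mn by (simp add: A_def)
  define \<mu> where "\<mu> = hmu m n r0 N i"
  define ga where "ga = hweight m n r0 N i a"
  define gb where "gb = hweight m n r0 N i b"
  define d where "d = hdiag m n"
  have gnn: "0 \<le> ga z" "0 \<le> gb z" for z by (auto simp: ga_def gb_def hweight_nonneg)
  have meas[measurable]: "\<mu> \<in> borel_measurable borel" "ga \<in> borel_measurable borel" "gb \<in> borel_measurable borel" "d \<in> borel_measurable borel"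
    unfolding \<mu>_def ga_def gb_def d_def by (auto intro: borel_measurable_hmu borel_measurable_hweight borel_measurable_hdiag)
  have idm: "(\<lambda>z. z) \<in> ?M \<rightarrow>\<^sub>M borel" by (rule ident_measurable_lebesgue_on)
  \<comment> \<open>The Hoelder extremal modulus g^(q-1), cut off where g exceeds \<open>k\<close>;
    the cut-off puts the test function in Lp before anything is known about the q-norm of g.\<close>
  define tr where "tr = (\<lambda>k w. gb w powr (q - 1) * (if gb w \<le> real k then 1 else 0))"
  have trm[measurable]: "tr k \<in> borel_measurable borel" for k unfolding tr_def by measurable
  \<comment> \<open>The unimodular factor of \<mu> times the truncated modulus. Where \<mu>
    vanishes, 1/0 = 0 is harmless because \<open>gb\<close> vanishes there too.\<close>
  define f where "f = (\<lambda>k w. \<mu> w * of_real (1 / cmod (\<mu> w) * tr k w))"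
  have fm: "f k \<in> borel_measurable borel" for k unfolding f_def by measurable
  have fM: "f k \<in> borel_measurable ?M" for k
    by (rule measurable_compose[OF idm fm])
  have ff: "cmod (f k w) powr p = gb w powr q * (if gb w \<le> real k then 1 else 0)" for k w
  proof (cases "\<mu> w = 0")
    case True
    then have "gb w = 0" by (simp add: gb_def hweight_def \<mu>_def)
    then show ?thesis using True p q1 by (simp add: f_def)
  next
    case False
    have "cmod (f k w) = cmod (\<mu> w) * (1 / cmod (\<mu> w)) * \<bar>tr k w\<bar>"
      unfolding f_def norm_mult norm_of_real abs_mult by simp
    also have "\<dots> = tr k w" using False by (simp add: tr_def)
    finally have "cmod (f k w) = tr k w" .
    then show ?thesis using qp p by (auto simp: tr_def powr_powr)
  qed
  define I where "I = (\<lambda>k. (LINT w|?M. cmod (f k w) powr p))"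
  have fi: "integrable ?M (\<lambda>w. cmod (f k w) powr p)" for k
  proof (rule M.integrable_const_bound[of _ "real k powr q"])
    show "AE w in ?M. norm (cmod (f k w) powr p) \<le> real k powr q"
      unfolding ff using gnn q1 by (intro AE_I2) (auto intro: powr_mono2)
    show "(\<lambda>w. cmod (f k w) powr p) \<in> borel_measurable ?M" using fM by measurable
  qed
  have fLp: "f k \<in> Lp_space p ?M" for k using fM fi by (simp add: Lp_space_def)
  have Inn: "0 \<le> I k" for k by (simp add: I_def)
  have Ieq: "(\<integral>\<^sup>+w. ennreal (gb w powr q * (if gb w \<le> real k then 1 else 0)) * indicator ?H w \<partial>lborel) = ennreal (I k)" for k
  proof -
    have "ennreal (I k) = (\<integral>\<^sup>+w. ennreal (cmod (f k w) powr p) \<partial>?M)"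
      unfolding I_def by (rule nn_integral_eq_integral[OF fi, symmetric]) auto
    also have "\<dots> = (\<integral>\<^sup>+w. ennreal (cmod (f k w) powr p) * indicator ?H w \<partial>lborel)"
      by (rule nn_integral_lebesgue_on) simp
    finally show ?thesis unfolding ff by simp
  qed
  \<comment> \<open>The torus-invariant part: \<open>f k\<close> times the factor with
    \<open>b\<close> is \<mu> times \<open>\<psi> k\<close>, the form that
    \<open>integral_kernel_power_hmu\<close> handles.\<close>
  define \<psi> where "\<psi> = (\<lambda>k w. 1 / cmod (\<mu> w) * tr k w * d w powr (- (b / 2)))"
  have inv: "\<psi> k (c * x, e * y) = \<psi> k (x, y)" if "cmod c = 1" "cmod e = 1" for k c e x y
  proof -
    have n: "cmod (\<mu> (c * x, e * y)) = cmod (\<mu> (x, y))"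
      using that unfolding \<mu>_def norm_hmu by (simp add: hmono_def hx_def norm_mult norm_divide norm_power)
    have dd: "d (c * x, e * y) = d (x, y)" unfolding d_def by (rule hdiag_rotate[OF that])
    have g: "gb (c * x, e * y) = gb (x, y)" using n dd by (simp add: gb_def hweight_def \<mu>_def d_def)
    show ?thesis unfolding \<psi>_def tr_def n dd g ..
  qed
  have \<mu>\<psi>: "(cmod (\<mu> w))\<^sup>2 * \<psi> k w = gb w powr q * (if gb w \<le> real k then 1 else 0)" for k w
  proof (cases "\<mu> w = 0")
    case True
    then have "gb w = 0" by (simp add: gb_def hweight_def \<mu>_def)
    then show ?thesis using True q1 by simp
  next
    case False
    have "(cmod (\<mu> w))\<^sup>2 * \<psi> k w = gb w * gb w powr (q - 1) * (if gb w \<le> real k then 1 else 0)"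
      using False by (simp add: \<psi>_def tr_def power2_eq_square) (simp add: gb_def hweight_def \<mu>_def d_def)
    also have "gb w * gb w powr (q - 1) = gb w powr q"
      using gnn(2)[of w] q1 by (cases "gb w = 0") (simp_all add: powr_mult_base)
    finally show ?thesis .
  qed
  have LI: "(LINT w|lborel. indicator ?H w * ((cmod (\<mu> w))\<^sup>2 * \<psi> k w)) = I k" for k
  proof -
    have "(LINT w|?M. cmod (f k w) powr p) = (LINT w|lborel. indicator ?H w *\<^sub>R (cmod (f k w) powr p))"
    proof (rule integral_lebesgue_on)
      show "(\<lambda>z. indicator ?H z *\<^sub>R cmod (f k z) powr p) \<in> borel_measurable borel" using fm by measurable
    qed simp
    then show ?thesis unfolding \<mu>\<psi> ff I_def by simp
  qed
  \<comment> \<open>The pairing of \<open>f k\<close> with g and the p-th power of its norm are the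
    same number \<open>I k\<close>, by extremality.\<close>
  have Sf: "AE z in ?M. cmod (integral_op ?M (S_kernel m n a b N) (f k) z) = A * I k * ga z" for k
  proof -
    have "AE z in ?M. integrable ?M (\<lambda>w. S_kernel m n a b N z w * f k w)" using C[OF fLp] by blast
    then show ?thesis
    proof (rule AE_mp, intro AE_I2 impI)
      fix z assume "z \<in> space ?M" and i: "integrable ?M (\<lambda>w. S_kernel m n a b N z w * f k w)"
      then have z: "z \<in> ?H" by simp
      have dz: "d z > 0" unfolding d_def by (rule hdiag_pos[OF mn z])
      define X where "X = (\<lambda>w. indicator ?H w *\<^sub>R (hartogs_kernel m n z w ^ N * (\<mu> w * of_real (\<psi> k w))))"
      have eq: "indicator ?H w *\<^sub>R (S_kernel m n a b N z w * f k w) = of_real (d z powr (- (a / 2))) * X w" for w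
      proof (cases "w \<in> ?H")
        case True
        show ?thesis
          unfolding S_kernel_def bergman_diag_def bergman_kernel_hartogs[OF mn z True] bergman_kernel_hartogs[OF mn z z] bergman_kernel_hartogs[OF mn True True]
          using True by (simp add: X_def f_def \<psi>_def d_def hdiag_def powr_minus_divide)
      qed (simp add: X_def)
      have Xm: "X \<in> borel_measurable borel"
      proof -
        have "(\<lambda>w. hartogs_kernel m n z w) \<in> borel_measurable borel"
          unfolding hartogs_kernel_def
          by (intro borel_measurable_kernel_fun borel_measurable_continuous_onI continuous_intros)
        then show ?thesis unfolding X_def \<psi>_def by measurable
      qed
      then have m: "(\<lambda>w. indicator ?H w *\<^sub>R (S_kernel m n a b N z w * f k w)) \<in> borel_measurable borel"
        unfolding eq by measurable
      have "integrable lborel (\<lambda>w. of_real (d z powr (- (a / 2))) * X w)"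
        using i unfolding integrable_lebesgue_on_iff[OF borel_hartogs m] eq .
      then have "integrable lborel (\<lambda>w. of_real (d z powr (a / 2)) * (of_real (d z powr (- (a / 2))) * X w))"
        by (rule integrable_mult_right)
      moreover have "of_real (d z powr (a / 2)) * (of_real (d z powr (- (a / 2))) * X w) = X w" for w
        using dz by (simp add: powr_minus_divide)
      ultimately have iX: "integrable lborel X" by simp
      have "integral_op ?M (S_kernel m n a b N) (f k) z = (LINT w|lborel. of_real (d z powr (- (a / 2))) * X w)"
        unfolding integral_op_def integral_lebesgue_on[OF borel_hartogs m] eq ..
      also have "\<dots> = of_real (d z powr (- (a / 2))) * (LINT w|lborel. X w)" by (rule integral_mult_right_zero)
      also have "(LINT w|lborel. X w) = of_real A * \<mu> z * of_real (I k)"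
        using integral_kernel_power_hmu[OF mn r0 z inv[of _ _ k], where i=i and N=N] iX
        unfolding X_def A_def LI[of k, symmetric] \<mu>_def by blast
      finally have "cmod (integral_op ?M (S_kernel m n a b N) (f k) z) = d z powr (- (a / 2)) * (A * cmod (\<mu> z) * I k)"
        using A Inn[of k] by (simp add: norm_mult)
      then show "cmod (integral_op ?M (S_kernel m n a b N) (f k) z) = A * I k * ga z"
        by (simp add: ga_def hweight_def \<mu>_def d_def)
    qed
  qed
  define Gn where "Gn = (\<integral>\<^sup>+z. ennreal (ga z powr p) * indicator ?H z \<partial>lborel)"
  define Hn where "Hn = (\<integral>\<^sup>+z. ennreal (gb z powr q) * indicator ?H z \<partial>lborel)"
  \<comment> \<open>Boundedness reads A I G^(1/p) \<le> C I^(1/p); cancelling I^(1/p) leaves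
    I^(1/q). Finiteness of \<open>Gn\<close> comes from the image lying in Lp, for a nonzero
    factor.\<close>
  have ineq: "\<exists>G. Gn = ennreal G \<and> G > 0 \<and> A * G powr (1 / p) * I k powr (1 / q) \<le> C" if Ik: "I k > 0" for k
  proof -
    let ?S = "integral_op ?M (S_kernel m n a b N) (f k)"
    have SL: "?S \<in> Lp_space p ?M" and SN: "Lp_norm p ?M ?S \<le> C * Lp_norm p ?M (f k)" using C[OF fLp] by blast+
    define c where "c = A * I k"
    have c: "c > 0" using A Ik by (simp add: c_def)
    have Si: "integrable ?M (\<lambda>z. cmod (?S z) powr p)" using SL by (simp add: Lp_space_def)
    define J where "J = (LINT z|?M. cmod (?S z) powr p)"
    have "ennreal J = (\<integral>\<^sup>+z. ennreal (cmod (?S z) powr p) \<partial>?M)"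
      unfolding J_def by (rule nn_integral_eq_integral[OF Si, symmetric]) auto
    also have "\<dots> = (\<integral>\<^sup>+z. ennreal (c powr p) * ennreal (ga z powr p) \<partial>?M)"
      using Sf[of k] c gnn
      by (intro nn_integral_cong_AE) (auto elim!: eventually_mono simp: c_def[symmetric] powr_mult ennreal_mult)
    also have "\<dots> = ennreal (c powr p) * (\<integral>\<^sup>+z. ennreal (ga z powr p) \<partial>?M)"
      by (rule nn_integral_cmult) (intro measurable_compose[OF idm], measurable)
    also have "(\<integral>\<^sup>+z. ennreal (ga z powr p) \<partial>?M) = Gn" unfolding Gn_def by (rule nn_integral_lebesgue_on) simp
    finally have J: "ennreal J = ennreal (c powr p) * Gn" .
    have "Gn \<noteq> top"
    proof
      assume "Gn = top"
      then have "ennreal J = top" using J c by (simp add: ennreal_mult_top)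
      then show False by simp
    qed
    then obtain G where G: "Gn = ennreal G" "0 \<le> G" by (cases Gn) auto
    have "Gn > 0" using Gpos by (simp add: Gn_def ga_def)
    then have G0: "G > 0" using G by simp
    have "J = c powr p * G"
    proof -
      have "ennreal J = ennreal (c powr p * G)" using J G by (simp add: ennreal_mult)
      moreover have "J \<ge> 0" by (simp add: J_def)
      ultimately show ?thesis using G by (simp add: ennreal_inj)
    qed
    then have "Lp_norm p ?M ?S = c * G powr (1 / p)"
      using c p by (simp add: Lp_norm_def J_def[symmetric] powr_mult powr_powr)
    moreover have "Lp_norm p ?M (f k) = I k powr (1 / p)" by (simp add: Lp_norm_def I_def)
    ultimately have "A * I k * G powr (1 / p) \<le> C * I k powr (1 / p)" using SN by (simp add: c_def)
    moreover have "I k = I k powr (1 / q) * I k powr (1 / p)"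
      using Ik pq by (simp add: powr_add[symmetric] add.commute)
    ultimately have "(A * G powr (1 / p) * I k powr (1 / q)) * I k powr (1 / p) \<le> C * I k powr (1 / p)"
      by (metis mult.assoc mult.commute)
    then have "A * G powr (1 / p) * I k powr (1 / q) \<le> C" using Ik by (simp add: mult_le_cancel_right)
    then show ?thesis using G G0 by blast
  qed
  \<comment> \<open>Monotone convergence removes the truncation, so the bound on all
    \<open>I k\<close> bounds the full q-norm.\<close>
  have sup: "Hn = (SUP k. ennreal (I k))"
  proof -
    have "(SUP k. ennreal (gb w powr q * (if gb w \<le> real k then 1 else 0)) * indicator ?H w) = ennreal (gb w powr q) * indicator ?H w" for w
    proof (rule antisym)
      show "(SUP k. ennreal (gb w powr q * (if gb w \<le> real k then 1 else 0)) * indicator ?H w) \<le> ennreal (gb w powr q) * indicator ?H w"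
        by (intro SUP_least mult_right_mono ennreal_leI) auto
      obtain k where "gb w \<le> real k" using real_arch_simple by blast
      then show "ennreal (gb w powr q) * indicator ?H w \<le> (SUP k. ennreal (gb w powr q * (if gb w \<le> real k then 1 else 0)) * indicator ?H w)"
        by (intro SUP_upper2[of k]) auto
    qed
    then have "Hn = (\<integral>\<^sup>+w. (SUP k. ennreal (gb w powr q * (if gb w \<le> real k then 1 else 0)) * indicator ?H w) \<partial>lborel)"
      unfolding Hn_def by simp
    also have "\<dots> = (SUP k. \<integral>\<^sup>+w. ennreal (gb w powr q * (if gb w \<le> real k then 1 else 0)) * indicator ?H w \<partial>lborel)"
    proof (rule nn_integral_monotone_convergence_SUP)
      show "incseq (\<lambda>k w. ennreal (gb w powr q * (if gb w \<le> real k then 1 else 0)) * indicator ?H w)"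
        by (intro incseq_SucI le_funI mult_right_mono ennreal_leI) auto
    qed measurable
    finally show ?thesis unfolding Ieq .
  qed
  have "Hn > 0" using Hpos by (simp add: Hn_def gb_def)
  then obtain k0 where k0: "I k0 > 0" unfolding sup by (auto simp: less_SUP_iff)
  from ineq[OF k0] obtain G where G: "Gn = ennreal G" "G > 0" by blast
  have ineq2: "A * G powr (1 / p) * I k powr (1 / q) \<le> C" if "I k > 0" for k
    using ineq[OF that] G by (metis ennreal_inj less_imp_le)
  have AG: "A * G powr (1 / p) > 0" using A G by simp
  have C0: "C > 0" using ineq2[OF k0] AG k0 by (smt (verit) mult_pos_pos powr_gt_zero)
  define B where "B = (C / (A * G powr (1 / p))) powr q"
  have IB: "I k \<le> B" for k
  proof (cases "I k > 0")
    case True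
    have "I k powr (1 / q) \<le> C / (A * G powr (1 / p))"
      using ineq2[OF True] AG by (simp add: le_divide_eq mult.commute)
    then have "(I k powr (1 / q)) powr q \<le> B" unfolding B_def using q1 by (intro powr_mono2) auto
    then show ?thesis using True q1 by (simp add: powr_powr)
  next
    case False
    then show ?thesis using Inn[of k] by (simp add: B_def)
  qed
  have "Hn \<le> ennreal B" unfolding sup by (intro SUP_least ennreal_leI IB)
  then obtain H where H: "Hn = ennreal H" "0 \<le> H" by (cases Hn) (auto simp: top_unique)
  then have H0: "H > 0" using \<open>Hn > 0\<close> by simp
  have "H \<le> B" using \<open>Hn \<le> ennreal B\<close> H by (simp add: B_def ennreal_le_iff)
  then have "H powr (1 / q) \<le> B powr (1 / q)" using H q1 by (intro powr_mono2) auto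
  also have "\<dots> = C / (A * G powr (1 / p))" using q1 C0 AG by (simp add: B_def powr_powr)
  finally have "A * (G powr (1 / p) * H powr (1 / q)) \<le> C" using AG by (simp add: le_divide_eq mult_ac)
  then show ?thesis
    using that[OF G(2) H0] G(1) H(1) by (simp add: A_def Gn_def Hn_def ga_def gb_def)
qed

section \<open>From weighted integrals to the inequalities\<close>

text \<open>On (0, 1/2) the factor (1 - r)^s is bounded below, so only the power at 0 decides; the
  constant \<open>c\<close> covers both signs of s.\<close>

lemma nn_integral_powr_one_minus_powr_finite_imp:
  fixes \<kappa> s :: real
  assumes "(\<integral>\<^sup>+r. ennreal (r powr \<kappa> * (1 - r) powr s) * indicator {0<..<1} r \<partial>lborel) < \<infinity>"
  shows "-1 < \<kappa>"
proof (rule ccontr)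
  assume "\<not> -1 < \<kappa>"
  then have \<kappa>: "\<kappa> \<le> -1" by simp
  define c where "c = min 1 ((1/2 :: real) powr s)"
  have c: "c > 0" by (simp add: c_def)
  have "\<infinity> = ennreal c * (\<integral>\<^sup>+r. ennreal (r powr \<kappa>) * indicator {0<..<1/2} r \<partial>lborel)"
    using nn_integral_powr_eq_top[OF \<kappa>, of "1/2"] c by (simp add: ennreal_mult_top)
  also have "\<dots> = (\<integral>\<^sup>+r. ennreal c * (ennreal (r powr \<kappa>) * indicator {0<..<1/2} r) \<partial>lborel)"
    by (rule nn_integral_cmult[symmetric]) measurable
  also have "\<dots> \<le> (\<integral>\<^sup>+r. ennreal (r powr \<kappa> * (1 - r) powr s) * indicator {0<..<1} r \<partial>lborel)"
  proof (rule nn_integral_mono)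
    fix r :: real
    show "ennreal c * (ennreal (r powr \<kappa>) * indicator {0<..<1/2} r) \<le> ennreal (r powr \<kappa> * (1 - r) powr s) * indicator {0<..<1} r"
    proof (cases "r \<in> {0<..<1/2}")
      case True
      have "c \<le> (1 - r) powr s"
      proof (cases "s \<ge> 0")
        case True
        then have "(1/2) powr s \<le> (1 - r) powr s" using \<open>r \<in> _\<close> by (intro powr_mono2) auto
        then show ?thesis by (simp add: c_def)
      next
        case False
        then have "1 powr s \<le> (1 - r) powr s" using True by (intro powr_mono2') auto
        then show ?thesis by (simp add: c_def)
      qed
      then have "c * r powr \<kappa> \<le> r powr \<kappa> * (1 - r) powr s" by (metis mult.commute mult_left_mono powr_ge_zero)
      then show ?thesis using True c by (simp add: ennreal_mult[symmetric] ennreal_leI)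
    qed auto
  qed
  finally show False using assms by simp
qed

lemma nn_integral_one_minus_powr_finite_imp:
  fixes s :: real
  assumes "(\<integral>\<^sup>+r. ennreal ((1 - r) powr s) * indicator {1/2<..<1} r \<partial>lborel) < \<infinity>"
  shows "-1 < s"
proof (rule ccontr)
  assume "\<not> -1 < s"
  then have "(\<integral>\<^sup>+r. ennreal (r powr s) * indicator {0<..<1/2} r \<partial>lborel) = \<infinity>"
    by (intro nn_integral_powr_eq_top) auto
  moreover have "(\<integral>\<^sup>+r. ennreal ((1 - r) powr s) * indicator {1/2<..<1} r \<partial>lborel)
      = (\<integral>\<^sup>+r. ennreal (r powr s) * indicator {0<..<1/2} r \<partial>lborel)"
    by (subst nn_integral_real_affine[where c = "-1" and t = 1])
       (auto intro!: nn_integral_cong simp: indicator_def)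
  ultimately show False using assms by simp
qed

text \<open>For r < 1 the power r^\<kappa> only decreases when \<kappa> is replaced by
  2(|\<kappa>|+1), for which \<open>nn_integral_power_powr_ge\<close> with k = 2 gives a positive
  bound.\<close>

lemma nn_integral_powr_one_minus_powr_pos:
  fixes \<kappa> s :: real
  shows "0 < (\<integral>\<^sup>+r. ennreal (r powr \<kappa> * (1 - r) powr s) * indicator {1/2<..<1} r \<partial>lborel)"
proof -
  obtain c :: real where c: "c > 0" "\<And>k. k \<ge> 2 \<Longrightarrow> ennreal (c * k powr (-s - 1))
      \<le> (\<integral>\<^sup>+r. ennreal (r powr ((\<bar>\<kappa>\<bar> + 1) * k) * (1 - r) powr s) * indicator {1/2<..<1} r \<partial>lborel)"
    by (rule nn_integral_power_powr_ge[of "\<bar>\<kappa>\<bar> + 1" s]) auto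
  have "0 < ennreal (c * 2 powr (-s - 1))" using c(1) by simp
  also have "\<dots> \<le> (\<integral>\<^sup>+r. ennreal (r powr ((\<bar>\<kappa>\<bar> + 1) * 2) * (1 - r) powr s) * indicator {1/2<..<1} r \<partial>lborel)"
    by (rule c(2)) simp
  also have "\<dots> \<le> (\<integral>\<^sup>+r. ennreal (r powr \<kappa> * (1 - r) powr s) * indicator {1/2<..<1} r \<partial>lborel)"
    by (intro nn_integral_mono) (auto simp: indicator_def intro!: ennreal_leI mult_right_mono powr_mono')
  finally show ?thesis .
qed

text \<open>Everything follows from the product bound. If the integral for i = 0 is finite, both
  one-dimensional factors are, because each is positive; their singularities at \<rho> = 1 and r = 0
  give the two inequalities. The factor in \<rho> supplies the growth in \<open>i\<close>.\<close>

lemma hweight_integral: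
  fixes a P :: real and m n r0 N :: nat
  assumes mn: "0 < m" "0 < n" and r0: "r0 < m" "LL m n r0 = 1" and P: "P > 0"
  defines "W \<equiv> \<lambda>i. \<integral>\<^sup>+z. ennreal (hweight m n r0 N i a z powr P) * indicator (hartogs m n) z \<partial>lborel"
  shows "0 < W i"
    and "W 0 < \<infinity> \<Longrightarrow> -1 < a * P"
      "W 0 < \<infinity> \<Longrightarrow> (real m + real n - 1) * (N - a) * P < 2 * (real m + real n)"
    and "\<exists>c>0. \<forall>i\<ge>2. ennreal (c * real i powr (- (a * P) - 1)) \<le> W i"
proof -
  define M where "M = (real m + real n - 1) / real m"
  define J where "J = (\<lambda>i::nat. \<integral>\<^sup>+\<rho>. ennreal (\<rho> powr (real m * P * real i) * (1 - \<rho>) powr (a * P)) * indicator {1/2<..<1} \<rho> \<partial>lborel)"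
  define L where "L = (\<integral>\<^sup>+r. ennreal (r powr (1 + 2 * (real n / real m) - M * (N - a) * P) * (1 - r) powr (a * P)) * indicator {0<..<1} r \<partial>lborel)"
  obtain c where c: "c > 0" "\<And>i. ennreal c * (J i * L) \<le> W i"
    unfolding J_def L_def W_def M_def by (rule hweight_lower_bound[OF mn r0 P]) blast
  have J: "0 < J i" for i unfolding J_def by (rule nn_integral_powr_one_minus_powr_pos)
  have "0 < (\<integral>\<^sup>+r. ennreal (r powr (1 + 2 * (real n / real m) - M * (N - a) * P) * (1 - r) powr (a * P)) * indicator {1/2<..<1} r \<partial>lborel)"
    by (rule nn_integral_powr_one_minus_powr_pos)
  also have "\<dots> \<le> L" unfolding L_def by (intro nn_integral_mono) (auto simp: indicator_def)
  finally have L: "0 < L" .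
  have "0 < ennreal c * (J i * L)" using c(1) J L by (simp add: ennreal_zero_less_mult_iff)
  also have "\<dots> \<le> W i" by (rule c(2))
  finally show "0 < W i" .
  have fin: "J 0 < \<infinity> \<and> L < \<infinity>" if "W 0 < \<infinity>"
  proof -
    have "ennreal c * (J 0 * L) < \<infinity>" using c(2)[of 0] that by simp
    then show ?thesis using c(1) J[of 0] L by (auto simp: ennreal_mult_less_top)
  qed
  show "-1 < a * P" if "W 0 < \<infinity>"
  proof (rule nn_integral_one_minus_powr_finite_imp)
    have "(\<integral>\<^sup>+r. ennreal ((1 - r) powr (a * P)) * indicator {1/2<..<1} r \<partial>lborel) = J 0"
      unfolding J_def by (intro nn_integral_cong) (auto simp: indicator_def)
    then show "(\<integral>\<^sup>+r. ennreal ((1 - r) powr (a * P)) * indicator {1/2<..<1} r \<partial>lborel) < \<infinity>"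
      using fin[OF that] by simp
  qed
  show "(real m + real n - 1) * (N - a) * P < 2 * (real m + real n)" if "W 0 < \<infinity>"
  proof -
    have "-1 < 1 + 2 * (real n / real m) - M * (N - a) * P"
      using fin[OF that] unfolding L_def by (intro nn_integral_powr_one_minus_powr_finite_imp) auto
    then have "real m * (M * (N - a) * P) < real m * (2 + 2 * (real n / real m))"
      using mn by (intro mult_strict_left_mono) auto
    then show ?thesis using mn by (simp add: M_def distrib_left)
  qed
  show "\<exists>c>0. \<forall>i\<ge>2. ennreal (c * real i powr (- (a * P) - 1)) \<le> W i"
  proof -
    have D: "real m * P > 0" using mn P by simp
    obtain c1 :: real where c1: "c1 > 0" "\<And>k. k \<ge> 2 \<Longrightarrow> ennreal (c1 * k powr (- (a * P) - 1))
        \<le> (\<integral>\<^sup>+r. ennreal (r powr (real m * P * k) * (1 - r) powr (a * P)) * indicator {1/2<..<1} r \<partial>lborel)"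
      by (rule nn_integral_power_powr_ge[OF D, of "a * P"]) blast
    \<comment> \<open>\<open>L\<close> may be infinite; cutting it off at 1 leaves a positive real
      constant.\<close>
    define l where "l = enn2real (min L 1)"
    have l: "l > 0" "ennreal l \<le> L"
      using L by (auto simp: l_def min_less_iff_disj enn2real_positive_iff ennreal_enn2real_if)
    have "ennreal (c * c1 * l * real i powr (- (a * P) - 1)) \<le> W i" if "i \<ge> 2" for i
    proof -
      have "ennreal (c * c1 * l * real i powr (- (a * P) - 1)) = ennreal c * (ennreal (c1 * real i powr (- (a * P) - 1)) * ennreal l)"
        using c(1) c1(1) l(1) by (simp add: ennreal_mult[symmetric] mult_ac)
      also have "\<dots> \<le> ennreal c * (J i * L)"
        unfolding J_def using that by (intro mult_left_mono mult_mono c1(2) l(2)) auto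
      also have "\<dots> \<le> W i" by (rule c(2))
      finally show ?thesis .
    qed
    then show ?thesis using c(1) c1(1) l(1) by (intro exI[of _ "c * c1 * l"]) auto
  qed
qed

text \<open>The weight with a in Lp yields the conditions on a, the weight with b in Lq those on b;
  multiplying by p - 1 turns the exponent q into p, so -1 < b q becomes 1 < (b + 1) p. Letting
  \<open>i\<close> grow in the product bound gives the remaining condition.\<close>

lemma conditions_of_S_bounded:
  assumes mn: "0 < m" "0 < n" and cop: "coprime m n" and p: "1 < p" and N: "0 < N"
    and S: "S_bounded m n a b N p"
  shows "- a * p < 1" "1 < (b + 1) * p"
    "(2 * real N - 2 * a) * (real m + real n - 1) * p < 4 * (real m + real n)"
    "4 * (real m + real n) < ((2 * b - 2 * real N) * (real m + real n - 1) + 4 * (real m + real n)) * p"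
    "2 * real N \<le> a + b + 2"
proof -
  let ?M = "lebesgue_on (hartogs m n)"
  obtain r0 where r0: "r0 < m" "LL m n r0 = 1" "\<And>r. r < m \<Longrightarrow> LL m n r = 1 \<Longrightarrow> r = r0"
    by (rule ex_LL_eq_1[OF mn cop]) blast
  obtain C where C: "\<And>f. f \<in> Lp_space p ?M \<Longrightarrow>
        (AE z in ?M. integrable ?M (\<lambda>w. S_kernel m n a b N z w * f w)) \<and>
        integral_op ?M (S_kernel m n a b N) f \<in> Lp_space p ?M \<and>
        Lp_norm p ?M (integral_op ?M (S_kernel m n a b N) f) \<le> C * Lp_norm p ?M f"
    using S unfolding S_bounded_def integral_op_bounded_def by blast
  define q where "q = p / (p - 1)"
  have q: "q > 1" using p by (simp add: q_def less_divide_eq)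
  have pq: "1 / p + 1 / q = 1" using p unfolding q_def by (simp add: field_simps)
  obtain N' where N': "N = Suc N'" using N by (cases N) auto
  obtain c0 where c0: "c0 > 0" "\<And>i. c0 * real (i + 1) ^ (2 * N' + 1) \<le> power_coeff (r0 + 1) m N i"
    using power_coeff_lower_bound[of "r0 + 1" m N'] mn unfolding N' by auto
  have cfp: "power_coeff (r0 + 1) m N i > 0" for i
  proof -
    have "0 < c0 * real (i + 1) ^ (2 * N' + 1)" using c0(1) by simp
    also have "\<dots> \<le> power_coeff (r0 + 1) m N i" by (rule c0(2))
    finally show ?thesis .
  qed
  define U where "U i = (\<integral>\<^sup>+z. ennreal (hweight m n r0 N i a z powr p) * indicator (hartogs m n) z \<partial>lborel)" for i
  define V where "V i = (\<integral>\<^sup>+z. ennreal (hweight m n r0 N i b z powr q) * indicator (hartogs m n) z \<partial>lborel)" for i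
  have p0: "0 < p" and q0: "0 < q" using p q by auto
  note Ua = hweight_integral[OF mn r0(1,2) p0, where N = N and a = a, folded U_def]
  note Vb = hweight_integral[OF mn r0(1,2) q0, where N = N and a = b, folded V_def]
  have main: "\<exists>G H. 0 < G \<and> 0 < H \<and> U i = ennreal G \<and> V i = ennreal H \<and>
      power_coeff (r0 + 1) m N i / (pi\<^sup>2 * m) ^ N * (G powr (1 / p) * H powr (1 / q)) \<le> C" for i
    by (rule S_bounded_weights[OF mn r0 p q_def C cfp[of i] Ua(1)[of i, unfolded U_def] Vb(1)[of i, unfolded V_def]])
       (auto simp: U_def V_def)
  have fin: "U 0 < \<infinity>" "V 0 < \<infinity>" using main[of 0] by auto
  show "- a * p < 1" using Ua(2)[OF fin(1)] by simp
  show "1 < (b + 1) * p" using Vb(2)[OF fin(2)] p by (simp add: q_def field_simps)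
  show "(2 * real N - 2 * a) * (real m + real n - 1) * p < 4 * (real m + real n)"
    using Ua(3)[OF fin(1)] by (simp add: algebra_simps)
  show "4 * (real m + real n) < ((2 * b - 2 * real N) * (real m + real n - 1) + 4 * (real m + real n)) * p"
  proof -
    have "(real m + real n - 1) * (real N - b) * q * (p - 1) < 2 * (real m + real n) * (p - 1)"
      using Vb(3)[OF fin(2)] p by (intro mult_strict_right_mono) auto
    also have "(real m + real n - 1) * (real N - b) * q * (p - 1) = (real m + real n - 1) * (real N - b) * p"
      using p by (simp add: q_def)
    finally show ?thesis by (simp add: algebra_simps)
  qed
  show "2 * real N \<le> a + b + 2"
  proof (rule ccontr)
    assume "\<not> 2 * real N \<le> a + b + 2"
    define e where "e = 2 * real N - (a + b + 2)"
    have e: "e > 0" using \<open>\<not> _\<close> by (simp add: e_def)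
    obtain c1 where c1: "c1 > 0" "\<And>i. i \<ge> 2 \<Longrightarrow> ennreal (c1 * real i powr (- (a * p) - 1)) \<le> U i" using Ua(4) by blast
    obtain c2 where c2: "c2 > 0" "\<And>i. i \<ge> 2 \<Longrightarrow> ennreal (c2 * real i powr (- (b * q) - 1)) \<le> V i" using Vb(4) by blast
    define K where "K = c0 / (pi\<^sup>2 * m) ^ N * (c1 powr (1 / p) * c2 powr (1 / q))"
    have K: "K > 0" using c0(1) c1(1) c2(1) mn by (simp add: K_def)
    have bound: "K * real i powr e \<le> C" if i: "i \<ge> 2" for i :: nat
    proof -
      obtain G H where GH: "0 < G" "0 < H" "U i = ennreal G" "V i = ennreal H"
        "power_coeff (r0 + 1) m N i / (pi\<^sup>2 * m) ^ N * (G powr (1 / p) * H powr (1 / q)) \<le> C"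
        using main[of i] by blast
      have "c1 * real i powr (- (a * p) - 1) \<le> G" using c1(2)[OF i] GH by (simp add: ennreal_le_iff)
      then have "(c1 * real i powr (- (a * p) - 1)) powr (1 / p) \<le> G powr (1 / p)"
        using c1(1) p by (intro powr_mono2) auto
      moreover have "(- (a * p) - 1) / p = - a - 1 / p" using p by (simp add: field_simps)
      ultimately have 1: "c1 powr (1 / p) * real i powr (- a - 1 / p) \<le> G powr (1 / p)"
        using c1(1) by (simp add: powr_mult powr_powr)
      have "c2 * real i powr (- (b * q) - 1) \<le> H" using c2(2)[OF i] GH by (simp add: ennreal_le_iff)
      then have "(c2 * real i powr (- (b * q) - 1)) powr (1 / q) \<le> H powr (1 / q)"
        using c2(1) q by (intro powr_mono2) auto
      moreover have "(- (b * q) - 1) / q = - b - 1 / q" using q by (simp add: field_simps)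
      ultimately have 2: "c2 powr (1 / q) * real i powr (- b - 1 / q) \<le> H powr (1 / q)"
        using c2(1) by (simp add: powr_mult powr_powr)
      have "real i ^ (2 * N' + 1) \<le> real (i + 1) ^ (2 * N' + 1)" by (intro power_mono) auto
      then have "c0 * real i ^ (2 * N' + 1) \<le> c0 * real (i + 1) ^ (2 * N' + 1)" using c0(1) by simp
      also note c0(2)[of i]
      finally have 3: "c0 * real i powr (2 * real N - 1) \<le> power_coeff (r0 + 1) m N i"
        using i powr_realpow[of "real i" "2 * N' + 1"] by (simp add: N' add.commute del: power_coeff.simps)
      \<comment> \<open>The coefficient grows with exponent 2N - 1, the norms contribute -a - 1/p
        and -b - 1/q, and 1/p + 1/q = 1 turns the total into 2N - a - b - 2.\<close>
      have ee: "e = (2 * real N - 1) + ((- a - 1 / p) + (- b - 1 / q))"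
        using pq by (simp add: e_def)
      have "K * real i powr e = c0 * real i powr (2 * real N - 1) / (pi\<^sup>2 * m) ^ N *
          ((c1 powr (1 / p) * real i powr (- a - 1 / p)) * (c2 powr (1 / q) * real i powr (- b - 1 / q)))"
        unfolding ee powr_add K_def by simp
      also have "\<dots> \<le> power_coeff (r0 + 1) m N i / (pi\<^sup>2 * m) ^ N * (G powr (1 / p) * H powr (1 / q))"
        using c0(1) c1(1) c2(1) cfp[of i] by (intro mult_mono divide_right_mono 1 2 3) auto
      also have "\<dots> \<le> C" by (rule GH)
      finally show ?thesis .
    qed
    define T where "T = \<bar>C\<bar> / K + 1"
    have T: "T > 0" using K by (simp add: T_def add_nonneg_pos)
    obtain i where i: "max 2 (T powr (1 / e)) \<le> real i" using real_arch_simple by blast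
    have "(T powr (1 / e)) powr e \<le> real i powr e" using e i by (intro powr_mono2) auto
    then have "T \<le> real i powr e" using e T by (simp add: powr_powr)
    then have "K * T \<le> K * real i powr e" using K by simp
    also have "\<dots> \<le> C" using i by (intro bound) auto
    finally show False using K by (simp add: T_def distrib_left)
  qed
qed

text \<open>The three properties are closed into a cycle: domination by the modulus, the test
  functions, and Schur's test.\<close>

theorem theorem1p2:
  fixes m n N :: nat and p a b :: real
  assumes "0 < m" and "0 < n" and "coprime m n" and "1 < p" and "0 < N"
  shows "(S_plus_bounded m n a b (2 * real N) p \<longleftrightarrow> S_bounded m n a b N p) \<and>
         (S_bounded m n a b N p \<longleftrightarrow>
           - a * p < 1 \<and> 1 < (b + 1) * p \<and>
           (2 * real N - 2 * a) * (real m + real n - 1) * p < 4 * (real m + real n) \<and>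
           4 * (real m + real n) <
             ((2 * b - 2 * real N) * (real m + real n - 1) + 4 * (real m + real n)) * p \<and>
           2 * real N \<le> a + b + 2)"
  using S_plus_bounded_imp_S_bounded[OF assms(1,2,5,4)] conditions_of_S_bounded[OF assms]
    S_plus_bounded_of_conditions[OF assms(1,2,4,5)] by blast

end
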